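(* Let $\kappa>0$ and $R>0$. For all $\epsilon\in(0,1]$, $\delta\in(0,1/2]$, $\alpha\in(0,1/2]$, there is an $\alpha$-accurate $(\epsilon,\delta)$-DP sampler for the class $\{\mathsf{N}(\mu,\Sigma)\mid I\preceq\Sigma\preceq\kappa I,\ \|\mu\|\le R\}$ (with $\mu,\Sigma$ unknown) with sample complexity $$O\left(\left(R^2+\kappa^2\left(d+\log\left(\frac{\log(1/\delta)}{\alpha\epsilon}\right)\right)\right)\cdot\frac{\log(1/\delta)}{\epsilon}\right).$$
   Context: $\|\cdot\|$ is the Euclidean norm; $A\preceq B$ means $B-A$ is positive semidefinite. $\mathsf{N}(\mu,\Sigma)$ is the Gaussian with density proportional to $\exp(-\frac12(x-\mu)^T\Sigma^{-1}(x-\mu))$. A sampler with sample complexity $n$ for a class $\mathcal{D}$ is an algorithm $\mathcal{A}$ receiving $n$ i.i.d. samples $\mathbf{X}\sim D^n$ from an unknown $D\in\mathcal{D}$ and outputting one point (or a failure symbol); with $Q_{\mathcal{A},D}$ its output distribution, it is $\alpha$-accurate if $d_{\mathrm{tv}}(D,Q_{\mathcal{A},D})\le\alpha$ for all $D\in\mathcal{D}$. Datasets are neighbors if they have the same size and differ in one element. $\mathcal{M}$ is $(\epsilon,\delta)$-DP if for all neighbors $Y,Y'$ and output sets $S$, $\Pr[\mathcal{M}(Y)\in S]\le e^\epsilon\Pr[\mathcal{M}(Y')\in S]+\delta$. *)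

theory Defs
  imports "HOL-Probability.Probability" "Jordan_Normal_Form.Gauss_Jordan_Elimination"
begin

text \<open>
  The dimension \<open>d\<close> is a natural number, so that a constant can be uniform in it.  A point of
  \<open>\<real>\<^sup>d\<close> is an extensional function on \<open>{..<d}\<close>, and \<open>Matrix.vec d x\<close> is the corresponding
  column vector; means and covariance matrices are elements of \<open>carrier_vec d\<close> and
  \<open>carrier_mat d d\<close>.
\<close>

definition lborel_pow :: "nat \<Rightarrow> (nat \<Rightarrow> real) measure" where
  "lborel_pow d = (\<Pi>\<^sub>M i\<in>{..<d}. lborel)"

definition pos_semidef :: "nat \<Rightarrow> real mat \<Rightarrow> bool" where
  "pos_semidef d A \<longleftrightarrow> A \<in> carrier_mat d d \<and> transpose_mat A = A \<and>
     (\<forall>v\<in>carrier_vec d. 0 \<le> scalar_prod v (A *\<^sub>v v))"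

definition loewner_le :: "nat \<Rightarrow> real mat \<Rightarrow> real mat \<Rightarrow> bool" where
  "loewner_le d A B \<longleftrightarrow> pos_semidef d (B - A)"

definition gaussian_weight :: "nat \<Rightarrow> real vec \<Rightarrow> real mat \<Rightarrow> (nat \<Rightarrow> real) \<Rightarrow> real" where
  "gaussian_weight d \<mu> \<Sigma> x =
     exp (- (1 / 2) * scalar_prod (Matrix.vec d x - \<mu>)
                        (the (mat_inverse \<Sigma>) *\<^sub>v (Matrix.vec d x - \<mu>)))"

definition gaussian :: "nat \<Rightarrow> real vec \<Rightarrow> real mat \<Rightarrow> (nat \<Rightarrow> real) measure" where
  "gaussian d \<mu> \<Sigma> = density (lborel_pow d)
     (\<lambda>x. ennreal (gaussian_weight d \<mu> \<Sigma> x) /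
          (\<integral>\<^sup>+ y. ennreal (gaussian_weight d \<mu> \<Sigma> y) \<partial>lborel_pow d))"

definition gaussian_class :: "nat \<Rightarrow> real \<Rightarrow> real \<Rightarrow> (nat \<Rightarrow> real) measure set" where
  "gaussian_class d \<kappa> R = {gaussian d \<mu> \<Sigma> | \<mu> \<Sigma>.
     \<mu> \<in> carrier_vec d \<and> \<Sigma> \<in> carrier_mat d d \<and>
     loewner_le d (1\<^sub>m d) \<Sigma> \<and> loewner_le d \<Sigma> (\<kappa> \<cdot>\<^sub>m 1\<^sub>m d) \<and>
     L2_set (\<lambda>i. vec_index \<mu> i) {..<d} \<le> R}"

text \<open>
  The measurable space \<open>M\<close> with one extra point \<open>None\<close>, the failure symbol.  It only carries a
  \<open>\<sigma>\<close>-algebra; its measure is zero.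
\<close>

definition option_space :: "'a measure \<Rightarrow> 'a option measure" where
  "option_space M = sigma (insert None (Some ` space M)) ((`) Some ` sets M)"

lemma space_option_space: "space (option_space M) = insert None (Some ` space M)"
  unfolding option_space_def
  by (rule space_measure_of) (use sets.sets_into_space in blast)

lemma Some_image_in_option_space: "B \<in> sets M \<Longrightarrow> Some ` B \<in> sets (option_space M)"
  unfolding option_space_def
  by (subst sets_measure_of) (use sets.sets_into_space in blast)+

lemma measurable_Some: "Some \<in> M \<rightarrow>\<^sub>M option_space M"
  unfolding option_space_def
proof (rule measurable_measure_of)
  show "(`) Some ` sets M \<subseteq> Pow (insert None (Some ` space M))"
    using sets.sets_into_space by blast
  show "Some -` y \<inter> space M \<in> sets M" if "y \<in> (`) Some ` sets M" for y
    using that by (auto simp: inj_vimage_image_eq)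
qed auto

definition tv_dist :: "'a measure \<Rightarrow> 'a measure \<Rightarrow> real" where
  "tv_dist P Q = (SUP S\<in>sets P. \<bar>measure P S - measure Q S\<bar>)"

text \<open>
  A randomized algorithm on datasets of \<open>n\<close> points of \<open>M\<close> is a Markov kernel from the datasets to
  the outputs, a dataset being an extensional function on \<open>{..<n}\<close>.
\<close>

definition is_sampler ::
  "nat \<Rightarrow> 'a measure \<Rightarrow> ((nat \<Rightarrow> 'a) \<Rightarrow> 'a option measure) \<Rightarrow> bool" where
  "is_sampler n M \<A> \<longleftrightarrow> \<A> \<in> (\<Pi>\<^sub>M i\<in>{..<n}. M) \<rightarrow>\<^sub>M prob_algebra (option_space M)"

definition output_dist ::
  "nat \<Rightarrow> ((nat \<Rightarrow> 'a) \<Rightarrow> 'a option measure) \<Rightarrow> 'a measure \<Rightarrow> 'a option measure" where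
  "output_dist n \<A> D = (\<Pi>\<^sub>M i\<in>{..<n}. D) \<bind> \<A>"

definition accurate_sampler ::
  "nat \<Rightarrow> real \<Rightarrow> 'a measure set \<Rightarrow> ((nat \<Rightarrow> 'a) \<Rightarrow> 'a option measure) \<Rightarrow> bool" where
  "accurate_sampler n \<alpha> \<D> \<A> \<longleftrightarrow>
     (\<forall>D\<in>\<D>. tv_dist (distr D (option_space D) Some) (output_dist n \<A> D) \<le> \<alpha>)"

definition neighbors :: "nat \<Rightarrow> (nat \<Rightarrow> 'a) \<Rightarrow> (nat \<Rightarrow> 'a) \<Rightarrow> bool" where
  "neighbors n Y Y' \<longleftrightarrow> (\<exists>!i. i < n \<and> Y i \<noteq> Y' i)"

definition differentially_private ::
  "nat \<Rightarrow> 'a measure \<Rightarrow> real \<Rightarrow> real \<Rightarrow> ((nat \<Rightarrow> 'a) \<Rightarrow> 'a option measure) \<Rightarrow> bool" where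
  "differentially_private n M \<epsilon> \<delta> \<A> \<longleftrightarrow>
     (\<forall>Y\<in>space (\<Pi>\<^sub>M i\<in>{..<n}. M). \<forall>Y'\<in>space (\<Pi>\<^sub>M i\<in>{..<n}. M). neighbors n Y Y' \<longrightarrow>
        (\<forall>S\<in>sets (option_space M). measure (\<A> Y) S \<le> exp \<epsilon> * measure (\<A> Y') S + \<delta>))"

end

theory Submission
  imports Defs "Jordan_Normal_Form.Determinant"
begin

text \<open>
  Let \<open>w\<close> be a vector of weights with \<open>\<Sum>w\<^sub>i = 1\<close> and \<open>\<Sum>w\<^sub>i\<^sup>2 = 1\<close>.  For independent \<open>X\<^sub>i\<close> with law \<open>N(\<mu>, \<Sigma>)\<close> the
  combination \<open>\<Sum>w\<^sub>i X\<^sub>i\<close> again has law \<open>N(\<mu>, \<Sigma>)\<close>.  The mechanism takes such weights at random: the mean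
  of \<open>N\<close> points plus a combination of the rows \<open>y\<^sub>j = (X\<^sub>2\<^sub>j - X\<^sub>2\<^sub>j\<^sub>+\<^sub>1) / sqrt 2\<close> whose coefficients are uniform on a
  sphere of squared radius \<open>1 - 1 / N\<close>.  All points are clipped, which is rarely visible on true samples.

  Privacy comes from the spherical coefficients.  Let \<open>g\<close> be standard Gaussian and consider the pair
  of \<open>\<Sum>g\<^sub>j y\<^sub>j\<close> and \<open>|g|\<^sup>2\<close>, of which the output is a function.  If the smallest eigenvalue of \<open>\<Sum>y\<^sub>j y\<^sub>j\<^sup>T\<close>
  is of order \<open>N\<close>, then one row or the change of the mean is a combination of the rows with a
  coefficient vector of norm \<open>O(B / sqrt N)\<close>.  Changing the data thus scales or shifts a single Gaussian
  coordinate slightly, while the directions in the kernel of the rows smooth \<open>|g|\<^sup>2\<close>.  A private test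
  rejects data with a small smallest eigenvalue; on true samples it accepts, by an exponential moment
  bound that is averaged over all directions (the PAC-Bayes method), which needs no covering argument.
\<close>

section \<open>Gaussian resampling\<close>

text \<open>On good data the output is to have exactly the law of a fresh sample, so the squared
  weights must sum to exactly one. This forces the normalisation of the Gaussian coefficients, and
  the normalisation is what complicates privacy: one coordinate cannot move without affecting the
  norm. The way out is to move a coordinate \<open>x\<close> at a fixed squared norm
  \<open>q\<close>. In dimension \<open>2 * p + 3\<close> its density is then proportional to
  \<open>(q - x^2)^p\<close>, and a small move costs a factor \<open>exp \<epsilon>\<close> once
  \<open>q - x^2\<close> is at least \<open>p / 4\<close>. The failure probability
  \<open>2^(-p)\<close> of this event makes \<open>p\<close> of order
  \<open>log (1/\<delta>)\<close>. The mean of \<open>N\<close> points is present because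
  differences carry no information on \<open>\<mu>\<close>; its weights use up \<open>1/N\<close> of
  the sum of squares. The rate is the price of the gate: with sensitivity \<open>B^2\<close>, a
  logistic test with additive error \<open>\<delta>\<close> needs a margin of order
  \<open>B^2 * log (1/\<delta>) / \<epsilon>\<close>, and the margin available is a fixed fraction
  of \<open>N\<close>. The conditions on rows and centre ask for no more than this order.\<close>

lemma sets_lborel_pow[measurable_cong]: "sets (lborel_pow d) = sets (\<Pi>\<^sub>M i\<in>{..<d}. borel)"
  unfolding lborel_pow_def by (intro sets_PiM_cong) auto

lemma space_lborel_pow: "space (lborel_pow d) = extensional {..<d}"
  by (simp add: lborel_pow_def space_PiM PiE_def)

lemma lborel_pow_component[measurable (raw)]:
  "i < d \<Longrightarrow> (\<lambda>x. x i) \<in> borel_measurable (lborel_pow d)"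
  by (simp add: measurable_cong_sets[OF sets_lborel_pow refl] measurable_component_singleton)

lemma measurable_restrict_lborel_pow:
  "(\<And>i. i < d \<Longrightarrow> (\<lambda>x. f x i) \<in> borel_measurable M) \<Longrightarrow> (\<lambda>x. \<lambda>i\<in>{..<d}. f x i) \<in> M \<rightarrow>\<^sub>M lborel_pow d"
  by (auto simp: measurable_cong_sets[OF refl sets_lborel_pow] intro!: measurable_restrict)

interpretation lborel_pow: sigma_finite_measure "lborel_pow d" for d
proof -
  interpret product_sigma_finite "\<lambda>_::nat. lborel" by standard
  show "sigma_finite_measure (lborel_pow d)"
    unfolding lborel_pow_def by (rule sigma_finite) simp
qed

interpretation lborel_pow_pair: pair_sigma_finite "lborel_pow d" "lborel_pow m" for d m
  by standard

lemma nn_integral_lborel_pow_Suc: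
  assumes f: "f \<in> borel_measurable (lborel_pow (Suc d))"
  shows "(\<integral>\<^sup>+x. f x \<partial>lborel_pow (Suc d)) = (\<integral>\<^sup>+x. (\<integral>\<^sup>+y. f (x(d := y)) \<partial>lborel) \<partial>lborel_pow d)"
proof -
  interpret product_sigma_finite "\<lambda>_::nat. lborel" by standard
  have eq: "{..<Suc d} = insert d {..<d}" by auto
  show ?thesis
    unfolding lborel_pow_def eq
    by (rule product_nn_integral_insert) (use f in \<open>auto simp: lborel_pow_def eq\<close>)
qed

lemma measurable_lborel_pow_upd:
  assumes f: "f \<in> borel_measurable (lborel_pow (Suc d))"
  shows "(\<lambda>(x, y). f (x(d := y))) \<in> borel_measurable (lborel_pow d \<Otimes>\<^sub>M lborel)"
proof -
  have [measurable]: "f \<in> borel_measurable (\<Pi>\<^sub>M i\<in>{..<Suc d}. borel)"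
    using f by (simp cong: measurable_cong_sets add: sets_lborel_pow)
  have "(\<lambda>p. (fst p)(d := snd p)) \<in> measurable (lborel_pow d \<Otimes>\<^sub>M lborel) (\<Pi>\<^sub>M i\<in>{..<Suc d}. borel)"
  proof (rule measurable_PiM_single')
    fix i assume i: "i \<in> {..<Suc d}"
    show "(\<lambda>p. ((fst p)(d := snd p)) i) \<in> borel_measurable (lborel_pow d \<Otimes>\<^sub>M lborel)"
    proof (cases "i = d")
      case True
      then show ?thesis by simp
    next
      case False
      then have "i < d" using i by auto
      then show ?thesis using False
        by (simp add: measurable_compose[OF measurable_fst lborel_pow_component])
    qed
  next
    show "(\<lambda>p i. ((fst p)(d := snd p)) i) \<in> space (lborel_pow d \<Otimes>\<^sub>M lborel) \<rightarrow> (\<Pi>\<^sub>E i\<in>{..<Suc d}. space borel)"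
    proof (rule Pi_I)
      fix p :: "(nat \<Rightarrow> real) \<times> real" assume "p \<in> space (lborel_pow d \<Otimes>\<^sub>M lborel)"
      then have "fst p x = undefined" if "\<not> x < d" for x
        using that by (auto simp: space_pair_measure space_lborel_pow extensional_def)
      then show "(\<lambda>i. ((fst p)(d := snd p)) i) \<in> (\<Pi>\<^sub>E i\<in>{..<Suc d}. space borel)"
        by (simp add: PiE_def extensional_def)
    qed
  qed
  from measurable_compose[OF this, of f] show ?thesis by (simp add: split_def)
qed

lemma measurable_lborel_pow_affine:
  "(\<lambda>x. \<lambda>i\<in>{..<d}. a * x i + b i) \<in> measurable (lborel_pow d) (lborel_pow d)"
  by measurable

text \<open>A common factor with a translation is the only substitution in several variables that
  the proof uses. The Jacobian is therefore a plain power, and Fubini peels off one coordinate at a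
  time.\<close>

lemma nn_integral_lborel_pow_affine:
  assumes "f \<in> borel_measurable (lborel_pow d)" and a: "a \<noteq> (0::real)"
  shows "(\<integral>\<^sup>+x. f x \<partial>lborel_pow d) =
    ennreal (\<bar>a\<bar> ^ d) * (\<integral>\<^sup>+x. f (\<lambda>i\<in>{..<d}. a * x i + b i) \<partial>lborel_pow d)"
  using assms(1)
proof (induction d arbitrary: f)
  case 0
  have "f (restrict (\<lambda>i. a * x i + b i) {..<0}) = f x" if "x \<in> space (lborel_pow 0)" for x
    using that by (auto simp: space_lborel_pow restrict_def intro!: arg_cong[where f=f])
  then have "(\<integral>\<^sup>+x. f (restrict (\<lambda>i. a * x i + b i) {..<0}) \<partial>lborel_pow 0) = (\<integral>\<^sup>+x. f x \<partial>lborel_pow 0)"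
    by (rule nn_integral_cong)
  then show ?case unfolding power_0 ennreal_1 mult_1_left by (rule sym)
next
  case (Suc d)
  note [measurable] = measurable_lborel_pow_upd[OF Suc.prems]
  let ?A = "\<lambda>x. \<lambda>i\<in>{..<d}. a * x i + b i"
  have m: "(\<lambda>x. \<integral>\<^sup>+y. f (x(d := y)) \<partial>lborel) \<in> borel_measurable (lborel_pow d)"
    by measurable
  have sec: "(\<lambda>y. f (x(d := y))) \<in> borel_measurable borel" if "x \<in> space (lborel_pow d)" for x
    using measurable_Pair2[OF measurable_lborel_pow_upd[OF Suc.prems] that] by (simp del: fun_upd_apply)
  have upd: "(?A x)(d := b d + a * y) = (\<lambda>i\<in>{..<Suc d}. a * (x(d := y)) i + b i)" for x y
    by (auto simp: fun_eq_iff restrict_def)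
  have fA: "(\<lambda>x. f (\<lambda>i\<in>{..<Suc d}. a * x i + b i)) \<in> borel_measurable (lborel_pow (Suc d))"
    by (rule measurable_compose[OF measurable_lborel_pow_affine Suc.prems])
  note [measurable] = measurable_lborel_pow_upd[OF fA]
  have "(\<integral>\<^sup>+x. f x \<partial>lborel_pow (Suc d)) = (\<integral>\<^sup>+x. (\<integral>\<^sup>+y. f (x(d := y)) \<partial>lborel) \<partial>lborel_pow d)"
    by (rule nn_integral_lborel_pow_Suc[OF Suc.prems])
  also have "\<dots> = ennreal (\<bar>a\<bar> ^ d) * (\<integral>\<^sup>+x. (\<integral>\<^sup>+y. f ((?A x)(d := y)) \<partial>lborel) \<partial>lborel_pow d)"
    by (rule Suc.IH[OF m])
  also have "(\<integral>\<^sup>+x. (\<integral>\<^sup>+y. f ((?A x)(d := y)) \<partial>lborel) \<partial>lborel_pow d) =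
    (\<integral>\<^sup>+x. ennreal \<bar>a\<bar> * (\<integral>\<^sup>+y. f (\<lambda>i\<in>{..<Suc d}. a * (x(d := y)) i + b i) \<partial>lborel) \<partial>lborel_pow d)"
  proof (rule nn_integral_cong)
    fix x assume "x \<in> space (lborel_pow d)"
    then have "?A x \<in> space (lborel_pow d)"
      using measurable_space[OF measurable_lborel_pow_affine] by blast
    from nn_integral_real_affine[OF sec[OF this] a, of "b d"]
    show "(\<integral>\<^sup>+y. f ((?A x)(d := y)) \<partial>lborel) =
      ennreal \<bar>a\<bar> * (\<integral>\<^sup>+y. f (\<lambda>i\<in>{..<Suc d}. a * (x(d := y)) i + b i) \<partial>lborel)"
      unfolding upd by simp
  qed
  also have "\<dots> = ennreal \<bar>a\<bar> * (\<integral>\<^sup>+x. f (\<lambda>i\<in>{..<Suc d}. a * x i + b i) \<partial>lborel_pow (Suc d))"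
    unfolding nn_integral_lborel_pow_Suc[OF fA]
    by (rule nn_integral_cmult) measurable
  finally show ?case
    by (simp only: mult.assoc[symmetric] ennreal_mult'[symmetric] power_Suc2 zero_le_power abs_ge_zero)
qed

lemma nn_integral_lborel_pow_translate:
  assumes "f \<in> borel_measurable (lborel_pow d)"
  shows "(\<integral>\<^sup>+x. f (\<lambda>i\<in>{..<d}. x i + b i) \<partial>lborel_pow d) = (\<integral>\<^sup>+x. f x \<partial>lborel_pow d)"
  using nn_integral_lborel_pow_affine[OF assms, of 1 b] by simp

lemma nn_integral_lborel_pow_prod:
  assumes "\<And>i. i < d \<Longrightarrow> f i \<in> borel_measurable lborel"
  shows "(\<integral>\<^sup>+x. (\<Prod>i<d. f i (x i)) \<partial>lborel_pow d) = (\<Prod>i<d. \<integral>\<^sup>+x. f i x \<partial>lborel)"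
proof -
  interpret product_sigma_finite "\<lambda>_::nat. lborel" by standard
  show ?thesis unfolding lborel_pow_def by (rule product_nn_integral_prod) (use assms in auto)
qed

section \<open>Bilinear forms and the Gaussian density\<close>

definition ip :: "nat \<Rightarrow> (nat \<Rightarrow> real) \<Rightarrow> (nat \<Rightarrow> real) \<Rightarrow> real" where
  "ip d x y = (\<Sum>i<d. x i * y i)"

definition bil :: "nat \<Rightarrow> (nat \<Rightarrow> nat \<Rightarrow> real) \<Rightarrow> (nat \<Rightarrow> real) \<Rightarrow> (nat \<Rightarrow> real) \<Rightarrow> real" where
  "bil d P x y = (\<Sum>i<d. \<Sum>j<d. x i * P i j * y j)"

definition gauss_density :: "nat \<Rightarrow> (nat \<Rightarrow> real) \<Rightarrow> real" where
  "gauss_density m T = (\<Prod>l<m. std_normal_density (T l))"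

lemma ip_measurable[measurable]:
  assumes "\<And>i. i < d \<Longrightarrow> (\<lambda>x. f x i) \<in> borel_measurable M" "\<And>i. i < d \<Longrightarrow> (\<lambda>x. g x i) \<in> borel_measurable M"
  shows "(\<lambda>x. ip d (f x) (g x)) \<in> borel_measurable M"
  unfolding ip_def by (intro borel_measurable_sum borel_measurable_times assms) auto

lemma bil_measurable[measurable]:
  assumes "\<And>i. i < d \<Longrightarrow> (\<lambda>x. f x i) \<in> borel_measurable M" "\<And>i. i < d \<Longrightarrow> (\<lambda>x. g x i) \<in> borel_measurable M"
  shows "(\<lambda>x. bil d P (f x) (g x)) \<in> borel_measurable M"
  unfolding bil_def by (intro borel_measurable_sum borel_measurable_times borel_measurable_const assms) auto

lemma gauss_density_measurable[measurable]:
  assumes "\<And>i. i < d \<Longrightarrow> (\<lambda>x. f x i) \<in> borel_measurable M"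
  shows "(\<lambda>x. gauss_density d (f x)) \<in> borel_measurable M"
  unfolding gauss_density_def
  by (intro borel_measurable_prod measurable_compose[OF assms borel_measurable_normal_density]) auto

lemma gauss_density_nonneg[simp]: "0 \<le> gauss_density m T"
  by (simp add: gauss_density_def prod_nonneg)

lemma gauss_density_eq: "gauss_density m T = (1 / sqrt (2 * pi)) ^ m * exp (- ip m T T / 2)"
  unfolding gauss_density_def ip_def
  by (induction m) (simp_all add: std_normal_density_def exp_add[symmetric] field_simps power2_eq_square)

lemma gauss_density_cong: "(\<And>i. i < m \<Longrightarrow> x i = y i) \<Longrightarrow> gauss_density m x = gauss_density m y"
  by (auto simp: gauss_density_def intro!: prod.cong)

lemma ip_cong: "(\<And>i. i < m \<Longrightarrow> x i = x' i) \<Longrightarrow> (\<And>i. i < m \<Longrightarrow> y i = y' i) \<Longrightarrow> ip m x y = ip m x' y'"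
  by (auto simp: ip_def intro!: sum.cong)

lemma bil_cong: "(\<And>i. i < m \<Longrightarrow> x i = x' i) \<Longrightarrow> (\<And>i. i < m \<Longrightarrow> y i = y' i) \<Longrightarrow> bil m P x y = bil m P x' y'"
  by (auto simp: bil_def intro!: sum.cong)

lemma ip_restrict[simp]: "ip m (restrict x {..<m}) y = ip m x y" "ip m y (restrict x {..<m}) = ip m y x"
  by (auto intro: ip_cong)

lemma bil_restrict[simp]: "bil m P (restrict x {..<m}) y = bil m P x y" "bil m P y (restrict x {..<m}) = bil m P y x"
  by (auto intro: bil_cong)

lemma gauss_density_restrict[simp]: "gauss_density m (restrict x {..<m}) = gauss_density m x"
  by (auto intro: gauss_density_cong)

lemma nn_integral_std_normal_density: "(\<integral>\<^sup>+x. ennreal (std_normal_density x) \<partial>lborel) = 1"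
  by (simp add: nn_integral_eq_integral)

lemma nn_integral_gauss_density: "(\<integral>\<^sup>+T. ennreal (gauss_density m T) \<partial>lborel_pow m) = 1"
proof -
  have "(\<integral>\<^sup>+T. ennreal (gauss_density m T) \<partial>lborel_pow m) =
    (\<integral>\<^sup>+T. (\<Prod>l<m. ennreal (std_normal_density (T l))) \<partial>lborel_pow m)"
    unfolding gauss_density_def by (simp add: prod_ennreal)
  also have "\<dots> = 1"
    by (subst nn_integral_lborel_pow_prod) (auto simp: nn_integral_std_normal_density)
  finally show ?thesis .
qed

lemma bil_add_left: "bil d P (\<lambda>i. x i + y i) z = bil d P x z + bil d P y z"
  by (simp add: bil_def sum.distrib algebra_simps)
lemma bil_add_right: "bil d P z (\<lambda>i. x i + y i) = bil d P z x + bil d P z y"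
  by (simp add: bil_def sum.distrib algebra_simps)
lemma bil_diff_left: "bil d P (\<lambda>i. x i - y i) z = bil d P x z - bil d P y z"
  by (simp add: bil_def sum_subtractf algebra_simps)
lemma bil_diff_right: "bil d P z (\<lambda>i. x i - y i) = bil d P z x - bil d P z y"
  by (simp add: bil_def sum_subtractf algebra_simps)
lemma bil_scale_left: "bil d P (\<lambda>i. c * x i) z = c * bil d P x z"
  by (simp add: bil_def sum_distrib_left mult.assoc)
lemma bil_scale_right: "bil d P z (\<lambda>i. c * x i) = c * bil d P z x"
  by (simp add: bil_def sum_distrib_left algebra_simps)

lemma bil_sum_left: "bil d P (\<lambda>i. \<Sum>l<m. u l i) z = (\<Sum>l<(m::nat). bil d P (u l) z)"
  by (induction m) (simp_all add: bil_add_left, simp add: bil_def)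
lemma bil_sum_right: "bil d P z (\<lambda>i. \<Sum>l<m. u l i) = (\<Sum>l<(m::nat). bil d P z (u l))"
  by (induction m) (simp_all add: bil_add_right, simp add: bil_def)

lemma bil_commute:
  assumes "\<And>i j. i < d \<Longrightarrow> j < d \<Longrightarrow> P i j = P j i"
  shows "bil d P x y = bil d P y x"
  unfolding bil_def by (subst sum.swap) (auto intro!: sum.cong simp: assms)

lemma ip_bil: "ip d x y = bil d (\<lambda>i j. if i = j then 1 else 0) x y"
  by (simp add: ip_def bil_def if_distrib if_distribR cong: if_cong)

text \<open>Bilinear expansion for a combination of \<open>P\<close>-orthonormal vectors: pairing
  with \<open>u l\<close> reads off a coefficient, and the square of the difference expands as for
  Pythagoras. Replacing \<open>T\<close> by \<open>- T\<close> gives the version for sums.\<close>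

lemma bil_project:
  fixes T :: "nat \<Rightarrow> real" and u :: "nat \<Rightarrow> nat \<Rightarrow> real"
  assumes sym: "\<And>i j. i < d \<Longrightarrow> j < d \<Longrightarrow> P i j = P j i"
    and orth: "\<And>l l'. l < m \<Longrightarrow> l' < m \<Longrightarrow> bil d P (u l) (u l') = (if l = l' then 1 else 0)"
  shows "\<And>l. l < m \<Longrightarrow> bil d P (u l) (\<lambda>i. \<Sum>l<m. T l * u l i) = T l"
    and "bil d P (\<lambda>i. y i - (\<Sum>l<m. T l * u l i)) (\<lambda>i. y i - (\<Sum>l<m. T l * u l i)) =
      bil d P y y - 2 * ip m T (\<lambda>l. bil d P (u l) y) + ip m T T"
proof -
  have *: "bil d P (u l) (\<lambda>i. \<Sum>l<m. T l * u l i) = T l" if "l < m" for l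
    using that by (simp add: bil_sum_right bil_scale_right orth if_distrib cong: if_cong)
  then show "\<And>l. l < m \<Longrightarrow> bil d P (u l) (\<lambda>i. \<Sum>l<m. T l * u l i) = T l" .
  have 1: "bil d P (\<lambda>i. \<Sum>l<m. T l * u l i) (\<lambda>i. \<Sum>l<m. T l * u l i) = ip m T T"
    by (subst bil_sum_left) (simp add: bil_scale_left * ip_def)
  have 2: "bil d P (\<lambda>i. \<Sum>l<m. T l * u l i) y = ip m T (\<lambda>l. bil d P (u l) y)"
    by (subst bil_sum_left) (simp add: bil_scale_left ip_def)
  show "bil d P (\<lambda>i. y i - (\<Sum>l<m. T l * u l i)) (\<lambda>i. y i - (\<Sum>l<m. T l * u l i)) =
      bil d P y y - 2 * ip m T (\<lambda>l. bil d P (u l) y) + ip m T T"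
    using bil_commute[where d=d and P=P and x=y and y="\<lambda>i. \<Sum>l<m. T l * u l i", OF sym]
    by (simp add: bil_diff_left bil_diff_right 1 2)
qed

lemma extensional_restrict_eq: "x \<in> space (lborel_pow d) \<Longrightarrow> restrict x {..<d} = x"
  by (simp add: space_lborel_pow extensional_restrict)

text \<open>
  Replacing the coefficients of a Gaussian vector along finitely many orthonormal directions by fresh
  ones does not change its law.  Translations and Fubini suffice, so no rotation is needed.
\<close>

theorem gauss_resample:
  assumes sym: "\<And>i j. i < d \<Longrightarrow> j < d \<Longrightarrow> P i j = P j i"
    and orth: "\<And>l l'. l < m \<Longrightarrow> l' < m \<Longrightarrow> bil d P (u l) (u l') = (if l = l' then 1 else 0)"
    and F: "F \<in> borel_measurable (lborel_pow d)"
  shows "(\<integral>\<^sup>+y. (\<integral>\<^sup>+T. F (\<lambda>i\<in>{..<d}. y i + (\<Sum>l<m. (T l - bil d P (u l) y) * u l i)) * ennreal (gauss_density m T) \<partial>lborel_pow m)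
            * ennreal (exp (- bil d P y y / 2)) \<partial>lborel_pow d) =
         (\<integral>\<^sup>+y. F y * ennreal (exp (- bil d P y y / 2)) \<partial>lborel_pow d)"
proof -
  define b where "b = (\<lambda>y l. bil d P (u l) y)"
  define W where "W = (\<lambda>y. exp (- bil d P y y / 2))"
  note Fm = measurable_compose[OF measurable_restrict_lborel_pow F]
  note ms = borel_measurable_times_ennreal Fm measurable_compose[OF _ measurable_ennreal] gauss_density_measurable
    borel_measurable_sum borel_measurable_times borel_measurable_add borel_measurable_diff borel_measurable_exp
    borel_measurable_divide borel_measurable_uminus borel_measurable_const bil_measurable
    lborel_pow_component measurable_compose[OF measurable_fst lborel_pow_component] measurable_compose[OF measurable_snd lborel_pow_component]
    measurable_restrict_lborel_pow
  \<comment> \<open>Translating \<open>T\<close> by the coefficients of \<open>y\<close> moves the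
    dependence on these coefficients out of \<open>F\<close> and into the density of
    \<open>T\<close>.\<close>
  have "(\<integral>\<^sup>+y. (\<integral>\<^sup>+T. F (\<lambda>i\<in>{..<d}. y i + (\<Sum>l<m. (T l - b y l) * u l i)) * ennreal (gauss_density m T) \<partial>lborel_pow m) * ennreal (W y) \<partial>lborel_pow d)
      = (\<integral>\<^sup>+y. (\<integral>\<^sup>+T. F (\<lambda>i\<in>{..<d}. y i + (\<Sum>l<m. T l * u l i)) * ennreal (gauss_density m (\<lambda>l. T l + b y l)) \<partial>lborel_pow m) * ennreal (W y) \<partial>lborel_pow d)"
    (is "_ = (\<integral>\<^sup>+y. ?g y * _ \<partial>_)")
  proof (rule nn_integral_cong, rule arg_cong2[where f="(*)", OF _ refl])
    fix y
    show "(\<integral>\<^sup>+T. F (\<lambda>i\<in>{..<d}. y i + (\<Sum>l<m. (T l - b y l) * u l i)) * ennreal (gauss_density m T) \<partial>lborel_pow m) = ?g y"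
      by (subst nn_integral_lborel_pow_translate[symmetric, where b="b y"])
         (unfold b_def, intro ms, simp_all cong: sum.cong_simp)
  qed
  also have "\<dots> = (\<integral>\<^sup>+y. (\<integral>\<^sup>+T. F (\<lambda>i\<in>{..<d}. y i + (\<Sum>l<m. T l * u l i)) * ennreal (gauss_density m (\<lambda>l. T l + b y l)) * ennreal (W y) \<partial>lborel_pow m) \<partial>lborel_pow d)"
    unfolding b_def W_def by (intro nn_integral_cong nn_integral_multc[symmetric] ms) auto
  also have "\<dots> = (\<integral>\<^sup>+T. (\<integral>\<^sup>+y. F (\<lambda>i\<in>{..<d}. y i + (\<Sum>l<m. T l * u l i)) * ennreal (gauss_density m (\<lambda>l. T l + b y l)) * ennreal (W y) \<partial>lborel_pow d) \<partial>lborel_pow m)"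
    unfolding b_def W_def split_def by (rule lborel_pow_pair.Fubini', unfold split_def, (intro ms; simp)+)
  \<comment> \<open>For fixed \<open>T\<close>, \<open>y\<close> is translated by minus the
    combination of the \<open>u l\<close>, so its coefficients become \<open>b y - T\<close>. By
    \<open>bil_project\<close> the two Gaussian weights recombine to \<open>W y\<close> times the
    density at \<open>T - b y\<close>, whose integral over \<open>T\<close> is one.\<close>
  also have "\<dots> = (\<integral>\<^sup>+T. (\<integral>\<^sup>+y. F y * ennreal (W y) * ennreal (gauss_density m (\<lambda>l. T l - b y l)) \<partial>lborel_pow d) \<partial>lborel_pow m)"
  proof (rule nn_integral_cong)
    fix T assume T: "T \<in> space (lborel_pow m)"
    let ?v = "\<lambda>i. \<Sum>l<m. T l * u l i"
    have "(\<integral>\<^sup>+y. F (\<lambda>i\<in>{..<d}. y i + ?v i) * ennreal (gauss_density m (\<lambda>l. T l + b y l)) * ennreal (W y) \<partial>lborel_pow d)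
      = (\<integral>\<^sup>+y. F (\<lambda>i\<in>{..<d}. (\<lambda>i\<in>{..<d}. y i + - ?v i) i + ?v i) * ennreal (gauss_density m (\<lambda>l. T l + b (\<lambda>i\<in>{..<d}. y i + - ?v i) l)) * ennreal (W (\<lambda>i\<in>{..<d}. y i + - ?v i)) \<partial>lborel_pow d)"
      unfolding b_def W_def by (rule nn_integral_lborel_pow_translate[symmetric], (intro ms; simp)+)
    also have "\<dots> = (\<integral>\<^sup>+y. F y * ennreal (W y) * ennreal (gauss_density m (\<lambda>l. T l - b y l)) \<partial>lborel_pow d)"
    proof (rule nn_integral_cong)
      fix y assume y: "y \<in> space (lborel_pow d)"
      have 1: "(\<lambda>i\<in>{..<d}. (\<lambda>i\<in>{..<d}. y i + - ?v i) i + ?v i) = y"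
      proof -
        have "(\<lambda>i\<in>{..<d}. (\<lambda>i\<in>{..<d}. y i + - ?v i) i + ?v i) = restrict y {..<d}"
          by (auto simp: fun_eq_iff restrict_def)
        then show ?thesis by (simp only: extensional_restrict_eq[OF y])
      qed
      have 2: "gauss_density m (\<lambda>l. T l + b (\<lambda>i\<in>{..<d}. y i + - ?v i) l) = gauss_density m (b y)"
        using bil_project(1)[where d=d and P=P and m=m and u=u and T=T, OF sym orth]
        by (intro gauss_density_cong) (simp add: b_def bil_diff_right)
      have 3: "gauss_density m (b y) * W (\<lambda>i\<in>{..<d}. y i + - ?v i) = W y * gauss_density m (\<lambda>l. T l - b y l)"
      proof -
        have "ip m (\<lambda>l. T l - b y l) (\<lambda>l. T l - b y l) = ip m T T - 2 * ip m T (b y) + ip m (b y) (b y)"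
          by (simp add: ip_def sum_subtractf sum.distrib algebra_simps sum_distrib_left)
        then have "ip m (b y) (b y) + bil d P (\<lambda>i. y i - ?v i) (\<lambda>i. y i - ?v i) = bil d P y y + ip m (\<lambda>l. T l - b y l) (\<lambda>l. T l - b y l)"
          using bil_project(2)[where d=d and P=P and m=m and u=u and T=T and y=y, OF sym orth] by (simp add: b_def)
        then have "exp (- ip m (b y) (b y) / 2) * exp (- bil d P (\<lambda>i. y i - ?v i) (\<lambda>i. y i - ?v i) / 2) =
          exp (- bil d P y y / 2) * exp (- ip m (\<lambda>l. T l - b y l) (\<lambda>l. T l - b y l) / 2)"
          unfolding exp_add[symmetric] by (simp add: field_simps)
        then show ?thesis unfolding W_def gauss_density_eq by simp
      qed
      show "F (\<lambda>i\<in>{..<d}. (\<lambda>i\<in>{..<d}. y i + - ?v i) i + ?v i) * ennreal (gauss_density m (\<lambda>l. T l + b (\<lambda>i\<in>{..<d}. y i + - ?v i) l)) * ennreal (W (\<lambda>i\<in>{..<d}. y i + - ?v i))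
        = F y * ennreal (W y) * ennreal (gauss_density m (\<lambda>l. T l - b y l))"
        unfolding 1 2 mult.assoc using 3
        by (simp add: ennreal_mult'[symmetric] W_def)
    qed
    finally show "(\<integral>\<^sup>+y. F (\<lambda>i\<in>{..<d}. y i + ?v i) * ennreal (gauss_density m (\<lambda>l. T l + b y l)) * ennreal (W y) \<partial>lborel_pow d)
      = (\<integral>\<^sup>+y. F y * ennreal (W y) * ennreal (gauss_density m (\<lambda>l. T l - b y l)) \<partial>lborel_pow d)" .
  qed
  also have "\<dots> = (\<integral>\<^sup>+y. (\<integral>\<^sup>+T. F y * ennreal (W y) * ennreal (gauss_density m (\<lambda>l. T l - b y l)) \<partial>lborel_pow m) \<partial>lborel_pow d)"
  proof (rule lborel_pow_pair.Fubini')
    have "(\<lambda>p. F (fst p)) \<in> borel_measurable (lborel_pow d \<Otimes>\<^sub>M lborel_pow m)"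
      by (rule measurable_compose[OF measurable_fst F])
    moreover have "(\<lambda>p. ennreal (W (fst p)) * ennreal (gauss_density m (\<lambda>l. snd p l - b (fst p) l))) \<in> borel_measurable (lborel_pow d \<Otimes>\<^sub>M lborel_pow m)"
      unfolding W_def b_def by (intro ms; simp)
    ultimately show "(\<lambda>(y, T). F y * ennreal (W y) * ennreal (gauss_density m (\<lambda>l. T l - b y l))) \<in> borel_measurable (lborel_pow d \<Otimes>\<^sub>M lborel_pow m)"
      unfolding split_def mult.assoc by (rule borel_measurable_times_ennreal)
  qed
  also have "\<dots> = (\<integral>\<^sup>+y. F y * ennreal (W y) \<partial>lborel_pow d)"
  proof (rule nn_integral_cong)
    fix y
    have "(\<integral>\<^sup>+T. ennreal (gauss_density m (\<lambda>l. T l - b y l)) \<partial>lborel_pow m) = 1"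
      using nn_integral_lborel_pow_translate[of "\<lambda>T. ennreal (gauss_density m T)" m "\<lambda>l. - b y l"]
      by (simp add: nn_integral_gauss_density)
    then show "(\<integral>\<^sup>+T. F y * ennreal (W y) * ennreal (gauss_density m (\<lambda>l. T l - b y l)) \<partial>lborel_pow m) = F y * ennreal (W y)"
      by (subst nn_integral_cmult) auto
  qed
  finally show ?thesis unfolding b_def W_def .
qed

section \<open>Standard Gaussians\<close>

definition std_gauss :: "nat \<Rightarrow> (nat \<Rightarrow> real) measure" where
  "std_gauss m = density (lborel_pow m) (\<lambda>x. ennreal (gauss_density m x))"

lemma sets_std_gauss[simp, measurable_cong]: "sets (std_gauss m) = sets (lborel_pow m)"
  by (simp add: std_gauss_def)

lemma space_std_gauss[simp]: "space (std_gauss m) = space (lborel_pow m)"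
  by (simp add: std_gauss_def)

lemma gauss_density_measurable'[measurable]: "gauss_density m \<in> borel_measurable (lborel_pow m)"
  by (rule gauss_density_measurable) (rule lborel_pow_component)

lemma nn_integral_std_gauss:
  assumes "f \<in> borel_measurable (lborel_pow m)"
  shows "(\<integral>\<^sup>+x. f x \<partial>std_gauss m) = (\<integral>\<^sup>+x. f x * ennreal (gauss_density m x) \<partial>lborel_pow m)"
  unfolding std_gauss_def by (subst nn_integral_density) (use assms in \<open>auto simp: mult.commute\<close>)

lemma prob_space_std_gauss: "prob_space (std_gauss m)"
  by (rule prob_spaceI) (simp add: std_gauss_def emeasure_density nn_integral_gauss_density
    space_std_gauss[unfolded std_gauss_def] cong: nn_integral_cong)

interpretation std_gauss: prob_space "std_gauss m" for m
  by (rule prob_space_std_gauss)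

interpretation std_gauss_pair: pair_sigma_finite "std_gauss d" "std_gauss m" for d m
  by standard

lemma nn_integral_std_gauss_prod:
  assumes [measurable]: "\<And>i. i < d \<Longrightarrow> f i \<in> borel_measurable borel"
  shows "(\<integral>\<^sup>+x. (\<Prod>i<d. f i (x i)) \<partial>std_gauss d) = (\<Prod>i<d. \<integral>\<^sup>+x. f i x * ennreal (std_normal_density x) \<partial>lborel)"
proof -
  have m: "(\<lambda>x. \<Prod>i<d. f i (x i)) \<in> borel_measurable (lborel_pow d)"
    by (intro borel_measurable_prod_ennreal measurable_compose[OF lborel_pow_component assms]) auto
  have "(\<integral>\<^sup>+x. (\<Prod>i<d. f i (x i)) \<partial>std_gauss d) = (\<integral>\<^sup>+x. (\<Prod>i<d. f i (x i) * ennreal (std_normal_density (x i))) \<partial>lborel_pow d)"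
    by (subst nn_integral_std_gauss[OF m]) (simp add: gauss_density_def prod_ennreal[symmetric] prod.distrib)
  also have "\<dots> = (\<Prod>i<d. \<integral>\<^sup>+x. f i x * ennreal (std_normal_density x) \<partial>lborel)"
    by (subst nn_integral_lborel_pow_prod) auto
  finally show ?thesis .
qed

lemma nn_integral_normal_density: "\<sigma> > 0 \<Longrightarrow> (\<integral>\<^sup>+x. ennreal (normal_density \<mu> \<sigma> x) \<partial>lborel) = 1"
  by (simp add: nn_integral_eq_integral)

text \<open>The factor turns the standard normal density into a multiple of the centred normal
  density with variance \<open>1 / (1 - 2 * a)\<close>. Positive \<open>a\<close> serves the upper
  tails, negative \<open>a\<close> the lower tail and the eigenvalue bound.\<close>

lemma std_normal_exp_square:
  assumes "a < 1/2"
  shows "(\<integral>\<^sup>+x. ennreal (exp (a * x\<^sup>2)) * ennreal (std_normal_density x) \<partial>lborel) = ennreal (1 / sqrt (1 - 2 * a))"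
proof -
  define \<sigma> where "\<sigma> = 1 / sqrt (1 - 2 * a)"
  have s: "\<sigma> > 0" "\<sigma>\<^sup>2 = 1 / (1 - 2 * a)" using assms by (auto simp: \<sigma>_def power_divide)
  have "exp (a * x\<^sup>2) * std_normal_density x = \<sigma> * normal_density 0 \<sigma> x" for x
  proof -
    have 1: "sqrt (2 * pi * \<sigma>\<^sup>2) = sqrt (2 * pi) * \<sigma>" using s(1) by (simp add: real_sqrt_mult)
    have 2: "a * x\<^sup>2 - x\<^sup>2 / 2 = - (x\<^sup>2 / (2 * \<sigma>\<^sup>2))"
      using assms by (simp add: s(2) field_simps)
    have 3: "exp (a * x\<^sup>2) * exp (- (x\<^sup>2 / 2)) = exp (- (x\<^sup>2 / (2 * \<sigma>\<^sup>2)))"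
      unfolding 2[symmetric] by (simp add: exp_add[symmetric])
    show ?thesis using s(1) by (simp add: normal_density_def 1 3)
  qed
  then have "(\<integral>\<^sup>+x. ennreal (exp (a * x\<^sup>2)) * ennreal (std_normal_density x) \<partial>lborel) = (\<integral>\<^sup>+x. ennreal \<sigma> * ennreal (normal_density 0 \<sigma> x) \<partial>lborel)"
    using s(1) by (simp add: ennreal_mult'[symmetric])
  also have "\<dots> = ennreal \<sigma>"
    by (subst nn_integral_cmult) (auto simp: nn_integral_normal_density s)
  finally show ?thesis by (simp add: \<sigma>_def)
qed

lemma std_normal_exp_linear:
  "(\<integral>\<^sup>+x. ennreal (exp (c * x)) * ennreal (std_normal_density x) \<partial>lborel) = ennreal (exp (c\<^sup>2 / 2))"
proof -
  have "exp (c * x) * std_normal_density x = exp (c\<^sup>2 / 2) * normal_density c 1 x" for x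
  proof -
    have "exp (c * x) * exp (- x\<^sup>2 / 2) = exp (c\<^sup>2 / 2) * exp (- (x - c)\<^sup>2 / 2)"
      by (simp add: exp_add[symmetric] power2_eq_square field_simps)
    then show ?thesis by (simp add: normal_density_def)
  qed
  then have "(\<integral>\<^sup>+x. ennreal (exp (c * x)) * ennreal (std_normal_density x) \<partial>lborel) = (\<integral>\<^sup>+x. ennreal (exp (c\<^sup>2 / 2)) * ennreal (normal_density c 1 x) \<partial>lborel)"
    by (simp add: ennreal_mult'[symmetric])
  also have "\<dots> = ennreal (exp (c\<^sup>2 / 2))"
    by (subst nn_integral_cmult) (auto simp: nn_integral_normal_density)
  finally show ?thesis .
qed

lemma std_gauss_exp_square:
  assumes "a < 1/2"
  shows "(\<integral>\<^sup>+x. ennreal (exp (a * ip d x x)) \<partial>std_gauss d) = ennreal ((1 / sqrt (1 - 2 * a)) ^ d)"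
proof -
  have "ennreal (exp (a * ip d x x)) = (\<Prod>i<d. ennreal (exp (a * (x i)\<^sup>2)))" for x
    by (simp add: prod_ennreal exp_sum[symmetric] ip_def sum_distrib_left power2_eq_square)
  then show ?thesis
    using assms nn_integral_std_gauss_prod[of d "\<lambda>_ x. ennreal (exp (a * x\<^sup>2))"]
    by (simp add: std_normal_exp_square ennreal_power)
qed

lemma std_gauss_exp_linear:
  "(\<integral>\<^sup>+x. ennreal (exp (ip d c x)) \<partial>std_gauss d) = ennreal (exp (ip d c c / 2))"
proof -
  have "ennreal (exp (ip d c x)) = (\<Prod>i<d. ennreal (exp (c i * x i)))" for x
    by (simp add: prod_ennreal exp_sum[symmetric] ip_def)
  then show ?thesis
    using nn_integral_std_gauss_prod[of d "\<lambda>i x. ennreal (exp (c i * x))"]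
    by (simp add: std_normal_exp_linear prod_ennreal exp_sum[symmetric] ip_def
       sum_divide_distrib power2_eq_square)
qed

lemma std_gauss_resample:
  assumes orth: "\<And>l l'. l < m \<Longrightarrow> l' < m \<Longrightarrow> ip d (u l) (u l') = (if l = l' then 1 else 0)"
    and F[measurable]: "F \<in> borel_measurable (lborel_pow d)"
  shows "(\<integral>\<^sup>+y. (\<integral>\<^sup>+T. F (\<lambda>i\<in>{..<d}. y i + (\<Sum>l<m. (T l - ip d (u l) y) * u l i)) \<partial>std_gauss m) \<partial>std_gauss d) =
         (\<integral>\<^sup>+y. F y \<partial>std_gauss d)"
proof -
  let ?c = "ennreal ((1 / sqrt (2 * pi)) ^ d)"
  let ?g = "\<lambda>y T. \<lambda>i\<in>{..<d}. y i + (\<Sum>l<m. (T l - ip d (u l) y) * u l i)"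
  have gd: "ennreal (gauss_density d y) = ?c * ennreal (exp (- ip d y y / 2))" for y
    unfolding gauss_density_eq by (rule ennreal_mult') simp
  note ms = borel_measurable_sum borel_measurable_times borel_measurable_add borel_measurable_diff borel_measurable_const
      measurable_ident ip_measurable measurable_compose[OF measurable_fst lborel_pow_component] measurable_compose[OF measurable_snd lborel_pow_component]
  have M: "(\<lambda>p. F (?g (fst p) (snd p))) \<in> borel_measurable (lborel_pow d \<Otimes>\<^sub>M std_gauss m)"
    by (rule measurable_compose[OF measurable_restrict_lborel_pow F], subst measurable_cong_sets[OF sets_pair_measure_cong[OF refl sets_std_gauss] refl])
       (intro ms; simp)
  have M1: "(\<lambda>T. F (?g y T)) \<in> borel_measurable (lborel_pow m)" if "y \<in> space (lborel_pow d)" for y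
    using measurable_Pair2[OF M that] by simp
  have M2[measurable]: "(\<lambda>y. \<integral>\<^sup>+T. F (?g y T) \<partial>std_gauss m) \<in> borel_measurable (lborel_pow d)"
    using M by measurable
  have "(\<integral>\<^sup>+y. (\<integral>\<^sup>+T. F (?g y T) \<partial>std_gauss m) \<partial>std_gauss d) =
    ?c * (\<integral>\<^sup>+y. (\<integral>\<^sup>+T. F (?g y T) \<partial>std_gauss m) * ennreal (exp (- ip d y y / 2)) \<partial>lborel_pow d)"
    by (simp add: nn_integral_std_gauss gd nn_integral_cmult[symmetric] ac_simps)
  also have "(\<integral>\<^sup>+y. (\<integral>\<^sup>+T. F (?g y T) \<partial>std_gauss m) * ennreal (exp (- ip d y y / 2)) \<partial>lborel_pow d) =
    (\<integral>\<^sup>+y. (\<integral>\<^sup>+T. F (?g y T) * ennreal (gauss_density m T) \<partial>lborel_pow m) * ennreal (exp (- ip d y y / 2)) \<partial>lborel_pow d)"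
    by (intro nn_integral_cong) (simp add: nn_integral_std_gauss[OF M1])
  also have "\<dots> = (\<integral>\<^sup>+y. F y * ennreal (exp (- ip d y y / 2)) \<partial>lborel_pow d)"
    using gauss_resample[of d "\<lambda>i j. if i = j then 1 else 0" m u F] orth
    by (simp add: ip_bil[symmetric])
  also have "?c * \<dots> = (\<integral>\<^sup>+y. F y \<partial>std_gauss d)"
    by (simp add: nn_integral_std_gauss gd nn_integral_cmult[symmetric] ac_simps)
  finally show ?thesis .
qed

section \<open>The law of the squared norm\<close>

lemma ip_nonneg[simp]: "0 \<le> ip m x x"
  by (simp add: ip_def sum_nonneg)

lemma ip_scale: "ip m (\<lambda>i. a * x i) (\<lambda>i. a * x i) = a\<^sup>2 * ip m x x"
  by (simp add: ip_def sum_distrib_left power2_eq_square ac_simps)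

text \<open>The first coordinate is nonzero almost everywhere: the indicator of its vanishing is a
  product of functions of single coordinates, and one factor has integral zero.\<close>

lemma AE_ip_pos:
  assumes "0 < m"
  shows "AE T in lborel_pow m. 0 < ip m T T"
proof -
  have "(\<integral>\<^sup>+T. (\<Prod>i<m. (if i = 0 then indicator {0} else (\<lambda>_. 1)) (T i)) \<partial>lborel_pow m) = 0"
    using assms by (subst nn_integral_lborel_pow_prod) (auto intro!: prod_zero bexI[of _ 0])
  then have "AE T in lborel_pow m. (\<Prod>i<m. (if i = 0 then indicator {0} else (\<lambda>_. 1)) (T i) :: ennreal) = 0"
    by (subst (asm) nn_integral_0_iff_AE)
       (auto intro!: borel_measurable_prod_ennreal measurable_compose[OF lborel_pow_component])
  then show ?thesis
  proof (eventually_elim)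
    case (elim T)
    then have "T 0 \<noteq> 0" by (auto simp: prod_zero_iff split: if_splits)
    then have "0 < T 0 * T 0" by (simp add: zero_less_mult_iff linorder_neq_iff disj_commute)
    also have "\<dots> \<le> ip m T T" unfolding ip_def
      by (rule member_le_sum[of 0 "{..<m}" "\<lambda>i. T i * T i"]) (use assms in auto)
    finally show ?case .
  qed
qed

lemma ip_self_measurable[measurable]: "(\<lambda>T. ip m T T) \<in> borel_measurable (lborel_pow m)"
  by (intro ip_measurable lborel_pow_component)

text \<open>In dimension \<open>m = 2 * p + 2\<close> the squared norm has a density proportional to
  \<open>r ^ p\<close>. Polar coordinates are avoided: scaling alone fixes the exponent
  \<open>m / 2 - 1\<close>, and \<open>C\<close> is never evaluated. The even dimension keeps the
  exponent a natural number.\<close>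

lemma nn_integral_sq_norm:
  fixes p :: nat
  defines "m \<equiv> 2 * p + 2"
  shows "\<exists>C. \<forall>h\<in>borel_measurable borel. (\<integral>\<^sup>+T. h (ip m T T) \<partial>lborel_pow m) =
    C * (\<integral>\<^sup>+r. h r * ennreal (if 0 < r then r ^ p else 0) \<partial>lborel)"
proof -
  \<comment> \<open>An auxiliary probability density on scales \<open>s\<close>. Averaging over
    dilations by \<open>sqrt s\<close> turns the squared norm into a free real variable.\<close>
  define k :: "real \<Rightarrow> real" where "k = (\<lambda>s. if 0 < s then exp (- s) else 0)"
  have k0: "0 \<le> k s" for s by (simp add: k_def)
  have km[measurable]: "k \<in> borel_measurable borel" unfolding k_def by measurable
  have k1: "(\<integral>\<^sup>+s. ennreal (k s) \<partial>lborel) = 1"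
  proof -
    have "(\<integral>\<^sup>+s. ennreal (k s) \<partial>lborel) = (\<integral>\<^sup>+s. ennreal (exponential_density 1 s) \<partial>lborel)"
      by (rule nn_integral_cong_AE) (use AE_lborel_singleton[of 0] in \<open>eventually_elim, auto simp: k_def exponential_density_def\<close>)
    also have "\<dots> = 1"
      using prob_space.emeasure_space_1[OF prob_space_exponential_density[of 1]]
      by (simp add: emeasure_density)
    finally show ?thesis .
  qed
  let ?N = "\<lambda>T. ip m T T"
  define C where "C = (\<integral>\<^sup>+T. ennreal (1 / ?N T * k (1 / ?N T) * (1 / ?N T) ^ (p + 1)) \<partial>lborel_pow m)"
  have "(\<integral>\<^sup>+T. h (?N T) \<partial>lborel_pow m) = C * (\<integral>\<^sup>+r. h r * ennreal (if 0 < r then r ^ p else 0) \<partial>lborel)"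
    if [measurable]: "h \<in> borel_measurable borel" for h :: "real \<Rightarrow> ennreal"
  proof -
    have "(\<integral>\<^sup>+T. h (?N T) \<partial>lborel_pow m) = (\<integral>\<^sup>+s. ennreal (k s) * (\<integral>\<^sup>+T. h (?N T) \<partial>lborel_pow m) \<partial>lborel)"
      by (simp add: nn_integral_multc k1)
    also have "\<dots> = (\<integral>\<^sup>+s. (\<integral>\<^sup>+T. ennreal (k s * s ^ (p + 1)) * h (s * ?N T) \<partial>lborel_pow m) \<partial>lborel)"
    proof (rule nn_integral_cong)
      fix s
      show "ennreal (k s) * (\<integral>\<^sup>+T. h (?N T) \<partial>lborel_pow m) = (\<integral>\<^sup>+T. ennreal (k s * s ^ (p + 1)) * h (s * ?N T) \<partial>lborel_pow m)"
      proof (cases "0 < s")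
        case True
        have "sqrt s ^ m = s ^ (p + 1)"
          using True by (simp add: m_def power_add power_mult)
        then have "(\<integral>\<^sup>+T. h (?N T) \<partial>lborel_pow m) = ennreal (s ^ (p + 1)) * (\<integral>\<^sup>+T. h (s * ?N T) \<partial>lborel_pow m)"
          using nn_integral_lborel_pow_affine[of "\<lambda>T. h (?N T)" m "sqrt s" "\<lambda>_. 0"] True
          by (simp add: ip_scale)
        then show ?thesis using True k0
          by (simp add: nn_integral_cmult ennreal_mult' mult.assoc)
      qed (simp add: k_def)
    qed
    also have "\<dots> = (\<integral>\<^sup>+T. (\<integral>\<^sup>+s. ennreal (k s * s ^ (p + 1)) * h (s * ?N T) \<partial>lborel) \<partial>lborel_pow m)"
      by (rule pair_sigma_finite.Fubini'[OF pair_sigma_finite.intro[OF lborel_pow.sigma_finite_measure_axioms lborel.sigma_finite_measure_axioms]]) measurable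
    \<comment> \<open>For fixed \<open>T\<close> the substitution \<open>r = s * ip m T T\<close>
      makes the argument of \<open>h\<close> independent of \<open>T\<close>.\<close>
    also have "\<dots> = (\<integral>\<^sup>+T. (\<integral>\<^sup>+r. ennreal (1 / ?N T * k (r / ?N T) * (r / ?N T) ^ (p + 1)) * h r \<partial>lborel) \<partial>lborel_pow m)"
    proof (rule nn_integral_cong_AE)
      have "0 < m" by (simp add: m_def)
      from AE_ip_pos[OF this] show "AE T in lborel_pow m. (\<integral>\<^sup>+s. ennreal (k s * s ^ (p + 1)) * h (s * ?N T) \<partial>lborel) =
        (\<integral>\<^sup>+r. ennreal (1 / ?N T * k (r / ?N T) * (r / ?N T) ^ (p + 1)) * h r \<partial>lborel)"
      proof eventually_elim
      case (elim T)
      have "(\<integral>\<^sup>+s. ennreal (k s * s ^ (p + 1)) * h (s * ?N T) \<partial>lborel) =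
        ennreal (1 / ?N T) * (\<integral>\<^sup>+r. ennreal (k (r / ?N T) * (r / ?N T) ^ (p + 1)) * h r \<partial>lborel)"
        using elim by (subst nn_integral_real_affine[where c="1 / ?N T" and t=0]) auto
      also have "\<dots> = (\<integral>\<^sup>+r. ennreal (1 / ?N T * k (r / ?N T) * (r / ?N T) ^ (p + 1)) * h r \<partial>lborel)"
        using elim by (subst nn_integral_cmult[symmetric]) (auto simp: ennreal_mult'[symmetric] mult.assoc[symmetric])
      finally show ?case .
      qed
    qed
    also have "\<dots> = (\<integral>\<^sup>+r. (\<integral>\<^sup>+T. ennreal (1 / ?N T * k (r / ?N T) * (r / ?N T) ^ (p + 1)) * h r \<partial>lborel_pow m) \<partial>lborel)"
      by (rule pair_sigma_finite.Fubini'[OF pair_sigma_finite.intro[OF lborel.sigma_finite_measure_axioms lborel_pow.sigma_finite_measure_axioms]]) measurable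
    also have "\<dots> = (\<integral>\<^sup>+r. C * (h r * ennreal (if 0 < r then r ^ p else 0)) \<partial>lborel)"
    proof (rule nn_integral_cong)
      fix r :: real
      show "(\<integral>\<^sup>+T. ennreal (1 / ?N T * k (r / ?N T) * (r / ?N T) ^ (p + 1)) * h r \<partial>lborel_pow m) = C * (h r * ennreal (if 0 < r then r ^ p else 0))"
      proof (cases "0 < r")
        case True
        have s: "sqrt r ^ m = r ^ (p + 1)" using True by (simp add: m_def power_add power_mult)
        \<comment> \<open>Dilating \<open>T\<close> by \<open>sqrt r\<close> extracts the power of
          \<open>r\<close> and leaves a constant independent of \<open>r\<close>.\<close>
        have "(\<integral>\<^sup>+T. ennreal (1 / ?N T * k (r / ?N T) * (r / ?N T) ^ (p + 1)) \<partial>lborel_pow m) =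
          ennreal (r ^ (p + 1)) * (\<integral>\<^sup>+T. ennreal (1 / (r * ?N T) * k (1 / ?N T) * (1 / ?N T) ^ (p + 1)) \<partial>lborel_pow m)"
          using True by (subst nn_integral_lborel_pow_affine[where a="sqrt r" and b="\<lambda>_. 0"]) (auto simp: ip_scale s)
        also have "(\<integral>\<^sup>+T. ennreal (1 / (r * ?N T) * k (1 / ?N T) * (1 / ?N T) ^ (p + 1)) \<partial>lborel_pow m) = ennreal (1 / r) * C"
          unfolding C_def using True
          by (subst nn_integral_cmult[symmetric]) (auto simp: ennreal_mult'[symmetric] mult.assoc[symmetric])
        also have "ennreal (r ^ (p + 1)) * (ennreal (1 / r) * C) = ennreal (r ^ p) * C"
          using True by (simp add: mult.assoc[symmetric] ennreal_mult'[symmetric])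
        finally have e: "(\<integral>\<^sup>+T. ennreal (1 / ?N T * k (r / ?N T) * (r / ?N T) ^ (p + 1)) \<partial>lborel_pow m) = ennreal (r ^ p) * C" .
        have "(\<integral>\<^sup>+T. ennreal (1 / ?N T * k (r / ?N T) * (r / ?N T) ^ (p + 1)) * h r \<partial>lborel_pow m) = ennreal (r ^ p) * C * h r"
          unfolding e[symmetric] by (rule nn_integral_multc) measurable
        then show ?thesis using True by (simp add: ac_simps)
      next
        case False
        then have "k (r / ?N T) = 0" for T by (auto simp: k_def zero_less_divide_iff not_less dest: order_trans[OF _ ip_nonneg])
        then show ?thesis using False by simp
      qed
    qed
    also have "\<dots> = C * (\<integral>\<^sup>+r. h r * ennreal (if 0 < r then r ^ p else 0) \<partial>lborel)"
      by (rule nn_integral_cmult) measurable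
    finally show ?thesis .
  qed
  then show ?thesis by blast
qed

text \<open>Up to a constant, the density of the squared norm in dimension \<open>2 * p + 2\<close>.
  It will be evaluated at \<open>q - x^2\<close>, which may be negative, hence the explicit cut at
  zero.\<close>

definition pos_power :: "nat \<Rightarrow> real \<Rightarrow> real" where
  "pos_power p r = (if 0 < r then r ^ p else 0)"

lemma pos_power_measurable[measurable]: "pos_power p \<in> borel_measurable borel"
  unfolding pos_power_def by measurable

lemma pos_power_nonneg[simp]: "0 \<le> pos_power p r"
  by (simp add: pos_power_def)

lemma pos_power_mono: "r \<le> r' \<Longrightarrow> pos_power p r \<le> pos_power p r'"
  by (auto simp: pos_power_def intro: power_mono)

lemma ip_Suc: "ip (Suc m) T T = ip m T T + (T m)\<^sup>2"
  by (simp add: ip_def power2_eq_square)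

lemma T_sq_norm_measurable[measurable]:
  "(\<lambda>T. (T m, ip (Suc m) T T)) \<in> lborel_pow (Suc m) \<rightarrow>\<^sub>M borel \<Otimes>\<^sub>M borel"
  by (intro measurable_Pair lborel_pow_component ip_self_measurable) simp

text \<open>The joint density of the last coordinate \<open>x\<close> and the whole squared norm
  \<open>q\<close>, up to the factor \<open>C\<close>. The Gaussian factor depends on
  \<open>q\<close> alone, so a change of \<open>x\<close> at fixed \<open>q\<close> is felt only
  through \<open>pos_power\<close>.\<close>

lemma std_gauss_polar:
  fixes p :: nat
  defines "m \<equiv> 2 * p + 2"
  shows "\<exists>C. \<forall>f\<in>borel_measurable (borel \<Otimes>\<^sub>M borel). (\<integral>\<^sup>+T. f (T m, ip (Suc m) T T) \<partial>std_gauss (Suc m)) =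
    C * (\<integral>\<^sup>+x. (\<integral>\<^sup>+q. f (x, q) * ennreal (exp (- q / 2) * pos_power p (q - x\<^sup>2)) \<partial>lborel) \<partial>lborel)"
proof -
  from nn_integral_sq_norm[of p] obtain C where
    C: "\<And>h. h \<in> borel_measurable borel \<Longrightarrow> (\<integral>\<^sup>+T. h (ip m T T) \<partial>lborel_pow m) =
      C * (\<integral>\<^sup>+r. h r * ennreal (pos_power p r) \<partial>lborel)"
    unfolding m_def pos_power_def by blast
  define c where "c = ennreal ((1 / sqrt (2 * pi)) ^ Suc m)"
  have gd: "ennreal (gauss_density (Suc m) T) = c * ennreal (exp (- ip (Suc m) T T / 2))" for T
    unfolding gauss_density_eq c_def by (rule ennreal_mult') simp
  have "(\<integral>\<^sup>+T. f (T m, ip (Suc m) T T) \<partial>std_gauss (Suc m)) =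
    c * C * (\<integral>\<^sup>+x. (\<integral>\<^sup>+q. f (x, q) * ennreal (exp (- q / 2) * pos_power p (q - x\<^sup>2)) \<partial>lborel) \<partial>lborel)"
    if f[measurable]: "f \<in> borel_measurable (borel \<Otimes>\<^sub>M borel)" for f
  proof -
    let ?h = "\<lambda>x q. f (x, q) * ennreal (exp (- q / 2))"
    have fm: "(\<lambda>T. f (T m, ip (Suc m) T T)) \<in> borel_measurable (lborel_pow (Suc m))"
      by (rule measurable_compose[OF T_sq_norm_measurable f])
    have hm[measurable]: "(\<lambda>T. ?h (T m) (ip (Suc m) T T)) \<in> borel_measurable (lborel_pow (Suc m))"
      by (intro borel_measurable_times_ennreal fm measurable_compose[OF _ measurable_ennreal]) measurable
    have "(\<integral>\<^sup>+T. f (T m, ip (Suc m) T T) \<partial>std_gauss (Suc m)) = c * (\<integral>\<^sup>+T. ?h (T m) (ip (Suc m) T T) \<partial>lborel_pow (Suc m))"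
      by (subst nn_integral_std_gauss[OF fm], subst nn_integral_cmult[OF hm, symmetric])
         (simp add: gd ac_simps)
    also have "(\<integral>\<^sup>+T. ?h (T m) (ip (Suc m) T T) \<partial>lborel_pow (Suc m)) =
      (\<integral>\<^sup>+T. (\<integral>\<^sup>+x. ?h x (ip m T T + x\<^sup>2) \<partial>lborel) \<partial>lborel_pow m)"
    proof (subst nn_integral_lborel_pow_Suc[OF hm], intro nn_integral_cong)
      fix T and x :: real
      have "ip (Suc m) (T(m := x)) (T(m := x)) = ip m T T + x\<^sup>2"
        by (simp add: ip_Suc) (auto intro: ip_cong)
      then show "?h ((T(m := x)) m) (ip (Suc m) (T(m := x)) (T(m := x))) = ?h x (ip m T T + x\<^sup>2)"
        by simp
    qed
    also have "\<dots> = (\<integral>\<^sup>+x. (\<integral>\<^sup>+T. ?h x (ip m T T + x\<^sup>2) \<partial>lborel_pow m) \<partial>lborel)"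
      by (rule pair_sigma_finite.Fubini'[OF pair_sigma_finite.intro[OF lborel.sigma_finite_measure_axioms lborel_pow.sigma_finite_measure_axioms]]) measurable
    also have "\<dots> = (\<integral>\<^sup>+x. C * (\<integral>\<^sup>+q. f (x, q) * ennreal (exp (- q / 2) * pos_power p (q - x\<^sup>2)) \<partial>lborel) \<partial>lborel)"
    proof (rule nn_integral_cong)
      fix x :: real
      have "(\<integral>\<^sup>+T. ?h x (ip m T T + x\<^sup>2) \<partial>lborel_pow m) = C * (\<integral>\<^sup>+r. ?h x (r + x\<^sup>2) * ennreal (pos_power p r) \<partial>lborel)"
        by (rule C) measurable
      also have "(\<integral>\<^sup>+r. ?h x (r + x\<^sup>2) * ennreal (pos_power p r) \<partial>lborel) =
        (\<integral>\<^sup>+q. f (x, q) * ennreal (exp (- q / 2) * pos_power p (q - x\<^sup>2)) \<partial>lborel)"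
        by (subst nn_integral_real_affine[where c=1 and t="- x\<^sup>2"]) (auto simp: ennreal_mult' mult.assoc)
      finally show "(\<integral>\<^sup>+T. ?h x (ip m T T + x\<^sup>2) \<partial>lborel_pow m) = C * (\<integral>\<^sup>+q. f (x, q) * ennreal (exp (- q / 2) * pos_power p (q - x\<^sup>2)) \<partial>lborel)" .
    qed
    also have "\<dots> = C * (\<integral>\<^sup>+x. (\<integral>\<^sup>+q. f (x, q) * ennreal (exp (- q / 2) * pos_power p (q - x\<^sup>2)) \<partial>lborel) \<partial>lborel)"
      by (rule nn_integral_cmult) measurable
    finally show ?thesis by (simp add: mult.assoc)
  qed
  then show ?thesis by blast
qed

section \<open>Changing one coordinate at a fixed norm\<close>

lemma nn_integral_real_affine_le:
  assumes [measurable]: "h \<in> borel_measurable borel" and "1 \<le> (s::real)"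
  shows "(\<integral>\<^sup>+x. h (s * x + b) \<partial>lborel) \<le> (\<integral>\<^sup>+x. h x \<partial>lborel)"
proof -
  have "1 * (\<integral>\<^sup>+x. h (s * x + b) \<partial>lborel) \<le> ennreal s * (\<integral>\<^sup>+x. h (s * x + b) \<partial>lborel)"
    by (rule mult_right_mono) (use assms(2) in auto)
  also have "\<dots> = (\<integral>\<^sup>+x. h x \<partial>lborel)"
    using assms nn_integral_real_affine[of h s b] by (simp add: add.commute)
  finally show ?thesis by simp
qed

text \<open>Substitution of \<open>s * x + b q\<close> for \<open>x\<close> at fixed
  \<open>q\<close>. The Jacobian \<open>1 / s\<close> is at most one, the ratio of the densities is
  at most \<open>exp \<epsilon>\<close> except on the event measured by the last term, and there
  \<open>f \<le> 1\<close> is used. The shift may depend on \<open>q\<close>; a change of the centre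
  produces such a shift.\<close>

lemma std_gauss_compare_up:
  fixes p :: nat and s \<epsilon> :: real
  defines "m \<equiv> 2 * p + 2"
  assumes f[measurable]: "f \<in> borel_measurable (borel \<Otimes>\<^sub>M borel)" and f1: "\<And>x. f x \<le> 1"
    and s: "1 \<le> s" and b[measurable]: "b \<in> borel_measurable borel"
  shows "(\<integral>\<^sup>+T. f (s * T m + b (ip (Suc m) T T), ip (Suc m) T T) \<partial>std_gauss (Suc m)) \<le>
    ennreal (exp \<epsilon>) * (\<integral>\<^sup>+T. f (T m, ip (Suc m) T T) \<partial>std_gauss (Suc m)) +
    (\<integral>\<^sup>+T. (if pos_power p (ip m T T) \<le> exp \<epsilon> * pos_power p (ip (Suc m) T T - (s * T m + b (ip (Suc m) T T))\<^sup>2)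
        then 0 else 1) \<partial>std_gauss (Suc m))"
proof -
  from std_gauss_polar[of p] obtain C where
    C: "\<And>f. f \<in> borel_measurable (borel \<Otimes>\<^sub>M borel) \<Longrightarrow> (\<integral>\<^sup>+T. f (T m, ip (Suc m) T T) \<partial>std_gauss (Suc m)) =
    C * (\<integral>\<^sup>+x. (\<integral>\<^sup>+q. f (x, q) * ennreal (exp (- q / 2) * pos_power p (q - x\<^sup>2)) \<partial>lborel) \<partial>lborel)"
    unfolding m_def by blast
  define G where "G = (\<lambda>(x, q). pos_power p (q - x\<^sup>2) \<le> exp \<epsilon> * pos_power p (q - (s * x + b q)\<^sup>2))"
  define f1 where "f1 = (\<lambda>(x, q). f (s * x + b q, q) * (if G (x, q) then 1 else 0))"
  define f2 :: "real \<times> real \<Rightarrow> ennreal" where "f2 = (\<lambda>(x, q). if G (x, q) then 0 else 1)"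
  have [measurable]: "Measurable.pred (borel \<Otimes>\<^sub>M borel) G" unfolding G_def by measurable
  have f1m[measurable]: "f1 \<in> borel_measurable (borel \<Otimes>\<^sub>M borel)" unfolding f1_def by measurable
  have f2m[measurable]: "f2 \<in> borel_measurable (borel \<Otimes>\<^sub>M borel)" unfolding f2_def by measurable
  have [measurable]: "(\<lambda>T. f1 (T m, ip (Suc m) T T)) \<in> borel_measurable (std_gauss (Suc m))"
      "(\<lambda>T. f2 (T m, ip (Suc m) T T)) \<in> borel_measurable (std_gauss (Suc m))"
    using measurable_compose[OF T_sq_norm_measurable f1m] measurable_compose[OF T_sq_norm_measurable f2m]
    by simp_all
  let ?w = "\<lambda>x q. ennreal (exp (- q / 2) * pos_power p (q - x\<^sup>2))"
  have "(\<integral>\<^sup>+T. f (s * T m + b (ip (Suc m) T T), ip (Suc m) T T) \<partial>std_gauss (Suc m)) \<le>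
    (\<integral>\<^sup>+T. f1 (T m, ip (Suc m) T T) + f2 (T m, ip (Suc m) T T) \<partial>std_gauss (Suc m))"
    by (rule nn_integral_mono) (auto simp: f1_def f2_def assms(3))
  also have "\<dots> = (\<integral>\<^sup>+T. f1 (T m, ip (Suc m) T T) \<partial>std_gauss (Suc m)) + (\<integral>\<^sup>+T. f2 (T m, ip (Suc m) T T) \<partial>std_gauss (Suc m))"
    by (rule nn_integral_add) measurable
  also have "(\<integral>\<^sup>+T. f1 (T m, ip (Suc m) T T) \<partial>std_gauss (Suc m)) \<le> ennreal (exp \<epsilon>) * (\<integral>\<^sup>+T. f (T m, ip (Suc m) T T) \<partial>std_gauss (Suc m))"
  proof -
    have "(\<integral>\<^sup>+x. (\<integral>\<^sup>+q. f1 (x, q) * ?w x q \<partial>lborel) \<partial>lborel) \<le>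
      (\<integral>\<^sup>+x. (\<integral>\<^sup>+q. ennreal (exp \<epsilon>) * (f (s * x + b q, q) * ?w (s * x + b q) q) \<partial>lborel) \<partial>lborel)"
    proof (intro nn_integral_mono)
      fix x q :: real
      show "f1 (x, q) * ?w x q \<le> ennreal (exp \<epsilon>) * (f (s * x + b q, q) * ?w (s * x + b q) q)"
      proof (cases "G (x, q)")
        case True
        then have "exp (- q / 2) * pos_power p (q - x\<^sup>2) \<le> exp \<epsilon> * (exp (- q / 2) * pos_power p (q - (s * x + b q)\<^sup>2))"
          by (simp add: G_def)
        then have "f (s * x + b q, q) * ?w x q \<le> f (s * x + b q, q) * (ennreal (exp \<epsilon>) * ?w (s * x + b q) q)"
          by (intro mult_left_mono) (simp_all add: ennreal_mult'[symmetric])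
        then show ?thesis using True by (simp add: f1_def ac_simps)
      qed (simp add: f1_def)
    qed
    also have "\<dots> = (\<integral>\<^sup>+q. (\<integral>\<^sup>+x. ennreal (exp \<epsilon>) * (f (s * x + b q, q) * ?w (s * x + b q) q) \<partial>lborel) \<partial>lborel)"
      by (rule lborel_pair.Fubini') measurable
    also have "\<dots> \<le> (\<integral>\<^sup>+q. (\<integral>\<^sup>+x. ennreal (exp \<epsilon>) * (f (x, q) * ?w x q) \<partial>lborel) \<partial>lborel)"
      by (intro nn_integral_mono nn_integral_real_affine_le[where h="\<lambda>x. ennreal (exp \<epsilon>) * (f (x, _) * ?w x _)"] s) measurable
    also have "\<dots> = (\<integral>\<^sup>+x. (\<integral>\<^sup>+q. ennreal (exp \<epsilon>) * (f (x, q) * ?w x q) \<partial>lborel) \<partial>lborel)"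
      by (rule lborel_pair.Fubini') measurable
    also have "\<dots> = ennreal (exp \<epsilon>) * (\<integral>\<^sup>+x. (\<integral>\<^sup>+q. f (x, q) * ?w x q \<partial>lborel) \<partial>lborel)"
      by (simp add: nn_integral_cmult)
    finally show ?thesis unfolding C[OF f1m] C[OF f]
      by (subst mult.left_commute) (rule mult_left_mono, auto)
  qed
  finally show ?thesis by (auto simp: f2_def G_def ip_Suc add_right_mono)
qed

text \<open>In this direction the Jacobian costs the factor \<open>s\<close>, but stretching
  \<open>x\<close> can only lower \<open>q - x^2\<close> and hence the density. So there is no
  exceptional event and no additive error.\<close>

lemma std_gauss_compare_down:
  fixes p :: nat and s :: real
  defines "m \<equiv> 2 * p + 2"
  assumes f[measurable]: "f \<in> borel_measurable (borel \<Otimes>\<^sub>M borel)" and s: "1 \<le> s"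
  shows "(\<integral>\<^sup>+T. f (T m, ip (Suc m) T T) \<partial>std_gauss (Suc m)) \<le>
    ennreal s * (\<integral>\<^sup>+T. f (s * T m, ip (Suc m) T T) \<partial>std_gauss (Suc m))"
proof -
  from std_gauss_polar[of p] obtain C where
    C: "\<And>f. f \<in> borel_measurable (borel \<Otimes>\<^sub>M borel) \<Longrightarrow> (\<integral>\<^sup>+T. f (T m, ip (Suc m) T T) \<partial>std_gauss (Suc m)) =
    C * (\<integral>\<^sup>+x. (\<integral>\<^sup>+q. f (x, q) * ennreal (exp (- q / 2) * pos_power p (q - x\<^sup>2)) \<partial>lborel) \<partial>lborel)"
    unfolding m_def by blast
  let ?w = "\<lambda>x q. ennreal (exp (- q / 2) * pos_power p (q - x\<^sup>2))"
  have fs: "(\<lambda>(x, q). f (s * x, q)) \<in> borel_measurable (borel \<Otimes>\<^sub>M borel)" by measurable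
  have "(\<integral>\<^sup>+x. (\<integral>\<^sup>+q. f (x, q) * ?w x q \<partial>lborel) \<partial>lborel) = (\<integral>\<^sup>+q. (\<integral>\<^sup>+x. f (x, q) * ?w x q \<partial>lborel) \<partial>lborel)"
    by (rule lborel_pair.Fubini') measurable
  also have "\<dots> = (\<integral>\<^sup>+q. ennreal s * (\<integral>\<^sup>+x. f (s * x, q) * ?w (s * x) q \<partial>lborel) \<partial>lborel)"
    using s by (intro nn_integral_cong) (subst nn_integral_real_affine[where c=s and t=0], auto)
  also have "\<dots> \<le> (\<integral>\<^sup>+q. ennreal s * (\<integral>\<^sup>+x. f (s * x, q) * ?w x q \<partial>lborel) \<partial>lborel)"
  proof (intro nn_integral_mono mult_left_mono ennreal_leI pos_power_mono)
    fix x q :: real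
    have "1 * x\<^sup>2 \<le> s\<^sup>2 * x\<^sup>2" by (rule mult_right_mono) (use s in auto)
    then show "q - (s * x)\<^sup>2 \<le> q - x\<^sup>2" by (simp add: power_mult_distrib)
  qed auto
  also have "\<dots> = ennreal s * (\<integral>\<^sup>+q. (\<integral>\<^sup>+x. f (s * x, q) * ?w x q \<partial>lborel) \<partial>lborel)"
    by (rule nn_integral_cmult) measurable
  also have "(\<integral>\<^sup>+q. (\<integral>\<^sup>+x. f (s * x, q) * ?w x q \<partial>lborel) \<partial>lborel) = (\<integral>\<^sup>+x. (\<integral>\<^sup>+q. f (s * x, q) * ?w x q \<partial>lborel) \<partial>lborel)"
    by (rule lborel_pair.Fubini') measurable
  finally show ?thesis unfolding C[OF f] using C[OF fs]
    by (simp add: mult.left_commute mult_left_mono)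
qed

section \<open>Random linear combinations of the rows of a matrix\<close>

definition comb :: "nat \<Rightarrow> nat \<Rightarrow> (nat \<Rightarrow> nat \<Rightarrow> real) \<Rightarrow> (nat \<Rightarrow> real) \<Rightarrow> nat \<Rightarrow> real" where
  "comb d k y g = (\<lambda>e\<in>{..<d}. \<Sum>j<k. g j * y j e)"

definition perp :: "nat \<Rightarrow> nat \<Rightarrow> (nat \<Rightarrow> nat \<Rightarrow> real) \<Rightarrow> (nat \<Rightarrow> real) \<Rightarrow> nat \<Rightarrow> real" where
  "perp k m u g = (\<lambda>i\<in>{..<k}. g i - (\<Sum>l<m. ip k (u l) g * u l i))"

lemma comb_measurable[measurable]: "comb d k y \<in> lborel_pow k \<rightarrow>\<^sub>M lborel_pow d"
  unfolding comb_def by (rule measurable_restrict_lborel_pow)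
    (intro borel_measurable_sum borel_measurable_times lborel_pow_component borel_measurable_const, auto)

lemma perp_measurable[measurable]: "perp k m u \<in> lborel_pow k \<rightarrow>\<^sub>M lborel_pow k"
  unfolding perp_def by (rule measurable_restrict_lborel_pow)
    (intro borel_measurable_sum borel_measurable_diff borel_measurable_times ip_measurable lborel_pow_component borel_measurable_const, auto)

text \<open>
  Only the last direction moves the linear combination; the kernel directions \<open>u l\<close> for \<open>l < m\<close> enter
  through the squared norm alone, and they smooth its conditional law (\<open>std_gauss_polar\<close>).
\<close>

lemma std_gauss_split:
  assumes orth: "\<And>l l'. l < Suc m \<Longrightarrow> l' < Suc m \<Longrightarrow> ip k (u l) (u l') = (if l = l' then 1 else 0)"
    and ker: "\<And>l e. l < m \<Longrightarrow> e < d \<Longrightarrow> (\<Sum>j<k. u l j * y j e) = 0"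
    and last: "\<And>e. e < d \<Longrightarrow> (\<Sum>j<k. u m j * y j e) = \<zeta> e"
    and F[measurable]: "F \<in> borel_measurable (lborel_pow d \<Otimes>\<^sub>M borel)"
  shows "(\<integral>\<^sup>+g. F (comb d k y g, ip k g g) \<partial>std_gauss k) =
    (\<integral>\<^sup>+g. (\<integral>\<^sup>+T. F (\<lambda>e\<in>{..<d}. comb d k y (perp k (Suc m) u g) e + T m * \<zeta> e,
       ip k (perp k (Suc m) u g) (perp k (Suc m) u g) + ip (Suc m) T T) \<partial>std_gauss (Suc m)) \<partial>std_gauss k)"
proof -
  have "(\<lambda>g. F (comb d k y g, ip k g g)) \<in> borel_measurable (lborel_pow k)"
    by measurable
  from std_gauss_resample[OF orth this, symmetric]
  have "(\<integral>\<^sup>+g. F (comb d k y g, ip k g g) \<partial>std_gauss k) =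
    (\<integral>\<^sup>+g. (\<integral>\<^sup>+T. F (comb d k y (\<lambda>i\<in>{..<k}. g i + (\<Sum>l<Suc m. (T l - ip k (u l) g) * u l i)),
      ip k (\<lambda>i\<in>{..<k}. g i + (\<Sum>l<Suc m. (T l - ip k (u l) g) * u l i)) (\<lambda>i\<in>{..<k}. g i + (\<Sum>l<Suc m. (T l - ip k (u l) g) * u l i))) \<partial>std_gauss (Suc m)) \<partial>std_gauss k)"
    by simp
  also have "\<dots> = (\<integral>\<^sup>+g. (\<integral>\<^sup>+T. F (\<lambda>e\<in>{..<d}. comb d k y (perp k (Suc m) u g) e + T m * \<zeta> e,
       ip k (perp k (Suc m) u g) (perp k (Suc m) u g) + ip (Suc m) T T) \<partial>std_gauss (Suc m)) \<partial>std_gauss k)"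
  proof (intro nn_integral_cong arg_cong[where f=F] prod_eqI; unfold fst_conv snd_conv)
    fix g T
    let ?h = "perp k (Suc m) u g"
    let ?v = "\<lambda>i. \<Sum>l<Suc m. T l * u l i"
    have *: "(\<lambda>i\<in>{..<k}. g i + (\<Sum>l<Suc m. (T l - ip k (u l) g) * u l i)) = (\<lambda>i\<in>{..<k}. ?h i + ?v i)"
      by (auto simp: perp_def fun_eq_iff algebra_simps sum_subtractf sum.distrib)
    have "(\<Sum>j<k. ?v j * y j e) = T m * \<zeta> e" if "e < d" for e
    proof -
      have "(\<Sum>j<k. ?v j * y j e) = (\<Sum>l<Suc m. T l * (\<Sum>j<k. u l j * y j e))"
        unfolding sum_distrib_left sum_distrib_right by (subst sum.swap) (simp add: ac_simps)
      also have "\<dots> = T m * \<zeta> e" using that by (simp add: ker last)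
      finally show ?thesis .
    qed
    then have "(\<Sum>j<k. (?h j + ?v j) * y j e) = comb d k y ?h e + T m * \<zeta> e" if "e < d" for e
      using that by (simp add: comb_def distrib_right sum.distrib)
    then show "comb d k y (\<lambda>i\<in>{..<k}. g i + (\<Sum>l<Suc m. (T l - ip k (u l) g) * u l i)) =
      (\<lambda>e\<in>{..<d}. comb d k y ?h e + T m * \<zeta> e)"
      unfolding * by (auto simp: comb_def[of d k y "restrict _ _"] fun_eq_iff intro!: restrict_ext)
    have h: "ip k ?h x = ip k (\<lambda>i. g i - (\<Sum>l<Suc m. ip k (u l) g * u l i)) x"
      "ip k x ?h = ip k x (\<lambda>i. g i - (\<Sum>l<Suc m. ip k (u l) g * u l i))" for x
      by (auto intro!: ip_cong simp: perp_def)
    let ?P = "\<lambda>i j. if i = j then 1 else (0::real)"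
    have sym: "?P i j = ?P j i" for i j by simp
    have orth': "bil k ?P (u l) (u l') = (if l = l' then 1 else 0)" if "l < Suc m" "l' < Suc m" for l l'
      using orth[OF that] by (simp add: ip_bil)
    have 0: "ip k (u l) ?h = 0" if "l < Suc m" for l
      apply (subst h(2))
      unfolding ip_bil bil_diff_right
      using bil_project(1)[where T="\<lambda>l. bil k ?P (u l) g" and m="Suc m", OF sym orth' that] by simp
    \<comment> \<open>Pythagoras for the residual plus the fresh combination.
      \<open>bil_project\<close> speaks of a difference, hence \<open>- T\<close>; the cross terms
      vanish by the preceding fact.\<close>
    have 1: "bil k ?P (\<lambda>i. ?h i - (\<Sum>l<Suc m. (- T l) * u l i)) (\<lambda>i. ?h i - (\<Sum>l<Suc m. (- T l) * u l i)) =
      ip k ?h ?h + ip (Suc m) T T"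
      using bil_project(2)[where T="\<lambda>l. - T l" and y="?h" and m="Suc m" and u=u and d=k, OF sym orth'] 0
      by (simp add: ip_bil[symmetric]) (simp add: ip_def)
    have "ip k (\<lambda>i\<in>{..<k}. ?h i + ?v i) (\<lambda>i\<in>{..<k}. ?h i + ?v i) = ip k ?h ?h + ip (Suc m) T T"
      unfolding 1[symmetric] ip_bil[symmetric] by (intro ip_cong) (simp_all add: sum_negf)
    then show "ip k (\<lambda>i\<in>{..<k}. g i + (\<Sum>l<Suc m. (T l - ip k (u l) g) * u l i)) (\<lambda>i\<in>{..<k}. g i + (\<Sum>l<Suc m. (T l - ip k (u l) g) * u l i)) =
      ip k ?h ?h + ip (Suc m) T T"
      unfolding * .
  qed
  finally show ?thesis .
qed

text \<open>The relative decrease of \<open>r\<close> is at most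
  \<open>(\<epsilon> / 8) / (p / 4) = \<epsilon> / (2 * p)\<close>. By Bernoulli the
  \<open>p\<close>-th power keeps at least the fraction \<open>1 - \<epsilon> / 2\<close>, and
  \<open>(1 + \<epsilon>) * (1 - \<epsilon> / 2) \<ge> 1\<close>.\<close>

lemma pos_power_compare:
  assumes p: "1 \<le> p" and eps: "0 < \<epsilon>" "\<epsilon> \<le> 1" and r: "real p / 4 \<le> r" and x: "x \<le> \<epsilon> / 8"
  shows "pos_power p r \<le> exp \<epsilon> * pos_power p (r - x)"
proof -
  define \<eta> where "\<eta> = \<epsilon> / (2 * real p)"
  have "0 < real p / 4" using p by simp
  then have r0: "0 < r" using r by linarith
  have \<eta>: "0 < \<eta>" "\<eta> \<le> 1/2" using p eps by (auto simp: \<eta>_def field_simps)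
  have "\<epsilon> / 8 = real p / 4 * \<eta>" using p by (simp add: \<eta>_def field_simps)
  also have "\<dots> \<le> r * \<eta>" using r \<eta> by (intro mult_right_mono) auto
  finally have "r * (1 - \<eta>) \<le> r - x" using x by (simp add: algebra_simps)
  moreover have "0 < r * (1 - \<eta>)" using r0 \<eta> by simp
  ultimately have "pos_power p (r * (1 - \<eta>)) \<le> pos_power p (r - x)" by (intro pos_power_mono)
  moreover have "pos_power p (r * (1 - \<eta>)) = r ^ p * (1 - \<eta>) ^ p"
    using \<open>0 < r * (1 - \<eta>)\<close> by (simp add: pos_power_def power_mult_distrib)
  ultimately have 1: "r ^ p * (1 - \<eta>) ^ p \<le> pos_power p (r - x)" by simp
  have "1 + real p * (- \<eta>) \<le> (1 + - \<eta>) ^ p" by (rule Bernoulli_inequality) (use \<eta> in auto)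
  moreover have "real p * \<eta> = \<epsilon> / 2" using p by (simp add: \<eta>_def)
  ultimately have 2: "1 - \<epsilon> / 2 \<le> (1 - \<eta>) ^ p" by simp
  have "1 \<le> (1 + \<epsilon>) * (1 - \<epsilon> / 2)"
  proof -
    have "\<epsilon> * \<epsilon> \<le> 1 * \<epsilon>" by (rule mult_right_mono) (use eps in auto)
    then show ?thesis by (simp add: algebra_simps)
  qed
  also have "\<dots> \<le> exp \<epsilon> * (1 - \<eta>) ^ p"
    by (rule mult_mono[OF exp_ge_add_one_self 2]) (use eps in auto)
  finally have "r ^ p * 1 \<le> r ^ p * (exp \<epsilon> * (1 - \<eta>) ^ p)"
    by (rule mult_left_mono) (use r0 in auto)
  also have "\<dots> = exp \<epsilon> * (r ^ p * (1 - \<eta>) ^ p)" by simp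
  also have "\<dots> \<le> exp \<epsilon> * pos_power p (r - x)" using 1 by simp
  finally show ?thesis using r0 by (simp add: pos_power_def)
qed

section \<open>Exponential tail bounds\<close>

lemma nn_integral_indicator_le:
  assumes "\<And>x. P x \<Longrightarrow> 1 \<le> c * u x" "u \<in> borel_measurable M" "(\<integral>\<^sup>+x. u x \<partial>M) = I"
  shows "(\<integral>\<^sup>+x. (if P x then 1 else 0) \<partial>M) \<le> c * I"
proof -
  have "(\<integral>\<^sup>+x. (if P x then 1 else 0) \<partial>M) \<le> (\<integral>\<^sup>+x. c * u x \<partial>M)"
    using assms(1) by (intro nn_integral_mono) auto
  also have "\<dots> = c * I" using assms by (simp add: nn_integral_cmult)
  finally show ?thesis .
qed

lemma std_gauss_coord_tail:
  "(\<integral>\<^sup>+T. (if z < (T m)\<^sup>2 then 1 else 0) \<partial>std_gauss (Suc m)) \<le> ennreal (sqrt 2 * exp (- z / 4))"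
proof -
  let ?f = "\<lambda>i x. if i = m then ennreal (exp (1/4 * x\<^sup>2)) else 1"
  have "(\<integral>\<^sup>+T. ennreal (exp (1/4 * (T m)\<^sup>2)) \<partial>std_gauss (Suc m)) = (\<integral>\<^sup>+T. (\<Prod>i<Suc m. ?f i (T i)) \<partial>std_gauss (Suc m))"
    by (intro nn_integral_cong) simp
  also have "\<dots> = ennreal (sqrt 2)"
    by (subst nn_integral_std_gauss_prod[where f="?f"])
       (auto simp: nn_integral_std_normal_density std_normal_exp_square[of "1/4", simplified] real_sqrt_divide)
  finally have "(\<integral>\<^sup>+T. ennreal (exp (1/4 * (T m)\<^sup>2)) \<partial>std_gauss (Suc m)) = ennreal (sqrt 2)" .
  then have "(\<integral>\<^sup>+T. (if z < (T m)\<^sup>2 then 1 else 0) \<partial>std_gauss (Suc m)) \<le> ennreal (exp (- z / 4)) * ennreal (sqrt 2)"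
    by (intro nn_integral_indicator_le[where u="\<lambda>T. ennreal (exp (1/4 * (T m)\<^sup>2))"])
       (auto simp: ennreal_mult'[symmetric] exp_add[symmetric] intro!: borel_measurable_exp measurable_compose[OF _ measurable_ennreal] borel_measurable_times
         borel_measurable_power lborel_pow_component)
  then show ?thesis by (simp add: ennreal_mult'[symmetric] mult.commute)
qed

text \<open>The mean of \<open>ip m T T\<close> is \<open>2 * p + 2\<close>, so \<open>p / 4\<close>
  lies far below it. Chernoff with \<open>exp (- ip m T T)\<close> gives a power with base
  \<open>exp (1/4) / 3 \<le> 1/2\<close>.\<close>

lemma std_gauss_lower_tail:
  fixes p :: nat
  defines "m \<equiv> 2 * p + 2"
  shows "(\<integral>\<^sup>+T. (if ip m T T < real p / 4 then 1 else 0) \<partial>std_gauss (Suc m)) \<le> ennreal ((1/2) ^ p)"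
proof -
  let ?f = "\<lambda>i x. if i < m then ennreal (exp (- 1 * x\<^sup>2)) else 1"
  have "(\<integral>\<^sup>+T. ennreal (exp (- ip m T T)) \<partial>std_gauss (Suc m)) = (\<integral>\<^sup>+T. (\<Prod>i<Suc m. ?f i (T i)) \<partial>std_gauss (Suc m))"
    by (intro nn_integral_cong) (simp add: prod_ennreal exp_sum[symmetric] ip_def sum_negf power2_eq_square)
  also have "\<dots> = ennreal ((1 / sqrt 3) ^ m)"
    by (subst nn_integral_std_gauss_prod[where f="?f"])
       (auto simp: nn_integral_std_normal_density std_normal_exp_square[of "-1", simplified] ennreal_power)
  also have "\<dots> = ennreal ((1/3) ^ (p + 1))"
    by (simp add: m_def power_mult power_add power_divide)
  finally have "(\<integral>\<^sup>+T. ennreal (exp (- ip m T T)) \<partial>std_gauss (Suc m)) = ennreal ((1/3) ^ (p + 1))" .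
  moreover have "(\<lambda>T. ip m T T) \<in> borel_measurable (std_gauss (Suc m))"
    unfolding measurable_cong_sets[OF sets_std_gauss refl]
    by (intro ip_measurable lborel_pow_component) auto
  then have "(\<lambda>T. ennreal (exp (- ip m T T))) \<in> borel_measurable (std_gauss (Suc m))"
    by measurable
  ultimately have "(\<integral>\<^sup>+T. (if ip m T T < real p / 4 then 1 else 0) \<partial>std_gauss (Suc m)) \<le> ennreal (exp (real p / 4)) * ennreal ((1/3) ^ (p + 1))"
    by (intro nn_integral_indicator_le) (auto simp: ennreal_mult'[symmetric] exp_add[symmetric])
  also have "\<dots> = ennreal (exp (1/4) ^ p * (1/3) ^ (p + 1))"
    by (simp add: ennreal_mult'[symmetric] exp_of_nat_mult[symmetric])
  also have "\<dots> \<le> ennreal ((1/2) ^ p)"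
  proof (rule ennreal_leI)
    have "exp (1/4::real) \<le> 1 + 1/4 + (1/4)\<^sup>2" by (rule exp_bound) auto
    then have "exp (1/4::real) \<le> 3/2" by (simp add: power2_eq_square)
    then have "exp (1/4) ^ p * (1/3) ^ (p + 1) \<le> (3/2) ^ p * (1/3::real) ^ p"
      by (intro mult_mono power_mono) auto
    then show "exp (1/4) ^ p * (1/3) ^ (p + 1) \<le> (1/2::real) ^ p"
      by (simp add: power_mult_distrib[symmetric])
  qed
  finally show ?thesis .
qed

text \<open>Chernoff with the exponent \<open>1/4\<close>, where the base is
  \<open>exp (- 2) * sqrt 2 \<le> 1/2\<close>.\<close>

lemma std_gauss_upper_tail:
  "(\<integral>\<^sup>+g. (if 8 * real k < ip k g g then 1 else 0) \<partial>std_gauss k) \<le> ennreal ((1/2) ^ k)"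
proof -
  have "(\<integral>\<^sup>+g. (if 8 * real k < ip k g g then 1 else 0) \<partial>std_gauss k) \<le>
    ennreal (exp (- 2 * real k)) * ennreal ((1 / sqrt (1 - 2 * (1/4))) ^ k)"
    by (intro nn_integral_indicator_le[where u="\<lambda>g. ennreal (exp (1/4 * ip k g g))"] std_gauss_exp_square)
       (auto simp: ennreal_mult'[symmetric] exp_add[symmetric])
  also have "\<dots> = ennreal ((exp (- 2) * sqrt 2) ^ k)"
    by (simp add: ennreal_mult'[symmetric] exp_of_nat_mult[symmetric] power_mult_distrib real_sqrt_divide ac_simps)
  also have "\<dots> \<le> ennreal ((1/2) ^ k)"
  proof (intro ennreal_leI power_mono)
    have "sqrt 2 \<le> (3/2::real)" by (rule real_le_lsqrt) (auto simp: power2_eq_square)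
    moreover have "exp (- 2) \<le> (1/3::real)"
      using exp_ge_add_one_self[of 2] by (simp add: exp_minus field_simps)
    ultimately have "exp (- 2) * sqrt 2 \<le> (1/3) * (3/2::real)" by (intro mult_mono) auto
    then show "exp (- 2) * sqrt 2 \<le> (1/2::real)" by simp
  qed auto
  finally show ?thesis .
qed

lemma restrict_affine_measurable:
  "(\<lambda>(x, q). (\<lambda>e\<in>{..<d}. z e + x * \<eta> e, c + q)) \<in> borel \<Otimes>\<^sub>M borel \<rightarrow>\<^sub>M lborel_pow d \<Otimes>\<^sub>M (borel :: real measure)"
  unfolding split_def by (intro measurable_Pair measurable_restrict_lborel_pow) measurable

lemma split_integrand_measurable:
  assumes F[measurable]: "F \<in> borel_measurable (lborel_pow d \<Otimes>\<^sub>M borel)"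
    and h[measurable]: "h \<in> borel_measurable (borel \<Otimes>\<^sub>M borel)"
  shows "(\<lambda>(g, T). F (\<lambda>e\<in>{..<d}. comb d k y (perp k n u g) e + h (T m, ip k (perp k n u g) (perp k n u g) + ip (Suc m) T T) * \<eta> e,
    ip k (perp k n u g) (perp k n u g) + ip (Suc m) T T)) \<in> borel_measurable (std_gauss k \<Otimes>\<^sub>M std_gauss (Suc m))"
proof -
  let ?M = "std_gauss k \<Otimes>\<^sub>M std_gauss (Suc m)"
  have [measurable]: "perp k n u \<in> std_gauss k \<rightarrow>\<^sub>M lborel_pow k" by simp
  have n[measurable]: "(\<lambda>p. ip k (perp k n u (fst p)) (perp k n u (fst p)) + ip (Suc m) (snd p) (snd p)) \<in> borel_measurable ?M"
    by (intro borel_measurable_add measurable_compose[OF _ ip_self_measurable]) measurable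
  have t[measurable]: "(\<lambda>p. snd p m) \<in> borel_measurable ?M"
    by (rule measurable_compose[OF measurable_snd]) (simp add: lborel_pow_component)
  have c: "(\<lambda>p. comb d k y (perp k n u (fst p)) e) \<in> borel_measurable ?M" if "e < d" for e
    by (rule measurable_compose[OF _ lborel_pow_component[OF that]]) measurable
  have h': "(\<lambda>p. h (snd p m, ip k (perp k n u (fst p)) (perp k n u (fst p)) + ip (Suc m) (snd p) (snd p)) * \<eta> e) \<in> borel_measurable ?M" for e
    by (intro borel_measurable_times measurable_compose[OF measurable_Pair[OF t n] h] borel_measurable_const)
  have "(\<lambda>p. (\<lambda>e\<in>{..<d}. comb d k y (perp k n u (fst p)) e + h (snd p m, ip k (perp k n u (fst p)) (perp k n u (fst p)) + ip (Suc m) (snd p) (snd p)) * \<eta> e)) \<in> ?M \<rightarrow>\<^sub>M lborel_pow d"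
    by (rule measurable_restrict_lborel_pow) (intro borel_measurable_add c h')
  from measurable_compose[OF measurable_Pair[OF this n] F] show ?thesis unfolding split_def .
qed

text \<open>\<open>std_gauss_compare_up\<close> in the coordinates \<open>T\<close> along the
  orthonormal vectors, with the residual of \<open>g\<close> held fixed. Outside three events (a
  large \<open>T m\<close>, a small norm along the kernel, a total squared norm above
  \<open>8 * k\<close>) the hypothesis \<open>small\<close> bounds the growth of the square of the
  moving coordinate by \<open>\<epsilon> / 8\<close>, as \<open>pos_power_compare\<close> requires.
  The shift is proportional to the total norm because the output is divided by that norm.\<close>

lemma split_compare_up:
  fixes p :: nat and s \<beta> \<epsilon> z :: real
  defines "m \<equiv> 2 * p + 2"
  assumes orth: "\<And>l l'. l < Suc m \<Longrightarrow> l' < Suc m \<Longrightarrow> ip k (u l) (u l') = (if l = l' then 1 else 0)"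
    and ker: "\<And>l e. l < m \<Longrightarrow> e < d \<Longrightarrow> (\<Sum>j<k. u l j * y j e) = 0"
    and F[measurable]: "F \<in> borel_measurable (lborel_pow d \<Otimes>\<^sub>M borel)" and F1: "\<And>x. F x \<le> 1"
    and p: "1 \<le> p" and eps: "0 < \<epsilon>" "\<epsilon> \<le> 1" and s: "1 \<le> s" and \<beta>: "0 \<le> \<beta>" and z: "0 \<le> z"
    and small: "(s\<^sup>2 - 1) * z + 2 * s * sqrt z * (\<beta> * sqrt (8 * real k)) + (\<beta> * sqrt (8 * real k))\<^sup>2 \<le> \<epsilon> / 8"
  defines "G \<equiv> \<lambda>g. comb d k y (perp k (Suc m) u g)"
    and "E \<equiv> \<lambda>g. ip k (perp k (Suc m) u g) (perp k (Suc m) u g)"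
  shows "(\<integral>\<^sup>+g. (\<integral>\<^sup>+T. F (\<lambda>e\<in>{..<d}. G g e + (s * T m + \<beta> * sqrt (E g + ip (Suc m) T T)) * \<eta> e, E g + ip (Suc m) T T) \<partial>std_gauss (Suc m)) \<partial>std_gauss k)
    \<le> ennreal (exp \<epsilon>) * (\<integral>\<^sup>+g. (\<integral>\<^sup>+T. F (\<lambda>e\<in>{..<d}. G g e + T m * \<eta> e, E g + ip (Suc m) T T) \<partial>std_gauss (Suc m)) \<partial>std_gauss k)
     + ennreal (sqrt 2 * exp (- z / 4) + (1/2) ^ p + (1/2) ^ k)" (is "?L \<le> _")
proof -
  let ?S = "std_gauss (Suc m)"
  have E0: "0 \<le> E g" for g by (simp add: E_def)
  let ?A = "\<lambda>g. \<integral>\<^sup>+T. F (\<lambda>e\<in>{..<d}. G g e + T m * \<eta> e, E g + ip (Suc m) T T) \<partial>?S"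
  let ?B3 = "\<lambda>g. \<integral>\<^sup>+T. (if 8 * real k < E g + ip (Suc m) T T then 1 else 0) \<partial>?S"
  have Am: "?A \<in> borel_measurable (std_gauss k)"
    using split_integrand_measurable[OF F measurable_fst, of k y "Suc m" u m \<eta>]
    unfolding G_def E_def fst_conv by (rule std_gauss.borel_measurable_nn_integral)
  let ?F3 = "\<lambda>p. if 8 * real k < snd p then 1 else (0::ennreal)"
  have F3: "?F3 \<in> borel_measurable (lborel_pow d \<Otimes>\<^sub>M borel)" by measurable
  have B3m: "?B3 \<in> borel_measurable (std_gauss k)"
    using split_integrand_measurable[OF F3 measurable_fst, of k y "Suc m" u m \<eta>]
    unfolding G_def E_def fst_conv snd_conv by (rule std_gauss.borel_measurable_nn_integral)
  have "(\<integral>\<^sup>+T. F (\<lambda>e\<in>{..<d}. G g e + (s * T m + \<beta> * sqrt (E g + ip (Suc m) T T)) * \<eta> e, E g + ip (Suc m) T T) \<partial>?S)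
     \<le> ennreal (exp \<epsilon>) * ?A g + (ennreal (sqrt 2 * exp (- z / 4) + (1/2) ^ p) + ?B3 g)" for g
  proof -
    define f where "f = (\<lambda>(x, q). F (\<lambda>e\<in>{..<d}. G g e + x * \<eta> e, E g + q))"
    have fm: "f \<in> borel_measurable (borel \<Otimes>\<^sub>M borel)"
      using measurable_compose[OF restrict_affine_measurable F, of "G g" \<eta> "E g"] by (simp add: f_def split_def)
    define b where "b = (\<lambda>q. \<beta> * sqrt (E g + q))"
    have bm: "b \<in> borel_measurable borel" unfolding b_def by measurable
    have "(\<integral>\<^sup>+T. F (\<lambda>e\<in>{..<d}. G g e + (s * T m + \<beta> * sqrt (E g + ip (Suc m) T T)) * \<eta> e, E g + ip (Suc m) T T) \<partial>?S) =
      (\<integral>\<^sup>+T. f (s * T m + b (ip (Suc m) T T), ip (Suc m) T T) \<partial>?S)"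
      by (simp add: f_def b_def)
    also have "\<dots> \<le> ennreal (exp \<epsilon>) * (\<integral>\<^sup>+T. f (T m, ip (Suc m) T T) \<partial>?S) +
      (\<integral>\<^sup>+T. (if pos_power p (ip m T T) \<le> exp \<epsilon> * pos_power p (ip (Suc m) T T - (s * T m + b (ip (Suc m) T T))\<^sup>2) then 0 else 1) \<partial>?S)"
      unfolding m_def by (rule std_gauss_compare_up[OF fm _ s bm]) (simp add: f_def split_def F1)
    also have "(\<integral>\<^sup>+T. f (T m, ip (Suc m) T T) \<partial>?S) = ?A g"
      by (simp add: f_def)
    also have "(\<integral>\<^sup>+T. (if pos_power p (ip m T T) \<le> exp \<epsilon> * pos_power p (ip (Suc m) T T - (s * T m + b (ip (Suc m) T T))\<^sup>2) then 0 else 1) \<partial>?S)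
      \<le> (\<integral>\<^sup>+T. (if z < (T m)\<^sup>2 then 1 else 0) + ((if ip m T T < real p / 4 then 1 else 0) + (if 8 * real k < E g + ip (Suc m) T T then 1 else 0)) \<partial>?S)"
    proof (rule nn_integral_mono)
      fix T
      have "pos_power p (ip m T T) \<le> exp \<epsilon> * pos_power p (ip (Suc m) T T - (s * T m + b (ip (Suc m) T T))\<^sup>2)"
        if "(T m)\<^sup>2 \<le> z" "real p / 4 \<le> ip m T T" "E g + ip (Suc m) T T \<le> 8 * real k"
      proof -
        let ?t = "T m" and ?w = "b (ip (Suc m) T T)" and ?v = "\<beta> * sqrt (8 * real k)"
        have w: "0 \<le> ?w" "?w \<le> ?v"
          using \<beta> that(3) E0[of g] by (auto simp: b_def intro!: mult_left_mono)
        have t: "\<bar>?t\<bar> \<le> sqrt z" using that(1) by (metis real_sqrt_abs real_sqrt_le_mono)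
        \<comment> \<open>The three terms of \<open>(s * t + w)^2 - t^2\<close> are bounded one by
          one.\<close>
        have "(s\<^sup>2 - 1) * ?t\<^sup>2 \<le> (s\<^sup>2 - 1) * z" using s that(1) by (intro mult_left_mono) auto
        moreover have "?t * ?w \<le> sqrt z * ?v"
          by (rule order_trans[OF mult_right_mono[OF abs_ge_self w(1)]]) (intro mult_mono t w, use z w in auto)
        then have "2 * s * (?t * ?w) \<le> 2 * s * (sqrt z * ?v)" using s by (intro mult_left_mono) auto
        moreover have "?w\<^sup>2 \<le> ?v\<^sup>2" using w by (intro power_mono)
        ultimately have "(s * ?t + ?w)\<^sup>2 - ?t\<^sup>2 \<le> \<epsilon> / 8"
          using small by (simp add: power2_eq_square algebra_simps)
        from pos_power_compare[OF p eps that(2) this]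
        show ?thesis by (simp add: ip_Suc algebra_simps)
      qed
      then show "(if pos_power p (ip m T T) \<le> exp \<epsilon> * pos_power p (ip (Suc m) T T - (s * T m + b (ip (Suc m) T T))\<^sup>2) then 0 else 1)
       \<le> (if z < (T m)\<^sup>2 then 1 else 0) + ((if ip m T T < real p / 4 then 1 else 0) + (if 8 * real k < E g + ip (Suc m) T T then 1 else (0::ennreal)))"
        by (auto simp: not_less)
    qed
    also have "\<dots> = (\<integral>\<^sup>+T. (if z < (T m)\<^sup>2 then 1 else 0) \<partial>?S) + ((\<integral>\<^sup>+T. (if ip m T T < real p / 4 then 1 else 0) \<partial>?S) + ?B3 g)"
    proof -
      have [measurable]: "(\<lambda>T. ip m T T) \<in> borel_measurable ?S"
        unfolding measurable_cong_sets[OF sets_std_gauss refl] by (intro ip_measurable lborel_pow_component) auto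
      have [measurable]: "(\<lambda>T. ip (Suc m) T T) \<in> borel_measurable ?S"
        unfolding measurable_cong_sets[OF sets_std_gauss refl] by (rule ip_self_measurable)
      have [measurable]: "(\<lambda>T. T m) \<in> borel_measurable ?S"
        unfolding measurable_cong_sets[OF sets_std_gauss refl] by (intro lborel_pow_component) auto
      have "(\<lambda>T. if z < (T m)\<^sup>2 then 1 else 0 :: ennreal) \<in> borel_measurable ?S"
        "(\<lambda>T. if ip m T T < real p / 4 then 1 else 0 :: ennreal) \<in> borel_measurable ?S"
        "(\<lambda>T. if 8 * real k < E g + ip (Suc m) T T then 1 else 0 :: ennreal) \<in> borel_measurable ?S"
        by measurable
      then show ?thesis by (simp only: nn_integral_add borel_measurable_add)
    qed
    also have "\<dots> \<le> ennreal (sqrt 2 * exp (- z / 4)) + (ennreal ((1/2) ^ p) + ?B3 g)"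
      by (intro add_mono std_gauss_coord_tail order_refl) (unfold m_def, rule std_gauss_lower_tail)
    also have "\<dots> = ennreal (sqrt 2 * exp (- z / 4) + (1/2) ^ p) + ?B3 g"
      by (simp add: add.assoc)
    finally show ?thesis by (simp only: add_left_mono)
  qed
  then have "(\<integral>\<^sup>+g. (\<integral>\<^sup>+T. F (\<lambda>e\<in>{..<d}. G g e + (s * T m + \<beta> * sqrt (E g + ip (Suc m) T T)) * \<eta> e, E g + ip (Suc m) T T) \<partial>?S) \<partial>std_gauss k)
    \<le> (\<integral>\<^sup>+g. ennreal (exp \<epsilon>) * ?A g + (ennreal (sqrt 2 * exp (- z / 4) + (1/2) ^ p) + ?B3 g) \<partial>std_gauss k)"
    by (rule nn_integral_mono)
  also have "\<dots> = ennreal (exp \<epsilon>) * (\<integral>\<^sup>+g. ?A g \<partial>std_gauss k) + (ennreal (sqrt 2 * exp (- z / 4) + (1/2) ^ p) + (\<integral>\<^sup>+g. ?B3 g \<partial>std_gauss k))"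
    by (subst nn_integral_add nn_integral_cmult nn_integral_const, (intro Am B3m borel_measurable_add borel_measurable_times_ennreal borel_measurable_const)+)+
       (simp only: nn_integral_const std_gauss.emeasure_space_1 mult_1_right)
  \<comment> \<open>The third event concerns the full norm: \<open>std_gauss_split\<close>, read
    backwards, reassembles residual and coordinates into \<open>g\<close>, to which the tail bound
    applies.\<close>
  also have "(\<integral>\<^sup>+g. ?B3 g \<partial>std_gauss k) = (\<integral>\<^sup>+g. (if 8 * real k < ip k g g then 1 else 0) \<partial>std_gauss k)"
    using std_gauss_split[where F="?F3" and y=y and d=d and \<zeta>="\<lambda>e. \<Sum>j<k. u m j * y j e", OF orth ker refl F3]
    by (simp add: E_def)
  also have "\<dots> \<le> ennreal ((1/2) ^ k)" by (rule std_gauss_upper_tail)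
  finally have "?L \<le> ennreal (exp \<epsilon>) * (\<integral>\<^sup>+g. ?A g \<partial>std_gauss k) + (ennreal (sqrt 2 * exp (- z / 4) + (1/2) ^ p) + ennreal ((1/2) ^ k))"
    by (simp only: add_left_mono)
  then show ?thesis by (simp add: ennreal_plus[symmetric] del: ennreal_plus)
qed

section \<open>Linear algebra\<close>

lemma ip_commute: "ip d x y = ip d y x"
  by (simp add: ip_def mult.commute)

lemma ip_sum_right: "ip d \<theta> (\<lambda>e. \<Sum>j\<in>J. c j * y j e) = (\<Sum>j\<in>J. c j * ip d \<theta> (y j))"
  unfolding ip_def sum_distrib_left by (subst sum.swap) (simp add: ac_simps)

lemma ip_eq_0_iff: "ip d x x = 0 \<longleftrightarrow> (\<forall>e<d. x e = 0)"
  unfolding ip_def by (subst sum_nonneg_eq_0_iff) auto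

lemma ip_Cauchy_Schwarz: "(ip d x y)\<^sup>2 \<le> ip d x x * ip d y y"
  using Cauchy_Schwarz_ineq_sum[of x y "{..<d}"] by (simp add: ip_def power2_eq_square)

text \<open>The sum \<open>A\<close> of the matrices \<open>y j (y j)^T\<close> is positive definite
  by \<open>low\<close>, so \<open>A \<theta> = v\<close> is solvable, and
  \<open>c j = ip d \<theta> (y j)\<close> are the least-squares coefficients. Their squared norm is
  \<open>ip d \<theta> v\<close>; Cauchy-Schwarz bounds its square by
  \<open>ip d \<theta> \<theta> * ip d v v\<close>, and \<open>low\<close> bounds the first factor
  by \<open>ip d \<theta> v / c0\<close>.\<close>

lemma solve_positive_form:
  fixes y :: "nat \<Rightarrow> nat \<Rightarrow> real"
  assumes J: "finite J" and lam: "0 < c0"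
    and low: "\<And>\<theta>. c0 * ip d \<theta> \<theta> \<le> (\<Sum>j\<in>J. (ip d \<theta> (y j))\<^sup>2)"
  obtains c where "\<And>j. j \<notin> J \<Longrightarrow> c j = 0" "\<And>e. e < d \<Longrightarrow> (\<Sum>j\<in>J. c j * y j e) = v e"
    "(\<Sum>j\<in>J. (c j)\<^sup>2) \<le> ip d v v / c0"
proof -
  define A where "A = Matrix.mat d d (\<lambda>(a, b). \<Sum>j\<in>J. y j a * y j b)"
  have A: "A \<in> carrier_mat d d" by (simp add: A_def)
  have Aw: "(A *\<^sub>v w) $ a = (\<Sum>j\<in>J. ip d (\<lambda>i. w $ i) (y j) * y j a)" if "w \<in> carrier_vec d" "a < d" for w a
  proof -
    have "(A *\<^sub>v w) $ a = (\<Sum>b<d. (\<Sum>j\<in>J. y j a * y j b) * w $ b)"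
      using that by (simp add: A_def scalar_prod_def lessThan_atLeast0)
    also have "\<dots> = (\<Sum>j\<in>J. ip d (\<lambda>i. w $ i) (y j) * y j a)"
      unfolding ip_def sum_distrib_right by (subst sum.swap) (simp add: ac_simps)
    finally show ?thesis .
  qed
  have "det A \<noteq> 0"
  proof
    assume "det A = 0"
    then obtain w where w: "w \<in> carrier_vec d" "w \<noteq> 0\<^sub>v d" "A *\<^sub>v w = 0\<^sub>v d"
      using det_0_iff_vec_prod_zero[OF A] by blast
    let ?\<theta> = "\<lambda>i. w $ i"
    have z: "(\<Sum>j\<in>J. ip d ?\<theta> (y j) * y j a) = 0" if "a < d" for a
      using Aw[OF w(1) that] w(3) that by simp
    have "(\<Sum>j\<in>J. (ip d ?\<theta> (y j))\<^sup>2) = ip d ?\<theta> (\<lambda>e. \<Sum>j\<in>J. ip d ?\<theta> (y j) * y j e)"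
      by (simp add: ip_sum_right power2_eq_square)
    also have "\<dots> = 0" using z by (simp add: ip_def)
    finally have "c0 * ip d ?\<theta> ?\<theta> \<le> 0" using low[of ?\<theta>] by simp
    then have "ip d ?\<theta> ?\<theta> = 0" using lam ip_nonneg[of d ?\<theta>] by (intro antisym) (simp_all add: mult_le_0_iff)
    then have "w = 0\<^sub>v d" using w(1) by (auto simp: ip_eq_0_iff)
    then show False using w(2) by simp
  qed
  then have "A \<in> Units (ring_mat TYPE(real) d ())" by (rule det_non_zero_imp_unit[OF A])
  then obtain B where B: "B \<in> carrier_mat d d" "A * B = 1\<^sub>m d"
    unfolding Units_def by (auto simp: ring_mat_simps)
  define w where "w = B *\<^sub>v Matrix.vec d v"
  have w: "w \<in> carrier_vec d" using B by (simp add: w_def)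
  have "A *\<^sub>v w = (A * B) *\<^sub>v Matrix.vec d v"
    unfolding w_def by (rule assoc_mult_mat_vec[symmetric, OF A B(1)]) simp
  then have Aw': "A *\<^sub>v w = Matrix.vec d v" using B by simp
  define \<theta> where "\<theta> i = w $ i" for i
  have v: "(\<Sum>j\<in>J. ip d \<theta> (y j) * y j a) = v a" if "a < d" for a
  proof -
    have "\<theta> = (\<lambda>i. w $ i)" by (simp add: \<theta>_def fun_eq_iff)
    then show ?thesis using Aw[OF w that] Aw' that by simp
  qed
  define c where "c j = (if j \<in> J then ip d \<theta> (y j) else 0)" for j
  have "(\<Sum>j\<in>J. (ip d \<theta> (y j))\<^sup>2) = ip d \<theta> (\<lambda>e. \<Sum>j\<in>J. ip d \<theta> (y j) * y j e)"
    by (simp add: ip_sum_right power2_eq_square)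
  also have "\<dots> = ip d \<theta> v" by (rule ip_cong) (auto simp: v)
  finally have S: "(\<Sum>j\<in>J. (ip d \<theta> (y j))\<^sup>2) = ip d \<theta> v" .
  let ?S = "ip d \<theta> v"
  have S0: "0 \<le> ?S" unfolding S[symmetric] by (simp add: sum_nonneg)
  have "?S * ?S \<le> ip d \<theta> \<theta> * ip d v v"
    using ip_Cauchy_Schwarz[of d \<theta> v] by (simp add: power2_eq_square)
  also have "\<dots> \<le> (?S / c0) * ip d v v"
    using low[of \<theta>] lam unfolding S by (intro mult_right_mono) (auto simp: field_simps)
  finally have "?S * (?S - ip d v v / c0) \<le> 0" by (simp add: algebra_simps)
  then have "?S \<le> ip d v v / c0"
    using S0 lam by (cases "?S = 0") (auto simp: mult_le_0_iff)
  then show thesis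
    by (intro that[of c]) (auto simp: c_def v S)
qed

text \<open>The vectors are the columns of a square matrix of size \<open>Suc d\<close> whose last
  row is zero. Its determinant vanishes, and a normalised kernel vector supplies the
  coefficients.\<close>

lemma dependent_vectors:
  fixes y :: "nat \<Rightarrow> nat \<Rightarrow> real"
  obtains a where "\<And>e. e < d \<Longrightarrow> (\<Sum>l<Suc d. a l * y l e) = 0" "ip (Suc d) a a = 1"
proof -
  let ?n = "Suc d"
  define A where "A = Matrix.mat ?n ?n (\<lambda>(e, l). if e < d then y l e else 0)"
  have A: "A \<in> carrier_mat ?n ?n" by (simp add: A_def)
  have "A\<^sup>T *\<^sub>v unit_vec ?n d = 0\<^sub>v ?n"
  proof (rule eq_vecI)
    fix e assume "e < dim_vec (0\<^sub>v ?n :: real vec)"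
    then have e: "e < ?n" by simp
    then have "(A\<^sup>T *\<^sub>v unit_vec ?n d) $ e = A $$ (d, e)"
      by (simp add: A_def)
    also have "\<dots> = 0" using e by (simp add: A_def)
    finally show "(A\<^sup>T *\<^sub>v unit_vec ?n d) $ e = 0\<^sub>v ?n $ e" using e by simp
  qed (simp add: A_def)
  then have "unit_vec ?n d \<in> carrier_vec ?n \<and> unit_vec ?n d \<noteq> 0\<^sub>v ?n \<and> A\<^sup>T *\<^sub>v unit_vec ?n d = 0\<^sub>v ?n"
    by simp
  moreover have "A\<^sup>T \<in> carrier_mat ?n ?n" using A by simp
  ultimately have "det A\<^sup>T = 0" using det_0_iff_vec_prod_zero by blast
  then have "det A = 0" using det_transpose[OF A] by simp
  then obtain w where w: "w \<in> carrier_vec ?n" "w \<noteq> 0\<^sub>v ?n" "A *\<^sub>v w = 0\<^sub>v ?n"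
    using det_0_iff_vec_prod_zero[OF A] by blast
  let ?N = "sqrt (ip ?n (\<lambda>i. w $ i) (\<lambda>i. w $ i))"
  have "ip ?n (\<lambda>i. w $ i) (\<lambda>i. w $ i) \<noteq> 0"
  proof
    assume "ip ?n (\<lambda>i. w $ i) (\<lambda>i. w $ i) = 0"
    then have "w = 0\<^sub>v ?n" unfolding ip_eq_0_iff by (intro eq_vecI) (use w(1) in auto)
    then show False using w(2) by simp
  qed
  then have pos: "0 < ip ?n (\<lambda>i. w $ i) (\<lambda>i. w $ i)" using ip_nonneg[of ?n "\<lambda>i. w $ i"] by linarith
  have 1: "(\<Sum>l<?n. w $ l * y l e) = 0" if "e < d" for e
  proof -
    have "(\<Sum>l<?n. w $ l * y l e) = (A *\<^sub>v w) $ e"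
      using w(1) that unfolding lessThan_atLeast0 by (simp add: A_def scalar_prod_def mult.commute del: sum.op_ivl_Suc)
    then show ?thesis using w(3) that by simp
  qed
  have "(\<Sum>l<?n. (1 / ?N * w $ l) * y l e) = 0" if "e < d" for e
  proof -
    have "(\<Sum>l<?n. (1 / ?N * w $ l) * y l e) = 1 / ?N * (\<Sum>l<?n. w $ l * y l e)"
      unfolding sum_distrib_left mult.assoc ..
    then show ?thesis using 1[OF that] by simp
  qed
  moreover have "ip ?n (\<lambda>l. 1 / ?N * w $ l) (\<lambda>l. 1 / ?N * w $ l) = 1"
    unfolding ip_scale using pos by (simp add: power_divide)
  ultimately show thesis by (rule that)
qed

lemma sum_block:
  fixes f :: "nat \<Rightarrow> real"
  assumes "s + n \<le> k" "\<And>j. j < s \<or> s + n \<le> j \<Longrightarrow> f j = 0"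
  shows "(\<Sum>j<k. f j) = (\<Sum>l<n. f (s + l))"
proof -
  have "(\<Sum>j<k. f j) = (\<Sum>j\<in>{s..<s+n}. f j)"
    using assms by (intro sum.mono_neutral_right) (auto simp: not_less not_le)
  also have "\<dots> = (\<Sum>l<n. f (s + l))"
    by (rule sum.reindex_bij_witness[of _ "\<lambda>l. s + l" "\<lambda>j. j - s"]) auto
  finally show ?thesis .
qed

text \<open>Each block of \<open>Suc d\<close> consecutive rows after the first \<open>N\<close> has
  its own linear relation. Disjoint supports make the vectors orthogonal to each other and to every
  coefficient vector supported on the first \<open>N\<close> rows, and they confine a changed row to
  a single block.\<close>

lemma kernel_vectors:
  fixes y :: "nat \<Rightarrow> nat \<Rightarrow> real" and N n d :: nat
  defines "k \<equiv> N + n * Suc d"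
  obtains \<kappa> :: "nat \<Rightarrow> nat \<Rightarrow> real" where
    "\<And>b j. b < n \<Longrightarrow> j < N + b * Suc d \<or> N + Suc b * Suc d \<le> j \<Longrightarrow> \<kappa> b j = 0"
    "\<And>b e. b < n \<Longrightarrow> e < d \<Longrightarrow> (\<Sum>j<k. \<kappa> b j * y j e) = 0"
    "\<And>b b'. b < n \<Longrightarrow> b' < n \<Longrightarrow> ip k (\<kappa> b) (\<kappa> b') = (if b = b' then 1 else 0)"
proof -
  have "\<exists>a. (\<forall>e<d. (\<Sum>l<Suc d. a l * y (N + b * Suc d + l) e) = 0) \<and> ip (Suc d) a a = 1" for b
    by (rule dependent_vectors[of d "\<lambda>l. y (N + b * Suc d + l)"]) blast
  then have "\<exists>a. \<forall>b. (\<forall>e<d. (\<Sum>l<Suc d. a b l * y (N + b * Suc d + l) e) = 0) \<and> ip (Suc d) (a b) (a b) = 1"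
    by (intro choice) blast
  then obtain a where a: "\<And>b e. e < d \<Longrightarrow> (\<Sum>l<Suc d. a b l * y (N + b * Suc d + l) e) = 0"
    "\<And>b. ip (Suc d) (a b) (a b) = 1" by blast
  define \<kappa> where "\<kappa> b j = (if j < N + b * Suc d \<or> N + Suc b * Suc d \<le> j then 0 else a b (j - (N + b * Suc d)))" for b j
  have le: "N + b * Suc d + Suc d \<le> k" if "b < n" for b
  proof -
    have "Suc b * Suc d \<le> n * Suc d" using that by (intro mult_right_mono) auto
    then show ?thesis by (simp add: k_def)
  qed
  have S: "(\<Sum>j<k. \<kappa> b j * f j) = (\<Sum>l<Suc d. a b l * f (N + b * Suc d + l))" if "b < n" for b f
  proof -
    have "(\<Sum>j<k. \<kappa> b j * f j) = (\<Sum>l<Suc d. \<kappa> b (N + b * Suc d + l) * f (N + b * Suc d + l))"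
      by (rule sum_block[OF le[OF that]]) (auto simp: \<kappa>_def)
    also have "\<dots> = (\<Sum>l<Suc d. a b l * f (N + b * Suc d + l))"
      by (rule sum.cong) (auto simp: \<kappa>_def)
    finally show ?thesis .
  qed
  have nz: "N + b * Suc d \<le> j \<and> j < N + Suc b * Suc d" if "\<kappa> b j \<noteq> 0" for b j
    using that by (auto simp: \<kappa>_def split: if_splits)
  show thesis
  proof (rule that)
    show "\<kappa> b j = 0" if "b < n" "j < N + b * Suc d \<or> N + Suc b * Suc d \<le> j" for b j
      using that by (simp only: \<kappa>_def if_True)
    show "(\<Sum>j<k. \<kappa> b j * y j e) = 0" if "b < n" "e < d" for b e
      using S[OF that(1), of "\<lambda>j. y j e"] a(1)[OF that(2)] by simp
    show "ip k (\<kappa> b) (\<kappa> b') = (if b = b' then 1 else 0)" if b: "b < n" "b' < n" for b b'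
    proof (cases "b = b'")
      case True
      have "ip k (\<kappa> b) (\<kappa> b) = (\<Sum>l<Suc d. a b l * \<kappa> b (N + b * Suc d + l))"
        unfolding ip_def by (rule S[OF b(1)])
      also have "\<dots> = ip (Suc d) (a b) (a b)"
        unfolding ip_def by (rule sum.cong) (auto simp: \<kappa>_def)
      finally show ?thesis using True a(2) by simp
    next
      case False
      have "\<kappa> b j * \<kappa> b' j = 0" for j
      proof (rule ccontr)
        assume "\<kappa> b j * \<kappa> b' j \<noteq> 0"
        then have "N + b * Suc d \<le> j" "j < N + Suc b * Suc d" "N + b' * Suc d \<le> j" "j < N + Suc b' * Suc d"
          using nz by auto
        then have "b * Suc d < Suc b' * Suc d" "b' * Suc d < Suc b * Suc d" by linarith+
        then have "b < Suc b'" "b' < Suc b" by (simp_all only: mult_less_cancel2)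
        then show False using False by simp
      qed
      then have "ip k (\<kappa> b) (\<kappa> b') = 0" unfolding ip_def by (intro sum.neutral) blast
      then show ?thesis using False by simp
    qed
  qed
qed

lemma ip_add_left: "ip d (\<lambda>i. x i + y i) z = ip d x z + ip d y z"
  by (simp add: ip_def sum.distrib algebra_simps)
lemma ip_add_right: "ip d z (\<lambda>i. x i + y i) = ip d z x + ip d z y"
  by (simp add: ip_def sum.distrib algebra_simps)
lemma ip_diff_left: "ip d (\<lambda>i. x i - y i) z = ip d x z - ip d y z"
  by (simp add: ip_def sum_subtractf algebra_simps)
lemma ip_diff_right: "ip d z (\<lambda>i. x i - y i) = ip d z x - ip d z y"
  by (simp add: ip_def sum_subtractf algebra_simps)
lemma ip_scale_left: "ip d (\<lambda>i. c * x i) z = c * ip d x z"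
  by (simp add: ip_def sum_distrib_left mult.assoc)
lemma ip_scale_right: "ip d z (\<lambda>i. c * x i) = c * ip d z x"
  by (simp add: ip_def sum_distrib_left algebra_simps)

lemmas ip_linear = ip_add_left ip_add_right ip_diff_left ip_diff_right ip_scale_left ip_scale_right

lemma ip_unit:
  assumes "i < k"
  shows "ip k (\<lambda>j. if j = i then 1 else 0) x = x i" "ip k x (\<lambda>j. if j = i then 1 else 0) = x i"
  using assms by (simp_all add: ip_def if_distrib if_distribR cong: if_cong)

section \<open>Stability of the core mechanism\<close>

text \<open>Bounds for the three exceptional events of \<open>split_compare_up\<close>: a large
  moving coordinate, a small norm along the kernel, a large total norm.\<close>

definition tail_bound :: "nat \<Rightarrow> nat \<Rightarrow> real \<Rightarrow> real" where
  "tail_bound p k z = sqrt 2 * exp (- z / 4) + (1/2) ^ p + (1/2) ^ k"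

text \<open>
  Write row \<open>i\<close> as a combination of the other rows with a coefficient vector \<open>c\<close> of squared norm \<open>\<gamma>\<close>.
  The span of \<open>c\<close>, the unit vector at \<open>i\<close> and the kernel vectors is the same for both data sets.  In it
  the output moves along row \<open>i\<close> with standard deviations \<open>sqrt (1 + \<gamma>)\<close> and \<open>1\<close>, up to a common factor.
\<close>

lemma row_zero_compare:
  fixes p N d i :: nat and y :: "nat \<Rightarrow> nat \<Rightarrow> real" and c0 B2 z \<epsilon> :: real
  defines "m \<equiv> 2 * p + 2"
  defines "k \<equiv> N + m * Suc d" and "y0 \<equiv> y(i := \<lambda>_. 0)"
  assumes i: "i < k" and c0: "0 < c0"
    and low: "\<And>\<theta>. c0 * ip d \<theta> \<theta> \<le> (\<Sum>j\<in>{..<N} - {i}. (ip d \<theta> (y j))\<^sup>2)"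
    and bound: "ip d (y i) (y i) \<le> B2"
    and p: "1 \<le> p" and eps: "0 < \<epsilon>" "\<epsilon> \<le> 1" and z: "1 \<le> z" and small: "B2 / c0 * z \<le> \<epsilon> / 8"
    and F[measurable]: "F \<in> borel_measurable (lborel_pow d \<Otimes>\<^sub>M borel)" and F1: "\<And>x. F x \<le> 1"
  shows row_zero_compare_up: "(\<integral>\<^sup>+g. F (comb d k y g, ip k g g) \<partial>std_gauss k) \<le>
      ennreal (exp \<epsilon>) * (\<integral>\<^sup>+g. F (comb d k y0 g, ip k g g) \<partial>std_gauss k) + ennreal (tail_bound p k z)" (is ?up)
    and row_zero_compare_down: "(\<integral>\<^sup>+g. F (comb d k y0 g, ip k g g) \<partial>std_gauss k) \<le>
      ennreal (exp \<epsilon>) * (\<integral>\<^sup>+g. F (comb d k y g, ip k g g) \<partial>std_gauss k)" (is ?down)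
proof -
  let ?I = "\<lambda>y. \<integral>\<^sup>+g. F (comb d k y g, ip k g g) \<partial>std_gauss k"
  \<comment> \<open>The support of \<open>c\<close> avoids row \<open>i\<close>, so \<open>c\<close>
    is orthogonal to the unit vector at \<open>i\<close>, and it avoids the blocks, so
    \<open>c\<close> is orthogonal to their kernel vectors.\<close>
  obtain c where c0': "\<And>j. j \<notin> {..<N} - {i} \<Longrightarrow> c j = 0"
    and cv: "\<And>e. e < d \<Longrightarrow> (\<Sum>j\<in>{..<N} - {i}. c j * y j e) = y i e"
    and cn: "(\<Sum>j\<in>{..<N} - {i}. (c j)\<^sup>2) \<le> ip d (y i) (y i) / c0"
    by (rule solve_positive_form[OF finite_Diff[OF finite_lessThan] c0 low, where v="y i"]) (rule that)
  have sub: "{..<N} - {i} \<subseteq> {..<k}" by (auto simp: k_def)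
  have cy: "ip k c (\<lambda>j. y j e) = y i e" if "e < d" for e
    unfolding ip_def cv[OF that, symmetric]
    by (rule sum.mono_neutral_right) (use sub c0' in auto)
  have ci: "c i = 0" by (rule c0') simp
  define \<gamma> where "\<gamma> = ip k c c"
  have "\<gamma> = (\<Sum>j\<in>{..<N} - {i}. (c j)\<^sup>2)"
    unfolding \<gamma>_def ip_def power2_eq_square
    by (rule sum.mono_neutral_right) (use sub c0' in auto)
  also have "\<dots> \<le> B2 / c0" using cn divide_right_mono[OF bound, of c0] c0 by simp
  finally have \<gamma>: "\<gamma> \<le> B2 / c0" .
  have \<gamma>0: "0 \<le> \<gamma>" by (simp add: \<gamma>_def)
  have \<gamma>z: "\<gamma> * z \<le> \<epsilon> / 8" using order_trans[OF mult_right_mono[OF \<gamma>] small] z by simp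
  have "\<gamma> * 1 \<le> \<gamma> * z" by (rule mult_left_mono) (use z \<gamma>0 in auto)
  then have \<gamma>e: "\<gamma> \<le> \<epsilon>" using \<gamma>z eps by simp
  have e1: "1 * ?I y \<le> ennreal (exp \<epsilon>) * ?I y" for y
    by (rule mult_right_mono) (use eps in auto)
  have "?up \<and> ?down"
  proof (cases "\<gamma> = 0")
    \<comment> \<open>Row \<open>i\<close> vanishes and zeroing it changes nothing. This case is
      separate because the directions below are normalised by
      \<open>w = sqrt \<gamma>\<close>.\<close>
    case True
    then have "\<forall>j<k. c j = 0" by (simp add: \<gamma>_def ip_eq_0_iff)
    then have yi: "y i e = 0" if "e < d" for e
      using cy[OF that] by (simp add: ip_def)
    have "comb d k y0 g = comb d k y g" for g
      unfolding comb_def y0_def by (intro restrict_ext sum.cong) (auto simp: yi)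
    then have eq: "?I y0 = ?I y" by simp
    have "?I y \<le> ennreal (exp \<epsilon>) * ?I y" using e1[of y] by simp
    moreover from this have "?I y \<le> ennreal (exp \<epsilon>) * ?I y + ennreal (tail_bound p k z)"
      by (rule order_trans) simp
    ultimately show ?thesis unfolding eq by (intro conjI)
  next
    case False
    then have \<gamma>pos: "0 < \<gamma>" using \<gamma>0 by simp
    define w where "w = sqrt \<gamma>"
    define s where "s = sqrt (1 + \<gamma>)"
    have w: "0 < w" "w * w = \<gamma>" using \<gamma>pos by (auto simp: w_def)
    have s: "1 \<le> s" "s * s = 1 + \<gamma>" using \<gamma>pos by (auto simp: s_def)
    have s0: "0 < s" using s(1) by simp
    obtain \<kappa> where \<kappa>0: "\<And>b j. b < m \<Longrightarrow> j < N + b * Suc d \<or> N + Suc b * Suc d \<le> j \<Longrightarrow> \<kappa> b j = 0"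
      and \<kappa>y: "\<And>b e. b < m \<Longrightarrow> e < d \<Longrightarrow> (\<Sum>j<k. \<kappa> b j * y j e) = 0"
      and \<kappa>o: "\<And>b b'. b < m \<Longrightarrow> b' < m \<Longrightarrow> ip k (\<kappa> b) (\<kappa> b') = (if b = b' then 1 else 0)"
      by (rule kernel_vectors[of m N d y, folded k_def]) (rule that)
    \<comment> \<open>The block of row \<open>i\<close>. For \<open>i < N\<close> truncated
      subtraction yields block \<open>0\<close>, so exactly one block is dropped in every case and
      \<open>2 * p + 1\<close> remain.\<close>
    define b0 where "b0 = (i - N) div Suc d"
    define sk where "sk b = (if b < b0 then b else Suc b)" for b
    have sk: "sk b < m" "sk b \<noteq> b0" if "b < 2 * p + 1" for b
      using that by (auto simp: sk_def m_def)
    have sk_inj: "sk b = sk b' \<longleftrightarrow> b = b'" for b b' by (auto simp: sk_def)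
    have \<kappa>i: "\<kappa> (sk b) i = 0" if "b < 2 * p + 1" for b
    proof (rule \<kappa>0[OF sk(1)[OF that]])
      show "i < N + sk b * Suc d \<or> N + Suc (sk b) * Suc d \<le> i"
      proof (cases "i < N")
        case False
        have lo: "b0 * Suc d \<le> i - N" unfolding b0_def by (rule div_times_less_eq_dividend)
        have hi: "i - N < Suc b0 * Suc d"
          using dividend_less_div_times[of "Suc d" "i - N"] unfolding b0_def mult_Suc by simp
        have "sk b \<noteq> b0" by (rule sk(2)[OF that])
        then consider "sk b < b0" | "b0 < sk b" by linarith
        then show ?thesis
        proof cases
          case 1
          then have "Suc (sk b) * Suc d \<le> b0 * Suc d" by (intro mult_right_mono) auto
          then show ?thesis using lo False by linarith
        next
          case 2
          then have "Suc b0 * Suc d \<le> sk b * Suc d" by (intro mult_right_mono) auto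
          then show ?thesis using hi False by linarith
        qed
      qed simp
    qed
    define \<delta> :: "nat \<Rightarrow> real" where "\<delta> = (\<lambda>j. if j = i then 1 else 0)"
    have \<delta>: "ip k \<delta> x = x i" "ip k x \<delta> = x i" for x using ip_unit[OF i] by (simp_all add: \<delta>_def)
    have \<kappa>c: "ip k (\<kappa> (sk b)) c = 0" "ip k c (\<kappa> (sk b)) = 0" if "b < 2 * p + 1" for b
    proof -
      have "\<kappa> (sk b) j * c j = 0" for j
        using \<kappa>0[OF sk(1)[OF that], of j] c0'[of j] by (cases "j < N") auto
      then show "ip k (\<kappa> (sk b)) c = 0" unfolding ip_def by (intro sum.neutral ballI)
      then show "ip k c (\<kappa> (sk b)) = 0" by (simp add: ip_commute)
    qed
    have cc: "ip k c c = \<gamma>" by (simp add: \<gamma>_def)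
    \<comment> \<open>\<open>ub\<close> is in the kernel of the original rows because
      \<open>c\<close> reproduces row \<open>i\<close>; for the zeroed rows the unit vector
      \<open>\<delta>\<close> takes its place. With the \<open>2 * p + 1\<close> blocks this makes
      \<open>m\<close> kernel directions on either side. \<open>ua\<close> and \<open>ua0\<close>
      complete the two orthonormal bases of the span of \<open>c\<close> and
      \<open>\<delta>\<close>.\<close>
    define ub where "ub = (\<lambda>j. 1 / s * (c j - \<delta> j))"
    define ua where "ua = (\<lambda>j. 1 / (w * s) * (c j + \<gamma> * \<delta> j))"
    define ua0 where "ua0 = (\<lambda>j. 1 / w * c j)"
    define U where "U = (\<lambda>l. if l < 2 * p + 1 then \<kappa> (sk l) else if l = 2 * p + 1 then ub else ua)"
    define U0 where "U0 = (\<lambda>l. if l < 2 * p + 1 then \<kappa> (sk l) else if l = 2 * p + 1 then \<delta> else ua0)"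
    have \<delta>i: "\<delta> i = 1" by (simp add: \<delta>_def)
    have uX: "ip k ub x = 1 / s * (ip k c x - x i)" "ip k ua x = 1 / (w * s) * (ip k c x + \<gamma> * x i)"
      "ip k ua0 x = 1 / w * ip k c x" for x
      unfolding ub_def ua_def ua0_def ip_linear \<delta> by simp_all
    have Xu: "ip k x ub = 1 / s * (ip k c x - x i)" "ip k x ua = 1 / (w * s) * (ip k c x + \<gamma> * x i)"
      "ip k x ua0 = 1 / w * ip k c x" for x
      using uX ip_commute by metis+
    have ui: "ub i = - 1 / s" "ua i = 1 / (w * s) * \<gamma>" "ua0 i = 0"
      using ci \<delta>i by (simp_all add: ub_def ua_def ua0_def)
    have o1: "ip k ub ub = 1" "ip k ua ua = 1" "ip k ua ub = 0" "ip k ub ua = 0" "ip k ua0 ua0 = 1" "ip k ua0 \<delta> = 0" "ip k \<delta> ua0 = 0" "ip k \<delta> \<delta> = 1"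
    proof -
      have "1 / s * (1 / s * \<gamma> + 1 / s) = (1 + \<gamma>) / (s * s)" using s0 by (simp add: field_simps)
      then show "ip k ub ub = 1" using s s0 \<gamma>pos by (simp add: uX(1) Xu(1) ui cc ci)
      have "1 / (w * s) * (1 / (w * s) * \<gamma> + \<gamma> * (1 / (w * s) * \<gamma>)) = \<gamma> * (1 + \<gamma>) / ((w * w) * (s * s))"
        using s0 w(1) by (simp add: field_simps)
      then show "ip k ua ua = 1" unfolding uX(2) Xu(2) ui cc ci using s(2) w(2) \<gamma>pos by simp
      show "ip k ua ub = 0" unfolding uX Xu ui cc ci using s0 w by simp
      then show "ip k ub ua = 0" by (simp add: ip_commute)
      show "ip k ua0 ua0 = 1" unfolding uX(3) Xu(3) cc using w \<gamma>pos by simp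
      show "ip k ua0 \<delta> = 0" "ip k \<delta> ua0 = 0" "ip k \<delta> \<delta> = 1" by (simp_all add: \<delta> ui \<delta>i)
    qed
    have o2: "ip k ub (\<kappa> (sk b)) = 0" "ip k ua (\<kappa> (sk b)) = 0" "ip k ua0 (\<kappa> (sk b)) = 0" "ip k \<delta> (\<kappa> (sk b)) = 0"
      "ip k (\<kappa> (sk b)) ub = 0" "ip k (\<kappa> (sk b)) ua = 0" "ip k (\<kappa> (sk b)) ua0 = 0" "ip k (\<kappa> (sk b)) \<delta> = 0" if "b < 2 * p + 1" for b
      using that by (simp_all add: uX Xu \<delta> \<kappa>c \<kappa>i)
    have lt: "l < 2 * p + 1 \<or> l = 2 * p + 1 \<or> l = 2 * p + 2" if "l < Suc m" for l
      using that by (auto simp: m_def)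
    have orthU: "ip k (U l) (U l') = (if l = l' then 1 else 0)" if "l < Suc m" "l' < Suc m" for l l'
      using lt[OF that(1)] lt[OF that(2)] by (elim disjE) (simp_all add: U_def o1 o2 \<kappa>o sk sk_inj)
    have orthU0: "ip k (U0 l) (U0 l') = (if l = l' then 1 else 0)" if "l < Suc m" "l' < Suc m" for l l'
      using lt[OF that(1)] lt[OF that(2)] by (elim disjE) (simp_all add: U0_def o1 o2 \<kappa>o sk sk_inj)
    define \<eta> where "\<eta> e = 1 / w * y i e" for e
    have y0i: "ip k x (\<lambda>j. y0 j e) = ip k x (\<lambda>j. y j e)" if "x i = 0" for x e
      unfolding ip_def by (rule sum.cong) (use that in \<open>auto simp: y0_def\<close>)
    have y0v: "y0 i e = 0" for e by (simp add: y0_def)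
    have kerU: "(\<Sum>j<k. U l j * y j e) = 0" if "l < m" "e < d" for l e
    proof -
      have "ip k (U l) (\<lambda>j. y j e) = 0"
        using lt[OF less_SucI[OF that(1)]] that \<kappa>y[OF sk(1), of l e]
        by (elim disjE) (auto simp: U_def m_def uX cy ip_def[symmetric])
      then show ?thesis by (simp add: ip_def)
    qed
    have lastU: "(\<Sum>j<k. U m j * y j e) = s * \<eta> e" if "e < d" for e
    proof -
      have "ip k (U m) (\<lambda>j. y j e) = 1 / (w * s) * ((1 + \<gamma>) * y i e)"
        using that by (simp add: U_def m_def uX cy algebra_simps)
      also have "\<dots> = s * \<eta> e" using s0 w unfolding s(2)[symmetric] by (simp add: \<eta>_def)
      finally show ?thesis by (simp add: ip_def)
    qed
    have kerU0: "(\<Sum>j<k. U0 l j * y0 j e) = 0" if "l < m" "e < d" for l e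
    proof -
      have "ip k (U0 l) (\<lambda>j. y0 j e) = 0"
        using lt[OF less_SucI[OF that(1)]] that \<kappa>y[OF sk(1), of l e]
        by (elim disjE) (auto simp: U0_def m_def \<delta> y0v y0i \<kappa>i ip_def[symmetric])
      then show ?thesis by (simp add: ip_def)
    qed
    have lastU0: "(\<Sum>j<k. U0 m j * y0 j e) = \<eta> e" if "e < d" for e
    proof -
      have "ip k (U0 m) (\<lambda>j. y0 j e) = \<eta> e"
        using that by (simp add: U0_def m_def uX ci cy y0i \<eta>_def)
      then show ?thesis by (simp add: ip_def)
    qed
    have Sm: "Suc m = Suc (Suc (2 * p + 1))" by (simp add: m_def)
    \<comment> \<open>Both bases span the same space, so the residuals agree. The computation
      compares the two expressions for the projection onto the span of \<open>c\<close> and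
      \<open>\<delta>\<close>.\<close>
    have PU: "perp k (Suc m) U g = perp k (Suc m) U0 g" for g
    proof -
      have "ip k ub g * ub j + ip k ua g * ua j = ip k \<delta> g * \<delta> j + ip k ua0 g * ua0 j" for j
      proof -
        have "ip k ub g * ub j + ip k ua g * ua j = (1 / (s * s)) * ((ip k c g - g i) * (c j - \<delta> j)) + (1 / (w * w * (s * s))) * ((ip k c g + \<gamma> * g i) * (c j + \<gamma> * \<delta> j))"
          unfolding uX by (simp add: ub_def ua_def)
        also have "\<dots> = g i * \<delta> j + 1 / \<gamma> * (ip k c g * c j)"
        proof -
          let ?A = "(ip k c g - g i) * (c j - \<delta> j)" and ?B = "(ip k c g + \<gamma> * g i) * (c j + \<gamma> * \<delta> j)"
          have nz: "\<gamma> \<noteq> 0" "1 + \<gamma> \<noteq> 0" using \<gamma>pos by auto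
          have "1 / (1 + \<gamma>) * ?A + 1 / (\<gamma> * (1 + \<gamma>)) * ?B = (\<gamma> * ?A + ?B) / (\<gamma> * (1 + \<gamma>))"
            using nz by (simp add: add_divide_distrib)
          also have "\<gamma> * ?A + ?B = (\<gamma> * (g i * \<delta> j) + ip k c g * c j) * (1 + \<gamma>)"
            by (simp add: algebra_simps)
          also have "\<dots> / (\<gamma> * (1 + \<gamma>)) = g i * \<delta> j + 1 / \<gamma> * (ip k c g * c j)"
            using nz by (simp add: add_divide_distrib)
          finally show ?thesis unfolding s(2) w(2) .
        qed
        also have "\<dots> = ip k \<delta> g * \<delta> j + ip k ua0 g * ua0 j"
          unfolding uX using w(2) by (simp add: ua0_def \<delta>)
        finally show ?thesis .
      qed
      then have "(\<Sum>l<Suc m. ip k (U l) g * U l j) = (\<Sum>l<Suc m. ip k (U0 l) g * U0 l j)" for j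
        unfolding Sm by (simp add: U_def U0_def add.assoc)
      then show ?thesis by (simp only: perp_def)
    qed
    \<comment> \<open>The span contains the unit vector at \<open>i\<close>, so the residual has no
      component there and cannot tell the two data sets apart.\<close>
    have "perp k (Suc m) U0 g i = 0" for g
    proof -
      have "(\<Sum>l<Suc m. ip k (U0 l) g * U0 l i) = g i"
        unfolding Sm by (simp add: U0_def \<kappa>i \<delta> \<delta>i ua0_def ci)
      then show ?thesis using i by (simp only: perp_def restrict_apply lessThan_iff if_True diff_self)
    qed
    then have CU: "comb d k y (perp k (Suc m) U0 g) = comb d k y0 (perp k (Suc m) U0 g)" for g
      unfolding comb_def by (intro restrict_ext sum.cong) (auto simp: y0_def)
    let ?G = "\<lambda>g. comb d k y0 (perp k (Suc m) U0 g)"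
    let ?E = "\<lambda>g. ip k (perp k (Suc m) U0 g) (perp k (Suc m) U0 g)"
    have Iy: "?I y = (\<integral>\<^sup>+g. (\<integral>\<^sup>+T. F (\<lambda>e\<in>{..<d}. ?G g e + s * T m * \<eta> e, ?E g + ip (Suc m) T T) \<partial>std_gauss (Suc m)) \<partial>std_gauss k)"
      using std_gauss_split[where y=y and u=U and \<zeta>="\<lambda>e. s * \<eta> e" and d=d and m=m and k=k, OF orthU kerU lastU F]
      unfolding PU CU by (simp only: mult.assoc mult.left_commute[of _ s])
    have Iy0: "?I y0 = (\<integral>\<^sup>+g. (\<integral>\<^sup>+T. F (\<lambda>e\<in>{..<d}. ?G g e + T m * \<eta> e, ?E g + ip (Suc m) T T) \<partial>std_gauss (Suc m)) \<partial>std_gauss k)"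
      by (rule std_gauss_split[OF orthU0 kerU0 lastU0 F])
    have ?up
    proof -
      have sm: "(s\<^sup>2 - 1) * z + 2 * s * sqrt z * (0 * sqrt (8 * real k)) + (0 * sqrt (8 * real k))\<^sup>2 \<le> \<epsilon> / 8"
        using \<gamma>z s(2) by (simp add: power2_eq_square)
      have "(\<integral>\<^sup>+g. (\<integral>\<^sup>+T. F (\<lambda>e\<in>{..<d}. ?G g e + (s * T m + 0 * sqrt (?E g + ip (Suc m) T T)) * \<eta> e, ?E g + ip (Suc m) T T) \<partial>std_gauss (Suc m)) \<partial>std_gauss k)
         \<le> ennreal (exp \<epsilon>) * ?I y0 + ennreal (tail_bound p k z)"
        unfolding Iy0 tail_bound_def m_def
        by (rule split_compare_up[OF orthU0[unfolded m_def] kerU0[unfolded m_def] F F1 p eps s(1) order_refl _ sm])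
           (use z in auto)
      then show ?thesis unfolding Iy by (simp add: mult.assoc cong: restrict_cong)
    qed
    moreover have ?down
    proof -
      have "?I y0 \<le> (\<integral>\<^sup>+g. ennreal s * (\<integral>\<^sup>+T. F (\<lambda>e\<in>{..<d}. ?G g e + s * T m * \<eta> e, ?E g + ip (Suc m) T T) \<partial>std_gauss (Suc m)) \<partial>std_gauss k)"
        unfolding Iy0
      proof (rule nn_integral_mono)
        fix g
        have fm: "(\<lambda>(x, q). F (\<lambda>e\<in>{..<d}. ?G g e + x * \<eta> e, ?E g + q)) \<in> borel_measurable (borel \<Otimes>\<^sub>M borel)"
          using measurable_compose[OF restrict_affine_measurable F, of "?G g" \<eta> "?E g"] by (simp only: split_def)
        show "(\<integral>\<^sup>+T. F (\<lambda>e\<in>{..<d}. ?G g e + T m * \<eta> e, ?E g + ip (Suc m) T T) \<partial>std_gauss (Suc m)) \<le>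
          ennreal s * (\<integral>\<^sup>+T. F (\<lambda>e\<in>{..<d}. ?G g e + s * T m * \<eta> e, ?E g + ip (Suc m) T T) \<partial>std_gauss (Suc m))"
          using std_gauss_compare_down[OF fm s(1), of p] unfolding split_conv m_def .
      qed
      also have "\<dots> = ennreal s * ?I y"
        unfolding Iy
        by (rule nn_integral_cmult, rule std_gauss.borel_measurable_nn_integral)
           (use split_integrand_measurable[OF F, of "\<lambda>p. s * fst p" k y0 "Suc m" U0 m \<eta>] in \<open>simp add: split_def\<close>)
      also have "\<dots> \<le> ennreal (exp \<epsilon>) * ?I y"
      proof (intro mult_right_mono ennreal_leI)
        have "s \<le> 1 + \<gamma>" unfolding s(2)[symmetric] using s(1) by simp
        also have "\<dots> \<le> exp \<gamma>" by (rule exp_ge_add_one_self)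
        finally show "s \<le> exp \<epsilon>" using \<gamma>e by (meson exp_le_cancel_iff order_trans)
      qed simp
      finally show ?thesis .
    qed
    ultimately show ?thesis ..
  qed
  then show ?up ?down by auto
qed

text \<open>\<open>v\<close> is a combination of the first \<open>N\<close> rows with a coefficient
  vector of norm \<open>w\<close>. Shifting the output by \<open>b * sqrt (ip k g g) * v\<close> is
  therefore the same as shifting one standard Gaussian coordinate by
  \<open>b * w * sqrt (ip k g g)\<close>. The rows themselves do not change, so all \<open>m\<close>
  blocks are available and the scale factor \<open>s\<close> is one.\<close>

lemma center_compare:
  fixes p N d :: nat and y :: "nat \<Rightarrow> nat \<Rightarrow> real" and c0 z \<epsilon> b :: real
  defines "m \<equiv> 2 * p + 2"
  defines "k \<equiv> N + m * Suc d"
  assumes c0: "0 < c0" and low: "\<And>\<theta>. c0 * ip d \<theta> \<theta> \<le> (\<Sum>j<N. (ip d \<theta> (y j))\<^sup>2)"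
    and p: "1 \<le> p" and eps: "0 < \<epsilon>" "\<epsilon> \<le> 1" and z: "1 \<le> z" and b: "0 \<le> b"
    and W: "b * sqrt (ip d v v / c0) * sqrt (8 * real k) \<le> W" and small: "2 * sqrt z * W + W\<^sup>2 \<le> \<epsilon> / 8"
    and F[measurable]: "F \<in> borel_measurable (lborel_pow d \<Otimes>\<^sub>M borel)" and F1: "\<And>x. F x \<le> 1"
  shows "(\<integral>\<^sup>+g. F (\<lambda>e\<in>{..<d}. comb d k y g e + b * sqrt (ip k g g) * v e, ip k g g) \<partial>std_gauss k) \<le>
      ennreal (exp \<epsilon>) * (\<integral>\<^sup>+g. F (comb d k y g, ip k g g) \<partial>std_gauss k) + ennreal (tail_bound p k z)"
proof -
  obtain c where c0': "\<And>j. j \<notin> {..<N} \<Longrightarrow> c j = 0"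
    and cv: "\<And>e. e < d \<Longrightarrow> (\<Sum>j<N. c j * y j e) = v e"
    and cn: "(\<Sum>j<N. (c j)\<^sup>2) \<le> ip d v v / c0"
    by (rule solve_positive_form[OF finite_lessThan c0 low, where v=v]) (rule that)
  have sub: "{..<N} \<subseteq> {..<k}" by (auto simp: k_def)
  have cy: "ip k c (\<lambda>j. y j e) = v e" if "e < d" for e
    unfolding ip_def cv[OF that, symmetric]
    by (rule sum.mono_neutral_right) (use sub c0' in auto)
  define \<gamma> where "\<gamma> = ip k c c"
  have "\<gamma> = (\<Sum>j<N. (c j)\<^sup>2)"
    unfolding \<gamma>_def ip_def power2_eq_square
    by (rule sum.mono_neutral_right) (use sub c0' in auto)
  then have \<gamma>: "\<gamma> \<le> ip d v v / c0" using cn by simp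
  have \<gamma>0: "0 \<le> \<gamma>" by (simp add: \<gamma>_def)
  let ?I = "\<integral>\<^sup>+g. F (comb d k y g, ip k g g) \<partial>std_gauss k"
  show ?thesis
  proof (cases "\<gamma> = 0")
    case True
    then have "\<forall>j<k. c j = 0" by (simp add: \<gamma>_def ip_eq_0_iff)
    then have v: "v e = 0" if "e < d" for e
      using cy[OF that] by (simp add: ip_def)
    have "(\<lambda>e\<in>{..<d}. comb d k y g e + b * sqrt (ip k g g) * v e) = comb d k y g" for g
      by (auto simp: comb_def v fun_eq_iff)
    then have "(\<integral>\<^sup>+g. F (\<lambda>e\<in>{..<d}. comb d k y g e + b * sqrt (ip k g g) * v e, ip k g g) \<partial>std_gauss k) = 1 * ?I" by simp
    also have "\<dots> \<le> ennreal (exp \<epsilon>) * ?I" by (rule mult_right_mono) (use eps in auto)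
    finally show ?thesis by (rule order_trans) simp
  next
    case False
    then have \<gamma>pos: "0 < \<gamma>" using \<gamma>0 by simp
    define w where "w = sqrt \<gamma>"
    have w: "0 < w" "w * w = \<gamma>" using \<gamma>pos by (auto simp: w_def)
    obtain \<kappa> where \<kappa>0: "\<And>b j. b < m \<Longrightarrow> j < N + b * Suc d \<or> N + Suc b * Suc d \<le> j \<Longrightarrow> \<kappa> b j = 0"
      and \<kappa>y: "\<And>b e. b < m \<Longrightarrow> e < d \<Longrightarrow> (\<Sum>j<k. \<kappa> b j * y j e) = 0"
      and \<kappa>o: "\<And>b b'. b < m \<Longrightarrow> b' < m \<Longrightarrow> ip k (\<kappa> b) (\<kappa> b') = (if b = b' then 1 else 0)"
      by (rule kernel_vectors[of m N d y, folded k_def]) (rule that)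
    have \<kappa>c: "ip k (\<kappa> b) c = 0" "ip k c (\<kappa> b) = 0" if "b < m" for b
    proof -
      have "\<kappa> b j * c j = 0" for j
        using \<kappa>0[OF that, of j] c0'[of j] by (cases "j < N") auto
      then show "ip k (\<kappa> b) c = 0" unfolding ip_def by (intro sum.neutral ballI)
      then show "ip k c (\<kappa> b) = 0" by (simp add: ip_commute)
    qed
    define ua where "ua = (\<lambda>j. 1 / w * c j)"
    define U where "U = (\<lambda>l. if l < m then \<kappa> l else ua)"
    have cc: "ip k c c = \<gamma>" by (simp add: \<gamma>_def)
    have o1: "ip k ua ua = 1" unfolding ua_def ip_scale_left ip_scale_right cc using w \<gamma>pos by simp
    have o2: "ip k ua (\<kappa> b) = 0" "ip k (\<kappa> b) ua = 0" if "b < m" for b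
      unfolding ua_def ip_scale_left ip_scale_right by (simp_all add: \<kappa>c that)
    have orthU: "ip k (U l) (U l') = (if l = l' then 1 else 0)" if "l < Suc m" "l' < Suc m" for l l'
      using that by (auto simp: U_def \<kappa>o o1 o2 less_Suc_eq)
    define \<eta> where "\<eta> e = 1 / w * v e" for e
    have kerU: "(\<Sum>j<k. U l j * y j e) = 0" if "l < m" "e < d" for l e
      using \<kappa>y[OF that] that by (simp add: U_def)
    have lastU: "(\<Sum>j<k. U m j * y j e) = \<eta> e" if "e < d" for e
    proof -
      have "ip k (U m) (\<lambda>j. y j e) = \<eta> e"
        using that by (simp add: U_def ua_def cy \<eta>_def ip_scale_left[of _ "1 / w", simplified])
      then show ?thesis by (simp add: ip_def)
    qed
    let ?G = "\<lambda>g. comb d k y (perp k (Suc m) U g)"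
    let ?E = "\<lambda>g. ip k (perp k (Suc m) U g) (perp k (Suc m) U g)"
    have Iy: "?I = (\<integral>\<^sup>+g. (\<integral>\<^sup>+T. F (\<lambda>e\<in>{..<d}. ?G g e + T m * \<eta> e, ?E g + ip (Suc m) T T) \<partial>std_gauss (Suc m)) \<partial>std_gauss k)"
      by (rule std_gauss_split[OF orthU kerU lastU F])
    \<comment> \<open>The shift is absorbed into the test function, so that one decomposition serves
      both sides.\<close>
    define F' where "F' = (\<lambda>p. F (\<lambda>e\<in>{..<d}. fst p e + b * sqrt (snd p) * v e, snd p))"
    have F'm: "F' \<in> borel_measurable (lborel_pow d \<Otimes>\<^sub>M borel)"
      unfolding F'_def
      by (rule measurable_compose[OF _ F], intro measurable_Pair measurable_restrict_lborel_pow borel_measurable_add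
         measurable_compose[OF measurable_fst lborel_pow_component] measurable_snd) (auto, measurable)
    have "(\<integral>\<^sup>+g. F (\<lambda>e\<in>{..<d}. comb d k y g e + b * sqrt (ip k g g) * v e, ip k g g) \<partial>std_gauss k) =
      (\<integral>\<^sup>+g. F' (comb d k y g, ip k g g) \<partial>std_gauss k)"
      by (simp add: F'_def)
    also have "\<dots> = (\<integral>\<^sup>+g. (\<integral>\<^sup>+T. F' (\<lambda>e\<in>{..<d}. ?G g e + T m * \<eta> e, ?E g + ip (Suc m) T T) \<partial>std_gauss (Suc m)) \<partial>std_gauss k)"
      by (rule std_gauss_split[OF orthU kerU lastU F'm])
    also have "\<dots> = (\<integral>\<^sup>+g. (\<integral>\<^sup>+T. F (\<lambda>e\<in>{..<d}. ?G g e + (1 * T m + (b * w) * sqrt (?E g + ip (Suc m) T T)) * \<eta> e, ?E g + ip (Suc m) T T) \<partial>std_gauss (Suc m)) \<partial>std_gauss k)"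
    proof -
      have v: "v e = w * \<eta> e" for e using w by (simp add: \<eta>_def)
      have "F' (\<lambda>e\<in>{..<d}. ?G g e + T m * \<eta> e, q) = F (\<lambda>e\<in>{..<d}. ?G g e + (1 * T m + (b * w) * sqrt q) * \<eta> e, q)" for g T q
        unfolding F'_def fst_conv snd_conv
        by (rule arg_cong[where f="\<lambda>x. F (x, q)"], rule restrict_ext) (simp add: v algebra_simps)
      then show ?thesis by simp
    qed
    also have "\<dots> \<le> ennreal (exp \<epsilon>) * ?I + ennreal (tail_bound p k z)"
    proof -
      let ?W = "b * w * sqrt (8 * real k)"
      have "?W \<le> b * sqrt (ip d v v / c0) * sqrt (8 * real k)"
        unfolding w_def by (intro mult_right_mono mult_left_mono real_sqrt_le_mono \<gamma> b) auto
      then have WW: "?W \<le> W" using W by simp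
      have W0: "0 \<le> ?W" using b w by simp
      have "2 * sqrt z * ?W + ?W\<^sup>2 \<le> 2 * sqrt z * W + W\<^sup>2"
        using WW W0 z by (intro add_mono mult_left_mono power_mono) auto
      then have sm: "(1\<^sup>2 - 1) * z + 2 * 1 * sqrt z * ?W + ?W\<^sup>2 \<le> \<epsilon> / 8" using small by simp
      show ?thesis
        unfolding Iy tail_bound_def m_def
        by (rule split_compare_up[OF orthU[unfolded m_def] kerU[unfolded m_def] F F1 p eps order_refl _ _ sm])
           (use z b w in auto)
    qed
    finally show ?thesis .
  qed
qed

section \<open>The gate\<close>

definition rat_dirs :: "nat \<Rightarrow> (nat \<Rightarrow> real) set" where
  "rat_dirs d = {\<theta> \<in> {..<d} \<rightarrow>\<^sub>E \<rat>. 0 < ip d \<theta> \<theta>}"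

text \<open>
  Rational directions make the infimum countable and therefore measurable in the data.
\<close>

definition low_eig :: "nat \<Rightarrow> nat \<Rightarrow> (nat \<Rightarrow> nat \<Rightarrow> real) \<Rightarrow> real" where
  "low_eig d N y = (INF \<theta>\<in>rat_dirs d. (\<Sum>j<N. (ip d \<theta> (y j))\<^sup>2) / ip d \<theta> \<theta>)"

lemma countable_rat_dirs: "countable (rat_dirs d)"
proof (rule countable_subset)
  show "rat_dirs d \<subseteq> {..<d} \<rightarrow>\<^sub>E \<rat>" by (auto simp: rat_dirs_def)
  show "countable ({..<d} \<rightarrow>\<^sub>E (\<rat> :: real set))" by (intro countable_PiE countable_rat) auto
qed

lemma rat_dirs_nonempty: "0 < d \<Longrightarrow> rat_dirs d \<noteq> {}"
proof -
  assume d: "0 < d"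
  let ?\<theta> = "\<lambda>i\<in>{..<d}. 1 :: real"
  have "ip d ?\<theta> ?\<theta> = real d" by (simp add: ip_def)
  then have "?\<theta> \<in> rat_dirs d" using d by (auto simp: rat_dirs_def)
  then show ?thesis by blast
qed

lemma low_eig_bdd: "bdd_below ((\<lambda>\<theta>. (\<Sum>j<N. (ip d \<theta> (y j))\<^sup>2) / ip d \<theta> \<theta>) ` rat_dirs d)"
  by (rule bdd_belowI[of _ 0]) (auto intro!: divide_nonneg_nonneg sum_nonneg)

lemma le_low_eig:
  assumes "0 < d" "\<And>\<theta>. 0 < ip d \<theta> \<theta> \<Longrightarrow> c * ip d \<theta> \<theta> \<le> (\<Sum>j<N. (ip d \<theta> (y j))\<^sup>2)"
  shows "c \<le> low_eig d N y"
  unfolding low_eig_def using rat_dirs_nonempty[OF assms(1)]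
  by (rule cINF_greatest) (use assms(2) in \<open>auto simp: rat_dirs_def field_simps\<close>)

lemma low_eig_le_rat:
  assumes "\<theta> \<in> rat_dirs d"
  shows "low_eig d N y * ip d \<theta> \<theta> \<le> (\<Sum>j<N. (ip d \<theta> (y j))\<^sup>2)"
proof -
  have "low_eig d N y \<le> (\<Sum>j<N. (ip d \<theta> (y j))\<^sup>2) / ip d \<theta> \<theta>"
    unfolding low_eig_def by (rule cINF_lower[OF low_eig_bdd assms])
  then show ?thesis using assms by (simp add: rat_dirs_def field_simps)
qed

lemma rat_sequence: "\<exists>q. (\<forall>n. q n \<in> \<rat>) \<and> q \<longlonglongrightarrow> (x::real)"
proof -
  have "\<exists>r\<in>\<rat>. x < r \<and> r < x + inverse (real (Suc n))" for n
    by (rule Rats_dense_in_real) simp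
  then have "\<exists>r. \<forall>n. r n \<in> \<rat> \<and> x < r n \<and> r n < x + inverse (real (Suc n))"
    by (intro choice) blast
  then obtain r where r: "\<And>n. r n \<in> \<rat>" "\<And>n. x < r n" "\<And>n. r n < x + inverse (real (Suc n))" by blast
  have "r \<longlonglongrightarrow> x"
  proof (rule tendsto_sandwich)
    show "eventually (\<lambda>n. x \<le> r n) sequentially" using r(2) by (simp add: less_imp_le)
    show "eventually (\<lambda>n. r n \<le> x + inverse (real (Suc n))) sequentially" using r(3) by (simp add: less_imp_le)
    show "(\<lambda>n. x + inverse (real (Suc n))) \<longlonglongrightarrow> x" by (rule LIMSEQ_inverse_real_of_nat_add)
  qed simp
  then show ?thesis using r(1) by blast
qed

text \<open>A real direction is a limit of rational ones, and both sides are continuous in the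
  direction. Approximants that vanish satisfy the inequality trivially.\<close>

lemma low_eig_le:
  "low_eig d N y * ip d \<theta> \<theta> \<le> (\<Sum>j<N. (ip d \<theta> (y j))\<^sup>2)"
proof -
  have "\<forall>i. \<exists>q. (\<forall>n. q n \<in> \<rat>) \<and> q \<longlonglongrightarrow> \<theta> i" using rat_sequence by blast
  then obtain q where q: "\<And>i n. q i n \<in> \<rat>" "\<And>i. q i \<longlonglongrightarrow> \<theta> i"
    using choice[of "\<lambda>i q. (\<forall>n. q n \<in> \<rat>) \<and> q \<longlonglongrightarrow> \<theta> i"] by blast
  let ?t = "\<lambda>n. \<lambda>i\<in>{..<d}. q i n"
  have le: "low_eig d N y * ip d (?t n) (?t n) \<le> (\<Sum>j<N. (ip d (?t n) (y j))\<^sup>2)" for n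
  proof (cases "ip d (?t n) (?t n) = 0")
    case True
    then show ?thesis by (simp add: sum_nonneg)
  next
    case False
    then have "0 < ip d (?t n) (?t n)" using ip_nonneg[of d "?t n"] by linarith
    then show ?thesis by (intro low_eig_le_rat) (auto simp: rat_dirs_def q)
  qed
  have lim: "(\<lambda>n. ip d (\<lambda>i. q i n) x) \<longlonglongrightarrow> ip d \<theta> x" for x
    unfolding ip_def by (intro tendsto_intros q)
  have lim2: "(\<lambda>n. ip d (\<lambda>i. q i n) (\<lambda>i. q i n)) \<longlonglongrightarrow> ip d \<theta> \<theta>"
    unfolding ip_def by (intro tendsto_intros q)
  show ?thesis
    by (rule LIMSEQ_le[of "\<lambda>n. low_eig d N y * ip d (?t n) (?t n)" _ "\<lambda>n. \<Sum>j<N. (ip d (?t n) (y j))\<^sup>2"])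
       (use le in \<open>auto intro!: tendsto_intros lim lim2\<close>)
qed

lemma low_eig_sensitivity:
  assumes d: "0 < d" and same: "\<And>j e. j \<noteq> i \<Longrightarrow> e < d \<Longrightarrow> y j e = y' j e" and b: "ip d (y i) (y i) \<le> B2"
  shows "low_eig d N y \<le> low_eig d N y' + B2"
proof -
  have B2: "0 \<le> B2" using b ip_nonneg[of d "y i"] by linarith
  have "low_eig d N y - B2 \<le> low_eig d N y'"
  proof (rule le_low_eig[OF d])
    fix \<theta> assume pos: "0 < ip d \<theta> \<theta>"
    have "(\<Sum>j<N. (ip d \<theta> (y j))\<^sup>2) \<le> (\<Sum>j<N. (ip d \<theta> (y' j))\<^sup>2 + (if j = i then B2 * ip d \<theta> \<theta> else 0))"
    proof (rule sum_mono)
      fix j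
      show "(ip d \<theta> (y j))\<^sup>2 \<le> (ip d \<theta> (y' j))\<^sup>2 + (if j = i then B2 * ip d \<theta> \<theta> else 0)"
      proof (cases "j = i")
        case True
        have "(ip d \<theta> (y i))\<^sup>2 \<le> ip d \<theta> \<theta> * ip d (y i) (y i)" by (rule ip_Cauchy_Schwarz)
        also have "\<dots> \<le> ip d \<theta> \<theta> * B2" by (rule mult_left_mono[OF b]) simp
        finally show ?thesis using True by (simp add: mult.commute add_increasing)
      next
        case False
        then have "ip d \<theta> (y j) = ip d \<theta> (y' j)" by (intro ip_cong) (auto simp: same)
        then show ?thesis using False by simp
      qed
    qed
    also have "\<dots> \<le> (\<Sum>j<N. (ip d \<theta> (y' j))\<^sup>2) + B2 * ip d \<theta> \<theta>"
      using B2 by (simp add: sum.distrib)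
    finally show "(low_eig d N y - B2) * ip d \<theta> \<theta> \<le> (\<Sum>j<N. (ip d \<theta> (y' j))\<^sup>2)"
      using low_eig_le[of d N y \<theta>] by (simp add: algebra_simps)
  qed
  then show ?thesis by simp
qed

lemma low_eig_measurable:
  assumes "\<And>j e. j < N \<Longrightarrow> e < d \<Longrightarrow> (\<lambda>x. y x j e) \<in> borel_measurable M"
  shows "(\<lambda>x. low_eig d N (y x)) \<in> borel_measurable M"
  unfolding low_eig_def
  by (intro borel_measurable_cINF_real countable_rat_dirs borel_measurable_divide borel_measurable_sum
     borel_measurable_power ip_measurable borel_measurable_const assms) auto

lemma low_eig_cong:
  assumes "\<And>j e. j < N \<Longrightarrow> e < d \<Longrightarrow> y j e = y' j e"
  shows "low_eig d N y = low_eig d N y'"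
  unfolding low_eig_def by (intro INF_cong refl arg_cong2[where f="(/)"] sum.cong arg_cong[where f="\<lambda>x. x\<^sup>2"] ip_cong) (auto simp: assms)

text \<open>
  The acceptance probability is a logistic function, which is purely private for arguments at distance
  at most one, with its tails cut off at the price of an additive error.
\<close>

definition accept :: "real \<Rightarrow> real \<Rightarrow> real \<Rightarrow> real" where
  "accept \<epsilon> t x = (if x < - t then 0 else if t < x then 1 else 1 / (1 + exp (- (\<epsilon> * x))))"

lemma accept_bounds: "0 \<le> accept \<epsilon> t x" "accept \<epsilon> t x \<le> 1"
  by (auto simp: accept_def field_simps add_pos_pos intro: order_trans[OF _ less_imp_le])

lemma accept_measurable[measurable]: "accept \<epsilon> t \<in> borel_measurable borel"
  unfolding accept_def by measurable

lemma logistic_flip: "1 - 1 / (1 + exp (- (x::real))) = 1 / (1 + exp x)"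
proof -
  have "1 + exp x \<noteq> 0" using exp_gt_zero[of x] by linarith
  then show ?thesis by (simp add: exp_minus divide_simps)
qed

lemma accept_flip: "0 \<le> t \<Longrightarrow> 1 - accept \<epsilon> t x = accept \<epsilon> t (- x)"
  using logistic_flip[of "\<epsilon> * x"] by (auto simp: accept_def)

lemma logistic_private:
  fixes \<epsilon> x x' :: real
  assumes "0 < \<epsilon>" "x \<le> x' + 1"
  shows "1 / (1 + exp (- (\<epsilon> * x))) \<le> exp \<epsilon> * (1 / (1 + exp (- (\<epsilon> * x'))))"
proof -
  have "\<epsilon> * x \<le> \<epsilon> * (x' + 1)" using assms by (intro mult_left_mono) auto
  then have "- (\<epsilon> * x') \<le> \<epsilon> + - (\<epsilon> * x)" by (simp add: distrib_left)
  then have "exp (- (\<epsilon> * x')) \<le> exp \<epsilon> * exp (- (\<epsilon> * x))"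
    unfolding exp_add[symmetric] by simp
  moreover have "1 \<le> exp \<epsilon>" using assms by simp
  ultimately have "1 + exp (- (\<epsilon> * x')) \<le> exp \<epsilon> * (1 + exp (- (\<epsilon> * x)))"
    unfolding distrib_left mult_1_right by linarith
  then show ?thesis by (simp add: field_simps add_pos_pos)
qed

lemma logistic_le_exp: "1 / (1 + exp (- (x::real))) \<le> exp x"
  by (simp add: exp_minus field_simps add_pos_pos)

text \<open>Between the cuts a unit step changes the logistic function by a factor at most
  \<open>exp \<epsilon>\<close>. If a cut separates the two arguments, the mass that was cut off is
  at most \<open>exp (\<epsilon> * (1 - t))\<close>; the \<open>1\<close> allows for the distance
  between the arguments.\<close>

lemma accept_private_aux:
  assumes eps: "0 < \<epsilon>" and t: "1 \<le> t" and x: "x \<le> x' + 1" and \<delta>: "exp (\<epsilon> * (1 - t)) \<le> \<delta>"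
  shows "accept \<epsilon> t x \<le> exp \<epsilon> * accept \<epsilon> t x' + \<delta>"
proof -
  have \<delta>0: "0 \<le> \<delta>" using \<delta> exp_gt_zero[of "\<epsilon> * (1 - t)"] by linarith
  consider "t < x'" | "x' < - t" | "- t \<le> x'" "x' \<le> t" by linarith
  then show ?thesis
  proof cases
    case 1
    have "accept \<epsilon> t x \<le> 1" by (rule accept_bounds)
    also have "1 \<le> exp \<epsilon>" using eps by simp
    finally show ?thesis using 1 t \<delta>0 by (simp add: accept_def)
  next
    case 2
    then have x1: "x < 1 - t" using x by simp
    have "accept \<epsilon> t x \<le> exp (\<epsilon> * x)"
      using x1 t logistic_le_exp[of "\<epsilon> * x"] by (auto simp: accept_def)
    also have "\<dots> \<le> exp (\<epsilon> * (1 - t))" using x1 eps by simp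
    finally show ?thesis using 2 \<delta> t by (simp add: accept_def)
  next
    case 3
    then have a': "accept \<epsilon> t x' = 1 / (1 + exp (- (\<epsilon> * x')))" by (auto simp: accept_def)
    have "accept \<epsilon> t x \<le> 1 / (1 + exp (- (\<epsilon> * x))) + \<delta>"
    proof (cases "t < x")
      case True
      have "1 - 1 / (1 + exp (- (\<epsilon> * x))) \<le> exp (- (\<epsilon> * x))"
        unfolding logistic_flip using logistic_le_exp[of "- (\<epsilon> * x)"] by simp
      also have "\<dots> \<le> exp (\<epsilon> * (1 - t))"
      proof -
        have "\<epsilon> * t \<le> \<epsilon> * x" using True eps by (intro mult_left_mono) auto
        then have "- (\<epsilon> * x) \<le> \<epsilon> - \<epsilon> * t" using eps by linarith
        then have "- (\<epsilon> * x) \<le> \<epsilon> * (1 - t)" by (simp add: right_diff_distrib)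
        then show ?thesis by simp
      qed
      finally show ?thesis using True \<delta> t by (simp add: accept_def)
    next
      case False
      have "0 \<le> 1 / (1 + exp (- (\<epsilon> * x)))" by (simp add: add_pos_pos less_imp_le)
      then show ?thesis using False \<delta>0 by (simp add: accept_def)
    qed
    then show ?thesis using logistic_private[OF eps x] unfolding a' by simp
  qed
qed

text \<open>Rejection is acceptance at the negated argument, because the logistic function and the
  two cuts are symmetric. One inequality therefore gives both.\<close>

lemma accept_private:
  assumes eps: "0 < \<epsilon>" and t: "1 \<le> t" and x: "\<bar>x - x'\<bar> \<le> 1" and \<delta>: "exp (\<epsilon> * (1 - t)) \<le> \<delta>"
  shows "accept \<epsilon> t x \<le> exp \<epsilon> * accept \<epsilon> t x' + \<delta>"
    and "1 - accept \<epsilon> t x \<le> exp \<epsilon> * (1 - accept \<epsilon> t x') + \<delta>"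
proof -
  show "accept \<epsilon> t x \<le> exp \<epsilon> * accept \<epsilon> t x' + \<delta>"
    using x by (intro accept_private_aux[OF eps t _ \<delta>]) auto
  have "accept \<epsilon> t (- x) \<le> exp \<epsilon> * accept \<epsilon> t (- x') + \<delta>"
    using x by (intro accept_private_aux[OF eps t _ \<delta>]) auto
  then show "1 - accept \<epsilon> t x \<le> exp \<epsilon> * (1 - accept \<epsilon> t x') + \<delta>"
    using t by (simp add: accept_flip)
qed

text \<open>
  The coefficients \<open>g / sqrt (ip k g g)\<close> are uniform on the unit sphere, up to the null event \<open>g = 0\<close>.
\<close>

definition core_out :: "nat \<Rightarrow> nat \<Rightarrow> real \<Rightarrow> (nat \<Rightarrow> real) \<Rightarrow> (nat \<Rightarrow> nat \<Rightarrow> real) \<Rightarrow> (nat \<Rightarrow> real) \<Rightarrow> nat \<Rightarrow> real" where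
  "core_out d k \<rho> c y g = (\<lambda>e\<in>{..<d}. c e + \<rho> * comb d k y g e / sqrt (ip k g g))"

section \<open>Privacy of the normalised output\<close>

lemma core_out_measurable[measurable]: "core_out d k \<rho> c y \<in> lborel_pow k \<rightarrow>\<^sub>M lborel_pow d"
  unfolding core_out_def
  by (intro measurable_restrict_lborel_pow borel_measurable_add borel_measurable_divide borel_measurable_times borel_measurable_const
     measurable_compose[OF comb_measurable lborel_pow_component] borel_measurable_sqrt) measurable

text \<open>Both data sets are compared with the one whose row \<open>i\<close> is zero. The step
  from \<open>y\<close> pays the additive error and the step to \<open>y'\<close> is purely
  multiplicative, so \<open>tail_bound\<close> occurs once and \<open>\<epsilon>\<close> twice.
  Deleting the row lowers the quadratic form by at most \<open>B2 * ip d \<theta> \<theta>\<close>,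
  hence the hypothesis with \<open>c0 + B2\<close>; the remaining rows are common to
  \<open>y\<close> and \<open>y'\<close>.\<close>

lemma row_core_private:
  fixes p N d i :: nat and y y' :: "nat \<Rightarrow> nat \<Rightarrow> real" and c0 B2 z \<epsilon> \<rho> :: real
  defines "k \<equiv> N + (2 * p + 2) * Suc d"
  assumes i: "i < k" and c0: "0 < c0" and same: "\<And>j. j \<noteq> i \<Longrightarrow> y j = y' j"
    and low: "\<And>\<theta>. (c0 + B2) * ip d \<theta> \<theta> \<le> (\<Sum>j<N. (ip d \<theta> (y j))\<^sup>2)"
    and b: "ip d (y i) (y i) \<le> B2" and b': "ip d (y' i) (y' i) \<le> B2"
    and p: "1 \<le> p" and eps: "0 < \<epsilon>" "\<epsilon> \<le> 1" and z: "1 \<le> z" and small: "B2 / c0 * z \<le> \<epsilon> / 8"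
    and S[measurable]: "S \<in> sets (lborel_pow d)"
  shows "(\<integral>\<^sup>+g. indicator S (core_out d k \<rho> c y g) \<partial>std_gauss k) \<le>
    ennreal (exp (2 * \<epsilon>)) * (\<integral>\<^sup>+g. indicator S (core_out d k \<rho> c y' g) \<partial>std_gauss k) + ennreal (tail_bound p k z)"
proof -
  define F where "F = (\<lambda>p. indicator S (\<lambda>e\<in>{..<d}. c e + \<rho> * fst p e / sqrt (snd p)) :: ennreal)"
  have Fm: "F \<in> borel_measurable (lborel_pow d \<Otimes>\<^sub>M borel)"
    unfolding F_def
    by (rule measurable_compose[OF _ borel_measurable_indicator[OF S]], intro measurable_restrict_lborel_pow borel_measurable_add borel_measurable_divide
        borel_measurable_times borel_measurable_const borel_measurable_sqrt measurable_snd
         measurable_compose[OF measurable_fst lborel_pow_component]) (auto, measurable)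
  have F1: "F x \<le> 1" for x by (simp add: F_def indicator_def)
  have FI: "indicator S (core_out d k \<rho> c y g) = F (comb d k y g, ip k g g)" for y g
    by (simp add: F_def core_out_def)
  have low0: "c0 * ip d \<theta> \<theta> \<le> (\<Sum>j\<in>{..<N} - {i}. (ip d \<theta> (y j))\<^sup>2)" for \<theta>
  proof -
    have "(ip d \<theta> (y i))\<^sup>2 \<le> ip d \<theta> \<theta> * ip d (y i) (y i)" by (rule ip_Cauchy_Schwarz)
    also have "\<dots> \<le> ip d \<theta> \<theta> * B2" by (rule mult_left_mono[OF b]) simp
    finally have 1: "(ip d \<theta> (y i))\<^sup>2 \<le> B2 * ip d \<theta> \<theta>" by (simp add: mult.commute)
    have "(\<Sum>j<N. (ip d \<theta> (y j))\<^sup>2) \<le> (\<Sum>j\<in>{..<N} - {i}. (ip d \<theta> (y j))\<^sup>2) + B2 * ip d \<theta> \<theta>"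
    proof (cases "i < N")
      case True
      then show ?thesis using 1 by (subst sum.remove[of _ i]) auto
    next
      case False
      then have "{..<N} - {i} = {..<N}" by auto
      moreover have "0 \<le> B2 * ip d \<theta> \<theta>" using 1 zero_le_power2[of "ip d \<theta> (y i)"] by linarith
      ultimately show ?thesis by simp
    qed
    then show ?thesis using low[of \<theta>] by (simp add: algebra_simps)
  qed
  have low0': "c0 * ip d \<theta> \<theta> \<le> (\<Sum>j\<in>{..<N} - {i}. (ip d \<theta> (y' j))\<^sup>2)" for \<theta>
  proof -
    have "(\<Sum>j\<in>{..<N} - {i}. (ip d \<theta> (y' j))\<^sup>2) = (\<Sum>j\<in>{..<N} - {i}. (ip d \<theta> (y j))\<^sup>2)"
      by (rule sum.cong) (auto simp: same)
    then show ?thesis using low0[of \<theta>] by simp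
  qed
  have y0: "y'(i := \<lambda>_. 0) = y(i := \<lambda>_. 0)" using same by (auto simp: fun_eq_iff)
  let ?I = "\<lambda>y. \<integral>\<^sup>+g. F (comb d k y g, ip k g g) \<partial>std_gauss k"
  have "?I y \<le> ennreal (exp \<epsilon>) * ?I (y(i := \<lambda>_. 0)) + ennreal (tail_bound p k z)"
    unfolding k_def by (rule row_zero_compare_up[OF i[unfolded k_def] c0 low0 b p eps z small Fm F1])
  also have "?I (y(i := \<lambda>_. 0)) \<le> ennreal (exp \<epsilon>) * ?I y'"
    unfolding k_def y0[symmetric] by (rule row_zero_compare_down[OF i[unfolded k_def] c0 low0' b' p eps z small Fm F1])
  finally have "?I y \<le> ennreal (exp \<epsilon>) * (ennreal (exp \<epsilon>) * ?I y') + ennreal (tail_bound p k z)"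
    by (simp add: add_right_mono mult_left_mono)
  also have "ennreal (exp \<epsilon>) * (ennreal (exp \<epsilon>) * ?I y') = ennreal (exp (2 * \<epsilon>)) * ?I y'"
    by (simp add: mult.assoc[symmetric] ennreal_mult'[symmetric] exp_add[symmetric])
  finally show ?thesis unfolding FI .
qed

lemma AE_std_gauss_ip_pos: "0 < k \<Longrightarrow> AE g in std_gauss k. 0 < ip k g g"
  unfolding std_gauss_def using AE_ip_pos[of k] by (subst AE_density) auto

text \<open>Relative to the combination of the rows, the difference of the centres is multiplied by
  \<open>sqrt (ip k g g) / \<rho>\<close>, which is the shift of \<open>center_compare\<close>. The
  identity requires \<open>g\<close> to be nonzero and so holds almost everywhere.\<close>

lemma center_core_private:
  fixes p N d :: nat and y :: "nat \<Rightarrow> nat \<Rightarrow> real" and c0 z \<epsilon> \<rho> W :: real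
  defines "k \<equiv> N + (2 * p + 2) * Suc d"
  assumes c0: "0 < c0"
    and low: "\<And>\<theta>. c0 * ip d \<theta> \<theta> \<le> (\<Sum>j<N. (ip d \<theta> (y j))\<^sup>2)"
    and p: "1 \<le> p" and eps: "0 < \<epsilon>" "\<epsilon> \<le> 1" and z: "1 \<le> z" and \<rho>: "0 < \<rho>"
    and W: "1 / \<rho> * sqrt (ip d (\<lambda>e. c e - c' e) (\<lambda>e. c e - c' e) / c0) * sqrt (8 * real k) \<le> W"
    and small: "2 * sqrt z * W + W\<^sup>2 \<le> \<epsilon> / 8"
    and S[measurable]: "S \<in> sets (lborel_pow d)"
  shows "(\<integral>\<^sup>+g. indicator S (core_out d k \<rho> c y g) \<partial>std_gauss k) \<le>
    ennreal (exp \<epsilon>) * (\<integral>\<^sup>+g. indicator S (core_out d k \<rho> c' y g) \<partial>std_gauss k) + ennreal (tail_bound p k z)"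
proof -
  define F where "F = (\<lambda>p. indicator S (\<lambda>e\<in>{..<d}. c' e + \<rho> * fst p e / sqrt (snd p)) :: ennreal)"
  have Fm: "F \<in> borel_measurable (lborel_pow d \<Otimes>\<^sub>M borel)"
    unfolding F_def
    by (rule measurable_compose[OF _ borel_measurable_indicator[OF S]], intro measurable_restrict_lborel_pow borel_measurable_add borel_measurable_divide
        borel_measurable_times borel_measurable_const borel_measurable_sqrt measurable_snd
         measurable_compose[OF measurable_fst lborel_pow_component]) (auto, measurable)
  have F1: "F x \<le> 1" for x by (simp add: F_def indicator_def)
  have FI: "indicator S (core_out d k \<rho> c' y g) = F (comb d k y g, ip k g g)" for g
    by (simp add: F_def core_out_def)
  have k: "0 < k" by (simp add: k_def)
  have "(\<integral>\<^sup>+g. indicator S (core_out d k \<rho> c y g) \<partial>std_gauss k) =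
    (\<integral>\<^sup>+g. F (\<lambda>e\<in>{..<d}. comb d k y g e + 1 / \<rho> * sqrt (ip k g g) * (c e - c' e), ip k g g) \<partial>std_gauss k)"
  proof (rule nn_integral_cong_AE)
    show "AE g in std_gauss k. indicator S (core_out d k \<rho> c y g) = F (\<lambda>e\<in>{..<d}. comb d k y g e + 1 / \<rho> * sqrt (ip k g g) * (c e - c' e), ip k g g)"
      using AE_std_gauss_ip_pos[OF k]
    proof eventually_elim
      case (elim g)
      show ?case unfolding F_def core_out_def fst_conv snd_conv
        by (rule arg_cong[where f="indicator S"], rule restrict_ext) (use elim \<rho> in \<open>simp add: field_simps\<close>)
    qed
  qed
  also have "\<dots> \<le> ennreal (exp \<epsilon>) * (\<integral>\<^sup>+g. F (comb d k y g, ip k g g) \<partial>std_gauss k) + ennreal (tail_bound p k z)"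
    unfolding k_def by (rule center_compare[OF c0 low p eps z _ W[unfolded k_def] small Fm F1]) (use \<rho> in simp)
  finally show ?thesis unfolding FI .
qed

section \<open>The mechanism and its privacy\<close>

text \<open>The identity on the ball, so that typical samples pass unchanged. Every other point is
  sent to the origin, so that the norm bound holds for arbitrary data.\<close>

definition clip :: "nat \<Rightarrow> real \<Rightarrow> (nat \<Rightarrow> real) \<Rightarrow> nat \<Rightarrow> real" where
  "clip d B v = (if ip d v v \<le> B\<^sup>2 then v else (\<lambda>_. 0))"

lemma clip_le: "ip d (clip d B v) (clip d B v) \<le> B\<^sup>2"
  by (simp add: clip_def) (simp add: ip_def)

lemma clip_measurable:
  assumes "\<And>e. e < d \<Longrightarrow> (\<lambda>x. v x e) \<in> borel_measurable M" "e < d"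
  shows "(\<lambda>x. clip d B (v x) e) \<in> borel_measurable M"
proof -
  have [measurable]: "(\<lambda>x. ip d (v x) (v x)) \<in> borel_measurable M"
    by (intro ip_measurable assms)
  have [measurable]: "(\<lambda>x. v x e) \<in> borel_measurable M" by (rule assms) fact
  have "(\<lambda>x. if ip d (v x) (v x) \<le> B\<^sup>2 then v x e else 0) \<in> borel_measurable M" by measurable
  then show ?thesis by (simp add: clip_def if_distribR cong: if_cong)
qed

definition center :: "nat \<Rightarrow> nat \<Rightarrow> real \<Rightarrow> (nat \<Rightarrow> nat \<Rightarrow> real) \<Rightarrow> nat \<Rightarrow> real" where
  "center d N B X e = (\<Sum>j<N. clip d B (X j) e) / real N"

text \<open>The difference removes the unknown mean, and the factor \<open>1 / sqrt 2\<close>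
  restores the covariance of a single sample.\<close>

definition pair_diff :: "nat \<Rightarrow> (nat \<Rightarrow> nat \<Rightarrow> real) \<Rightarrow> nat \<Rightarrow> nat \<Rightarrow> real" where
  "pair_diff N X j e = (X (N + 2 * j) e - X (N + 2 * j + 1) e) / sqrt 2"

definition rows :: "nat \<Rightarrow> nat \<Rightarrow> real \<Rightarrow> (nat \<Rightarrow> nat \<Rightarrow> real) \<Rightarrow> nat \<Rightarrow> nat \<Rightarrow> real" where
  "rows d N B X j = clip d B (pair_diff N X j)"

text \<open>
  The first \<open>N\<close> rows certify the eigenvalue bound, and every block of \<open>Suc d\<close> further rows provides one
  kernel vector.  The block that contains the changed row is lost.
\<close>

definition num_rows :: "nat \<Rightarrow> nat \<Rightarrow> nat \<Rightarrow> nat" where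
  "num_rows d N p = N + (2 * p + 2) * Suc d"

definition num_samples :: "nat \<Rightarrow> nat \<Rightarrow> nat \<Rightarrow> nat" where
  "num_samples d N p = N + 2 * num_rows d N p"

text \<open>
  For \<open>t * B\<^sup>2 \<le> N / 32\<close> the gate is closed below \<open>N / 16\<close> and open above \<open>N / 8\<close>, and \<open>3 / 32\<close> is the
  midpoint.
\<close>

definition accept_prob :: "nat \<Rightarrow> nat \<Rightarrow> real \<Rightarrow> real \<Rightarrow> real \<Rightarrow> (nat \<Rightarrow> nat \<Rightarrow> real) \<Rightarrow> real" where
  "accept_prob d N B \<epsilon> t X = accept \<epsilon> t ((low_eig d N (rows d N B X) - 3/32 * real N) / B\<^sup>2)"

section \<open>The mechanism as a measurable kernel\<close>

definition coin :: "real measure" where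
  "coin = uniform_measure lborel {0..1}"

definition mech_fun :: "nat \<Rightarrow> nat \<Rightarrow> nat \<Rightarrow> real \<Rightarrow> real \<Rightarrow> real \<Rightarrow> real \<Rightarrow> (nat \<Rightarrow> nat \<Rightarrow> real) \<Rightarrow> real \<times> (nat \<Rightarrow> real) \<Rightarrow> (nat \<Rightarrow> real) option" where
  "mech_fun d N p B \<rho> \<epsilon> t X = (\<lambda>(u, g). if u \<le> accept_prob d N B \<epsilon> t X
     then Some (core_out d (num_rows d N p) \<rho> (center d N B X) (rows d N B X) g) else None)"

definition mech :: "nat \<Rightarrow> nat \<Rightarrow> nat \<Rightarrow> real \<Rightarrow> real \<Rightarrow> real \<Rightarrow> real \<Rightarrow> (nat \<Rightarrow> nat \<Rightarrow> real) \<Rightarrow> (nat \<Rightarrow> real) option measure" where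
  "mech d N p B \<rho> \<epsilon> t X = distr (coin \<Otimes>\<^sub>M std_gauss (num_rows d N p)) (option_space (lborel_pow d)) (mech_fun d N p B \<rho> \<epsilon> t X)"

lemma sets_coin[simp, measurable_cong]: "sets coin = sets borel" by (simp add: coin_def)

lemma prob_space_coin: "prob_space coin"
  unfolding coin_def by (rule prob_space_uniform_measure) auto

lemma prob_space_coin_gauss: "prob_space (coin \<Otimes>\<^sub>M std_gauss k)"
  by (intro prob_space_pair prob_space_coin prob_space_std_gauss)

lemma nn_integral_coin:
  assumes "0 \<le> a" "a \<le> 1"
  shows "(\<integral>\<^sup>+u. (if u \<le> a then h else I) \<partial>coin) = ennreal a * h + ennreal (1 - a) * I"
proof -
  have "(\<integral>\<^sup>+u. (if u \<le> a then h else I) \<partial>coin) = (\<integral>\<^sup>+u. h * indicator {0..a} u + I * indicator {a<..1} u \<partial>lborel)"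
    unfolding coin_def using assms
    by (subst nn_integral_uniform_measure) (auto intro!: nn_integral_cong simp: indicator_def divide_ennreal_def)
  also have "\<dots> = ennreal a * h + ennreal (1 - a) * I"
    using assms by (subst nn_integral_add) (auto simp: nn_integral_cmult mult.commute)
  finally show ?thesis .
qed

lemma mech_fun_measurable:
  "(\<lambda>(X, w). mech_fun d N p B \<rho> \<epsilon> t X w) \<in>
    (\<Pi>\<^sub>M i\<in>{..<num_samples d N p}. lborel_pow d) \<Otimes>\<^sub>M (coin \<Otimes>\<^sub>M std_gauss (num_rows d N p)) \<rightarrow>\<^sub>M option_space (lborel_pow d)"
proof -
  let ?n = "num_samples d N p" and ?k = "num_rows d N p"
  let ?M = "(\<Pi>\<^sub>M i\<in>{..<?n}. lborel_pow d) \<Otimes>\<^sub>M (coin \<Otimes>\<^sub>M std_gauss ?k)"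
  have X: "(\<lambda>q. fst q j e) \<in> borel_measurable ?M" if "j < ?n" "e < d" for j e
    by (rule measurable_compose[OF _ lborel_pow_component[OF that(2)]],
        rule measurable_compose[OF measurable_fst measurable_component_singleton]) (use that in simp)
  have c: "(\<lambda>q. center d N B (fst q) e) \<in> borel_measurable ?M" if "e < d" for e
    unfolding center_def
    by (intro borel_measurable_divide borel_measurable_sum borel_measurable_const clip_measurable X that) (auto simp: num_samples_def)
  have r: "(\<lambda>q. rows d N B (fst q) j e) \<in> borel_measurable ?M" if "j < ?k" "e < d" for j e
    unfolding rows_def
    by (intro clip_measurable that, unfold pair_diff_def, intro borel_measurable_divide borel_measurable_diff borel_measurable_const X)
       (use that in \<open>auto simp: num_samples_def\<close>)
  have a[measurable]: "(\<lambda>q. accept_prob d N B \<epsilon> t (fst q)) \<in> borel_measurable ?M"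
    unfolding accept_prob_def
    by (intro measurable_compose[OF _ accept_measurable] borel_measurable_divide borel_measurable_diff borel_measurable_const low_eig_measurable r)
       (auto simp: num_rows_def)
  have g: "(\<lambda>q. snd (snd q) j) \<in> borel_measurable ?M" if "j < ?k" for j
    by (rule measurable_compose[OF _ lborel_pow_component[OF that]]) measurable
  have cb: "(\<lambda>q. comb d ?k (rows d N B (fst q)) (snd (snd q)) e) \<in> borel_measurable ?M" if "e < d" for e
  proof -
    have "(\<lambda>q. \<Sum>j<?k. snd (snd q) j * rows d N B (fst q) j e) \<in> borel_measurable ?M"
      by (intro borel_measurable_sum borel_measurable_times g r that) auto
    then show ?thesis using that by (simp add: comb_def)
  qed
  have [measurable]: "(\<lambda>q. core_out d ?k \<rho> (center d N B (fst q)) (rows d N B (fst q)) (snd (snd q))) \<in> ?M \<rightarrow>\<^sub>M lborel_pow d"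
    unfolding core_out_def
    by (intro measurable_restrict_lborel_pow borel_measurable_add borel_measurable_divide borel_measurable_times borel_measurable_const c cb
      measurable_compose[OF ip_measurable borel_measurable_sqrt] g)
  have [measurable]: "(\<lambda>q. Some (core_out d ?k \<rho> (center d N B (fst q)) (rows d N B (fst q)) (snd (snd q)))) \<in> ?M \<rightarrow>\<^sub>M option_space (lborel_pow d)"
    by (rule measurable_compose[OF _ measurable_Some]) measurable
  have [measurable]: "(\<lambda>q. None) \<in> ?M \<rightarrow>\<^sub>M option_space (lborel_pow d)"
    by (rule measurable_const) (simp add: space_option_space)
  show ?thesis unfolding mech_fun_def split_def by measurable
qed

lemma mech_is_sampler: "is_sampler (num_samples d N p) (lborel_pow d) (mech d N p B \<rho> \<epsilon> t)"
  unfolding is_sampler_def mech_def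
proof (rule measurable_distr_prob_space2[OF _ mech_fun_measurable])
  have "coin \<Otimes>\<^sub>M std_gauss (num_rows d N p) \<in> space (prob_algebra (coin \<Otimes>\<^sub>M std_gauss (num_rows d N p)))"
    using prob_space_coin_gauss by (simp add: space_prob_algebra)
  then show "(\<lambda>x. coin \<Otimes>\<^sub>M std_gauss (num_rows d N p)) \<in> (\<Pi>\<^sub>M i\<in>{..<num_samples d N p}. lborel_pow d) \<rightarrow>\<^sub>M prob_algebra (coin \<Otimes>\<^sub>M std_gauss (num_rows d N p))"
    by (rule measurable_const)
qed

lemma mech_fun_measurable2:
  "X \<in> space (\<Pi>\<^sub>M i\<in>{..<num_samples d N p}. lborel_pow d) \<Longrightarrow>
   mech_fun d N p B \<rho> \<epsilon> t X \<in> coin \<Otimes>\<^sub>M std_gauss (num_rows d N p) \<rightarrow>\<^sub>M option_space (lborel_pow d)"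
  using measurable_Pair2[OF mech_fun_measurable] by simp

interpretation coin_gauss: pair_sigma_finite coin "std_gauss k" for k
  by (intro pair_sigma_finite.intro prob_space_imp_sigma_finite prob_space_coin prob_space_std_gauss)

lemma emeasure_mech:
  fixes d N p :: nat and B \<rho> \<epsilon> t :: real
  assumes X: "X \<in> space (\<Pi>\<^sub>M i\<in>{..<num_samples d N p}. lborel_pow d)"
    and S: "S \<in> sets (option_space (lborel_pow d))"
  defines "a \<equiv> accept_prob d N B \<epsilon> t X"
  shows "emeasure (mech d N p B \<rho> \<epsilon> t X) S =
    ennreal a * (\<integral>\<^sup>+g. indicator (Some -` S \<inter> space (lborel_pow d)) (core_out d (num_rows d N p) \<rho> (center d N B X) (rows d N B X) g) \<partial>std_gauss (num_rows d N p))
     + ennreal (1 - a) * indicator S None"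
proof -
  let ?k = "num_rows d N p"
  let ?f = "mech_fun d N p B \<rho> \<epsilon> t X" and ?o = "core_out d ?k \<rho> (center d N B X) (rows d N B X)"
  let ?h = "\<integral>\<^sup>+g. indicator (Some -` S \<inter> space (lborel_pow d)) (?o g) \<partial>std_gauss ?k"
  note f[measurable] = mech_fun_measurable2[OF X]
  note [measurable] = S
  have "emeasure (mech d N p B \<rho> \<epsilon> t X) S = (\<integral>\<^sup>+w. indicator S w \<partial>mech d N p B \<rho> \<epsilon> t X)"
    by (rule nn_integral_indicator[symmetric]) (simp add: mech_def S)
  also have "\<dots> = (\<integral>\<^sup>+w. indicator S (?f w) \<partial>(coin \<Otimes>\<^sub>M std_gauss ?k))"
    unfolding mech_def by (rule nn_integral_distr) measurable
  also have "\<dots> = (\<integral>\<^sup>+u. (\<integral>\<^sup>+g. indicator S (?f (u, g)) \<partial>std_gauss ?k) \<partial>coin)"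
    by (rule std_gauss.nn_integral_fst[symmetric]) measurable
  also have "\<dots> = (\<integral>\<^sup>+u. (if u \<le> a then ?h else indicator S None) \<partial>coin)"
  proof (rule nn_integral_cong)
    fix u
    show "(\<integral>\<^sup>+g. indicator S (?f (u, g)) \<partial>std_gauss ?k) = (if u \<le> a then ?h else indicator S None)"
    proof (cases "u \<le> a")
      case True
      have "(\<integral>\<^sup>+g. indicator S (?f (u, g)) \<partial>std_gauss ?k) = ?h"
      proof (rule nn_integral_cong)
        fix g assume "g \<in> space (std_gauss ?k)"
        then have "?o g \<in> space (lborel_pow d)" using measurable_space[OF core_out_measurable] by simp
        then show "indicator S (?f (u, g)) = (indicator (Some -` S \<inter> space (lborel_pow d)) (?o g) :: ennreal)"
          using True by (simp add: mech_fun_def a_def indicator_def)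
      qed
      then show ?thesis using True by simp
    next
      case False
      then have "(\<integral>\<^sup>+g. indicator S (?f (u, g)) \<partial>std_gauss ?k) = (\<integral>\<^sup>+g. indicator S None \<partial>std_gauss ?k)"
        by (intro nn_integral_cong) (simp add: mech_fun_def a_def)
      also have "\<dots> = indicator S None" by (simp only: nn_integral_const std_gauss.emeasure_space_1 mult_1_right)
      finally show ?thesis using False by simp
    qed
  qed
  also have "\<dots> = ennreal a * ?h + ennreal (1 - a) * indicator S None"
    by (rule nn_integral_coin) (simp_all add: a_def accept_prob_def accept_bounds)
  finally show ?thesis .
qed

section \<open>The effect of one changed sample\<close>

lemma rows_diff:
  assumes "\<And>j. j \<noteq> i \<Longrightarrow> X j = X' j" "j \<noteq> (i - N) div 2 \<or> i < N"
  shows "rows d N B X j = rows d N B X' j"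
proof -
  have "N + 2 * j \<noteq> i" "N + 2 * j + 1 \<noteq> i" using assms(2) by auto
  then have "pair_diff N X j = pair_diff N X' j" by (simp add: pair_diff_def fun_eq_iff assms(1))
  then show ?thesis by (simp add: rows_def)
qed

lemma center_diff_outside:
  assumes "\<And>j. j \<noteq> i \<Longrightarrow> X j = X' j" "N \<le> i"
  shows "center d N B X = center d N B X'"
  unfolding center_def by (intro ext arg_cong2[where f="(/)"] sum.cong) (use assms in auto)

lemma ip_diff_le:
  assumes "ip d x x \<le> B\<^sup>2" "ip d y y \<le> B\<^sup>2"
  shows "ip d (\<lambda>e. x e - y e) (\<lambda>e. x e - y e) \<le> (2 * B)\<^sup>2"
proof -
  have "0 \<le> ip d (\<lambda>e. x e + y e) (\<lambda>e. x e + y e)" by simp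
  then show ?thesis using assms by (simp add: ip_linear ip_commute[of d y x] power_mult_distrib)
qed

lemma center_diff_inside:
  assumes "\<And>j. j \<noteq> i \<Longrightarrow> X j = X' j" "i < N"
  shows "ip d (\<lambda>e. center d N B X e - center d N B X' e) (\<lambda>e. center d N B X e - center d N B X' e) \<le> (2 * B / real N)\<^sup>2"
proof -
  let ?u = "\<lambda>e. clip d B (X i) e - clip d B (X' i) e"
  have "center d N B X e - center d N B X' e = 1 / real N * ?u e" for e
  proof -
    have "center d N B X e - center d N B X' e = (\<Sum>j<N. clip d B (X j) e - clip d B (X' j) e) / real N"
      by (simp add: center_def sum_subtractf diff_divide_distrib)
    also have "(\<Sum>j<N. clip d B (X j) e - clip d B (X' j) e) = (\<Sum>j\<in>{i}. clip d B (X j) e - clip d B (X' j) e)"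
      by (rule sum.mono_neutral_right) (use assms in auto)
    finally show ?thesis by simp
  qed
  then have "ip d (\<lambda>e. center d N B X e - center d N B X' e) (\<lambda>e. center d N B X e - center d N B X' e) = (1 / real N)\<^sup>2 * ip d ?u ?u"
    by (simp only: ip_scale)
  also have "\<dots> \<le> (1 / real N)\<^sup>2 * (2 * B)\<^sup>2"
    by (intro mult_left_mono ip_diff_le clip_le) auto
  finally show ?thesis by (simp add: power_divide power_mult_distrib)
qed

lemma low_eig_abs_sensitivity:
  assumes d: "0 < d" and same: "\<And>j. j \<noteq> i \<Longrightarrow> y j = y' j" and b: "ip d (y i) (y i) \<le> B2" "ip d (y' i) (y' i) \<le> B2"
  shows "\<bar>low_eig d N y - low_eig d N y'\<bar> \<le> B2"
  using low_eig_sensitivity[OF d, of i y y' B2 N] low_eig_sensitivity[OF d, of i y' y B2 N] same b by force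

text \<open>Composition of gate and core, each with \<open>\<epsilon> / 2\<close>. The error
  \<open>\<delta>1\<close> is paid twice in the accepted part, where it meets the factor
  \<open>exp (\<epsilon> / 2) \<le> 2\<close>, and once in the rejected part. Privacy of the core is
  asked for only when \<open>0 < a\<close>, since an open gate is what certifies the eigenvalue
  bound.\<close>

lemma gated_mixture_private:
  fixes a a' h h' I \<epsilon> \<delta>1 \<delta>2 :: real
  assumes a: "0 \<le> a" "a \<le> 1" and a': "0 \<le> a'" "a' \<le> 1" and h': "0 \<le> h'" "h' \<le> 1" and I: "0 \<le> I" "I \<le> 1"
    and eps: "0 \<le> \<epsilon>" "\<epsilon> \<le> 1" and \<delta>: "0 \<le> \<delta>1" "0 \<le> \<delta>2"
    and 1: "a \<le> exp (\<epsilon>/2) * a' + \<delta>1" and 2: "1 - a \<le> exp (\<epsilon>/2) * (1 - a') + \<delta>1"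
    and 3: "0 < a \<Longrightarrow> h \<le> exp (\<epsilon>/2) * h' + \<delta>2"
  shows "a * h + (1 - a) * I \<le> exp \<epsilon> * (a' * h' + (1 - a') * I) + (3 * \<delta>1 + \<delta>2)"
proof -
  have e: "exp (\<epsilon>/2) * exp (\<epsilon>/2) = exp \<epsilon>" unfolding exp_add[symmetric] by simp
  have "exp (\<epsilon>/2) \<le> exp (1/2)" using eps by simp
  also have "exp (1/2::real) \<le> 1 + 1/2 + (1/2)\<^sup>2" by (rule exp_bound) auto
  finally have e2: "exp (\<epsilon>/2) \<le> 2" by (simp add: power2_eq_square)
  have "a * h \<le> a * (exp (\<epsilon>/2) * h' + \<delta>2)"
    using a 3 by (cases "a = 0") (auto intro!: mult_left_mono)
  also have "\<dots> \<le> (exp (\<epsilon>/2) * h') * a + \<delta>2"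
    using mult_right_mono[OF a(2) \<delta>(2)] by (simp add: algebra_simps)
  also have "\<dots> \<le> (exp (\<epsilon>/2) * h') * (exp (\<epsilon>/2) * a' + \<delta>1) + \<delta>2"
    using mult_left_mono[OF 1, of "exp (\<epsilon>/2) * h'"] h' by simp
  also have "\<dots> = exp \<epsilon> * (a' * h') + (exp (\<epsilon>/2) * h') * \<delta>1 + \<delta>2"
    by (simp add: e[symmetric] algebra_simps)
  also have "(exp (\<epsilon>/2) * h') * \<delta>1 \<le> (2 * 1) * \<delta>1"
    by (intro mult_right_mono mult_mono e2 h' \<delta>) auto
  finally have A: "a * h \<le> exp \<epsilon> * (a' * h') + 2 * \<delta>1 + \<delta>2" by simp
  have "(1 - a) * I \<le> (exp (\<epsilon>/2) * (1 - a') + \<delta>1) * I" by (rule mult_right_mono[OF 2 I(1)])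
  also have "\<dots> \<le> exp (\<epsilon>/2) * ((1 - a') * I) + \<delta>1"
    using mult_left_mono[OF I(2) \<delta>(1)] by (simp add: algebra_simps)
  also have "exp (\<epsilon>/2) * ((1 - a') * I) \<le> exp \<epsilon> * ((1 - a') * I)"
    using eps a' I by (intro mult_right_mono) auto
  finally show ?thesis using A by (simp add: distrib_left)
qed

text \<open>Half of \<open>\<epsilon>\<close> goes to the gate and half to the core; a changed row
  spends the second half in two steps of \<open>\<epsilon> / 4\<close>. A changed sample among the
  first \<open>N\<close> affects only the centre, a later one only a single row. The additive errors
  are \<open>3 * \<delta> / 8\<close> for the gate and \<open>\<delta> / 2\<close> for the
  core.\<close>

theorem mech_private:
  fixes d N p :: nat and B \<rho> \<epsilon> \<delta> t z W :: real
  defines "k \<equiv> num_rows d N p"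
  assumes d: "0 < d" and p: "1 \<le> p" and eps: "0 < \<epsilon>" "\<epsilon> \<le> 1" and B: "0 < B" and \<rho>: "0 < \<rho>" and N: "0 < N"
    and t: "1 \<le> t" "t * B\<^sup>2 \<le> real N / 32" and z: "1 \<le> z"
    and gate: "exp (\<epsilon> / 2 * (1 - t)) \<le> \<delta> / 8"
    and row: "B\<^sup>2 / (real N / 32) * z \<le> \<epsilon> / 4 / 8"
    and W: "1 / \<rho> * sqrt ((2 * B / real N)\<^sup>2 / (real N / 32)) * sqrt (8 * real k) \<le> W"
    and cen: "2 * sqrt z * W + W\<^sup>2 \<le> \<epsilon> / 2 / 8"
    and tail: "tail_bound p k z \<le> \<delta> / 2"
  shows "differentially_private (num_samples d N p) (lborel_pow d) \<epsilon> \<delta> (mech d N p B \<rho> (\<epsilon> / 2) t)"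
  unfolding differentially_private_def
proof (intro ballI impI)
  let ?n = "num_samples d N p" and ?O = "option_space (lborel_pow d)"
  fix X X' S
  assume X: "X \<in> space (\<Pi>\<^sub>M i\<in>{..<?n}. lborel_pow d)" and X': "X' \<in> space (\<Pi>\<^sub>M i\<in>{..<?n}. lborel_pow d)"
    and nb: "neighbors ?n X X'" and S: "S \<in> sets ?O"
  have \<delta>: "0 \<le> \<delta>" using gate exp_gt_zero[of "\<epsilon> / 2 * (1 - t)"] by linarith
  obtain i where i: "i < ?n" and same': "\<And>j. j < ?n \<Longrightarrow> j \<noteq> i \<Longrightarrow> X j = X' j"
    using nb unfolding neighbors_def by blast
  have same: "X j = X' j" if "j \<noteq> i" for j
    using same'[OF _ that] X X' by (cases "j < ?n") (auto simp: space_PiM PiE_def extensional_def)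
  define y where "y = rows d N B X"
  define y' where "y' = rows d N B X'"
  define c where "c = center d N B X"
  define c' where "c' = center d N B X'"
  define S0 where "S0 = Some -` S \<inter> space (lborel_pow d)"
  have S0: "S0 \<in> sets (lborel_pow d)" unfolding S0_def by (rule measurable_sets[OF measurable_Some S])
  have bnd: "ip d (y j) (y j) \<le> B\<^sup>2" "ip d (y' j) (y' j) \<le> B\<^sup>2" for j
    by (simp_all add: y_def y'_def rows_def clip_le)
  let ?i = "(i - N) div 2"
  have ys: "y j = y' j" if "j \<noteq> ?i \<or> i < N" for j
    unfolding y_def y'_def by (rule rows_diff[OF same that])
  define a where "a = accept_prob d N B (\<epsilon>/2) t X"
  define a' where "a' = accept_prob d N B (\<epsilon>/2) t X'"
  have ab: "0 \<le> a" "a \<le> 1" "0 \<le> a'" "a' \<le> 1" by (simp_all add: a_def a'_def accept_prob_def accept_bounds)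
  have B2: "0 < B\<^sup>2" using B by simp
  have "\<bar>(low_eig d N y - 3/32 * real N) / B\<^sup>2 - (low_eig d N y' - 3/32 * real N) / B\<^sup>2\<bar> = \<bar>low_eig d N y - low_eig d N y'\<bar> / B\<^sup>2"
    by (simp add: diff_divide_distrib[symmetric])
  also have "\<dots> \<le> 1"
    using low_eig_abs_sensitivity[OF d, of ?i y y' "B\<^sup>2" N] ys bnd B2 by simp
  finally have ga: "a \<le> exp (\<epsilon>/2) * a' + \<delta>/8" "1 - a \<le> exp (\<epsilon>/2) * (1 - a') + \<delta>/8"
    unfolding a_def a'_def accept_prob_def y_def[symmetric] y'_def[symmetric]
    using eps t gate by (auto intro!: accept_private)
  define h where "h = (\<integral>\<^sup>+g. indicator S0 (core_out d k \<rho> c y g) \<partial>std_gauss k)"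
  define h' where "h' = (\<integral>\<^sup>+g. indicator S0 (core_out d k \<rho> c' y' g) \<partial>std_gauss k)"
  have le1: "(\<integral>\<^sup>+g. indicator S0 (core_out d k \<rho> c y g) \<partial>std_gauss k) \<le> 1" for c y
  proof -
    have "(\<integral>\<^sup>+g. indicator S0 (core_out d k \<rho> c y g) \<partial>std_gauss k) \<le> (\<integral>\<^sup>+g. 1 \<partial>std_gauss k)"
      by (intro nn_integral_mono) (simp add: indicator_def)
    also have "\<dots> = 1" by (simp only: nn_integral_const std_gauss.emeasure_space_1 mult_1_right)
    finally show ?thesis .
  qed
  have hh: "h = ennreal (enn2real h)" "h' = ennreal (enn2real h')"
    using le1[of c y] le1[of c' y'] unfolding h_def[symmetric] h'_def[symmetric]
    by (auto intro!: ennreal_enn2real[symmetric] simp: less_top[symmetric] top_unique)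
  have h1: "enn2real h' \<le> 1" using le1[of c' y'] unfolding h'_def[symmetric] by (simp add: enn2real_leI)
  have hle: "h \<le> ennreal (exp (\<epsilon>/2)) * h' + ennreal (\<delta>/2)" if "0 < a"
  proof -
    \<comment> \<open>A positive acceptance probability puts the argument above the lower cut, that
      is, \<open>low_eig\<close> above \<open>3/32 * N - t * B^2 \<ge> N / 16\<close>.\<close>
    have "\<not> (low_eig d N y - 3/32 * real N) / B\<^sup>2 < - t"
      using that unfolding a_def accept_prob_def y_def[symmetric] by (auto simp: accept_def)
    then have "- t * B\<^sup>2 \<le> low_eig d N y - 3/32 * real N" using B2 by (simp add: field_simps)
    then have "real N / 16 \<le> low_eig d N y" using t(2) by simp
    then have low: "real N / 16 * ip d \<theta> \<theta> \<le> (\<Sum>j<N. (ip d \<theta> (y j))\<^sup>2)" for \<theta>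
      using mult_right_mono[of "real N / 16" "low_eig d N y" "ip d \<theta> \<theta>"] low_eig_le[of d N y \<theta>] by simp
    have c0: "0 < real N / 32" using N by simp
    show ?thesis
    proof (cases "i < N")
      case True
      then have yy: "y = y'" using ys by blast
      let ?q = "ip d (\<lambda>e. c e - c' e) (\<lambda>e. c e - c' e)"
      have q: "?q \<le> (2 * B / real N)\<^sup>2"
        unfolding c_def c'_def by (rule center_diff_inside[OF same True])
      have W': "1 / \<rho> * sqrt (?q / (real N / 32)) * sqrt (8 * real k) \<le> W"
        by (rule order_trans[OF _ W]) (intro mult_right_mono mult_left_mono real_sqrt_le_mono divide_right_mono q, use \<rho> in auto)
      have low': "real N / 32 * ip d \<theta> \<theta> \<le> (\<Sum>j<N. (ip d \<theta> (y j))\<^sup>2)" for \<theta>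
        by (rule order_trans[OF mult_right_mono low]) auto
      have "h \<le> ennreal (exp (\<epsilon>/2)) * h' + ennreal (tail_bound p k z)"
        unfolding h_def h'_def yy[symmetric] k_def num_rows_def
        by (rule center_core_private[OF c0 low' p _ _ z \<rho> W'[unfolded k_def num_rows_def] cen S0]) (use eps in auto)
      also have "\<dots> \<le> ennreal (exp (\<epsilon>/2)) * h' + ennreal (\<delta>/2)"
        by (intro add_left_mono ennreal_leI tail)
      finally show ?thesis .
    next
      case False
      then have cc: "c = c'" unfolding c_def c'_def by (intro center_diff_outside[OF same]) auto
      have i': "?i < N + (2 * p + 2) * Suc d"
        using i False unfolding num_samples_def num_rows_def by simp
      \<comment> \<open>\<open>B^2 \<le> N / 32\<close> leaves room for deleting the changed row
        from the certificate.\<close>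
      have "1 * B\<^sup>2 \<le> t * B\<^sup>2" by (rule mult_right_mono) (use t in auto)
      then have "real N / 32 + B\<^sup>2 \<le> real N / 16" using t(2) by simp
      then have low': "(real N / 32 + B\<^sup>2) * ip d \<theta> \<theta> \<le> (\<Sum>j<N. (ip d \<theta> (y j))\<^sup>2)" for \<theta>
        by (rule order_trans[OF mult_right_mono low]) auto
      have "h \<le> ennreal (exp (2 * (\<epsilon>/4))) * h' + ennreal (tail_bound p k z)"
        unfolding h_def h'_def cc[symmetric] k_def num_rows_def
        by (rule row_core_private[OF i' c0 _ low' bnd p _ _ z row S0]) (use eps ys in auto)
      also have "\<dots> \<le> ennreal (exp (\<epsilon>/2)) * h' + ennreal (\<delta>/2)"
        using tail by (simp add: add_left_mono ennreal_leI)
      finally show ?thesis .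
    qed
  qed
  have hr: "enn2real h \<le> exp (\<epsilon>/2) * enn2real h' + \<delta>/2" if "0 < a"
  proof -
    have "ennreal (enn2real h) \<le> ennreal (exp (\<epsilon>/2) * enn2real h' + \<delta>/2)"
      using hle[OF that] \<delta> unfolding hh(1)[symmetric]
      by (subst ennreal_plus) (auto simp: ennreal_mult' hh(2)[symmetric])
    then show ?thesis using \<delta> by (subst (asm) ennreal_le_iff) auto
  qed
  let ?I = "indicator S None :: real"
  have mX: "measure (mech d N p B \<rho> (\<epsilon>/2) t X) S = a * enn2real h + (1 - a) * ?I"
  proof -
    have "emeasure (mech d N p B \<rho> (\<epsilon>/2) t X) S = ennreal a * h + ennreal (1 - a) * indicator S None"
      unfolding emeasure_mech[OF X S] a_def h_def S0_def c_def y_def k_def ..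
    also have "\<dots> = ennreal (a * enn2real h + (1 - a) * ?I)"
      by (subst hh(1)) (use ab in \<open>simp add: ennreal_mult' ennreal_indicator[symmetric]\<close>)
    finally have "emeasure (mech d N p B \<rho> (\<epsilon>/2) t X) S = ennreal (a * enn2real h + (1 - a) * ?I)" .
    moreover have "0 \<le> a * enn2real h + (1 - a) * ?I" using ab by simp
    ultimately show ?thesis by (simp only: measure_def enn2real_ennreal)
  qed
  have mX': "measure (mech d N p B \<rho> (\<epsilon>/2) t X') S = a' * enn2real h' + (1 - a') * ?I"
  proof -
    have "emeasure (mech d N p B \<rho> (\<epsilon>/2) t X') S = ennreal a' * h' + ennreal (1 - a') * indicator S None"
      unfolding emeasure_mech[OF X' S] a'_def h'_def S0_def c'_def y'_def k_def ..
    also have "\<dots> = ennreal (a' * enn2real h' + (1 - a') * ?I)"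
      by (subst hh(2)) (use ab in \<open>simp add: ennreal_mult' ennreal_indicator[symmetric]\<close>)
    finally have "emeasure (mech d N p B \<rho> (\<epsilon>/2) t X') S = ennreal (a' * enn2real h' + (1 - a') * ?I)" .
    moreover have "0 \<le> a' * enn2real h' + (1 - a') * ?I" using ab by simp
    ultimately show ?thesis by (simp only: measure_def enn2real_ennreal)
  qed
  have "a * enn2real h + (1 - a) * ?I \<le> exp \<epsilon> * (a' * enn2real h' + (1 - a') * ?I) + (3 * (\<delta>/8) + \<delta>/2)"
    by (rule gated_mixture_private) (use ab h1 eps \<delta> ga hr in auto)
  then show "measure (mech d N p B \<rho> (\<epsilon>/2) t X) S \<le> exp \<epsilon> * measure (mech d N p B \<rho> (\<epsilon>/2) t X') S + \<delta>"
    unfolding mX mX' using \<delta> by simp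
qed

section \<open>Gaussians with bounded covariance\<close>

text \<open>\<open>P\<close> is the inverse covariance matrix and \<open>S\<close> is the covariance
  acting on vectors. \<open>bil_S\<close> expresses that they are inverse to each other,
  \<open>low\<close> and \<open>up\<close> are the two Loewner bounds, and \<open>Z_fin\<close>
  makes the normalising constant finite. Index functions replace matrices so that the integration
  lemmas apply directly.\<close>

locale gauss_form =
  fixes d :: nat and P :: "nat \<Rightarrow> nat \<Rightarrow> real" and S :: "(nat \<Rightarrow> real) \<Rightarrow> nat \<Rightarrow> real" and \<kappa> :: real
  assumes sym: "i < d \<Longrightarrow> j < d \<Longrightarrow> P i j = P j i"
    and bil_S: "bil d P (S \<theta>) y = ip d \<theta> y"
    and low: "ip d \<theta> \<theta> \<le> ip d \<theta> (S \<theta>)"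
    and up: "ip d \<theta> (S \<theta>) \<le> \<kappa> * ip d \<theta> \<theta>"
    and Z_fin: "(\<integral>\<^sup>+y. ennreal (exp (- bil d P y y / 2)) \<partial>lborel_pow d) \<noteq> \<infinity>"
begin

definition W :: "(nat \<Rightarrow> real) \<Rightarrow> real" where "W y = exp (- bil d P y y / 2)"

definition Z :: ennreal where "Z = (\<integral>\<^sup>+y. ennreal (W y) \<partial>lborel_pow d)"

definition D :: "(nat \<Rightarrow> real) \<Rightarrow> (nat \<Rightarrow> real) measure" where
  "D \<mu> = density (lborel_pow d) (\<lambda>x. ennreal (W (\<lambda>i. x i - \<mu> i)) / Z)"

lemma W_measurable[measurable]:
  "(\<And>i. i < d \<Longrightarrow> (\<lambda>x. f x i) \<in> borel_measurable M) \<Longrightarrow> (\<lambda>x. W (f x)) \<in> borel_measurable M"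
proof -
  assume f: "\<And>i. i < d \<Longrightarrow> (\<lambda>x. f x i) \<in> borel_measurable M"
  have [measurable]: "(\<lambda>x. bil d P (f x) (f x)) \<in> borel_measurable M" by (rule bil_measurable[OF f f])
  show ?thesis unfolding W_def by measurable
qed

lemma W_cong: "(\<And>i. i < d \<Longrightarrow> x i = y i) \<Longrightarrow> W x = W y"
  unfolding W_def by (auto intro!: arg_cong[where f=exp] bil_cong arg_cong[where f=uminus] arg_cong[where f="\<lambda>x. x/2"])

lemma W_restrict[simp]: "W (restrict x {..<d}) = W x" by (rule W_cong) auto

lemma W_m[measurable]: "W \<in> borel_measurable (lborel_pow d)"
  by (rule W_measurable) (rule lborel_pow_component)

lemma Z_neq: "Z \<noteq> 0" "Z \<noteq> \<infinity>"
proof -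
  show "Z \<noteq> \<infinity>" using Z_fin by (simp add: Z_def W_def)
  show "Z \<noteq> 0"
  proof
    assume "Z = 0"
    then have "AE x in lborel_pow d. ennreal (W x) = 0"
      unfolding Z_def by (subst (asm) nn_integral_0_iff_AE) auto
    \<comment> \<open>\<open>W\<close> is nowhere zero, so its vanishing almost everywhere would
      make any claim true almost everywhere. \<open>gauss_density\<close>, of total mass one,
      refutes this.\<close>
    then have "AE x in lborel_pow d. ennreal (gauss_density d x) = 0"
      by eventually_elim (simp add: W_def)
    then have "(\<integral>\<^sup>+T. ennreal (gauss_density d T) \<partial>lborel_pow d) = 0"
      by (subst nn_integral_0_iff_AE) auto
    then show False by (simp add: nn_integral_gauss_density)
  qed
qed

lemma Z_div: "Z / Z = 1"
  by (rule ennreal_divide_self) (use Z_neq in \<open>auto simp: less_top\<close>)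

lemma sets_D[simp, measurable_cong]: "sets (D \<mu>) = sets (lborel_pow d)" by (simp add: D_def)
lemma space_D[simp]: "space (D \<mu>) = space (lborel_pow d)" by (simp add: D_def)

lemma restrict_add_measurable:
  "(\<lambda>x. \<lambda>i\<in>{..<d}. a * x i + \<mu> i) \<in> lborel_pow d \<rightarrow>\<^sub>M lborel_pow d"
  by (rule measurable_lborel_pow_affine)

lemma nn_integral_D:
  assumes f[measurable]: "f \<in> borel_measurable (lborel_pow d)"
  shows "(\<integral>\<^sup>+x. f x \<partial>D \<mu>) = (\<integral>\<^sup>+x. f (\<lambda>i\<in>{..<d}. x i + \<mu> i) * ennreal (W x) \<partial>lborel_pow d) / Z"
proof -
  have m: "(\<lambda>x. W (\<lambda>i. x i - \<mu> i)) \<in> borel_measurable (lborel_pow d)"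
    by (intro W_measurable borel_measurable_diff lborel_pow_component borel_measurable_const)
  have m2[measurable]: "(\<lambda>x. f (\<lambda>i\<in>{..<d}. x i + \<mu> i)) \<in> borel_measurable (lborel_pow d)"
    using measurable_compose[OF restrict_add_measurable f, of 1 \<mu>] by simp
  have "(\<integral>\<^sup>+x. f x \<partial>D \<mu>) = (\<integral>\<^sup>+x. f x * ennreal (W (\<lambda>i. x i - \<mu> i)) / Z \<partial>lborel_pow d)"
    unfolding D_def by (subst nn_integral_density) (use m in \<open>auto simp: divide_ennreal_def ac_simps\<close>)
  also have "\<dots> = (\<integral>\<^sup>+x. f x * ennreal (W (\<lambda>i. x i - \<mu> i)) \<partial>lborel_pow d) / Z"
    using m by (intro nn_integral_divide) measurable
  also have "(\<integral>\<^sup>+x. f x * ennreal (W (\<lambda>i. x i - \<mu> i)) \<partial>lborel_pow d) = (\<integral>\<^sup>+x. f (\<lambda>i\<in>{..<d}. x i + \<mu> i) * ennreal (W x) \<partial>lborel_pow d)"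
  proof (subst nn_integral_lborel_pow_translate[symmetric, where b=\<mu>])
    show "(\<lambda>x. f x * ennreal (W (\<lambda>i. x i - \<mu> i))) \<in> borel_measurable (lborel_pow d)" using m by measurable
    show "(\<integral>\<^sup>+x. f (\<lambda>i\<in>{..<d}. x i + \<mu> i) * ennreal (W (\<lambda>i. (\<lambda>i\<in>{..<d}. x i + \<mu> i) i - \<mu> i)) \<partial>lborel_pow d)
      = (\<integral>\<^sup>+x. f (\<lambda>i\<in>{..<d}. x i + \<mu> i) * ennreal (W x) \<partial>lborel_pow d)"
      by (intro nn_integral_cong arg_cong2[where f="(*)"] refl arg_cong[where f=ennreal] W_cong) simp
  qed
  finally show ?thesis .
qed

lemma restrict_plus0: "x \<in> space (lborel_pow d) \<Longrightarrow> (\<lambda>i\<in>{..<d}. x i + 0) = x"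
  using extensional_restrict_eq[of x d] by simp

lemma nn_integral_D0:
  assumes f: "f \<in> borel_measurable (lborel_pow d)"
  shows "(\<integral>\<^sup>+x. f x \<partial>D (\<lambda>_. 0)) = (\<integral>\<^sup>+x. f x * ennreal (W x) \<partial>lborel_pow d) / Z"
  unfolding nn_integral_D[OF f]
  by (intro arg_cong[where f="\<lambda>x. x / Z"] nn_integral_cong) (simp only: restrict_plus0)

lemma nn_integral_D_shift:
  assumes f: "f \<in> borel_measurable (lborel_pow d)"
  shows "(\<integral>\<^sup>+x. f x \<partial>D \<mu>) = (\<integral>\<^sup>+x. f (\<lambda>i\<in>{..<d}. x i + \<mu> i) \<partial>D (\<lambda>_. 0))"
  unfolding nn_integral_D[OF f]
  using measurable_compose[OF restrict_add_measurable f, of 1 \<mu>] by (subst nn_integral_D0) auto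

lemma prob_space_D: "prob_space (D \<mu>)"
proof (rule prob_spaceI)
  have "emeasure (D \<mu>) (space (D \<mu>)) = (\<integral>\<^sup>+x. 1 \<partial>D \<mu>)" by simp
  also have "\<dots> = Z / Z" by (subst nn_integral_D) (auto simp: Z_def)
  also have "\<dots> = 1" by (rule Z_div)
  finally show "emeasure (D \<mu>) (space (D \<mu>)) = 1" .
qed

lemma nn_integral_D_const: "(\<integral>\<^sup>+x. c \<partial>D \<mu>) = c"
  by (simp only: nn_integral_const prob_space.emeasure_space_1[OF prob_space_D] mult_1_right)

section \<open>One-dimensional marginals and exponential moments\<close>

lemma nn_integral_lborel_pow_1:
  assumes [measurable]: "f \<in> borel_measurable borel"
  shows "(\<integral>\<^sup>+T. f (T 0) * ennreal (gauss_density 1 T) \<partial>lborel_pow 1) = (\<integral>\<^sup>+t. f t * ennreal (std_normal_density t) \<partial>lborel)"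
  using nn_integral_lborel_pow_prod[of 1 "\<lambda>_ t. f t * ennreal (std_normal_density t)"]
  by (simp add: gauss_density_def)

text \<open>\<open>gauss_resample\<close> with the single direction \<open>S \<theta>\<close>,
  normalised. By \<open>bil_S\<close> the coefficient of \<open>y\<close> along it is
  \<open>ip d \<theta> y\<close> divided by its standard deviation, so resampling replaces the
  functional by that standard deviation times a fresh standard normal variable.\<close>

lemma marginal:
  assumes f[measurable]: "f \<in> borel_measurable borel" and \<theta>: "0 < ip d \<theta> \<theta>"
  shows "(\<integral>\<^sup>+x. f (ip d \<theta> x) \<partial>D (\<lambda>_. 0)) =
    (\<integral>\<^sup>+t. f (sqrt (ip d \<theta> (S \<theta>)) * t) * ennreal (std_normal_density t) \<partial>lborel)"
proof -
  let ?s = "ip d \<theta> (S \<theta>)"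
  have s: "0 < ?s" using \<theta> low[of \<theta>] by linarith
  define u where "u = (\<lambda>(l::nat) i. 1 / sqrt ?s * S \<theta> i)"
  have bu: "bil d P (u l) y = ip d \<theta> y / sqrt ?s" for l y
    unfolding u_def bil_scale_left bil_S by simp
  have tu: "ip d \<theta> (u l) = sqrt ?s" for l
    unfolding u_def ip_scale_right using s by (simp add: field_simps)
  have orth: "bil d P (u l) (u l') = (if l = l' then 1 else 0)" if "l < 1" "l' < 1" for l l'
    using that s by (simp add: bu tu)
  have Fm: "(\<lambda>x. f (ip d \<theta> x)) \<in> borel_measurable (lborel_pow d)"
    by (rule measurable_compose[OF _ f]) (intro ip_measurable lborel_pow_component borel_measurable_const)
  let ?R = "\<integral>\<^sup>+t. f (sqrt ?s * t) * ennreal (std_normal_density t) \<partial>lborel"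
  have R: "(\<integral>\<^sup>+T. f (sqrt ?s * T 0) * ennreal (gauss_density 1 T) \<partial>lborel_pow 1) = ?R"
    by (rule nn_integral_lborel_pow_1) measurable
  have pt: "ip d \<theta> (\<lambda>i\<in>{..<d}. y i + (\<Sum>l<1. (T l - bil d P (u l) y) * u l i)) = sqrt ?s * T 0" for y and T :: "nat \<Rightarrow> real"
  proof -
    have "ip d \<theta> (\<lambda>i. y i + (T 0 - ip d \<theta> y / sqrt ?s) * u 0 i) = sqrt ?s * T 0"
      unfolding ip_add_right ip_scale_right tu using s by (simp add: field_simps)
    then show ?thesis by (simp add: bu)
  qed
  have "(\<integral>\<^sup>+x. f (ip d \<theta> x) * ennreal (W x) \<partial>lborel_pow d) = (\<integral>\<^sup>+y. ?R * ennreal (W y) \<partial>lborel_pow d)"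
    using gauss_resample[of d P 1 u "\<lambda>x. f (ip d \<theta> x)", OF sym orth Fm, symmetric]
    unfolding pt R W_def .
  also have "\<dots> = ?R * Z" unfolding Z_def by (rule nn_integral_cmult) measurable
  finally show ?thesis
    unfolding nn_integral_D0[OF Fm] by (simp add: ennreal_times_divide[symmetric] Z_div)
qed

lemma exp_linear_le: "(\<integral>\<^sup>+x. ennreal (exp (c * ip d \<theta> x)) \<partial>D (\<lambda>_. 0)) \<le> ennreal (exp (c\<^sup>2 * \<kappa> * ip d \<theta> \<theta> / 2))"
proof (cases "ip d \<theta> \<theta> = 0")
  case True
  then have "ip d \<theta> x = 0" for x unfolding ip_eq_0_iff by (simp add: ip_def)
  then show ?thesis using True by (simp add: nn_integral_D_const del: nn_integral_const)
next
  case False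
  then have pos: "0 < ip d \<theta> \<theta>" using ip_nonneg[of d \<theta>] by linarith
  let ?s = "ip d \<theta> (S \<theta>)"
  have s: "0 < ?s" using pos low[of \<theta>] by linarith
  have "(\<integral>\<^sup>+x. ennreal (exp (c * ip d \<theta> x)) \<partial>D (\<lambda>_. 0)) = (\<integral>\<^sup>+t. ennreal (exp (c * sqrt ?s * t)) * ennreal (std_normal_density t) \<partial>lborel)"
    using marginal[OF _ pos, of "\<lambda>t. ennreal (exp (c * t))"] by (simp add: mult.assoc)
  also have "\<dots> = ennreal (exp ((c * sqrt ?s)\<^sup>2 / 2))" by (rule std_normal_exp_linear)
  also have "\<dots> \<le> ennreal (exp (c\<^sup>2 * \<kappa> * ip d \<theta> \<theta> / 2))"
    using s mult_left_mono[OF up[of \<theta>], of "c\<^sup>2"] by (intro ennreal_leI) (simp add: power_mult_distrib mult.assoc)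
  finally show ?thesis .
qed

text \<open>The variance of the functional is at least \<open>ip d \<theta> \<theta>\<close> by
  \<open>low\<close>. This is how the lower covariance bound enters the eigenvalue estimate.\<close>

lemma exp_neg_square_le:
  "(\<integral>\<^sup>+x. ennreal (exp (- (ip d \<theta> x)\<^sup>2)) \<partial>D (\<lambda>_. 0)) \<le> ennreal (1 / sqrt (1 + 2 * ip d \<theta> \<theta>))"
proof (cases "ip d \<theta> \<theta> = 0")
  case True
  then have "ip d \<theta> x = 0" for x unfolding ip_eq_0_iff by (simp add: ip_def)
  then show ?thesis using True by (simp add: nn_integral_D_const del: nn_integral_const)
next
  case False
  then have pos: "0 < ip d \<theta> \<theta>" using ip_nonneg[of d \<theta>] by linarith
  let ?s = "ip d \<theta> (S \<theta>)"
  have s: "0 < ?s" using pos low[of \<theta>] by linarith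
  have "(\<integral>\<^sup>+x. ennreal (exp (- (ip d \<theta> x)\<^sup>2)) \<partial>D (\<lambda>_. 0)) = (\<integral>\<^sup>+t. ennreal (exp (- ?s * t\<^sup>2)) * ennreal (std_normal_density t) \<partial>lborel)"
    using marginal[OF _ pos, of "\<lambda>t. ennreal (exp (- t\<^sup>2))"] s by (simp add: power_mult_distrib)
  also have "\<dots> = ennreal (1 / sqrt (1 - 2 * (- ?s)))" by (rule std_normal_exp_square) (use s in simp)
  also have "\<dots> \<le> ennreal (1 / sqrt (1 + 2 * ip d \<theta> \<theta>))"
    using s low[of \<theta>] pos by (intro ennreal_leI divide_left_mono) auto
  finally show ?thesis .
qed

lemma kappa_pos: "0 < d \<Longrightarrow> 1 \<le> \<kappa>"
proof -
  assume "0 < d"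
  then have "ip d (\<lambda>j. if j = 0 then 1 else 0) (\<lambda>j. if j = 0 then 1 else 0) = 1" by (simp add: ip_unit)
  then show ?thesis using order_trans[OF low up, of "\<lambda>j. if j = 0 then 1 else 0"] by simp
qed

text \<open>
  The squared norm is linearised by an independent standard Gaussian, which reduces its exponential
  moment to those of the linear functionals.
\<close>

lemma exp_norm_le:
  assumes d: "0 < d"
  shows "(\<integral>\<^sup>+x. ennreal (exp (ip d x x / (4 * \<kappa>))) \<partial>D (\<lambda>_. 0)) \<le> ennreal (sqrt 2 ^ d)"
proof -
  have k: "0 < \<kappa>" using kappa_pos[OF d] by simp
  \<comment> \<open>With this \<open>c\<close> the linearisation reproduces the exponent
    \<open>1 / (4 * \<kappa>)\<close>, and the bound for the linear functionals leaves
    \<open>1/4 * ip d h h\<close>, safely below the critical factor \<open>1/2\<close>.\<close>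
  let ?c = "1 / sqrt (2 * \<kappa>)"
  have c2: "?c\<^sup>2 = 1 / (2 * \<kappa>)" using k by (simp add: power_divide)
  have "(\<integral>\<^sup>+x. ennreal (exp (ip d x x / (4 * \<kappa>))) \<partial>D (\<lambda>_. 0)) = (\<integral>\<^sup>+x. (\<integral>\<^sup>+h. ennreal (exp (?c * ip d h x)) \<partial>std_gauss d) \<partial>D (\<lambda>_. 0))"
  proof (rule nn_integral_cong)
    fix x
    have "(\<integral>\<^sup>+h. ennreal (exp (ip d (\<lambda>i. ?c * x i) h)) \<partial>std_gauss d) = ennreal (exp (?c\<^sup>2 * ip d x x / 2))"
      unfolding std_gauss_exp_linear ip_scale ..
    moreover have "ip d (\<lambda>i. ?c * x i) h = ?c * ip d h x" for h
      by (simp only: ip_scale_left ip_commute[of d x h])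
    ultimately show "ennreal (exp (ip d x x / (4 * \<kappa>))) = (\<integral>\<^sup>+h. ennreal (exp (?c * ip d h x)) \<partial>std_gauss d)"
      unfolding c2 by simp
  qed
  also have "\<dots> = (\<integral>\<^sup>+h. (\<integral>\<^sup>+x. ennreal (exp (?c * ip d h x)) \<partial>D (\<lambda>_. 0)) \<partial>std_gauss d)"
  proof (rule pair_sigma_finite.Fubini')
    show "pair_sigma_finite (std_gauss d) (D (\<lambda>_. 0))"
      by (intro pair_sigma_finite.intro prob_space_imp_sigma_finite prob_space_D prob_space_std_gauss)
    have "(\<lambda>p. ip d (fst p) (snd p)) \<in> borel_measurable (std_gauss d \<Otimes>\<^sub>M D (\<lambda>_. 0))"
      by (intro ip_measurable) (rule measurable_compose[OF _ lborel_pow_component], measurable)+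
    then show "(\<lambda>(h, x). ennreal (exp (?c * ip d h x))) \<in> borel_measurable (std_gauss d \<Otimes>\<^sub>M D (\<lambda>_. 0))"
      unfolding split_def by measurable
  qed
  also have "\<dots> \<le> (\<integral>\<^sup>+h. ennreal (exp (1/4 * ip d h h)) \<partial>std_gauss d)"
  proof (rule nn_integral_mono)
    fix h
    have "?c\<^sup>2 * \<kappa> * ip d h h / 2 = 1/4 * ip d h h" unfolding c2 using k by simp
    then show "(\<integral>\<^sup>+x. ennreal (exp (?c * ip d h x)) \<partial>D (\<lambda>_. 0)) \<le> ennreal (exp (1/4 * ip d h h))"
      using exp_linear_le[of ?c h] by (simp only:)
  qed
  also have "\<dots> = ennreal ((1 / sqrt (1 - 2 * (1/4))) ^ d)" by (rule std_gauss_exp_square) simp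
  finally show ?thesis by (simp add: real_sqrt_divide)
qed

text \<open>Let \<open>x\<close> and \<open>x'\<close> be independent with weight \<open>W\<close>,
  and let \<open>y = a * x + b * x'\<close>. The left side is the joint weight in \<open>x\<close>
  and \<open>y\<close>. The right side factors it into the conditional law of \<open>x\<close>, with
  mean \<open>a / r^2 * y\<close> and scale \<open>b / r\<close>, and the law of \<open>y\<close>,
  with scale \<open>r\<close>.\<close>

lemma W_complete_square:
  fixes a b r :: real
  assumes b: "b \<noteq> 0" and r: "0 < r" and r2: "r\<^sup>2 = a\<^sup>2 + b\<^sup>2"
  shows "W x * W (\<lambda>i. 1 / b * y i - a / b * x i) = W (\<lambda>i. r / b * x i - a / (r * b) * y i) * W (\<lambda>i. 1 / r * y i)"
proof -
  let ?X = "bil d P x x" and ?Y = "bil d P y y" and ?V = "bil d P x y"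
  have c: "bil d P y x = ?V" using bil_commute[OF sym, where x=y and y=x] by simp
  have 1: "bil d P (\<lambda>i. 1 / b * y i - a / b * x i) (\<lambda>i. 1 / b * y i - a / b * x i) = (?Y - 2 * a * ?V + a\<^sup>2 * ?X) / b\<^sup>2"
    unfolding bil_diff_left bil_diff_right bil_scale_left bil_scale_right c using b by (simp add: field_simps power2_eq_square)
  have 2: "bil d P (\<lambda>i. r / b * x i - a / (r * b) * y i) (\<lambda>i. r / b * x i - a / (r * b) * y i) = (r\<^sup>2 * ?X - 2 * a * ?V + a\<^sup>2 / r\<^sup>2 * ?Y) / b\<^sup>2"
    unfolding bil_diff_left bil_diff_right bil_scale_left bil_scale_right c using b r by (simp add: field_simps power2_eq_square)
  have 3: "bil d P (\<lambda>i. 1 / r * y i) (\<lambda>i. 1 / r * y i) = ?Y / r\<^sup>2"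
    unfolding bil_scale_left bil_scale_right by (simp add: power2_eq_square)
  have r20: "r\<^sup>2 \<noteq> 0" "b\<^sup>2 \<noteq> 0" using r b by auto
  have "a\<^sup>2 / r\<^sup>2 * ?Y + b\<^sup>2 * (?Y / r\<^sup>2) = (a\<^sup>2 + b\<^sup>2) * ?Y / r\<^sup>2"
    by (simp add: add_divide_distrib distrib_right)
  then have 4: "a\<^sup>2 / r\<^sup>2 * ?Y + b\<^sup>2 * (?Y / r\<^sup>2) = ?Y"
    unfolding r2[symmetric] using r20 by simp
  have "?X + (?Y - 2 * a * ?V + a\<^sup>2 * ?X) / b\<^sup>2 = (b\<^sup>2 * ?X + ?Y - 2 * a * ?V + a\<^sup>2 * ?X) / b\<^sup>2"
    using r20 by (simp add: field_simps)
  also have "b\<^sup>2 * ?X + ?Y - 2 * a * ?V + a\<^sup>2 * ?X = r\<^sup>2 * ?X - 2 * a * ?V + a\<^sup>2 / r\<^sup>2 * ?Y + b\<^sup>2 * (?Y / r\<^sup>2)"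
    unfolding r2[symmetric] using 4 r2 by (simp add: algebra_simps)
  also have "\<dots> / b\<^sup>2 = (r\<^sup>2 * ?X - 2 * a * ?V + a\<^sup>2 / r\<^sup>2 * ?Y) / b\<^sup>2 + ?Y / r\<^sup>2"
    using r20 by (simp add: add_divide_distrib)
  finally have e: "?X + (?Y - 2 * a * ?V + a\<^sup>2 * ?X) / b\<^sup>2 = (r\<^sup>2 * ?X - 2 * a * ?V + a\<^sup>2 / r\<^sup>2 * ?Y) / b\<^sup>2 + ?Y / r\<^sup>2" .
  have half: "- a / 2 + - b / 2 = - c / 2 + - e / 2" if "a + b = c + e" for a b c e :: real using that by linarith
  show ?thesis
    unfolding W_def exp_add[symmetric] 1 2 3 by (intro arg_cong[where f=exp] half e)
qed

end

section \<open>Sums of independent Gaussian vectors\<close>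

lemma component_measurable:
  assumes "i \<in> I" "e < d"
  shows "(\<lambda>X. X i e) \<in> borel_measurable (\<Pi>\<^sub>M i\<in>I. lborel_pow d)"
  using measurable_compose[OF measurable_component_singleton[of i I "\<lambda>_. lborel_pow d"] lborel_pow_component] assms
  by simp

context gauss_form begin

lemma restrict_lincomb_measurable:
  "(\<lambda>p. \<lambda>e\<in>{..<d}. a * fst p e + b * snd p e) \<in> lborel_pow d \<Otimes>\<^sub>M lborel_pow d \<rightarrow>\<^sub>M lborel_pow d"
  by (intro measurable_restrict_lborel_pow borel_measurable_add borel_measurable_times borel_measurable_const
      measurable_compose[OF measurable_fst lborel_pow_component] measurable_compose[OF measurable_snd lborel_pow_component])

text \<open>Substituting the combination for the inner variable and completing the square allows
  \<open>x\<close> to be integrated out first. The Jacobians of the three scalings by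
  \<open>1 / b\<close>, \<open>b / r\<close> and \<open>r\<close> cancel.\<close>

lemma two_stable_lebesgue:
  fixes a b r :: real
  assumes F: "F \<in> borel_measurable (lborel_pow d)"
    and b: "b \<noteq> 0" and r: "0 < r" and r2: "r\<^sup>2 = a\<^sup>2 + b\<^sup>2"
  shows "(\<integral>\<^sup>+x. (\<integral>\<^sup>+y. F (\<lambda>e\<in>{..<d}. a * x e + b * y e) * ennreal (W y) * ennreal (W x) \<partial>lborel_pow d) \<partial>lborel_pow d) =
    Z * (\<integral>\<^sup>+x. F (\<lambda>e\<in>{..<d}. r * x e) * ennreal (W x) \<partial>lborel_pow d)"
proof -
  let ?L = "lborel_pow d"
  note Fab = measurable_compose[OF restrict_lincomb_measurable F]
  have Wm: "(\<lambda>y. ennreal (W (\<lambda>i. s * y i + v i))) \<in> borel_measurable ?L" for s v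
    by (intro measurable_compose[OF _ measurable_ennreal] W_measurable borel_measurable_add borel_measurable_times lborel_pow_component borel_measurable_const)
  have inner: "(\<integral>\<^sup>+y. F (\<lambda>e\<in>{..<d}. a * x e + b * y e) * ennreal (W y) * ennreal (W x) \<partial>?L) =
    (\<integral>\<^sup>+y. ennreal (\<bar>1 / b\<bar> ^ d) * F y * (ennreal (W (\<lambda>i. r / b * x i - a / (r * b) * y i)) * ennreal (W (\<lambda>i. 1 / r * y i))) \<partial>?L)"
    if x: "x \<in> space ?L" for x
  proof -
    have m: "(\<lambda>y. F (\<lambda>e\<in>{..<d}. a * x e + b * y e) * ennreal (W y) * ennreal (W x)) \<in> borel_measurable ?L"
      using measurable_Pair2[OF Fab x, of a b] Wm[of 1 "\<lambda>_. 0"] by simp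
    have m': "(\<lambda>y. F y * (ennreal (W (\<lambda>i. r / b * x i - a / (r * b) * y i)) * ennreal (W (\<lambda>i. 1 / r * y i)))) \<in> borel_measurable ?L"
      using F Wm[of "- (a / (r * b))" "\<lambda>i. r / b * x i"] Wm[of "1 / r" "\<lambda>_. 0"] by (simp add: algebra_simps)
    have "(\<integral>\<^sup>+y. F (\<lambda>e\<in>{..<d}. a * x e + b * y e) * ennreal (W y) * ennreal (W x) \<partial>?L) =
      ennreal (\<bar>1 / b\<bar> ^ d) * (\<integral>\<^sup>+y. F y * (ennreal (W (\<lambda>i. r / b * x i - a / (r * b) * y i)) * ennreal (W (\<lambda>i. 1 / r * y i))) \<partial>?L)"
    proof (subst nn_integral_lborel_pow_affine[OF m, of "1 / b" "\<lambda>i. - (a / b) * x i"])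
      show "1 / b \<noteq> 0" using b by simp
      have "F (\<lambda>e\<in>{..<d}. a * x e + b * (\<lambda>i\<in>{..<d}. 1 / b * y i + - (a / b) * x i) e) * ennreal (W (\<lambda>i\<in>{..<d}. 1 / b * y i + - (a / b) * x i)) * ennreal (W x)
        = F y * (ennreal (W (\<lambda>i. r / b * x i - a / (r * b) * y i)) * ennreal (W (\<lambda>i. 1 / r * y i)))"
        if y: "y \<in> space ?L" for y
      proof -
        have "(\<lambda>e\<in>{..<d}. a * x e + b * (\<lambda>i\<in>{..<d}. 1 / b * y i + - (a / b) * x i) e) = restrict y {..<d}"
          by (rule restrict_ext) (use b in \<open>simp add: algebra_simps\<close>)
        then have 1: "(\<lambda>e\<in>{..<d}. a * x e + b * (\<lambda>i\<in>{..<d}. 1 / b * y i + - (a / b) * x i) e) = y"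
          by (simp only: extensional_restrict_eq[OF y])
        have 2: "W (\<lambda>i. 1 / b * y i + - (a / b) * x i) * W x = W (\<lambda>i. r / b * x i - a / (r * b) * y i) * W (\<lambda>i. 1 / r * y i)"
          using W_complete_square[OF b r r2, of x y] by (simp add: mult.commute)
        show ?thesis unfolding 1 W_restrict mult.assoc
          using 2 by (simp add: ennreal_mult'[symmetric] W_def)
      qed
      then show "ennreal (\<bar>1 / b\<bar> ^ d) * (\<integral>\<^sup>+y. F (\<lambda>e\<in>{..<d}. a * x e + b * (\<lambda>i\<in>{..<d}. 1 / b * y i + - (a / b) * x i) e) * ennreal (W (\<lambda>i\<in>{..<d}. 1 / b * y i + - (a / b) * x i)) * ennreal (W x) \<partial>?L) =
        ennreal (\<bar>1 / b\<bar> ^ d) * (\<integral>\<^sup>+y. F y * (ennreal (W (\<lambda>i. r / b * x i - a / (r * b) * y i)) * ennreal (W (\<lambda>i. 1 / r * y i))) \<partial>?L)"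
        by (intro arg_cong[where f="\<lambda>x. ennreal (\<bar>1 / b\<bar> ^ d) * x"] nn_integral_cong)
    qed
    also have "\<dots> = (\<integral>\<^sup>+y. ennreal (\<bar>1 / b\<bar> ^ d) * F y * (ennreal (W (\<lambda>i. r / b * x i - a / (r * b) * y i)) * ennreal (W (\<lambda>i. 1 / r * y i))) \<partial>?L)"
      unfolding mult.assoc by (rule nn_integral_cmult[OF m', symmetric])
    finally show ?thesis .
  qed
  have gap: "(\<integral>\<^sup>+x. ennreal (W (\<lambda>i. r / b * x i - a / (r * b) * y i)) \<partial>?L) = ennreal (\<bar>b / r\<bar> ^ d) * Z" for y
  proof -
    let ?J = "\<integral>\<^sup>+x. ennreal (W (\<lambda>i. r / b * x i - a / (r * b) * y i)) \<partial>?L"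
    have "Z = ennreal (\<bar>r / b\<bar> ^ d) * ?J"
      unfolding Z_def using b r
      by (subst nn_integral_lborel_pow_affine[where a="r / b" and b="\<lambda>i. - (a / (r * b)) * y i"]) auto
    then have "ennreal (\<bar>b / r\<bar> ^ d) * Z = ennreal (\<bar>b / r\<bar> ^ d * \<bar>r / b\<bar> ^ d) * ?J"
      by (simp add: mult.assoc[symmetric] ennreal_mult'[symmetric])
    also have "\<bar>b / r\<bar> ^ d * \<bar>r / b\<bar> ^ d = 1"
      using b r by (simp add: power_mult_distrib[symmetric] abs_mult[symmetric])
    finally show ?thesis by simp
  qed
  have G: "(\<integral>\<^sup>+y. F y * ennreal (W (\<lambda>i. 1 / r * y i)) \<partial>?L) = ennreal (r ^ d) * (\<integral>\<^sup>+x. F (\<lambda>e\<in>{..<d}. r * x e) * ennreal (W x) \<partial>?L)"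
  proof -
    have m: "(\<lambda>y. F y * ennreal (W (\<lambda>i. 1 / r * y i))) \<in> borel_measurable ?L"
      using F Wm[of "1 / r" "\<lambda>_. 0"] by simp
    have w: "W (\<lambda>i. 1 / r * (\<lambda>i\<in>{..<d}. r * y i + 0) i) = W y" for y
      by (rule W_cong) (use r in simp)
    show ?thesis
      using nn_integral_lborel_pow_affine[OF m, of r "\<lambda>_. 0"] r unfolding w by simp
  qed
  have "(\<integral>\<^sup>+x. (\<integral>\<^sup>+y. F (\<lambda>e\<in>{..<d}. a * x e + b * y e) * ennreal (W y) * ennreal (W x) \<partial>?L) \<partial>?L) =
    (\<integral>\<^sup>+x. (\<integral>\<^sup>+y. ennreal (\<bar>1 / b\<bar> ^ d) * F y * (ennreal (W (\<lambda>i. r / b * x i - a / (r * b) * y i)) * ennreal (W (\<lambda>i. 1 / r * y i))) \<partial>?L) \<partial>?L)"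
    by (rule nn_integral_cong) (rule inner)
  also have "\<dots> = (\<integral>\<^sup>+y. (\<integral>\<^sup>+x. ennreal (\<bar>1 / b\<bar> ^ d) * F y * (ennreal (W (\<lambda>i. r / b * x i - a / (r * b) * y i)) * ennreal (W (\<lambda>i. 1 / r * y i))) \<partial>?L) \<partial>?L)"
  proof (rule lborel_pow_pair.Fubini')
    show "(\<lambda>(y, x). ennreal (\<bar>1 / b\<bar> ^ d) * F y * (ennreal (W (\<lambda>i. r / b * x i - a / (r * b) * y i)) * ennreal (W (\<lambda>i. 1 / r * y i)))) \<in> borel_measurable (?L \<Otimes>\<^sub>M ?L)"
      unfolding split_def
      by (intro borel_measurable_times_ennreal borel_measurable_const measurable_compose[OF measurable_fst F] measurable_compose[OF _ measurable_ennreal] W_measurable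
        borel_measurable_diff borel_measurable_times measurable_compose[OF measurable_fst lborel_pow_component] measurable_compose[OF measurable_snd lborel_pow_component])
  qed
  also have "\<dots> = (\<integral>\<^sup>+y. ennreal (\<bar>1 / b\<bar> ^ d) * ennreal (\<bar>b / r\<bar> ^ d) * Z * (F y * ennreal (W (\<lambda>i. 1 / r * y i))) \<partial>?L)"
  proof (rule nn_integral_cong)
    fix y
    have m: "(\<lambda>x. ennreal (W (\<lambda>i. r / b * x i - a / (r * b) * y i))) \<in> borel_measurable ?L"
      using Wm[of "r / b" "\<lambda>i. - (a / (r * b)) * y i"] by simp
    have "(\<integral>\<^sup>+x. ennreal (\<bar>1 / b\<bar> ^ d) * F y * (ennreal (W (\<lambda>i. r / b * x i - a / (r * b) * y i)) * ennreal (W (\<lambda>i. 1 / r * y i))) \<partial>?L) =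
      (\<integral>\<^sup>+x. (ennreal (\<bar>1 / b\<bar> ^ d) * F y * ennreal (W (\<lambda>i. 1 / r * y i))) * ennreal (W (\<lambda>i. r / b * x i - a / (r * b) * y i)) \<partial>?L)"
      by (simp only: ac_simps)
    also have "\<dots> = (ennreal (\<bar>1 / b\<bar> ^ d) * F y * ennreal (W (\<lambda>i. 1 / r * y i))) * (ennreal (\<bar>b / r\<bar> ^ d) * Z)"
      unfolding gap[of y, symmetric] by (rule nn_integral_cmult[OF m])
    finally show "(\<integral>\<^sup>+x. ennreal (\<bar>1 / b\<bar> ^ d) * F y * (ennreal (W (\<lambda>i. r / b * x i - a / (r * b) * y i)) * ennreal (W (\<lambda>i. 1 / r * y i))) \<partial>?L) =
      ennreal (\<bar>1 / b\<bar> ^ d) * ennreal (\<bar>b / r\<bar> ^ d) * Z * (F y * ennreal (W (\<lambda>i. 1 / r * y i)))"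
      by (simp only: ac_simps)
  qed
  also have "\<dots> = ennreal (\<bar>1 / b\<bar> ^ d) * ennreal (\<bar>b / r\<bar> ^ d) * Z * (\<integral>\<^sup>+y. F y * ennreal (W (\<lambda>i. 1 / r * y i)) \<partial>?L)"
    using F Wm[of "1 / r" "\<lambda>_. 0"] by (intro nn_integral_cmult) simp
  also have "\<dots> = (ennreal (\<bar>1 / b\<bar> ^ d) * ennreal (\<bar>b / r\<bar> ^ d) * ennreal (r ^ d)) * Z * (\<integral>\<^sup>+x. F (\<lambda>e\<in>{..<d}. r * x e) * ennreal (W x) \<partial>?L)"
    unfolding G by (simp only: ac_simps)
  also have "ennreal (\<bar>1 / b\<bar> ^ d) * ennreal (\<bar>b / r\<bar> ^ d) * ennreal (r ^ d) = ennreal ((\<bar>1 / b\<bar> * \<bar>b / r\<bar> * r) ^ d)"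
    by (simp only: power_mult_distrib ennreal_mult' zero_le_power abs_ge_zero mult_nonneg_nonneg)
  also have "\<bar>1 / b\<bar> * \<bar>b / r\<bar> * r = 1" using b r by simp
  finally show ?thesis by (simp only: power_one ennreal_1 mult_1_left)
qed

lemma two_stable:
  assumes F: "F \<in> borel_measurable (lborel_pow d)" and a: "0 \<le> a"
  shows "(\<integral>\<^sup>+x. (\<integral>\<^sup>+y. F (\<lambda>e\<in>{..<d}. a * x e + b * y e) \<partial>D (\<lambda>_. 0)) \<partial>D (\<lambda>_. 0)) =
    (\<integral>\<^sup>+x. F (\<lambda>e\<in>{..<d}. sqrt (a\<^sup>2 + b\<^sup>2) * x e) \<partial>D (\<lambda>_. 0))"
proof (cases "b = 0")
  \<comment> \<open>Division by \<open>b\<close> is impossible here; \<open>0 \<le> a\<close>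
    identifies \<open>sqrt (a^2)\<close> with \<open>a\<close>.\<close>
  case True
  then show ?thesis using a by (simp add: nn_integral_D_const del: nn_integral_const)
next
  case False
  let ?L = "lborel_pow d" and ?r = "sqrt (a\<^sup>2 + b\<^sup>2)"
  have r: "0 < ?r" "?r\<^sup>2 = a\<^sup>2 + b\<^sup>2" using False by (simp_all add: add_nonneg_pos)
  note Fab = measurable_compose[OF restrict_lincomb_measurable F]
  have Fx: "(\<lambda>y. F (\<lambda>e\<in>{..<d}. a * x e + b * y e)) \<in> borel_measurable ?L" if "x \<in> space ?L" for x
    using measurable_Pair2[OF Fab that, of a b] by simp
  have FyW: "(\<lambda>x. \<integral>\<^sup>+y. F (\<lambda>e\<in>{..<d}. a * x e + b * y e) * ennreal (W y) \<partial>?L) \<in> borel_measurable ?L"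
  proof (rule lborel_pow.borel_measurable_nn_integral)
    show "(\<lambda>(x, y). F (\<lambda>e\<in>{..<d}. a * x e + b * y e) * ennreal (W y)) \<in> borel_measurable (?L \<Otimes>\<^sub>M ?L)"
      unfolding split_def
      by (intro borel_measurable_times_ennreal Fab measurable_compose[OF _ measurable_ennreal] measurable_compose[OF measurable_snd W_m])
  qed
  have Fr: "(\<lambda>x. F (\<lambda>e\<in>{..<d}. ?r * x e)) \<in> borel_measurable ?L"
    using measurable_compose[OF restrict_add_measurable F, of ?r "\<lambda>_. 0"] by simp
  have "(\<integral>\<^sup>+x. (\<integral>\<^sup>+y. F (\<lambda>e\<in>{..<d}. a * x e + b * y e) \<partial>D (\<lambda>_. 0)) \<partial>D (\<lambda>_. 0)) =
    (\<integral>\<^sup>+x. (\<integral>\<^sup>+y. F (\<lambda>e\<in>{..<d}. a * x e + b * y e) * ennreal (W y) \<partial>?L) / Z \<partial>D (\<lambda>_. 0))"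
    by (intro nn_integral_cong nn_integral_D0 Fx) simp
  also have "\<dots> = (\<integral>\<^sup>+x. (\<integral>\<^sup>+y. F (\<lambda>e\<in>{..<d}. a * x e + b * y e) * ennreal (W y) \<partial>?L) / Z * ennreal (W x) \<partial>?L) / Z"
    unfolding divide_ennreal_def
    by (rule nn_integral_D0[unfolded divide_ennreal_def]) (intro borel_measurable_times_ennreal FyW borel_measurable_const)
  also have "(\<integral>\<^sup>+x. (\<integral>\<^sup>+y. F (\<lambda>e\<in>{..<d}. a * x e + b * y e) * ennreal (W y) \<partial>?L) / Z * ennreal (W x) \<partial>?L) =
    (\<integral>\<^sup>+x. (\<integral>\<^sup>+y. F (\<lambda>e\<in>{..<d}. a * x e + b * y e) * ennreal (W y) \<partial>?L) * ennreal (W x) / Z \<partial>?L)"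
    by (simp add: divide_ennreal_def ac_simps)
  also have "\<dots> = (\<integral>\<^sup>+x. (\<integral>\<^sup>+y. F (\<lambda>e\<in>{..<d}. a * x e + b * y e) * ennreal (W y) \<partial>?L) * ennreal (W x) \<partial>?L) / Z"
    by (intro nn_integral_divide borel_measurable_times_ennreal FyW measurable_compose[OF W_m measurable_ennreal])
  also have "(\<integral>\<^sup>+x. (\<integral>\<^sup>+y. F (\<lambda>e\<in>{..<d}. a * x e + b * y e) * ennreal (W y) \<partial>?L) * ennreal (W x) \<partial>?L) =
    (\<integral>\<^sup>+x. (\<integral>\<^sup>+y. F (\<lambda>e\<in>{..<d}. a * x e + b * y e) * ennreal (W y) * ennreal (W x) \<partial>?L) \<partial>?L)"
    by (rule nn_integral_cong, rule nn_integral_multc[symmetric], intro borel_measurable_times_ennreal Fx measurable_compose[OF W_m measurable_ennreal])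
  also have "\<dots> = Z * (\<integral>\<^sup>+x. F (\<lambda>e\<in>{..<d}. ?r * x e) * ennreal (W x) \<partial>?L)"
    by (rule two_stable_lebesgue[OF F False r])
  also have "\<dots> / Z / Z = (\<integral>\<^sup>+x. F (\<lambda>e\<in>{..<d}. ?r * x e) * ennreal (W x) \<partial>?L) / Z"
    by (simp add: mult.commute[of Z] ennreal_times_divide[symmetric] Z_div)
  also have "\<dots> = (\<integral>\<^sup>+x. F (\<lambda>e\<in>{..<d}. ?r * x e) \<partial>D (\<lambda>_. 0))"
    by (rule nn_integral_D0[OF Fr, symmetric])
  finally show ?thesis .
qed

lemma lincomb_measurable:
  "(\<lambda>X. \<lambda>e\<in>{..<d}. \<Sum>j<n. w j * X j e) \<in> (\<Pi>\<^sub>M i\<in>{..<n}. lborel_pow d) \<rightarrow>\<^sub>M lborel_pow d"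
  by (intro measurable_restrict_lborel_pow borel_measurable_sum borel_measurable_times borel_measurable_const
      component_measurable)

lemma sets_PiM_D: "sets (\<Pi>\<^sub>M i\<in>I. D \<mu>) = sets (\<Pi>\<^sub>M i\<in>I. lborel_pow d)"
  by (intro sets_PiM_cong) auto

text \<open>Induction on the number of summands, with everything expressed by the centred law: the
  standard deviation grows by \<open>two_stable\<close> and the means simply add up.\<close>

lemma sum_stable:
  fixes w :: "nat \<Rightarrow> real"
  assumes F: "F \<in> borel_measurable (lborel_pow d)"
  shows "(\<integral>\<^sup>+X. F (\<lambda>e\<in>{..<d}. \<Sum>j<n. w j * X j e) \<partial>(\<Pi>\<^sub>M i\<in>{..<n}. D \<mu>)) =
    (\<integral>\<^sup>+x. F (\<lambda>e\<in>{..<d}. sqrt (\<Sum>j<n. (w j)\<^sup>2) * x e + (\<Sum>j<n. w j) * \<mu> e) \<partial>D (\<lambda>_. 0))"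
  using F
proof (induction n arbitrary: F)
  case 0
  interpret product_sigma_finite "\<lambda>_::nat. D \<mu>"
    by (intro product_sigma_finite.intro prob_space_imp_sigma_finite prob_space_D)
  show ?case by (simp add: nn_integral_empty nn_integral_D_const del: nn_integral_const)
next
  case (Suc n)
  interpret product_sigma_finite "\<lambda>_::nat. D \<mu>"
    by (intro product_sigma_finite.intro prob_space_imp_sigma_finite prob_space_D)
  have ins: "{..<Suc n} = insert n {..<n}" by auto
  let ?\<sigma> = "sqrt (\<Sum>j<n. (w j)\<^sup>2)" and ?s = "\<Sum>j<n. w j"
  let ?F' = "\<lambda>v. F (\<lambda>e\<in>{..<d}. v e + (?s + w n) * \<mu> e)"
  have F'm: "?F' \<in> borel_measurable (lborel_pow d)"
    using measurable_compose[OF restrict_add_measurable Suc.prems, of 1 "\<lambda>e. (?s + w n) * \<mu> e"] by (simp only: mult_1_left)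
  define G where "G = (\<lambda>v. \<integral>\<^sup>+y. F (\<lambda>e\<in>{..<d}. v e + w n * y e) \<partial>D \<mu>)"
  have FG: "(\<lambda>p. F (\<lambda>e\<in>{..<d}. fst p e + w n * snd p e)) \<in> borel_measurable (lborel_pow d \<Otimes>\<^sub>M lborel_pow d)"
    using measurable_compose[OF restrict_lincomb_measurable Suc.prems, of 1 "w n"] by (simp only: mult_1_left)
  have Gm: "G \<in> borel_measurable (lborel_pow d)"
    unfolding G_def
    by (rule sigma_finite_measure.borel_measurable_nn_integral[OF prob_space_imp_sigma_finite[OF prob_space_D]]) (use FG in \<open>simp add: split_def measurable_cong_sets[OF sets_pair_measure_cong[OF refl sets_D] refl]\<close>)
  have meas: "(\<lambda>X. F (\<lambda>e\<in>{..<d}. \<Sum>j<Suc n. w j * X j e)) \<in> borel_measurable (\<Pi>\<^sub>M i\<in>insert n {..<n}. D \<mu>)"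
    using measurable_compose[OF lincomb_measurable Suc.prems, of w "Suc n"]
    unfolding ins[symmetric] measurable_cong_sets[OF sets_PiM_D refl] .
  have "(\<integral>\<^sup>+X. F (\<lambda>e\<in>{..<d}. \<Sum>j<Suc n. w j * X j e) \<partial>(\<Pi>\<^sub>M i\<in>{..<Suc n}. D \<mu>)) =
    (\<integral>\<^sup>+X. (\<integral>\<^sup>+y. F (\<lambda>e\<in>{..<d}. \<Sum>j<Suc n. w j * (X(n := y)) j e) \<partial>D \<mu>) \<partial>(\<Pi>\<^sub>M i\<in>{..<n}. D \<mu>))"
    unfolding ins by (rule product_nn_integral_insert[OF _ _ meas[unfolded ins]]) auto
  also have "\<dots> = (\<integral>\<^sup>+X. G (\<lambda>e\<in>{..<d}. \<Sum>j<n. w j * X j e) \<partial>(\<Pi>\<^sub>M i\<in>{..<n}. D \<mu>))"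
    unfolding G_def by (intro nn_integral_cong arg_cong[where f=F] restrict_ext) simp
  also have "\<dots> = (\<integral>\<^sup>+x. G (\<lambda>e\<in>{..<d}. ?\<sigma> * x e + ?s * \<mu> e) \<partial>D (\<lambda>_. 0))"
    by (rule Suc.IH[OF Gm])
  also have "\<dots> = (\<integral>\<^sup>+x. (\<integral>\<^sup>+y. ?F' (\<lambda>e\<in>{..<d}. ?\<sigma> * x e + w n * y e) \<partial>D (\<lambda>_. 0)) \<partial>D (\<lambda>_. 0))"
  proof (rule nn_integral_cong)
    fix x assume "x \<in> space (D (\<lambda>_. 0))"
    let ?v = "\<lambda>e\<in>{..<d}. ?\<sigma> * x e + ?s * \<mu> e"
    have "?v \<in> space (lborel_pow d)" by (simp add: space_lborel_pow)
    from measurable_Pair2[OF FG this]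
    have m: "(\<lambda>y. F (\<lambda>e\<in>{..<d}. ?v e + w n * y e)) \<in> borel_measurable (lborel_pow d)"
      by (simp only: fst_conv snd_conv)
    have "G ?v = (\<integral>\<^sup>+y. F (\<lambda>e\<in>{..<d}. ?v e + w n * (\<lambda>i\<in>{..<d}. y i + \<mu> i) e) \<partial>D (\<lambda>_. 0))"
      unfolding G_def by (rule nn_integral_D_shift[OF m])
    also have "\<dots> = (\<integral>\<^sup>+y. ?F' (\<lambda>e\<in>{..<d}. ?\<sigma> * x e + w n * y e) \<partial>D (\<lambda>_. 0))"
      by (intro nn_integral_cong arg_cong[where f=F] restrict_ext) (simp add: algebra_simps)
    finally show "G ?v = (\<integral>\<^sup>+y. ?F' (\<lambda>e\<in>{..<d}. ?\<sigma> * x e + w n * y e) \<partial>D (\<lambda>_. 0))" .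
  qed
  also have "\<dots> = (\<integral>\<^sup>+x. ?F' (\<lambda>e\<in>{..<d}. sqrt (?\<sigma>\<^sup>2 + (w n)\<^sup>2) * x e) \<partial>D (\<lambda>_. 0))"
    by (rule two_stable[OF F'm]) (simp add: sum_nonneg)
  also have "\<dots> = (\<integral>\<^sup>+x. F (\<lambda>e\<in>{..<d}. sqrt (\<Sum>j<Suc n. (w j)\<^sup>2) * x e + (\<Sum>j<Suc n. w j) * \<mu> e) \<partial>D (\<lambda>_. 0))"
    by (intro nn_integral_cong arg_cong[where f=F] restrict_ext) (simp add: sum_nonneg)
  finally show ?case .
qed

text \<open>Weights of total one return the law of a single sample, which is the accuracy of the
  mechanism; weights of total zero give the centred law of the differences.\<close>

lemma weighted_law:
  fixes w :: "nat \<Rightarrow> real"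
  assumes F: "F \<in> borel_measurable (lborel_pow d)" and w: "(\<Sum>j<n. (w j)\<^sup>2) = 1"
  shows "(\<integral>\<^sup>+X. F (\<lambda>e\<in>{..<d}. \<Sum>j<n. w j * X j e) \<partial>(\<Pi>\<^sub>M i\<in>{..<n}. D \<mu>)) =
    (\<integral>\<^sup>+x. F x \<partial>D (\<lambda>e. (\<Sum>j<n. w j) * \<mu> e))"
  unfolding sum_stable[OF F] w nn_integral_D_shift[OF F] by simp

lemma indep_components:
  assumes "0 < n"
  shows "prob_space.indep_vars (\<Pi>\<^sub>M i\<in>{..<n}. D \<mu>) (\<lambda>_. lborel_pow d) (\<lambda>i X. X i) {..<n::nat}"
proof -
  let ?P = "\<Pi>\<^sub>M i\<in>{..<n}. D \<mu>"
  interpret P: prob_space ?P by (intro prob_space_PiM prob_space_D)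
  have c: "distr ?P (lborel_pow d) (\<lambda>X. X i) = D \<mu>" if "i < n" for i
  proof -
    have "distr ?P (lborel_pow d) (\<lambda>X. X i) = distr ?P (D \<mu>) (\<lambda>X. X i)"
      by (rule distr_cong) auto
    also have "\<dots> = D \<mu>" by (rule distr_PiM_component) (use that prob_space_D in auto)
    finally show ?thesis .
  qed
  have "distr ?P (\<Pi>\<^sub>M i\<in>{..<n}. lborel_pow d) (\<lambda>X. \<lambda>i\<in>{..<n}. X i) = distr ?P ?P (\<lambda>X. X)"
  proof (rule distr_cong)
    show "sets (\<Pi>\<^sub>M i\<in>{..<n}. lborel_pow d) = sets ?P" by (rule sets_PiM_D[symmetric])
    show "(\<lambda>i\<in>{..<n}. X i) = X" if "X \<in> space ?P" for X
      using that by (auto simp: space_PiM PiE_def extensional_def fun_eq_iff)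
  qed simp
  also have "\<dots> = ?P" by (rule distr_id)
  also have "\<dots> = (\<Pi>\<^sub>M i\<in>{..<n}. distr ?P (lborel_pow d) (\<lambda>X. X i))"
    by (rule PiM_cong) (auto simp: c)
  finally show ?thesis
    using assms by (subst P.indep_vars_iff_distr_eq_PiM')
      (auto simp: measurable_cong_sets[OF sets_PiM_D refl])
qed

lemma pair_diff_law:
  assumes F: "F \<in> borel_measurable (lborel_pow d)" and j: "N + 2 * j + 1 < n"
  shows "(\<integral>\<^sup>+X. F (\<lambda>e\<in>{..<d}. pair_diff N X j e) \<partial>(\<Pi>\<^sub>M i\<in>{..<n}. D \<mu>)) = (\<integral>\<^sup>+x. F x \<partial>D (\<lambda>_. 0))"
proof -
  define w where "w i = (if i = N + 2 * j then 1 / sqrt 2 else if i = N + 2 * j + 1 then - 1 / sqrt 2 else 0)" for i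
  let ?A = "{N + 2 * j, N + 2 * j + 1}"
  have s: "(\<Sum>i<n. f i) = (\<Sum>i\<in>?A. f i)" if "\<And>i. w i = 0 \<Longrightarrow> f i = 0" for f :: "nat \<Rightarrow> real"
    by (rule sum.mono_neutral_right) (use j that in \<open>auto simp: w_def\<close>)
  have w0: "(\<Sum>i<n. w i) = 0" by (subst s) (simp_all add: w_def)
  have w1: "(\<Sum>i<n. (w i)\<^sup>2) = 1" by (subst s) (simp_all add: w_def power_divide)
  have wx: "(\<Sum>i<n. w i * X i e) = pair_diff N X j e" for X :: "nat \<Rightarrow> nat \<Rightarrow> real" and e
    by (subst s) (simp_all add: w_def pair_diff_def diff_divide_distrib)
  show ?thesis using weighted_law[OF F w1, of \<mu>] unfolding wx w0 by simp
qed

text \<open>Different rows use disjoint pairs of samples. They are therefore independent, and the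
  integral of the product factorises.\<close>

lemma pair_diff_prod:
  assumes \<phi>: "\<phi> \<in> borel_measurable (lborel_pow d)" and n: "N + 2 * M \<le> n" "0 < n"
  shows "(\<integral>\<^sup>+X. (\<Prod>j<M. \<phi> (\<lambda>e\<in>{..<d}. pair_diff N X j e)) \<partial>(\<Pi>\<^sub>M i\<in>{..<n}. D \<mu>)) = (\<integral>\<^sup>+x. \<phi> x \<partial>D (\<lambda>_. 0)) ^ M"
proof -
  let ?P = "\<Pi>\<^sub>M i\<in>{..<n}. D \<mu>"
  interpret P: prob_space ?P by (intro prob_space_PiM prob_space_D)
  let ?K = "\<lambda>j. {N + 2 * j, N + 2 * j + 1}"
  have i1: "P.indep_vars (\<lambda>j. \<Pi>\<^sub>M i\<in>?K j. lborel_pow d) (\<lambda>j X. restrict (\<lambda>i. X i) (?K j)) {..<M}"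
    by (rule P.indep_vars_restrict[OF indep_components[OF n(2)]]) (use n in \<open>auto simp: disjoint_family_on_def\<close>)
  let ?Y = "\<lambda>j x. \<phi> (\<lambda>e\<in>{..<d}. pair_diff N x j e)"
  have Ym: "?Y j \<in> borel_measurable (\<Pi>\<^sub>M i\<in>?K j. lborel_pow d)" for j
    unfolding pair_diff_def
    by (rule measurable_compose[OF _ \<phi>], intro measurable_restrict_lborel_pow borel_measurable_divide borel_measurable_diff borel_measurable_const
       component_measurable) auto
  have i2: "P.indep_vars (\<lambda>_. borel) (\<lambda>j X. ?Y j (restrict (\<lambda>i. X i) (?K j))) {..<M}"
    by (rule P.indep_vars_compose2[OF i1 Ym])
  have Yr: "?Y j (restrict (\<lambda>i. X i) (?K j)) = ?Y j X" for j X
    by (simp add: pair_diff_def)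
  have "(\<integral>\<^sup>+X. (\<Prod>j<M. ?Y j X) \<partial>?P) = (\<Prod>j<M. \<integral>\<^sup>+X. ?Y j X \<partial>?P)"
    using P.indep_vars_nn_integral[OF _ i2] unfolding Yr by simp
  also have "\<dots> = (\<Prod>j<M. \<integral>\<^sup>+x. \<phi> x \<partial>D (\<lambda>_. 0))"
    by (intro prod.cong refl pair_diff_law[OF \<phi>]) (use n in auto)
  finally show ?thesis by simp
qed

end

section \<open>A lower eigenvalue bound\<close>

text \<open>The power of the square root compensates the bound of \<open>exp_neg_square_le\<close>
  for \<open>N\<close> independent rows, so that each fixed \<open>\<theta>\<close> gives a weight
  of mean at most one. An unusually small quadratic form makes the weight large.\<close>

definition pb_weight :: "nat \<Rightarrow> nat \<Rightarrow> (nat \<Rightarrow> nat \<Rightarrow> real) \<Rightarrow> (nat \<Rightarrow> real) \<Rightarrow> real" where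
  "pb_weight d N y \<theta> = exp (- (\<Sum>j<N. (ip d \<theta> (y j))\<^sup>2)) * sqrt (1 + 2 * ip d \<theta> \<theta>) ^ N"

text \<open>The weights are mixed over a Gaussian prior of scale \<open>r\<close>. The mean stays at
  most one, while a single value of the mixture controls all directions at once.\<close>

definition pb_integral :: "nat \<Rightarrow> nat \<Rightarrow> real \<Rightarrow> (nat \<Rightarrow> nat \<Rightarrow> real) \<Rightarrow> ennreal" where
  "pb_integral d N r y = (\<integral>\<^sup>+h. ennreal (pb_weight d N y (\<lambda>i. r * h i)) \<partial>std_gauss d)"

lemma pb_weight_measurable:
  assumes "\<And>i. i < d \<Longrightarrow> (\<lambda>x. \<theta> x i) \<in> borel_measurable M" "\<And>j i. j < N \<Longrightarrow> i < d \<Longrightarrow> (\<lambda>x. y x j i) \<in> borel_measurable M"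
  shows "(\<lambda>x. pb_weight d N (y x) (\<theta> x)) \<in> borel_measurable M"
proof -
  have 1: "(\<lambda>x. \<Sum>j<N. (ip d (\<theta> x) (y x j))\<^sup>2) \<in> borel_measurable M"
    by (intro borel_measurable_sum borel_measurable_power ip_measurable assms) auto
  have 2: "(\<lambda>x. ip d (\<theta> x) (\<theta> x)) \<in> borel_measurable M" by (intro ip_measurable assms)
  note [measurable] = 1 2
  show ?thesis unfolding pb_weight_def by measurable
qed

lemma pb_weight_cong:
  "(\<And>i. i < d \<Longrightarrow> \<theta> i = \<theta>' i) \<Longrightarrow> pb_weight d N y \<theta> = pb_weight d N y \<theta>'"
proof -
  assume e: "\<And>i. i < d \<Longrightarrow> \<theta> i = \<theta>' i"
  have "ip d \<theta> x = ip d \<theta>' x" for x by (rule ip_cong) (simp_all add: e)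
  moreover have "ip d \<theta> \<theta> = ip d \<theta>' \<theta>'" by (rule ip_cong) (simp_all add: e)
  ultimately show ?thesis by (simp add: pb_weight_def)
qed

section \<open>Gaussian averages of quadratic functions\<close>

lemma square_le_exp: "x\<^sup>2 \<le> 4 * (exp x + exp (- x))" for x :: real
proof -
  have "\<bar>x\<bar> / 2 \<le> exp (\<bar>x\<bar> / 2)" using exp_ge_add_one_self[of "\<bar>x\<bar> / 2"] by linarith
  then have "(\<bar>x\<bar> / 2)\<^sup>2 \<le> (exp (\<bar>x\<bar> / 2))\<^sup>2" by (rule power_mono) simp
  also have "(exp (\<bar>x\<bar> / 2))\<^sup>2 = exp \<bar>x\<bar>" by (simp add: power2_eq_square exp_add[symmetric])
  also have "exp \<bar>x\<bar> \<le> exp x + exp (- x)" by (cases "0 \<le> x") auto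
  finally show ?thesis by (simp add: power_divide)
qed

lemma exp_half_le_2: "exp (1/2 :: real) \<le> 2"
proof -
  have "exp (1/2::real) \<le> 1 + 1/2 + (1/2)\<^sup>2" by (rule exp_bound) auto
  then show ?thesis by (simp add: power2_eq_square)
qed

text \<open>The square is dominated by two exponentials of linear functionals, whose moments are
  known; scaling by \<open>B\<close> keeps the resulting exponents at most \<open>1/2\<close>. The
  constant \<open>16\<close> is crude.\<close>

lemma std_gauss_second_moment:
  assumes B: "0 < B" and y: "ip d y y \<le> B\<^sup>2"
  shows "(\<integral>\<^sup>+h. ennreal ((ip d h y)\<^sup>2) \<partial>std_gauss d) \<le> ennreal (16 * B\<^sup>2)"
proof -
  let ?c = "\<lambda>i. 1 / B * y i" and ?c' = "\<lambda>i. - 1 / B * y i"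
  have c: "ip d ?c h = ip d h y / B" "ip d ?c' h = - (ip d h y / B)" for h
    unfolding ip_scale_left by (simp_all add: ip_commute[of d y h])
  have m[measurable]: "(\<lambda>h. ip d v h) \<in> borel_measurable (std_gauss d)" for v
    unfolding measurable_cong_sets[OF sets_std_gauss refl]
    by (intro ip_measurable lborel_pow_component borel_measurable_const)
  have "(\<integral>\<^sup>+h. ennreal ((ip d h y)\<^sup>2) \<partial>std_gauss d) \<le> (\<integral>\<^sup>+h. ennreal (4 * B\<^sup>2) * (ennreal (exp (ip d ?c h)) + ennreal (exp (ip d ?c' h))) \<partial>std_gauss d)"
  proof (rule nn_integral_mono)
    fix h
    have "(ip d h y)\<^sup>2 = B\<^sup>2 * (ip d h y / B)\<^sup>2" using B by (simp add: power_divide)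
    also have "\<dots> \<le> B\<^sup>2 * (4 * (exp (ip d h y / B) + exp (- (ip d h y / B))))"
      by (intro mult_left_mono square_le_exp) simp
    also have "\<dots> = 4 * B\<^sup>2 * (exp (ip d h y / B) + exp (- (ip d h y / B)))" by simp
    finally have "ennreal ((ip d h y)\<^sup>2) \<le> ennreal (4 * B\<^sup>2 * (exp (ip d h y / B) + exp (- (ip d h y / B))))"
      by (rule ennreal_leI)
    also have "\<dots> = ennreal (4 * B\<^sup>2) * ennreal (exp (ip d h y / B) + exp (- (ip d h y / B)))"
      by (rule ennreal_mult') simp
    also have "ennreal (exp (ip d h y / B) + exp (- (ip d h y / B))) = ennreal (exp (ip d h y / B)) + ennreal (exp (- (ip d h y / B)))"
      by (rule ennreal_plus) simp_all
    finally show "ennreal ((ip d h y)\<^sup>2) \<le> ennreal (4 * B\<^sup>2) * (ennreal (exp (ip d ?c h)) + ennreal (exp (ip d ?c' h)))"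
      unfolding c .
  qed
  also have "\<dots> = ennreal (4 * B\<^sup>2) * ((\<integral>\<^sup>+h. ennreal (exp (ip d ?c h)) \<partial>std_gauss d) + (\<integral>\<^sup>+h. ennreal (exp (ip d ?c' h)) \<partial>std_gauss d))"
    by (subst nn_integral_cmult, measurable, subst nn_integral_add, measurable)
  also have "\<dots> = ennreal (4 * B\<^sup>2) * (ennreal (exp (ip d ?c ?c / 2)) + ennreal (exp (ip d ?c' ?c' / 2)))"
    unfolding std_gauss_exp_linear ..
  also have "\<dots> \<le> ennreal (4 * B\<^sup>2) * (ennreal 2 + ennreal 2)"
  proof (intro mult_left_mono add_mono ennreal_leI)
    have "(1 / B)\<^sup>2 * ip d y y \<le> (1 / B)\<^sup>2 * B\<^sup>2" by (rule mult_left_mono[OF y]) simp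
    then have q: "(1 / B)\<^sup>2 * ip d y y \<le> 1" using B by (simp add: power_divide)
    then have "exp ((1 / B)\<^sup>2 * ip d y y / 2) \<le> exp (1/2)" by simp
    then show "exp (ip d ?c ?c / 2) \<le> 2" unfolding ip_scale using exp_half_le_2 by linarith
    have "exp ((- 1 / B)\<^sup>2 * ip d y y / 2) \<le> exp (1/2)" using q by simp
    then show "exp (ip d ?c' ?c' / 2) \<le> 2" unfolding ip_scale using exp_half_le_2 by linarith
  qed auto
  also have "\<dots> = ennreal (4 * B\<^sup>2 * (2 + 2))"
    by (subst ennreal_plus[symmetric], simp_all only: ennreal_mult'[symmetric] zero_le_numeral add_nonneg_nonneg)
       (subst ennreal_mult'[symmetric], simp_all)
  also have "4 * B\<^sup>2 * (2 + 2) = 16 * B\<^sup>2" by simp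
  finally show ?thesis .
qed

text \<open>The mean of the quadratic form is at most \<open>16 * N * B^2\<close>, so by Markov it
  is at most twice that with probability at least one half. The integrand is kept only on that
  event.\<close>

lemma std_gauss_exp_quadratic_lower:
  assumes B: "0 < B" and y: "\<And>j. j < N \<Longrightarrow> ip d (y j) (y j) \<le> B\<^sup>2"
  shows "ennreal (1/2 * exp (- r\<^sup>2 * (32 * real N * B\<^sup>2))) \<le> (\<integral>\<^sup>+h. ennreal (exp (- r\<^sup>2 * (\<Sum>j<N. (ip d h (y j))\<^sup>2))) \<partial>std_gauss d)"
proof (cases "N = 0")
  case True
  have "ennreal (1/2) \<le> ennreal 1" by (rule ennreal_leI) simp
  then show ?thesis using True by (simp add: std_gauss.emeasure_space_1[unfolded space_std_gauss])
next
  case False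
  let ?Q = "\<lambda>h. \<Sum>j<N. (ip d h (y j))\<^sup>2" and ?K = "32 * real N * B\<^sup>2"
  have K: "0 < ?K" using False B by simp
  have m[measurable]: "(\<lambda>h. ip d h v) \<in> borel_measurable (std_gauss d)" for v
    unfolding measurable_cong_sets[OF sets_std_gauss refl]
    by (intro ip_measurable lborel_pow_component borel_measurable_const)
  have "(\<integral>\<^sup>+h. ennreal (?Q h) \<partial>std_gauss d) = (\<Sum>j<N. \<integral>\<^sup>+h. ennreal ((ip d h (y j))\<^sup>2) \<partial>std_gauss d)"
    by (subst nn_integral_sum[symmetric]) (auto simp: sum_ennreal)
  also have "\<dots> \<le> (\<Sum>j<N. ennreal (16 * B\<^sup>2))"
    by (intro sum_mono std_gauss_second_moment B y) auto
  also have "\<dots> = ennreal (?K / 2)" by (simp add: ennreal_of_nat_eq_real_of_nat ennreal_mult'[symmetric])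
  finally have EQ: "(\<integral>\<^sup>+h. ennreal (?Q h) \<partial>std_gauss d) \<le> ennreal (?K / 2)" .
  have "(\<integral>\<^sup>+h. (if ?K < ?Q h then 1 else 0) \<partial>std_gauss d) \<le> ennreal (1 / ?K) * (\<integral>\<^sup>+h. ennreal (?Q h) \<partial>std_gauss d)"
  proof (rule nn_integral_indicator_le[OF _ _ refl])
    fix h assume "?K < ?Q h"
    then have "1 \<le> 1 / ?K * ?Q h" using K by (simp add: field_simps)
    then show "1 \<le> ennreal (1 / ?K) * ennreal (?Q h)"
      using K by (simp add: ennreal_mult'[symmetric])
  qed measurable
  also have "\<dots> \<le> ennreal (1 / ?K) * ennreal (?K / 2)" by (intro mult_left_mono EQ) simp
  also have "\<dots> = ennreal (1/2)" using K False B by (simp add: ennreal_mult'[symmetric])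
  finally have bad: "(\<integral>\<^sup>+h. (if ?K < ?Q h then 1 else 0) \<partial>std_gauss d) \<le> ennreal (1/2)" .
  have one: "1 = (\<integral>\<^sup>+h. (if ?K < ?Q h then 1 else 0) \<partial>std_gauss d) + (\<integral>\<^sup>+h. (if ?K < ?Q h then 0 else 1) \<partial>std_gauss d)"
  proof -
    have "1 = (\<integral>\<^sup>+h. 1 \<partial>std_gauss d)" by (simp only: nn_integral_const std_gauss.emeasure_space_1 mult_1_right)
    also have "\<dots> = (\<integral>\<^sup>+h. (if ?K < ?Q h then 1 else 0) + (if ?K < ?Q h then 0 else 1) \<partial>std_gauss d)"
      by (intro nn_integral_cong) simp
    also have "\<dots> = (\<integral>\<^sup>+h. (if ?K < ?Q h then 1 else 0) \<partial>std_gauss d) + (\<integral>\<^sup>+h. (if ?K < ?Q h then 0 else 1) \<partial>std_gauss d)"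
      by (rule nn_integral_add) measurable
    finally show ?thesis .
  qed
  have good: "ennreal (1/2) \<le> (\<integral>\<^sup>+h. (if ?K < ?Q h then 0 else 1) \<partial>std_gauss d)"
  proof -
    have "ennreal (1/2) + ennreal (1/2) = 1" by (subst ennreal_plus[symmetric]) simp_all
    also have "\<dots> \<le> ennreal (1/2) + (\<integral>\<^sup>+h. (if ?K < ?Q h then 0 else 1) \<partial>std_gauss d)"
      by (subst one) (rule add_right_mono[OF bad])
    finally show ?thesis by (subst (asm) ennreal_add_left_cancel_le) auto
  qed
  have "ennreal (1/2 * exp (- r\<^sup>2 * ?K)) = ennreal (exp (- r\<^sup>2 * ?K)) * ennreal (1/2)"
    by (subst ennreal_mult'[symmetric]) (simp_all add: mult.commute)
  also have "\<dots> \<le> ennreal (exp (- r\<^sup>2 * ?K)) * (\<integral>\<^sup>+h. (if ?K < ?Q h then 0 else 1) \<partial>std_gauss d)"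
    by (intro mult_left_mono good) simp
  also have "\<dots> = (\<integral>\<^sup>+h. ennreal (exp (- r\<^sup>2 * ?K)) * (if ?K < ?Q h then 0 else 1) \<partial>std_gauss d)"
    by (rule nn_integral_cmult[symmetric]) measurable
  also have "\<dots> \<le> (\<integral>\<^sup>+h. ennreal (exp (- r\<^sup>2 * ?Q h)) \<partial>std_gauss d)"
    by (intro nn_integral_mono) (auto simp: not_less intro!: ennreal_leI mult_left_mono)
  finally show ?thesis .
qed

text \<open>The Cameron-Martin formula in finite dimension, by translating the density.\<close>

lemma std_gauss_shift:
  assumes f: "f \<in> borel_measurable (lborel_pow d)"
  shows "(\<integral>\<^sup>+h. f h \<partial>std_gauss d) = (\<integral>\<^sup>+h. f (\<lambda>i\<in>{..<d}. h i + v i) * ennreal (exp (- ip d v h - ip d v v / 2)) \<partial>std_gauss d)"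
proof -
  have fm: "(\<lambda>h. f (\<lambda>i\<in>{..<d}. h i + v i)) \<in> borel_measurable (lborel_pow d)"
    using measurable_compose[OF measurable_lborel_pow_affine f, of 1 v] by (simp only: mult_1_left)
  have em: "(\<lambda>h. ennreal (exp (- ip d v h - ip d v v / 2))) \<in> borel_measurable (lborel_pow d)"
  proof -
    have [measurable]: "(\<lambda>h. ip d v h) \<in> borel_measurable (lborel_pow d)"
      by (intro ip_measurable lborel_pow_component borel_measurable_const)
    show ?thesis by measurable
  qed
  have g: "gauss_density d (\<lambda>i. h i + v i) = exp (- ip d v h - ip d v v / 2) * gauss_density d h" for h
  proof -
    have "exp (- ip d (\<lambda>i. h i + v i) (\<lambda>i. h i + v i) / 2) = exp (- ip d v h - ip d v v / 2) * exp (- ip d h h / 2)"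
      unfolding exp_add[symmetric] ip_add_left ip_add_right ip_commute[of d h v] by (simp add: field_simps)
    then show ?thesis unfolding gauss_density_eq by simp
  qed
  have "(\<integral>\<^sup>+h. f h \<partial>std_gauss d) = (\<integral>\<^sup>+h. f (\<lambda>i\<in>{..<d}. h i + v i) * ennreal (gauss_density d (\<lambda>i\<in>{..<d}. h i + v i)) \<partial>lborel_pow d)"
    unfolding nn_integral_std_gauss[OF f]
    by (rule nn_integral_lborel_pow_translate[symmetric]) (intro borel_measurable_times_ennreal f measurable_compose[OF gauss_density_measurable' measurable_ennreal])
  also have "\<dots> = (\<integral>\<^sup>+h. f (\<lambda>i\<in>{..<d}. h i + v i) * ennreal (exp (- ip d v h - ip d v v / 2)) * ennreal (gauss_density d h) \<partial>lborel_pow d)"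
    by (intro nn_integral_cong) (simp only: gauss_density_restrict g ennreal_mult' exp_ge_zero mult.assoc)
  also have "\<dots> = (\<integral>\<^sup>+h. f (\<lambda>i\<in>{..<d}. h i + v i) * ennreal (exp (- ip d v h - ip d v v / 2)) \<partial>std_gauss d)"
    by (rule nn_integral_std_gauss[symmetric]) (intro borel_measurable_times_ennreal fm em)
  finally show ?thesis .
qed

lemma std_gauss_neg:
  assumes f: "f \<in> borel_measurable (lborel_pow d)"
  shows "(\<integral>\<^sup>+h. f h \<partial>std_gauss d) = (\<integral>\<^sup>+h. f (\<lambda>i\<in>{..<d}. - h i) \<partial>std_gauss d)"
proof -
  have fm: "(\<lambda>h. f (\<lambda>i\<in>{..<d}. - h i)) \<in> borel_measurable (lborel_pow d)"
    using measurable_compose[OF measurable_lborel_pow_affine f, of "-1" "\<lambda>_. 0"] by (simp only: mult_minus1 add_0_right)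
  have g: "gauss_density d (\<lambda>i. - h i) = gauss_density d h" for h
    by (simp add: gauss_density_eq ip_def)
  have m: "(\<lambda>h. f h * ennreal (gauss_density d h)) \<in> borel_measurable (lborel_pow d)"
    by (intro borel_measurable_times_ennreal f measurable_compose[OF gauss_density_measurable' measurable_ennreal])
  have "(\<integral>\<^sup>+h. f h \<partial>std_gauss d) = (\<integral>\<^sup>+h. f (\<lambda>i\<in>{..<d}. - 1 * h i + 0) * ennreal (gauss_density d (\<lambda>i\<in>{..<d}. - 1 * h i + 0)) \<partial>lborel_pow d)"
    unfolding nn_integral_std_gauss[OF f]
    using nn_integral_lborel_pow_affine[OF m, of "-1" "\<lambda>_. 0"]
    by (simp only: abs_minus_cancel abs_one power_one ennreal_1 mult_1_left neg_equal_0_iff_equal one_neq_zero not_False_eq_True)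
  also have "\<dots> = (\<integral>\<^sup>+h. f (\<lambda>i\<in>{..<d}. - h i) * ennreal (gauss_density d h) \<partial>lborel_pow d)"
    by (simp only: mult_minus1 add_0_right gauss_density_restrict g)
  also have "\<dots> = (\<integral>\<^sup>+h. f (\<lambda>i\<in>{..<d}. - h i) \<partial>std_gauss d)"
    by (rule nn_integral_std_gauss[OF fm, symmetric])
  finally show ?thesis .
qed

text \<open>
  A change of measure centres the smoothing distribution at the unit vector \<open>\<theta>\<close>; averaging over
  \<open>h\<close> and \<open>- h\<close> by the inequality of the means removes all terms that are linear in \<open>h\<close>.
\<close>

lemma pb_integral_lower:
  assumes r: "0 < r" and B: "0 < B" and y: "\<And>j. j < N \<Longrightarrow> ip d (y j) (y j) \<le> B\<^sup>2" and \<theta>: "ip d \<theta> \<theta> = 1"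
  shows "ennreal (exp (- 1 / (2 * r\<^sup>2) - (\<Sum>j<N. (ip d \<theta> (y j))\<^sup>2)) * sqrt 2 ^ N * (1/2 * exp (- r\<^sup>2 * (32 * real N * B\<^sup>2))))
    \<le> pb_integral d N r y"
proof -
  \<comment> \<open>With this shift \<open>r * (h + v)\<close> becomes
    \<open>\<theta> + r * h\<close>. The cost in the exponent is
    \<open>ip d v v / 2 = 1 / (2 * r^2)\<close>.\<close>
  define v where "v = (\<lambda>i. 1 / r * \<theta> i)"
  have vv: "ip d v v = 1 / r\<^sup>2" unfolding v_def ip_scale \<theta> by (simp add: power_divide)
  define f where "f = (\<lambda>h. pb_weight d N y (\<lambda>i. \<theta> i + r * h i) * exp (- ip d v h - ip d v v / 2))"
  have fm: "(\<lambda>h. ennreal (f h)) \<in> borel_measurable (lborel_pow d)"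
    unfolding f_def
    by (intro measurable_compose[OF _ measurable_ennreal] borel_measurable_times pb_weight_measurable borel_measurable_add borel_measurable_const lborel_pow_component
       measurable_compose[OF _ borel_measurable_exp] borel_measurable_diff borel_measurable_uminus ip_measurable)
  have fm': "(\<lambda>h. ennreal (f (\<lambda>i\<in>{..<d}. - h i))) \<in> borel_measurable (lborel_pow d)"
    using measurable_compose[OF measurable_lborel_pow_affine fm, of "-1" "\<lambda>_. 0"] by (simp only: mult_minus1 add_0_right)
  have f0: "0 \<le> f h" for h by (simp add: f_def pb_weight_def)
  have pm: "(\<lambda>h. ennreal (pb_weight d N y (\<lambda>i. r * h i))) \<in> borel_measurable (lborel_pow d)"
    by (intro measurable_compose[OF _ measurable_ennreal] borel_measurable_times pb_weight_measurable borel_measurable_const lborel_pow_component)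
  have I: "pb_integral d N r y = (\<integral>\<^sup>+h. ennreal (f h) \<partial>std_gauss d)"
    unfolding pb_integral_def std_gauss_shift[OF pm, of v]
  proof (rule nn_integral_cong)
    fix h
    have "pb_weight d N y (\<lambda>i. r * (\<lambda>i\<in>{..<d}. h i + v i) i) = pb_weight d N y (\<lambda>i. \<theta> i + r * h i)"
      by (rule pb_weight_cong) (use r in \<open>simp add: v_def field_simps\<close>)
    then show "ennreal (pb_weight d N y (\<lambda>i. r * (\<lambda>i\<in>{..<d}. h i + v i) i)) * ennreal (exp (- ip d v h - ip d v v / 2)) = ennreal (f h)"
      by (simp add: f_def ennreal_mult' pb_weight_def)
  qed
  let ?A = "\<Sum>j<N. (ip d \<theta> (y j))\<^sup>2" and ?Q = "\<lambda>h. \<Sum>j<N. (ip d h (y j))\<^sup>2"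
  let ?c = "exp (- 1 / (2 * r\<^sup>2) - ?A) * sqrt 2 ^ N"
  have pt: "2 * (?c * exp (- r\<^sup>2 * ?Q h)) \<le> f h + f (\<lambda>i\<in>{..<d}. - h i)" for h
  proof -
    let ?p = "\<lambda>i. \<theta> i + r * h i" and ?m = "\<lambda>i. \<theta> i + r * - h i"
    have m: "f (\<lambda>i\<in>{..<d}. - h i) = pb_weight d N y ?m * exp (ip d v h - ip d v v / 2)"
    proof -
      have "pb_weight d N y (\<lambda>i. \<theta> i + r * (\<lambda>i\<in>{..<d}. - h i) i) = pb_weight d N y ?m"
        by (rule pb_weight_cong) simp
      moreover have "ip d v (\<lambda>i. - h i) = - ip d v h" by (simp add: ip_def sum_negf)
      ultimately show ?thesis by (simp add: f_def)
    qed
    have e1: "(ip d ?p x)\<^sup>2 + (ip d ?m x)\<^sup>2 = 2 * (ip d \<theta> x)\<^sup>2 + 2 * r\<^sup>2 * (ip d h x)\<^sup>2" for x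
    proof -
      have "ip d ?p x = ip d \<theta> x + r * ip d h x" by (simp only: ip_add_left ip_scale_left)
      moreover have "ip d ?m x = ip d \<theta> x - r * ip d h x"
        by (simp add: ip_def sum.distrib sum_subtractf sum_distrib_left algebra_simps)
      ultimately have "(ip d ?p x)\<^sup>2 + (ip d ?m x)\<^sup>2 = (ip d \<theta> x + r * ip d h x)\<^sup>2 + (ip d \<theta> x - r * ip d h x)\<^sup>2" by (simp only:)
      then show ?thesis by (simp add: power2_eq_square algebra_simps)
    qed
    then have e2: "(\<Sum>j<N. (ip d ?p (y j))\<^sup>2) + (\<Sum>j<N. (ip d ?m (y j))\<^sup>2) = 2 * ?A + 2 * r\<^sup>2 * ?Q h"
      by (simp add: sum.distrib[symmetric] sum_distrib_left)
    let ?u = "ip d ?p ?p" and ?w = "ip d ?m ?m"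
    have uw: "2 \<le> ?u + ?w"
    proof -
      have "?u + ?w = 2 * ip d \<theta> \<theta> + 2 * r\<^sup>2 * ip d h h"
        by (simp add: ip_def sum.distrib[symmetric] sum_distrib_left power2_eq_square algebra_simps)
      then show ?thesis using \<theta> by simp
    qed
    have u0: "0 \<le> ?u" "0 \<le> ?w" by simp_all
    \<comment> \<open>The two squared norms have sum at least two, but one of them may be small, so
      only the product is bounded:
      \<open>(1 + 2 * a) * (1 + 2 * b) \<ge> 1 + 2 * (a + b) \<ge> 4\<close>.\<close>
    have "2\<^sup>2 \<le> (1 + 2 * ?u) * (1 + 2 * ?w)"
    proof -
      have "2\<^sup>2 \<le> (1 + 2 * a) * (1 + 2 * b)" if "2 \<le> a + b" "0 \<le> a" "0 \<le> b" for a b :: real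
        using that(1) mult_nonneg_nonneg[OF that(2,3)] by (simp add: algebra_simps)
      then show ?thesis using uw u0 .
    qed
    then have "2 \<le> sqrt ((1 + 2 * ?u) * (1 + 2 * ?w))" by (rule real_le_rsqrt)
    then have "2 ^ N \<le> sqrt ((1 + 2 * ?u) * (1 + 2 * ?w)) ^ N" by (intro power_mono) auto
    also have "\<dots> = sqrt (1 + 2 * ?u) ^ N * sqrt (1 + 2 * ?w) ^ N" by (simp add: real_sqrt_mult power_mult_distrib)
    finally have q: "2 ^ N \<le> sqrt (1 + 2 * ?u) ^ N * sqrt (1 + 2 * ?w) ^ N" .
    have "f h * f (\<lambda>i\<in>{..<d}. - h i) =
      exp (- (\<Sum>j<N. (ip d ?p (y j))\<^sup>2) + (- (\<Sum>j<N. (ip d ?m (y j))\<^sup>2)) + (- ip d v h - ip d v v / 2) + (ip d v h - ip d v v / 2)) * (sqrt (1 + 2 * ?u) ^ N * sqrt (1 + 2 * ?w) ^ N)"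
      unfolding m unfolding f_def pb_weight_def exp_add by simp
    also have "- (\<Sum>j<N. (ip d ?p (y j))\<^sup>2) + (- (\<Sum>j<N. (ip d ?m (y j))\<^sup>2)) + (- ip d v h - ip d v v / 2) + (ip d v h - ip d v v / 2) =
      2 * (- 1 / (2 * r\<^sup>2) - ?A - r\<^sup>2 * ?Q h)"
      using e2 vv by simp
    also have "exp (2 * (- 1 / (2 * r\<^sup>2) - ?A - r\<^sup>2 * ?Q h)) = (exp (- 1 / (2 * r\<^sup>2) - ?A) * exp (- r\<^sup>2 * ?Q h))\<^sup>2"
      unfolding power2_eq_square exp_add[symmetric] by simp
    finally have ff: "f h * f (\<lambda>i\<in>{..<d}. - h i) = (exp (- 1 / (2 * r\<^sup>2) - ?A) * exp (- r\<^sup>2 * ?Q h))\<^sup>2 * (sqrt (1 + 2 * ?u) ^ N * sqrt (1 + 2 * ?w) ^ N)" .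
    define E where "E = exp (- 1 / (2 * r\<^sup>2) - ?A) * exp (- r\<^sup>2 * ?Q h)"
    define q1 where "q1 = sqrt (2 ^ N :: real)"
    have q1: "q1 = sqrt 2 ^ N" "q1\<^sup>2 = 2 ^ N"
    proof -
      show "q1 = sqrt 2 ^ N" by (simp add: q1_def real_sqrt_power)
      show "q1\<^sup>2 = 2 ^ N" unfolding q1_def by (rule real_sqrt_pow2) simp
    qed
    have "(E * q1)\<^sup>2 \<le> f h * f (\<lambda>i\<in>{..<d}. - h i)"
      unfolding ff E_def[symmetric] power_mult_distrib q1(2)
      using q by (intro mult_left_mono) auto
    also have "\<dots> \<le> ((f h + f (\<lambda>i\<in>{..<d}. - h i)) / 2)\<^sup>2"
      using zero_le_power2[of "f h - f (\<lambda>i\<in>{..<d}. - h i)"] by (simp add: power2_eq_square field_simps)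
    finally have "E * q1 \<le> (f h + f (\<lambda>i\<in>{..<d}. - h i)) / 2"
      by (rule power2_le_imp_le) (simp add: f0)
    then show ?thesis unfolding E_def q1(1) by (simp add: mult_ac)
  qed
  have m[measurable]: "(\<lambda>h. ip d h x) \<in> borel_measurable (std_gauss d)" for x
    unfolding measurable_cong_sets[OF sets_std_gauss refl]
    by (intro ip_measurable lborel_pow_component borel_measurable_const)
  let ?I = "\<integral>\<^sup>+h. ennreal (f h) \<partial>std_gauss d"
  have "ennreal (?c * (1/2 * exp (- r\<^sup>2 * (32 * real N * B\<^sup>2)))) \<le> ennreal ?c * (\<integral>\<^sup>+h. ennreal (exp (- r\<^sup>2 * ?Q h)) \<partial>std_gauss d)"
    by (subst ennreal_mult', simp) (rule mult_left_mono[OF std_gauss_exp_quadratic_lower[OF B y]], simp_all)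
  also have "\<dots> = (\<integral>\<^sup>+h. ennreal ?c * ennreal (exp (- r\<^sup>2 * ?Q h)) \<partial>std_gauss d)"
    by (rule nn_integral_cmult[symmetric]) measurable
  also have "\<dots> \<le> (\<integral>\<^sup>+h. ennreal (1/2) * (ennreal (f h) + ennreal (f (\<lambda>i\<in>{..<d}. - h i))) \<partial>std_gauss d)"
  proof (rule nn_integral_mono)
    fix h
    have "ennreal (?c * exp (- r\<^sup>2 * ?Q h)) \<le> ennreal (1/2 * (f h + f (\<lambda>i\<in>{..<d}. - h i)))"
    proof (rule ennreal_leI)
      have "a \<le> 1/2 * b" if "2 * a \<le> b" for a b :: real using that by simp
      then show "?c * exp (- r\<^sup>2 * ?Q h) \<le> 1/2 * (f h + f (\<lambda>i\<in>{..<d}. - h i))" using pt[of h] .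
    qed
    also have "\<dots> = ennreal (1/2) * ennreal (f h + f (\<lambda>i\<in>{..<d}. - h i))" by (rule ennreal_mult') simp
    also have "ennreal (f h + f (\<lambda>i\<in>{..<d}. - h i)) = ennreal (f h) + ennreal (f (\<lambda>i\<in>{..<d}. - h i))"
      by (rule ennreal_plus[OF f0 f0])
    finally show "ennreal ?c * ennreal (exp (- r\<^sup>2 * ?Q h)) \<le> ennreal (1/2) * (ennreal (f h) + ennreal (f (\<lambda>i\<in>{..<d}. - h i)))"
      by (simp only: ennreal_mult'[symmetric] exp_ge_zero mult_nonneg_nonneg zero_le_power real_sqrt_ge_zero zero_le_numeral)
  qed
  also have "\<dots> = ennreal (1/2) * (?I + (\<integral>\<^sup>+h. ennreal (f (\<lambda>i\<in>{..<d}. - h i)) \<partial>std_gauss d))"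
  proof -
    have fS: "(\<lambda>h. ennreal (f h)) \<in> borel_measurable (std_gauss d)"
      "(\<lambda>h. ennreal (f (\<lambda>i\<in>{..<d}. - h i))) \<in> borel_measurable (std_gauss d)"
      unfolding measurable_cong_sets[OF sets_std_gauss refl] by (rule fm fm')+
    show ?thesis
      unfolding nn_integral_add[OF fS, symmetric] by (rule nn_integral_cmult[OF borel_measurable_add[OF fS]])
  qed
  also have "(\<integral>\<^sup>+h. ennreal (f (\<lambda>i\<in>{..<d}. - h i)) \<partial>std_gauss d) = ?I"
    by (rule std_gauss_neg[OF fm, symmetric])
  also have "ennreal (1/2) * (?I + ?I) = (ennreal (1/2) * ennreal 2) * ?I" by (simp add: mult_2[symmetric] mult.assoc)
  also have "ennreal (1/2) * ennreal 2 = 1" by (subst ennreal_mult'[symmetric]) simp_all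
  finally show ?thesis unfolding I by simp
qed

text \<open>Logarithms are taken in \<open>pb_integral_lower\<close>. The prior scale
  \<open>r^2 = 1 / (512 * B^2)\<close> makes the smoothing loss \<open>N / 16\<close> and the shift
  cost \<open>256 * B^2\<close>. Since \<open>ln 2 / 2 \<ge> 5/16\<close>, at least
  \<open>5/16 * N - 1/16 * N - 1/8 * N = N / 8\<close> remains.\<close>

lemma low_eig_of_pb_integral:
  assumes d: "0 < d" and B: "0 < B" and y: "\<And>j. j < N \<Longrightarrow> ip d (y j) (y j) \<le> B\<^sup>2"
    and t: "0 < t" and pb: "pb_integral d N (1 / (sqrt 512 * B)) y \<le> ennreal t"
    and N: "256 * B\<^sup>2 + ln (2 * t) \<le> real N / 8"
  shows "real N / 8 \<le> low_eig d N y"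
proof (rule le_low_eig[OF d])
  fix \<theta>0 assume pos: "0 < ip d \<theta>0 \<theta>0"
  let ?l = "sqrt (ip d \<theta>0 \<theta>0)"
  define \<theta> where "\<theta> = (\<lambda>i. 1 / ?l * \<theta>0 i)"
  have \<theta>: "ip d \<theta> \<theta> = 1" unfolding \<theta>_def ip_scale using pos by (simp add: power_divide)
  let ?r = "1 / (sqrt 512 * B)"
  have r: "0 < ?r" "?r\<^sup>2 = 1 / (512 * B\<^sup>2)" using B by (simp_all add: power_divide power_mult_distrib)
  let ?A = "\<Sum>j<N. (ip d \<theta> (y j))\<^sup>2"
  have "ennreal (exp (- 1 / (2 * ?r\<^sup>2) - ?A) * sqrt 2 ^ N * (1/2 * exp (- ?r\<^sup>2 * (32 * real N * B\<^sup>2)))) \<le> ennreal t"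
    using order_trans[OF pb_integral_lower[OF r(1) B y \<theta>] pb] by simp
  then have le: "exp (- 1 / (2 * ?r\<^sup>2) - ?A) * sqrt 2 ^ N * (1/2 * exp (- ?r\<^sup>2 * (32 * real N * B\<^sup>2))) \<le> t"
    using t by (subst (asm) ennreal_le_iff) auto
  have s2: "sqrt 2 ^ N = exp (real N * (ln 2 / 2))"
    by (simp add: exp_of_nat_mult ln_sqrt[symmetric])
  have x: "- 1 / (2 * ?r\<^sup>2) = - 256 * B\<^sup>2" "- ?r\<^sup>2 * (32 * real N * B\<^sup>2) = - real N / 16"
    unfolding r(2) using B by simp_all
  have "exp (- 256 * B\<^sup>2 - ?A + real N * (ln 2 / 2) + - real N / 16) \<le> 2 * t"
    using le unfolding x s2 exp_add by (simp add: mult_ac)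
  then have "- 256 * B\<^sup>2 - ?A + real N * (ln 2 / 2) + - real N / 16 \<le> ln (2 * t)"
    using t by (subst ln_ge_iff) simp_all
  moreover have "real N * (5/16) \<le> real N * (ln 2 / 2)"
  proof (rule mult_left_mono)
    have "(5/8::real) \<le> ln 2" using ln2_ge_two_thirds by simp
    then show "5/16 \<le> ln 2 / (2::real)" by simp
  qed simp
  ultimately have A: "real N / 8 \<le> ?A" using N by linarith
  have "(ip d \<theta> (y j))\<^sup>2 = (ip d \<theta>0 (y j))\<^sup>2 / ip d \<theta>0 \<theta>0" for j
    unfolding \<theta>_def ip_scale_left using pos by (simp add: power_mult_distrib power_divide)
  then have "?A = (\<Sum>j<N. (ip d \<theta>0 (y j))\<^sup>2) / ip d \<theta>0 \<theta>0" by (simp add: sum_divide_distrib)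
  then have "?A * ip d \<theta>0 \<theta>0 = (\<Sum>j<N. (ip d \<theta>0 (y j))\<^sup>2)" using pos by simp
  then show "real N / 8 * ip d \<theta>0 \<theta>0 \<le> (\<Sum>j<N. (ip d \<theta>0 (y j))\<^sup>2)"
    using mult_right_mono[OF A, of "ip d \<theta>0 \<theta>0"] pos by simp
qed

lemma sum_pairs:
  fixes f :: "nat \<Rightarrow> real"
  shows "(\<Sum>i<N + 2 * k. f i) = (\<Sum>i<N. f i) + (\<Sum>j<k. f (N + 2 * j) + f (N + 2 * j + 1))"
  by (induction k) (simp_all add: add.assoc)

section \<open>Accuracy\<close>

text \<open>The coefficient of sample \<open>i\<close> in the output when nothing is clipped; the
  two samples of a pair receive opposite signs. It presents the output as one linear combination,
  the form required by \<open>weighted_law\<close>.\<close>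

definition final_weight :: "nat \<Rightarrow> nat \<Rightarrow> real \<Rightarrow> (nat \<Rightarrow> real) \<Rightarrow> nat \<Rightarrow> real" where
  "final_weight N k \<rho> g i = (if i < N then 1 / real N
     else \<rho> * g ((i - N) div 2) / sqrt (ip k g g) * ((if even (i - N) then 1 else - 1) / sqrt 2))"

lemma final_weight_sum:
  "(\<Sum>i<N + 2 * k. final_weight N k \<rho> g i * f i) =
    (\<Sum>i<N. f i) / real N + \<rho> * (\<Sum>j<k. g j * ((f (N + 2 * j) - f (N + 2 * j + 1)) / sqrt 2)) / sqrt (ip k g g)"
proof -
  have "(\<Sum>i<N + 2 * k. final_weight N k \<rho> g i * f i) = (\<Sum>i<N. 1 / real N * f i) +
    (\<Sum>j<k. \<rho> / sqrt (ip k g g) * (g j * ((f (N + 2 * j) - f (N + 2 * j + 1)) / sqrt 2)))"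
    unfolding sum_pairs
    by (intro arg_cong2[where f="(+)"] sum.cong refl) (simp_all add: final_weight_def diff_divide_distrib right_diff_distrib)
  then show ?thesis by (simp add: sum_distrib_left[symmetric] sum_divide_distrib[symmetric])
qed

lemma final_weight_total:
  assumes "0 < N"
  shows "(\<Sum>i<N + 2 * k. final_weight N k \<rho> g i) = 1"
  using final_weight_sum[of N k \<rho> g "\<lambda>_. 1"] assms by simp

text \<open>The mean contributes \<open>N * (1 / N)^2 = 1 / N\<close>. The two samples of pair
  \<open>j\<close> together contribute \<open>\<rho>^2 * (g j)^2 / ip k g g\<close>, which adds up
  to \<open>\<rho>^2\<close>.\<close>

lemma final_weight_squares:
  assumes N: "0 < N" and g: "0 < ip k g g" and \<rho>: "\<rho>\<^sup>2 = 1 - 1 / real N"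
  shows "(\<Sum>i<N + 2 * k. (final_weight N k \<rho> g i)\<^sup>2) = 1"
proof -
  have "(\<Sum>i<N + 2 * k. (final_weight N k \<rho> g i)\<^sup>2) = (\<Sum>i<N. (1 / real N)\<^sup>2) + (\<Sum>j<k. \<rho>\<^sup>2 / ip k g g * (g j * g j))"
    unfolding sum_pairs
    by (intro arg_cong2[where f="(+)"] sum.cong refl)
       (use g in \<open>simp_all add: final_weight_def power_mult_distrib power_divide power2_eq_square field_simps\<close>)
  also have "\<dots> = 1 / real N + \<rho>\<^sup>2 / ip k g g * ip k g g"
    using N by (simp add: ip_def sum_distrib_left power2_eq_square)
  also have "\<dots> = 1" using g \<rho> by simp
  finally show ?thesis .
qed

lemma option_space_cong: "sets M = sets M' \<Longrightarrow> option_space M = option_space M'"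
  unfolding option_space_def using sets_eq_imp_space_eq[of M M'] by simp

context gauss_form begin

section \<open>The probability of bad samples\<close>

lemma norm_tail:
  assumes d: "0 < d"
  shows "(\<integral>\<^sup>+x. (if z < ip d x x then 1 else 0) \<partial>D (\<lambda>_. 0)) \<le> ennreal (exp (- z / (4 * \<kappa>)) * sqrt 2 ^ d)"
proof -
  have k: "0 < \<kappa>" using kappa_pos[OF d] by simp
  have m: "(\<lambda>x. ennreal (exp (ip d x x / (4 * \<kappa>)))) \<in> borel_measurable (D (\<lambda>_. 0))"
  proof -
    have [measurable]: "(\<lambda>x. ip d x x) \<in> borel_measurable (D (\<lambda>_. 0))"
      unfolding measurable_cong_sets[OF sets_D refl] by (rule ip_self_measurable)
    show ?thesis by measurable
  qed
  have "(\<integral>\<^sup>+x. (if z < ip d x x then 1 else 0) \<partial>D (\<lambda>_. 0)) \<le> ennreal (exp (- z / (4 * \<kappa>))) * (\<integral>\<^sup>+x. ennreal (exp (ip d x x / (4 * \<kappa>))) \<partial>D (\<lambda>_. 0))"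
  proof (rule nn_integral_indicator_le[OF _ m refl])
    fix x assume "z < ip d x x"
    then have "0 \<le> - z / (4 * \<kappa>) + ip d x x / (4 * \<kappa>)" using k by (simp add: field_simps)
    then have "1 \<le> exp (- z / (4 * \<kappa>) + ip d x x / (4 * \<kappa>))" by simp
    then show "1 \<le> ennreal (exp (- z / (4 * \<kappa>))) * ennreal (exp (ip d x x / (4 * \<kappa>)))"
      unfolding exp_add by (simp add: ennreal_mult'[symmetric])
  qed
  also have "\<dots> \<le> ennreal (exp (- z / (4 * \<kappa>))) * ennreal (sqrt 2 ^ d)"
    by (intro mult_left_mono exp_norm_le d) simp
  finally show ?thesis by (simp add: ennreal_mult')
qed

lemma PX_component_measurable:
  "i < n \<Longrightarrow> e < d \<Longrightarrow> (\<lambda>X. X i e) \<in> borel_measurable (\<Pi>\<^sub>M i\<in>{..<n}. D \<mu>)"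
  unfolding measurable_cong_sets[OF sets_PiM_D refl] by (rule component_measurable) auto

lemma pair_diff_measurable:
  "N + 2 * j + 1 < n \<Longrightarrow> e < d \<Longrightarrow> (\<lambda>X. pair_diff N X j e) \<in> borel_measurable (\<Pi>\<^sub>M i\<in>{..<n}. D \<mu>)"
  unfolding pair_diff_def by (intro borel_measurable_divide borel_measurable_diff borel_measurable_const PX_component_measurable) auto

lemma ind_norm_measurable: "(\<lambda>x. if c < ip d x x then 1 else (0::ennreal)) \<in> borel_measurable (lborel_pow d)"
  by measurable

text \<open>A single sample is the combination with a unit weight vector. The mean is separated by
  bounding the squared norm of \<open>x + \<mu>\<close> by twice the sum of the squared norms, hence
  the threshold \<open>(B2 - 2 * R^2) / 2\<close> for the centred law.\<close>

lemma sample_tail: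
  fixes i n :: nat
  assumes d: "0 < d" and i: "i < n" and \<mu>: "ip d \<mu> \<mu> \<le> R\<^sup>2"
  shows "(\<integral>\<^sup>+X. (if B2 < ip d (X i) (X i) then 1 else 0) \<partial>(\<Pi>\<^sub>M i\<in>{..<n}. D \<mu>)) \<le> ennreal (exp (- (B2 - 2 * R\<^sup>2) / (8 * \<kappa>)) * sqrt 2 ^ d)"
proof -
  define w :: "nat \<Rightarrow> real" where "w j = (if j = i then 1 else 0)" for j
  have w2: "(w j)\<^sup>2 = w j" for j by (simp add: w_def)
  have "(\<Sum>j<n. w j) = 1" using i by (simp add: w_def)
  then have w: "(\<Sum>j<n. (w j)\<^sup>2) = 1" "(\<Sum>j<n. w j) = 1" unfolding w2 by auto
  have wX: "(\<Sum>j<n. w j * X j e) = X i e" for X :: "nat \<Rightarrow> nat \<Rightarrow> real" and e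
    using i by (simp add: w_def if_distribR if_distrib cong: if_cong)
  let ?F = "\<lambda>x. if B2 < ip d x x then 1 else (0::ennreal)"
  have "(\<integral>\<^sup>+X. ?F (X i) \<partial>(\<Pi>\<^sub>M i\<in>{..<n}. D \<mu>)) = (\<integral>\<^sup>+X. ?F (\<lambda>e\<in>{..<d}. \<Sum>j<n. w j * X j e) \<partial>(\<Pi>\<^sub>M i\<in>{..<n}. D \<mu>))"
    unfolding wX by simp
  also have "\<dots> = (\<integral>\<^sup>+x. ?F x \<partial>D \<mu>)"
    unfolding weighted_law[OF ind_norm_measurable w(1)] w(2) by simp
  also have "\<dots> = (\<integral>\<^sup>+x. ?F (\<lambda>i\<in>{..<d}. x i + \<mu> i) \<partial>D (\<lambda>_. 0))"
    by (rule nn_integral_D_shift[OF ind_norm_measurable])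
  also have "\<dots> \<le> (\<integral>\<^sup>+x. (if (B2 - 2 * R\<^sup>2) / 2 < ip d x x then 1 else 0) \<partial>D (\<lambda>_. 0))"
  proof (rule nn_integral_mono)
    fix x
    have "0 \<le> ip d (\<lambda>i. x i - \<mu> i) (\<lambda>i. x i - \<mu> i)" by simp
    then have "ip d (\<lambda>i. x i + \<mu> i) (\<lambda>i. x i + \<mu> i) \<le> 2 * ip d x x + 2 * R\<^sup>2"
      using \<mu> by (simp add: ip_linear)
    then have "(B2 - 2 * R\<^sup>2) / 2 < ip d x x" if "B2 < ip d (\<lambda>i. x i + \<mu> i) (\<lambda>i. x i + \<mu> i)"
      using that by simp
    then show "?F (\<lambda>i\<in>{..<d}. x i + \<mu> i) \<le> (if (B2 - 2 * R\<^sup>2) / 2 < ip d x x then 1 else 0)" by simp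
  qed
  also have "\<dots> \<le> ennreal (exp (- ((B2 - 2 * R\<^sup>2) / 2) / (4 * \<kappa>)) * sqrt 2 ^ d)" by (rule norm_tail[OF d])
  also have "- ((B2 - 2 * R\<^sup>2) / 2) / (4 * \<kappa>) = - (B2 - 2 * R\<^sup>2) / (8 * \<kappa>)"
    using kappa_pos[OF d] by (simp add: field_simps)
  finally show ?thesis .
qed

text \<open>Differences are centred and have a better tail. It is weakened to the form of
  \<open>sample_tail\<close> so that all clipping events share one bound.\<close>

lemma pair_diff_tail:
  assumes d: "0 < d" and j: "N + 2 * j + 1 < n" and B2: "0 \<le> B2"
  shows "(\<integral>\<^sup>+X. (if B2 < ip d (pair_diff N X j) (pair_diff N X j) then 1 else 0) \<partial>(\<Pi>\<^sub>M i\<in>{..<n}. D \<mu>)) \<le> ennreal (exp (- (B2 - 2 * R\<^sup>2) / (8 * \<kappa>)) * sqrt 2 ^ d)"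
proof -
  have k: "0 < \<kappa>" using kappa_pos[OF d] by simp
  have "(\<integral>\<^sup>+X. (if B2 < ip d (pair_diff N X j) (pair_diff N X j) then 1 else 0) \<partial>(\<Pi>\<^sub>M i\<in>{..<n}. D \<mu>)) = (\<integral>\<^sup>+x. (if B2 < ip d x x then 1 else 0) \<partial>D (\<lambda>_. 0))"
    using pair_diff_law[OF ind_norm_measurable[of B2] j, of \<mu>] by simp
  also have "\<dots> \<le> ennreal (exp (- B2 / (4 * \<kappa>)) * sqrt 2 ^ d)" by (rule norm_tail[OF d])
  also have "\<dots> \<le> ennreal (exp (- (B2 - 2 * R\<^sup>2) / (8 * \<kappa>)) * sqrt 2 ^ d)"
    using k B2 by (intro ennreal_leI mult_right_mono) (auto simp: field_simps intro: order_trans[of _ 0])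
  finally show ?thesis .
qed

lemma pb_weight_joint_measurable:
  assumes "N + 2 * N \<le> n"
  shows "(\<lambda>(h, X). pb_weight d N (pair_diff N X) (\<lambda>i. r * h i)) \<in> borel_measurable (std_gauss d \<Otimes>\<^sub>M (\<Pi>\<^sub>M i\<in>{..<n}. D \<mu>))"
  unfolding split_def
proof (rule pb_weight_measurable)
  show "(\<lambda>p. r * fst p i) \<in> borel_measurable (std_gauss d \<Otimes>\<^sub>M (\<Pi>\<^sub>M i\<in>{..<n}. D \<mu>))" if "i < d" for i
    using that by (intro borel_measurable_times borel_measurable_const measurable_compose[OF measurable_fst])
      (simp add: measurable_cong_sets[OF sets_std_gauss refl] lborel_pow_component)
  show "(\<lambda>p. pair_diff N (snd p) j i) \<in> borel_measurable (std_gauss d \<Otimes>\<^sub>M (\<Pi>\<^sub>M i\<in>{..<n}. D \<mu>))" if "j < N" "i < d" for j i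
    using that assms by (intro measurable_compose[OF measurable_snd pair_diff_measurable]) auto
qed

lemma pb_integral_measurable:
  assumes "N + 2 * N \<le> n"
  shows "(\<lambda>X. pb_integral d N r (pair_diff N X)) \<in> borel_measurable (\<Pi>\<^sub>M i\<in>{..<n}. D \<mu>)"
  unfolding pb_integral_def
proof (rule std_gauss.borel_measurable_nn_integral)
  have "(\<lambda>(h, X). ennreal (pb_weight d N (pair_diff N X) (\<lambda>i. r * h i))) \<in> borel_measurable (std_gauss d \<Otimes>\<^sub>M (\<Pi>\<^sub>M i\<in>{..<n}. D \<mu>))"
    using measurable_compose[OF pb_weight_joint_measurable[OF assms] measurable_ennreal] by (simp add: split_def)
  from measurable_compose[OF measurable_Pair[OF measurable_snd measurable_fst] this]
  show "(\<lambda>(X, h). ennreal (pb_weight d N (pair_diff N X) (\<lambda>i. r * h i))) \<in> borel_measurable ((\<Pi>\<^sub>M i\<in>{..<n}. D \<mu>) \<Otimes>\<^sub>M std_gauss d)"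
    unfolding split_def fst_conv snd_conv .
qed

text \<open>For a fixed direction, independence of the rows and \<open>exp_neg_square_le\<close>
  bound the mean of the weight by one; Fubini carries this over to the mixture.\<close>

lemma pb_integral_expectation:
  assumes n: "N + 2 * N \<le> n" "0 < n"
  shows "(\<integral>\<^sup>+X. pb_integral d N r (pair_diff N X) \<partial>(\<Pi>\<^sub>M i\<in>{..<n}. D \<mu>)) \<le> 1"
proof -
  let ?P = "\<Pi>\<^sub>M i\<in>{..<n}. D \<mu>"
  have pP: "prob_space ?P" by (intro prob_space_PiM prob_space_D)
  have "(\<integral>\<^sup>+X. pb_integral d N r (pair_diff N X) \<partial>?P) =
    (\<integral>\<^sup>+h. (\<integral>\<^sup>+X. ennreal (pb_weight d N (pair_diff N X) (\<lambda>i. r * h i)) \<partial>?P) \<partial>std_gauss d)"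
    unfolding pb_integral_def
  proof (rule pair_sigma_finite.Fubini')
    show "pair_sigma_finite (std_gauss d) ?P"
      by (intro pair_sigma_finite.intro prob_space_imp_sigma_finite prob_space_std_gauss pP)
    show "(\<lambda>(h, X). ennreal (pb_weight d N (pair_diff N X) (\<lambda>i. r * h i))) \<in> borel_measurable (std_gauss d \<Otimes>\<^sub>M ?P)"
      using measurable_compose[OF pb_weight_joint_measurable[OF n(1)] measurable_ennreal] by (simp add: split_def)
  qed
  also have "\<dots> \<le> (\<integral>\<^sup>+h. 1 \<partial>std_gauss d)"
  proof (rule nn_integral_mono)
    fix h :: "nat \<Rightarrow> real"
    let ?\<theta> = "\<lambda>i. r * h i"
    let ?s = "sqrt (1 + 2 * ip d ?\<theta> ?\<theta>)"
    let ?\<phi> = "\<lambda>x. ennreal (exp (- (ip d ?\<theta> x)\<^sup>2))"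
    have s: "0 < ?s" by (simp add: add_pos_nonneg)
    have \<phi>m: "?\<phi> \<in> borel_measurable (lborel_pow d)"
    proof -
      have [measurable]: "(\<lambda>x. ip d ?\<theta> x) \<in> borel_measurable (lborel_pow d)"
        by (intro ip_measurable lborel_pow_component borel_measurable_const)
      show ?thesis by measurable
    qed
    have pm: "(\<lambda>X. \<Prod>j<N. ?\<phi> (\<lambda>e\<in>{..<d}. pair_diff N X j e)) \<in> borel_measurable ?P"
      by (intro borel_measurable_prod_ennreal measurable_compose[OF _ \<phi>m] measurable_restrict_lborel_pow pair_diff_measurable) (use n in auto)
    have "(\<integral>\<^sup>+X. ennreal (pb_weight d N (pair_diff N X) ?\<theta>) \<partial>?P) = (\<integral>\<^sup>+X. ennreal (?s ^ N) * (\<Prod>j<N. ?\<phi> (\<lambda>e\<in>{..<d}. pair_diff N X j e)) \<partial>?P)"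
    proof (rule nn_integral_cong)
      fix X
      have "pb_weight d N (pair_diff N X) ?\<theta> = ?s ^ N * (\<Prod>j<N. exp (- (ip d ?\<theta> (\<lambda>e\<in>{..<d}. pair_diff N X j e))\<^sup>2))"
        by (simp add: pb_weight_def exp_sum[symmetric] sum_negf)
      then show "ennreal (pb_weight d N (pair_diff N X) ?\<theta>) = ennreal (?s ^ N) * (\<Prod>j<N. ?\<phi> (\<lambda>e\<in>{..<d}. pair_diff N X j e))"
        using s by (simp only: prod_ennreal exp_ge_zero ennreal_mult' zero_le_power less_imp_le)
    qed
    also have "\<dots> = ennreal (?s ^ N) * (\<integral>\<^sup>+X. (\<Prod>j<N. ?\<phi> (\<lambda>e\<in>{..<d}. pair_diff N X j e)) \<partial>?P)"
      by (rule nn_integral_cmult[OF pm])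
    also have "\<dots> = ennreal (?s ^ N) * (\<integral>\<^sup>+x. ?\<phi> x \<partial>D (\<lambda>_. 0)) ^ N"
      unfolding pair_diff_prod[OF \<phi>m n] ..
    also have "\<dots> \<le> ennreal (?s ^ N) * ennreal (1 / ?s) ^ N"
      by (intro mult_left_mono power_mono exp_neg_square_le) auto
    also have "\<dots> = ennreal ((?s * (1 / ?s)) ^ N)"
      using s by (simp add: ennreal_power ennreal_mult'[symmetric] power_mult_distrib[symmetric] del: mult_1_right times_divide_eq_right)
    also have "\<dots> = 1" using s by simp
    finally show "(\<integral>\<^sup>+X. ennreal (pb_weight d N (pair_diff N X) ?\<theta>) \<partial>?P) \<le> 1" .
  qed
  also have "\<dots> = 1" by (simp only: nn_integral_const std_gauss.emeasure_space_1 mult_1_right)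
  finally show ?thesis .
qed

text \<open>A count of failures instead of an event: it is at least one on every bad sample, and the
  union bound becomes linearity of the integral.\<close>

definition bad_data :: "nat \<Rightarrow> nat \<Rightarrow> real \<Rightarrow> real \<Rightarrow> (nat \<Rightarrow> nat \<Rightarrow> real) \<Rightarrow> ennreal" where
  "bad_data N k B t X = (\<Sum>j<N. if B\<^sup>2 < ip d (X j) (X j) then 1 else 0) +
     (\<Sum>j<k. if B\<^sup>2 < ip d (pair_diff N X j) (pair_diff N X j) then 1 else 0) +
     (if ennreal t < pb_integral d N (1 / (sqrt 512 * B)) (pair_diff N X) then 1 else 0)"

lemma bad_data_measurable:
  assumes n: "n = N + 2 * k" and k: "N \<le> k"
  shows "bad_data N k B t \<in> borel_measurable (\<Pi>\<^sub>M i\<in>{..<n}. D \<mu>)"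
proof -
  let ?P = "\<Pi>\<^sub>M i\<in>{..<n}. D \<mu>"
  have 1: "(\<lambda>X. if B\<^sup>2 < ip d (X j) (X j) then 1 else (0::ennreal)) \<in> borel_measurable ?P" if "j < N" for j
  proof -
    have [measurable]: "(\<lambda>X. ip d (X j) (X j)) \<in> borel_measurable ?P"
      by (intro ip_measurable PX_component_measurable) (use that n in auto)
    show ?thesis by measurable
  qed
  have 2: "(\<lambda>X. if B\<^sup>2 < ip d (pair_diff N X j) (pair_diff N X j) then 1 else (0::ennreal)) \<in> borel_measurable ?P" if "j < k" for j
  proof -
    have [measurable]: "(\<lambda>X. ip d (pair_diff N X j) (pair_diff N X j)) \<in> borel_measurable ?P"
      by (intro ip_measurable pair_diff_measurable) (use that n in auto)
    show ?thesis by measurable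
  qed
  have [measurable]: "(\<lambda>X. pb_integral d N (1 / (sqrt 512 * B)) (pair_diff N X)) \<in> borel_measurable ?P"
    by (rule pb_integral_measurable) (use n k in auto)
  have 3: "(\<lambda>X. if ennreal t < pb_integral d N (1 / (sqrt 512 * B)) (pair_diff N X) then 1 else (0::ennreal)) \<in> borel_measurable ?P"
    by measurable
  show ?thesis unfolding bad_data_def by (intro borel_measurable_add borel_measurable_sum 1 2 3) auto
qed

lemma bad_data_expectation:
  assumes d: "0 < d" and n: "n = N + 2 * k" "0 < n" and k: "N \<le> k" and \<mu>: "ip d \<mu> \<mu> \<le> R\<^sup>2" and t: "0 < t"
  shows "(\<integral>\<^sup>+X. bad_data N k B t X \<partial>(\<Pi>\<^sub>M i\<in>{..<n}. D \<mu>)) \<le>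
    ennreal (real (N + k) * (exp (- (B\<^sup>2 - 2 * R\<^sup>2) / (8 * \<kappa>)) * sqrt 2 ^ d) + 1 / t)"
proof -
  let ?P = "\<Pi>\<^sub>M i\<in>{..<n}. D \<mu>" and ?\<tau> = "exp (- (B\<^sup>2 - 2 * R\<^sup>2) / (8 * \<kappa>)) * sqrt 2 ^ d"
  have 1: "(\<lambda>X. if B\<^sup>2 < ip d (X j) (X j) then 1 else (0::ennreal)) \<in> borel_measurable ?P" if "j < N" for j
  proof -
    have [measurable]: "(\<lambda>X. ip d (X j) (X j)) \<in> borel_measurable ?P"
      by (intro ip_measurable PX_component_measurable) (use that n in auto)
    show ?thesis by measurable
  qed
  have 2: "(\<lambda>X. if B\<^sup>2 < ip d (pair_diff N X j) (pair_diff N X j) then 1 else (0::ennreal)) \<in> borel_measurable ?P" if "j < k" for j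
  proof -
    have [measurable]: "(\<lambda>X. ip d (pair_diff N X j) (pair_diff N X j)) \<in> borel_measurable ?P"
      by (intro ip_measurable pair_diff_measurable) (use that n in auto)
    show ?thesis by measurable
  qed
  have pbm[measurable]: "(\<lambda>X. pb_integral d N (1 / (sqrt 512 * B)) (pair_diff N X)) \<in> borel_measurable ?P"
    by (rule pb_integral_measurable) (use n k in auto)
  have 3: "(\<lambda>X. if ennreal t < pb_integral d N (1 / (sqrt 512 * B)) (pair_diff N X) then 1 else (0::ennreal)) \<in> borel_measurable ?P"
    by measurable
  have I3: "(\<integral>\<^sup>+X. (if ennreal t < pb_integral d N (1 / (sqrt 512 * B)) (pair_diff N X) then 1 else 0) \<partial>?P) \<le> ennreal (1 / t)"
  proof -
    have "(\<integral>\<^sup>+X. (if ennreal t < pb_integral d N (1 / (sqrt 512 * B)) (pair_diff N X) then 1 else 0) \<partial>?P) \<le>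
      ennreal (1 / t) * (\<integral>\<^sup>+X. pb_integral d N (1 / (sqrt 512 * B)) (pair_diff N X) \<partial>?P)"
    proof (rule nn_integral_indicator_le[OF _ pbm refl])
      fix X assume "ennreal t < pb_integral d N (1 / (sqrt 512 * B)) (pair_diff N X)"
      then have "ennreal (1 / t) * ennreal t \<le> ennreal (1 / t) * pb_integral d N (1 / (sqrt 512 * B)) (pair_diff N X)"
        by (intro mult_left_mono) auto
      then show "1 \<le> ennreal (1 / t) * pb_integral d N (1 / (sqrt 512 * B)) (pair_diff N X)"
        using t by (simp add: ennreal_mult'[symmetric])
    qed
    also have "\<dots> \<le> ennreal (1 / t) * 1"
      by (intro mult_left_mono pb_integral_expectation) (use n k in auto)
    finally show ?thesis by simp
  qed
  have "(\<integral>\<^sup>+X. bad_data N k B t X \<partial>?P) = (\<Sum>j<N. \<integral>\<^sup>+X. (if B\<^sup>2 < ip d (X j) (X j) then 1 else 0) \<partial>?P) +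
    (\<Sum>j<k. \<integral>\<^sup>+X. (if B\<^sup>2 < ip d (pair_diff N X j) (pair_diff N X j) then 1 else 0) \<partial>?P) +
    (\<integral>\<^sup>+X. (if ennreal t < pb_integral d N (1 / (sqrt 512 * B)) (pair_diff N X) then 1 else 0) \<partial>?P)"
  proof -
    have s1: "(\<lambda>X. \<Sum>j<N. if B\<^sup>2 < ip d (X j) (X j) then 1 else (0::ennreal)) \<in> borel_measurable ?P"
      by (intro borel_measurable_sum 1) auto
    have s2: "(\<lambda>X. \<Sum>j<k. if B\<^sup>2 < ip d (pair_diff N X j) (pair_diff N X j) then 1 else (0::ennreal)) \<in> borel_measurable ?P"
      by (intro borel_measurable_sum 2) auto
    have "(\<integral>\<^sup>+X. (\<Sum>j<N. if B\<^sup>2 < ip d (X j) (X j) then 1 else 0) \<partial>?P) = (\<Sum>j<N. \<integral>\<^sup>+X. (if B\<^sup>2 < ip d (X j) (X j) then 1 else 0) \<partial>?P)"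
      by (rule nn_integral_sum) (use 1 in auto)
    moreover have "(\<integral>\<^sup>+X. (\<Sum>j<k. if B\<^sup>2 < ip d (pair_diff N X j) (pair_diff N X j) then 1 else 0) \<partial>?P) = (\<Sum>j<k. \<integral>\<^sup>+X. (if B\<^sup>2 < ip d (pair_diff N X j) (pair_diff N X j) then 1 else 0) \<partial>?P)"
      by (rule nn_integral_sum) (use 2 in auto)
    ultimately show ?thesis unfolding bad_data_def
      by (simp only: nn_integral_add[OF borel_measurable_add[OF s1 s2] 3] nn_integral_add[OF s1 s2])
  qed
  also have "\<dots> \<le> (\<Sum>j<N. ennreal ?\<tau>) + (\<Sum>j<k. ennreal ?\<tau>) + ennreal (1 / t)"
    by (intro add_mono sum_mono sample_tail pair_diff_tail I3 d \<mu>) (use n in auto)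
  also have "\<dots> = ennreal (real (N + k) * ?\<tau> + 1 / t)"
    using t by (simp add: ennreal_plus[symmetric] ennreal_of_nat_eq_real_of_nat ennreal_mult'[symmetric] distrib_right del: ennreal_plus)
  finally show ?thesis .
qed

end

section \<open>Coupling with the unclipped output\<close>

context gauss_form begin

definition good_data :: "nat \<Rightarrow> nat \<Rightarrow> real \<Rightarrow> real \<Rightarrow> (nat \<Rightarrow> nat \<Rightarrow> real) \<Rightarrow> bool" where
  "good_data N k B t X \<longleftrightarrow> (\<forall>j<N. ip d (X j) (X j) \<le> B\<^sup>2) \<and> (\<forall>j<k. ip d (pair_diff N X j) (pair_diff N X j) \<le> B\<^sup>2) \<and>
     pb_integral d N (1 / (sqrt 512 * B)) (pair_diff N X) \<le> ennreal t"

lemma not_good_data: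
  assumes "\<not> good_data N k B t X"
  shows "1 \<le> bad_data N k B t X"
proof -
  let ?a = "\<lambda>j. if B\<^sup>2 < ip d (X j) (X j) then 1 else (0::ennreal)"
  let ?b = "\<lambda>j. if B\<^sup>2 < ip d (pair_diff N X j) (pair_diff N X j) then 1 else (0::ennreal)"
  consider j where "j < N" "B\<^sup>2 < ip d (X j) (X j)" | j where "j < k" "B\<^sup>2 < ip d (pair_diff N X j) (pair_diff N X j)"
    | "ennreal t < pb_integral d N (1 / (sqrt 512 * B)) (pair_diff N X)"
    using assms by (auto simp: good_data_def not_le)
  then show ?thesis
  proof cases
    case 1
    have "1 = ?a j" using 1 by simp
    also have "\<dots> \<le> (\<Sum>j<N. ?a j)" by (rule member_le_sum) (use 1 in auto)
    also have "\<dots> \<le> bad_data N k B t X" unfolding bad_data_def by (simp add: add.assoc)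
    finally show ?thesis .
  next
    case 2
    have "1 = ?b j" using 2 by simp
    also have "\<dots> \<le> (\<Sum>j<k. ?b j)" by (rule member_le_sum) (use 2 in auto)
    also have "\<dots> \<le> bad_data N k B t X" unfolding bad_data_def by (simp add: add.assoc add_increasing)
    finally show ?thesis .
  next
    case 3
    then show ?thesis unfolding bad_data_def by (simp add: add_increasing)
  qed
qed

definition ideal_out :: "nat \<Rightarrow> nat \<Rightarrow> real \<Rightarrow> (nat \<Rightarrow> nat \<Rightarrow> real) \<Rightarrow> (nat \<Rightarrow> real) \<Rightarrow> nat \<Rightarrow> real" where
  "ideal_out N k \<rho> X g = (\<lambda>e\<in>{..<d}. \<Sum>i<N + 2 * k. final_weight N k \<rho> g i * X i e)"

lemma core_out_good:
  assumes g: "good_data N k B t X" and k: "k = num_rows d N p"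
  shows "core_out d k \<rho> (center d N B X) (rows d N B X) g' = ideal_out N k \<rho> X g'"
proof -
  have "clip d B (X j) = X j" if "j < N" for j
    using g that by (simp add: clip_def good_data_def)
  then have c: "center d N B X e = (\<Sum>j<N. X j e) / real N" for e by (simp add: center_def)
  have r: "rows d N B X j = pair_diff N X j" if "j < k" for j
    using g that by (simp add: rows_def clip_def good_data_def)
  have "comb d k (rows d N B X) g' e = (\<Sum>j<k. g' j * ((X (N + 2 * j) e - X (N + 2 * j + 1) e) / sqrt 2))" if "e < d" for e
    using that r by (simp add: comb_def pair_diff_def)
  then show ?thesis
    unfolding core_out_def ideal_out_def final_weight_sum
    by (intro restrict_ext) (simp add: c)
qed

text \<open>The mixture bound makes \<open>low_eig\<close> at least \<open>N / 8\<close>. This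
  exceeds the midpoint \<open>3/32 * N\<close> by \<open>N / 32 > T * B^2\<close>, so the upper cut
  of \<open>accept\<close> applies and the probability is exactly one.\<close>

lemma accept_prob_good:
  assumes g: "good_data N (num_rows d N p) B t X" and d: "0 < d" and B: "0 < B" and t: "0 < t"
    and N: "256 * B\<^sup>2 + ln (2 * t) \<le> real N / 8" and T: "0 \<le> T" "T * B\<^sup>2 < real N / 32"
  shows "accept_prob d N B \<epsilon> T X = 1"
proof -
  have r: "rows d N B X j = pair_diff N X j" if "j < N" for j
    using g that by (simp add: rows_def clip_def good_data_def num_rows_def)
  have "low_eig d N (rows d N B X) = low_eig d N (pair_diff N X)"
    by (rule low_eig_cong) (simp add: r)
  moreover have "real N / 8 \<le> low_eig d N (pair_diff N X)"
    by (rule low_eig_of_pb_integral[OF d B _ t _ N]) (use g in \<open>auto simp: good_data_def num_rows_def\<close>)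
  ultimately have "T * B\<^sup>2 < low_eig d N (rows d N B X) - 3/32 * real N" using T by simp
  then have "T < (low_eig d N (rows d N B X) - 3/32 * real N) / B\<^sup>2"
    using B by (simp add: pos_less_divide_eq)
  then show ?thesis using T by (simp add: accept_prob_def accept_def)
qed

lemma ideal_out_joint_measurable:
  assumes n: "n = N + 2 * k"
  shows "(\<lambda>(g, X). ideal_out N k \<rho> X g) \<in> std_gauss k \<Otimes>\<^sub>M (\<Pi>\<^sub>M i\<in>{..<n}. D \<mu>) \<rightarrow>\<^sub>M lborel_pow d"
proof -
  let ?M = "std_gauss k \<Otimes>\<^sub>M (\<Pi>\<^sub>M i\<in>{..<n}. D \<mu>)"
  have gm: "(\<lambda>q. fst q j) \<in> borel_measurable ?M" if "j < k" for j
    by (rule measurable_compose[OF measurable_fst]) (simp add: measurable_cong_sets[OF sets_std_gauss refl] lborel_pow_component that)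
  have sm: "(\<lambda>q. sqrt (ip k (fst q) (fst q))) \<in> borel_measurable ?M"
    by (rule measurable_compose[OF ip_measurable borel_measurable_sqrt]) (rule gm, assumption)+
  have wm: "(\<lambda>q. final_weight N k \<rho> (fst q) i) \<in> borel_measurable ?M" if "i < n" for i
  proof (cases "i < N")
    case True
    then show ?thesis by (simp add: final_weight_def)
  next
    case False
    then have "(i - N) div 2 < k" using that n by auto
    then show ?thesis unfolding final_weight_def using False
      by (simp only: if_False) (intro borel_measurable_times borel_measurable_divide borel_measurable_const gm sm)
  qed
  show ?thesis unfolding ideal_out_def split_def n[symmetric]
    by (intro measurable_restrict_lborel_pow borel_measurable_sum borel_measurable_times wm
       measurable_compose[OF measurable_snd PX_component_measurable]) auto
qed

text \<open>For every fixed nonzero \<open>g\<close> the weights sum to one and so do their squares,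
  so the target law is attained exactly and not merely on average over \<open>g\<close>.\<close>

lemma ideal_out_law:
  assumes F: "F \<in> borel_measurable (lborel_pow d)" and N: "0 < N" and g: "0 < ip k g g" and \<rho>: "\<rho>\<^sup>2 = 1 - 1 / real N"
  shows "(\<integral>\<^sup>+X. F (ideal_out N k \<rho> X g) \<partial>(\<Pi>\<^sub>M i\<in>{..<N + 2 * k}. D \<mu>)) = (\<integral>\<^sup>+x. F x \<partial>D \<mu>)"
  unfolding ideal_out_def weighted_law[OF F final_weight_squares[OF N g \<rho>]] final_weight_total[OF N] by simp

text \<open>The mechanism is compared with \<open>ideal_out\<close> on the same samples. On good
  data the two kernels coincide; on other data \<open>bad_data\<close> is at least one and dominates
  any difference of probabilities. The expectation of \<open>bad_data\<close> therefore bounds the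
  total variation distance.\<close>

theorem mech_accurate:
  fixes N p :: nat and B \<rho> \<epsilon> \<alpha> T R t :: real
  defines "k \<equiv> num_rows d N p" and "n \<equiv> num_samples d N p"
  assumes d: "0 < d" and N: "0 < N" and B: "0 < B" and \<mu>: "ip d \<mu> \<mu> \<le> R\<^sup>2" and \<rho>: "\<rho>\<^sup>2 = 1 - 1 / real N"
    and T: "0 \<le> T" "T * B\<^sup>2 < real N / 32" and t: "0 < t" and Nt: "256 * B\<^sup>2 + ln (2 * t) \<le> real N / 8"
    and \<alpha>: "real (N + k) * (exp (- (B\<^sup>2 - 2 * R\<^sup>2) / (8 * \<kappa>)) * sqrt 2 ^ d) + 1 / t \<le> \<alpha>"
  shows "tv_dist (distr (D \<mu>) (option_space (D \<mu>)) Some) (output_dist n (mech d N p B \<rho> \<epsilon> T) (D \<mu>)) \<le> \<alpha>"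
proof -
  let ?O = "option_space (lborel_pow d)" and ?P = "\<Pi>\<^sub>M i\<in>{..<n}. D \<mu>"
  let ?A = "mech d N p B \<rho> \<epsilon> T"
  have nk: "n = N + 2 * k" by (simp add: n_def num_samples_def k_def)
  have Nk: "N \<le> k" by (simp add: k_def num_rows_def)
  have k0: "0 < k" using N Nk by simp
  have n0: "0 < n" using N nk by simp
  have \<alpha>0: "0 \<le> \<alpha>" by (rule order_trans[OF _ \<alpha>]) (use t in simp)
  have O: "option_space (D \<mu>) = ?O" by (rule option_space_cong) simp
  have pP: "prob_space ?P" by (intro prob_space_PiM prob_space_D)
  interpret Dm: prob_space "D \<mu>" by (rule prob_space_D)
  let ?D' = "distr (D \<mu>) ?O Some"
  have Sm: "Some \<in> D \<mu> \<rightarrow>\<^sub>M ?O" unfolding measurable_cong_sets[OF sets_D refl] by (rule measurable_Some)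
  have PA: "?P \<in> space (prob_algebra (\<Pi>\<^sub>M i\<in>{..<n}. lborel_pow d))"
    unfolding space_prob_algebra using pP sets_PiM_D by auto
  have Am: "?A \<in> (\<Pi>\<^sub>M i\<in>{..<n}. lborel_pow d) \<rightarrow>\<^sub>M prob_algebra ?O"
    using mech_is_sampler[of d N p B \<rho> \<epsilon> T] unfolding is_sampler_def n_def .
  have AmP: "?A \<in> ?P \<rightarrow>\<^sub>M prob_algebra ?O" using Am unfolding measurable_cong_sets[OF sets_PiM_D refl] .
  let ?Q = "output_dist n ?A (D \<mu>)"
  have Qe: "emeasure ?Q S = (\<integral>\<^sup>+X. emeasure (?A X) S \<partial>?P)" if "S \<in> sets ?O" for S
    unfolding output_dist_def by (rule emeasure_bind_prob_algebra[OF PA Am that])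
  have Q: "prob_space ?Q"
    unfolding output_dist_def using prob_space_bind'[OF PA Am] .
  have D': "prob_space ?D'" by (rule Dm.prob_space_distr[OF Sm])
  have bad: "(\<integral>\<^sup>+X. bad_data N k B t X \<partial>?P) \<le> ennreal \<alpha>"
    by (rule order_trans[OF bad_data_expectation[OF d nk n0 Nk \<mu> t] ennreal_leI[OF \<alpha>]])
  have badm: "bad_data N k B t \<in> borel_measurable ?P" by (rule bad_data_measurable[OF nk Nk])
  have main: "\<bar>measure ?D' S - measure ?Q S\<bar> \<le> \<alpha>" if S: "S \<in> sets ?O" for S
  proof -
    define S0 where "S0 = Some -` S \<inter> space (lborel_pow d)"
    have S0: "S0 \<in> sets (lborel_pow d)" unfolding S0_def by (rule measurable_sets[OF measurable_Some S])
    have iS: "(indicator S0 :: _ \<Rightarrow> ennreal) \<in> borel_measurable (lborel_pow d)" using S0 by simp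
    define E where "E X = (\<integral>\<^sup>+g. indicator S0 (ideal_out N k \<rho> X g) \<partial>std_gauss k)" for X
    have jm: "(\<lambda>(g, X). indicator S0 (ideal_out N k \<rho> X g) :: ennreal) \<in> borel_measurable (std_gauss k \<Otimes>\<^sub>M ?P)"
      using measurable_compose[OF ideal_out_joint_measurable[OF nk] iS] by (simp add: split_def)
    have jm': "(\<lambda>(X, g). indicator S0 (ideal_out N k \<rho> X g) :: ennreal) \<in> borel_measurable (?P \<Otimes>\<^sub>M std_gauss k)"
      using measurable_compose[OF measurable_Pair[OF measurable_snd measurable_fst] jm] unfolding split_def fst_conv snd_conv .
    have Em: "E \<in> borel_measurable ?P"
      unfolding E_def by (rule std_gauss.borel_measurable_nn_integral[OF jm'])
    have EI: "(\<integral>\<^sup>+X. E X \<partial>?P) = emeasure ?D' S"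
    proof -
      \<comment> \<open>The samples are integrated first, with the coefficients fixed; for almost
        all coefficients this gives exactly the law of one sample.\<close>
      have "(\<integral>\<^sup>+X. E X \<partial>?P) = (\<integral>\<^sup>+g. (\<integral>\<^sup>+X. indicator S0 (ideal_out N k \<rho> X g) \<partial>?P) \<partial>std_gauss k)"
        unfolding E_def
        by (rule pair_sigma_finite.Fubini'[OF _ jm])
           (intro pair_sigma_finite.intro prob_space_imp_sigma_finite prob_space_std_gauss pP)
      also have "\<dots> = (\<integral>\<^sup>+g. emeasure (D \<mu>) S0 \<partial>std_gauss k)"
      proof (rule nn_integral_cong_AE)
        show "AE g in std_gauss k. (\<integral>\<^sup>+X. indicator S0 (ideal_out N k \<rho> X g) \<partial>?P) = emeasure (D \<mu>) S0"
          using AE_std_gauss_ip_pos[OF k0]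
        proof eventually_elim
          case (elim g)
          show ?case unfolding nk ideal_out_law[OF iS N elim \<rho>] using S0 by simp
        qed
      qed
      also have "\<dots> = emeasure (D \<mu>) S0"
        by (simp only: nn_integral_const std_gauss.emeasure_space_1 mult_1_right)
      also have "\<dots> = emeasure ?D' S"
        unfolding emeasure_distr[OF Sm S] S0_def by simp
      finally show ?thesis .
    qed
    have close: "emeasure (?A X) S \<le> E X + bad_data N k B t X \<and> E X \<le> emeasure (?A X) S + bad_data N k B t X"
      if X: "X \<in> space ?P" for X
    proof -
      have X': "X \<in> space (\<Pi>\<^sub>M i\<in>{..<num_samples d N p}. lborel_pow d)"
        using X sets_eq_imp_space_eq[OF sets_PiM_D, of "{..<n}" \<mu>] unfolding n_def by simp
      have E1: "E X \<le> 1"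
      proof -
        have "E X \<le> (\<integral>\<^sup>+g. 1 \<partial>std_gauss k)" unfolding E_def by (intro nn_integral_mono) (simp add: indicator_def)
        also have "\<dots> = 1" by (simp only: nn_integral_const std_gauss.emeasure_space_1 mult_1_right)
        finally show ?thesis .
      qed
      have pA: "prob_space (?A X)"
        using measurable_space[OF AmP X] by (simp add: space_prob_algebra)
      have A1: "emeasure (?A X) S \<le> 1" by (rule prob_space.measure_le_1[OF pA])
      show ?thesis
      proof (cases "good_data N k B t X")
        case True
        have a: "accept_prob d N B \<epsilon> T X = 1"
          by (rule accept_prob_good[OF True[unfolded k_def] d B t Nt T])
        have "emeasure (?A X) S = E X"
          unfolding emeasure_mech[OF X' S] a E_def S0_def[symmetric] k_def[symmetric] core_out_good[OF True k_def[THEN meta_eq_to_obj_eq]]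
          by simp
        then show ?thesis by simp
      next
        case False
        have b: "1 \<le> bad_data N k B t X" by (rule not_good_data[OF False])
        have "emeasure (?A X) S \<le> bad_data N k B t X" "E X \<le> bad_data N k B t X"
          using A1 E1 b by (auto intro: order_trans)
        then show ?thesis by (auto intro: add_increasing)
      qed
    qed
    have AmS: "(\<lambda>X. emeasure (?A X) S) \<in> borel_measurable ?P"
      by (rule measurable_emeasure_kernel[OF measurable_prob_algebraD[OF AmP] S])
    have "emeasure ?Q S \<le> (\<integral>\<^sup>+X. E X + bad_data N k B t X \<partial>?P)"
      unfolding Qe[OF S] by (rule nn_integral_mono) (use close in blast)
    also have "\<dots> = emeasure ?D' S + (\<integral>\<^sup>+X. bad_data N k B t X \<partial>?P)"
      unfolding nn_integral_add[OF Em badm] EI ..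
    also have "\<dots> \<le> emeasure ?D' S + ennreal \<alpha>" by (rule add_left_mono[OF bad])
    finally have 1: "emeasure ?Q S \<le> emeasure ?D' S + ennreal \<alpha>" .
    have "emeasure ?D' S \<le> (\<integral>\<^sup>+X. emeasure (?A X) S + bad_data N k B t X \<partial>?P)"
      unfolding EI[symmetric] by (rule nn_integral_mono) (use close in blast)
    also have "\<dots> = emeasure ?Q S + (\<integral>\<^sup>+X. bad_data N k B t X \<partial>?P)"
      unfolding nn_integral_add[OF AmS badm] Qe[OF S] ..
    also have "\<dots> \<le> emeasure ?Q S + ennreal \<alpha>" by (rule add_left_mono[OF bad])
    finally have 2: "emeasure ?D' S \<le> emeasure ?Q S + ennreal \<alpha>" .
    have e: "emeasure ?Q S = ennreal (measure ?Q S)" "emeasure ?D' S = ennreal (measure ?D' S)"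
    proof -
      interpret Q: prob_space ?Q by (rule Q)
      show "emeasure ?Q S = ennreal (measure ?Q S)" by (rule Q.emeasure_eq_measure)
      interpret D': prob_space ?D' by (rule D')
      show "emeasure ?D' S = ennreal (measure ?D' S)" by (rule D'.emeasure_eq_measure)
    qed
    have "measure ?Q S \<le> measure ?D' S + \<alpha>"
      using 1 \<alpha>0 unfolding e ennreal_plus[OF measure_nonneg \<alpha>0, symmetric] by (subst (asm) ennreal_le_iff) auto
    moreover have "measure ?D' S \<le> measure ?Q S + \<alpha>"
      using 2 \<alpha>0 unfolding e ennreal_plus[OF measure_nonneg \<alpha>0, symmetric] by (subst (asm) ennreal_le_iff) auto
    ultimately show ?thesis by simp
  qed
  show ?thesis
    unfolding tv_dist_def O
  proof (rule cSUP_least)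
    show "sets ?D' \<noteq> {}" by auto
    show "\<bar>measure ?D' S - measure ?Q S\<bar> \<le> \<alpha>" if "S \<in> sets ?D'" for S
      using that by (intro main) simp
  qed
qed

end

section \<open>Covariance matrices and the choice of the parameters\<close>

lemma scalar_prod_bil:
  assumes A: "A \<in> carrier_mat d d" and v: "v \<in> carrier_vec d"
  shows "scalar_prod v (A *\<^sub>v v) = bil d (\<lambda>i j. A $$ (i, j)) (vec_index v) (vec_index v)"
proof -
  have r: "vec_index (A *\<^sub>v v) i = (\<Sum>j<d. A $$ (i, j) * vec_index v j)" if "i < d" for i
    using A v that unfolding lessThan_atLeast0 by (simp add: scalar_prod_def)
  have dv: "dim_vec (A *\<^sub>v v) = d" using A by simp
  have "scalar_prod v (A *\<^sub>v v) = (\<Sum>i<d. vec_index v i * vec_index (A *\<^sub>v v) i)"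
    unfolding scalar_prod_def dv lessThan_atLeast0 ..
  also have "\<dots> = bil d (\<lambda>i j. A $$ (i, j)) (vec_index v) (vec_index v)"
    unfolding bil_def by (intro sum.cong refl) (simp add: r sum_distrib_left mult.assoc)
  finally show ?thesis .
qed

lemma nn_integral_exp_neg_square:
  assumes "0 < K"
  shows "(\<integral>\<^sup>+x. ennreal (exp (- x\<^sup>2 / (2 * K))) \<partial>lborel) = ennreal (sqrt (2 * pi * K))"
proof -
  have e: "exp (- x\<^sup>2 / (2 * K)) = sqrt (2 * pi * K) * normal_density 0 (sqrt K) x" for x
    using assms by (simp add: normal_density_def)
  have "(\<integral>\<^sup>+x. ennreal (exp (- x\<^sup>2 / (2 * K))) \<partial>lborel) = (\<integral>\<^sup>+x. ennreal (sqrt (2 * pi * K)) * ennreal (normal_density 0 (sqrt K) x) \<partial>lborel)"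
    unfolding e using assms by (simp add: ennreal_mult')
  also have "\<dots> = ennreal (sqrt (2 * pi * K))"
    using assms by (subst nn_integral_cmult) (auto simp: nn_integral_normal_density)
  finally show ?thesis .
qed

text \<open>The passage from matrices to the locale. The lower Loewner bound makes
  \<open>\<Sigma>\<close> injective, hence invertible, and it makes the inverse coercive, which
  yields a finite normalising constant.\<close>

lemma gaussian_class_gauss_form:
  assumes \<mu>: "\<mu> \<in> carrier_vec d" and \<Sigma>: "\<Sigma> \<in> carrier_mat d d"
    and lo: "loewner_le d (1\<^sub>m d) \<Sigma>" and up: "loewner_le d \<Sigma> (\<kappa> \<cdot>\<^sub>m 1\<^sub>m d)"
  obtains P S where "gauss_form d P S \<kappa>" "gaussian d \<mu> \<Sigma> = gauss_form.D d P (vec_index \<mu>)"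
proof -
  define s where "s i j = \<Sigma> $$ (i, j)" for i j
  define S where "S \<theta> i = (\<Sum>j<d. s i j * \<theta> j)" for \<theta> :: "nat \<Rightarrow> real" and i
  have ipS: "ip d \<theta> (S \<theta>) = bil d s \<theta> \<theta>" for \<theta>
    by (simp add: ip_def bil_def S_def sum_distrib_left mult.assoc)
  have sym: "s i j = s j i" if "i < d" "j < d" for i j
  proof -
    have "transpose_mat (\<Sigma> - 1\<^sub>m d) = \<Sigma> - 1\<^sub>m d" using lo by (simp add: loewner_le_def pos_semidef_def)
    then have "transpose_mat (\<Sigma> - 1\<^sub>m d) $$ (i, j) = (\<Sigma> - 1\<^sub>m d) $$ (i, j)" by simp
    then show ?thesis using that \<Sigma> by (simp add: s_def split: if_splits)
  qed
  have vi: "bil d Q (vec_index (Matrix.vec d \<theta>)) (vec_index (Matrix.vec d \<theta>)) = bil d Q \<theta> \<theta>" for Q \<theta>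
    by (rule bil_cong) simp_all
  have low: "ip d \<theta> \<theta> \<le> ip d \<theta> (S \<theta>)" for \<theta>
  proof -
    have "0 \<le> scalar_prod (Matrix.vec d \<theta>) ((\<Sigma> - 1\<^sub>m d) *\<^sub>v Matrix.vec d \<theta>)"
      using lo by (simp add: loewner_le_def pos_semidef_def)
    also have "\<dots> = bil d (\<lambda>i j. (\<Sigma> - 1\<^sub>m d) $$ (i, j)) \<theta> \<theta>"
      by (subst scalar_prod_bil) (use \<Sigma> in \<open>auto simp: vi\<close>)
    also have "\<dots> = bil d (\<lambda>i j. s i j - (if i = j then 1 else 0)) \<theta> \<theta>"
      unfolding bil_def by (intro sum.cong refl) (use \<Sigma> in \<open>auto simp: s_def\<close>)
    also have "\<dots> = bil d s \<theta> \<theta> - ip d \<theta> \<theta>"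
      unfolding ip_bil by (simp add: bil_def sum_subtractf algebra_simps)
    finally show ?thesis by (simp add: ipS)
  qed
  have upp: "ip d \<theta> (S \<theta>) \<le> \<kappa> * ip d \<theta> \<theta>" for \<theta>
  proof -
    have "0 \<le> scalar_prod (Matrix.vec d \<theta>) ((\<kappa> \<cdot>\<^sub>m 1\<^sub>m d - \<Sigma>) *\<^sub>v Matrix.vec d \<theta>)"
      using up by (simp add: loewner_le_def pos_semidef_def)
    also have "\<dots> = bil d (\<lambda>i j. (\<kappa> \<cdot>\<^sub>m 1\<^sub>m d - \<Sigma>) $$ (i, j)) \<theta> \<theta>"
      by (subst scalar_prod_bil) (use \<Sigma> in \<open>auto simp: vi\<close>)
    also have "\<dots> = bil d (\<lambda>i j. \<kappa> * (if i = j then 1 else 0) - s i j) \<theta> \<theta>"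
      unfolding bil_def by (intro sum.cong refl) (use \<Sigma> in \<open>auto simp: s_def\<close>)
    also have "\<dots> = \<kappa> * ip d \<theta> \<theta> - bil d s \<theta> \<theta>"
      unfolding ip_bil by (simp add: bil_def sum_subtractf sum_distrib_left algebra_simps)
    finally show ?thesis by (simp add: ipS)
  qed
  have "det \<Sigma> \<noteq> 0"
  proof
    assume "det \<Sigma> = 0"
    then obtain w where w: "w \<in> carrier_vec d" "w \<noteq> 0\<^sub>v d" "\<Sigma> *\<^sub>v w = 0\<^sub>v d"
      using det_0_iff_vec_prod_zero[OF \<Sigma>] by blast
    have "bil d s (vec_index w) (vec_index w) = scalar_prod w (\<Sigma> *\<^sub>v w)"
      unfolding scalar_prod_bil[OF \<Sigma> w(1)] s_def ..
    also have "\<dots> = 0" using w by simp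
    finally have "ip d (vec_index w) (vec_index w) \<le> 0" using low[of "vec_index w"] by (simp add: ipS)
    then have "ip d (vec_index w) (vec_index w) = 0" by (intro antisym) simp_all
    then have "w = 0\<^sub>v d" unfolding ip_eq_0_iff by (intro eq_vecI) (use w(1) in auto)
    then show False using w(2) by simp
  qed
  then have "\<Sigma> \<in> Units (ring_mat TYPE(real) d ())" by (rule det_non_zero_imp_unit[OF \<Sigma>])
  then have "mat_inverse \<Sigma> \<noteq> None" using mat_inverse(1)[OF \<Sigma>, where b="()"] by blast
  then obtain Pm where Pm: "mat_inverse \<Sigma> = Some Pm" by blast
  have inv: "\<Sigma> * Pm = 1\<^sub>m d" "Pm * \<Sigma> = 1\<^sub>m d" "Pm \<in> carrier_mat d d"
    using mat_inverse(2)[OF \<Sigma> Pm] by auto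
  define P where "P i j = Pm $$ (i, j)" for i j
  have "transpose_mat \<Sigma> = \<Sigma>"
    by (rule eq_matI) (use \<Sigma> sym in \<open>auto simp: s_def\<close>)
  then have "transpose_mat Pm * \<Sigma> = 1\<^sub>m d"
    using transpose_mult[OF \<Sigma> inv(3)] inv(1) by simp
  then have "transpose_mat Pm * \<Sigma> * Pm = Pm" using inv(3) by simp
  moreover have "transpose_mat Pm * \<Sigma> * Pm = transpose_mat Pm * (\<Sigma> * Pm)"
    by (rule assoc_mult_mat) (use inv \<Sigma> in auto)
  ultimately have "transpose_mat Pm = Pm" using inv by simp
  then have symP: "P i j = P j i" if "i < d" "j < d" for i j
    using that inv(3) unfolding P_def by (metis carrier_matD index_transpose_mat(1))
  have sP: "(\<Sum>i<d. s l i * P i j) = (if l = j then 1 else 0)" if "l < d" "j < d" for l j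
  proof -
    have "(\<Sum>i<d. s l i * P i j) = (\<Sigma> * Pm) $$ (l, j)"
      using that \<Sigma> inv(3) unfolding lessThan_atLeast0 by (simp add: scalar_prod_def s_def P_def)
    then show ?thesis using that unfolding inv(1) by simp
  qed
  have bilS: "bil d P (S \<theta>) y = ip d \<theta> y" for \<theta> y
  proof -
    have "bil d P (S \<theta>) y = (\<Sum>i<d. \<Sum>j<d. \<Sum>l<d. \<theta> l * (s l i * P i j) * y j)"
      unfolding bil_def S_def sum_distrib_right
      by (intro sum.cong refl) (simp add: sym mult_ac)
    also have "\<dots> = (\<Sum>j<d. \<Sum>i<d. \<Sum>l<d. \<theta> l * (s l i * P i j) * y j)" by (rule sum.swap)
    also have "\<dots> = (\<Sum>j<d. \<Sum>l<d. \<Sum>i<d. \<theta> l * (s l i * P i j) * y j)" by (intro sum.cong refl sum.swap)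
    also have "\<dots> = (\<Sum>j<d. \<Sum>l<d. \<theta> l * (if l = j then 1 else 0) * y j)"
      by (intro sum.cong refl) (simp only: sum_distrib_right[symmetric] sum_distrib_left[symmetric] sP lessThan_iff)
    also have "\<dots> = ip d \<theta> y" by (simp add: ip_def if_distrib if_distribR cong: if_cong)
    finally show ?thesis .
  qed
  \<comment> \<open>One plus the squared Frobenius norm of the covariance. For
    \<open>x = S \<theta>\<close> it gives \<open>ip d x x \<le> K * ip d \<theta> \<theta> \<le> K
    * ip d \<theta> (S \<theta>)\<close>, and the last form equals
    \<open>bil d P x x\<close>.\<close>
  define K where "K = 1 + (\<Sum>i<d. \<Sum>j<d. (s i j)\<^sup>2)"
  have K: "0 < K" unfolding K_def by (intro add_pos_nonneg sum_nonneg) auto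
  have coer: "ip d x x \<le> K * bil d P x x" for x
  proof -
    define \<theta> where "\<theta> i = (\<Sum>j<d. P i j * x j)" for i
    have Sx: "S \<theta> i = x i" if "i < d" for i
    proof -
      have "S \<theta> i = (\<Sum>j<d. \<Sum>l<d. s i j * P j l * x l)"
        by (simp add: S_def \<theta>_def sum_distrib_left mult.assoc)
      also have "\<dots> = (\<Sum>l<d. \<Sum>j<d. s i j * P j l * x l)" by (rule sum.swap)
      also have "\<dots> = (\<Sum>l<d. (if i = l then 1 else 0) * x l)"
        by (intro sum.cong refl) (simp only: sum_distrib_right[symmetric] sP that lessThan_iff)
      also have "\<dots> = x i" using that by (simp add: if_distribR if_distrib cong: if_cong)
      finally show ?thesis .
    qed
    have b: "bil d P x x = ip d \<theta> (S \<theta>)"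
    proof -
      have "bil d P x x = bil d P (S \<theta>) (S \<theta>)" by (rule bil_cong) (simp_all add: Sx)
      then show ?thesis by (simp add: bilS)
    qed
    have "ip d x x = (\<Sum>i<d. (S \<theta> i)\<^sup>2)"
      unfolding ip_def by (intro sum.cong refl) (simp add: Sx power2_eq_square)
    also have "\<dots> \<le> (\<Sum>i<d. (\<Sum>j<d. (s i j)\<^sup>2) * ip d \<theta> \<theta>)"
    proof (rule sum_mono)
      fix i
      show "(S \<theta> i)\<^sup>2 \<le> (\<Sum>j<d. (s i j)\<^sup>2) * ip d \<theta> \<theta>"
        using Cauchy_Schwarz_ineq_sum[of "s i" \<theta> "{..<d}"] by (simp add: S_def ip_def power2_eq_square)
    qed
    also have "\<dots> = (K - 1) * ip d \<theta> \<theta>" by (simp add: K_def sum_distrib_right)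
    also have "\<dots> \<le> K * ip d \<theta> \<theta>" by (rule mult_right_mono) auto
    also have "\<dots> \<le> K * ip d \<theta> (S \<theta>)" using low K by (intro mult_left_mono) auto
    finally show ?thesis unfolding b .
  qed
  have Zfin: "(\<integral>\<^sup>+y. ennreal (exp (- bil d P y y / 2)) \<partial>lborel_pow d) \<noteq> \<infinity>"
  proof -
    have "(\<integral>\<^sup>+y. ennreal (exp (- bil d P y y / 2)) \<partial>lborel_pow d) \<le> (\<integral>\<^sup>+y. (\<Prod>i<d. ennreal (exp (- (y i)\<^sup>2 / (2 * K)))) \<partial>lborel_pow d)"
    proof (rule nn_integral_mono)
      fix y
      have "ip d y y / (2 * K) \<le> bil d P y y / 2" using coer[of y] K by (simp add: field_simps)
      then have "exp (- bil d P y y / 2) \<le> exp (- (ip d y y / (2 * K)))" by simp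
      also have "\<dots> = (\<Prod>i<d. exp (- (y i)\<^sup>2 / (2 * K)))"
        by (simp add: exp_sum[symmetric] ip_def sum_divide_distrib sum_negf power2_eq_square)
      finally show "ennreal (exp (- bil d P y y / 2)) \<le> (\<Prod>i<d. ennreal (exp (- (y i)\<^sup>2 / (2 * K))))"
        by (subst prod_ennreal) (auto intro: ennreal_leI)
    qed
    also have "\<dots> = ennreal (sqrt (2 * pi * K)) ^ d"
      by (subst nn_integral_lborel_pow_prod) (auto simp: nn_integral_exp_neg_square[OF K, simplified])
    also have "\<dots> < \<infinity>" using K by (simp add: ennreal_power)
    finally show ?thesis by simp
  qed
  have gf: "gauss_form d P S \<kappa>" by unfold_locales (use symP bilS low upp Zfin in auto)
  interpret gauss_form d P S \<kappa> by (rule gf)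
  have wt: "gaussian_weight d \<mu> \<Sigma> x = W (\<lambda>i. x i - vec_index \<mu> i)" for x
  proof -
    have c: "Matrix.vec d x - \<mu> \<in> carrier_vec d" using \<mu> by simp
    have "scalar_prod (Matrix.vec d x - \<mu>) (Pm *\<^sub>v (Matrix.vec d x - \<mu>)) = bil d P (vec_index (Matrix.vec d x - \<mu>)) (vec_index (Matrix.vec d x - \<mu>))"
      unfolding scalar_prod_bil[OF inv(3) c] P_def ..
    also have "\<dots> = bil d P (\<lambda>i. x i - vec_index \<mu> i) (\<lambda>i. x i - vec_index \<mu> i)"
      by (rule bil_cong) (use \<mu> in auto)
    finally show ?thesis unfolding gaussian_weight_def W_def Pm by simp
  qed
  have "(\<integral>\<^sup>+y. ennreal (W (\<lambda>i. y i - vec_index \<mu> i)) \<partial>lborel_pow d) = Z"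
  proof -
    have "(\<integral>\<^sup>+y. ennreal (W (\<lambda>i\<in>{..<d}. y i + - vec_index \<mu> i)) \<partial>lborel_pow d) = Z"
      unfolding Z_def by (rule nn_integral_lborel_pow_translate) (rule measurable_compose[OF W_m measurable_ennreal])
    then show ?thesis by simp
  qed
  then have "gaussian d \<mu> \<Sigma> = D (vec_index \<mu>)"
    unfolding gaussian_def D_def wt by simp
  then show thesis using that gf by blast
qed

text \<open>\<open>L / \<epsilon>\<close> may be less than one, so the logarithm in the rate can
  fall below \<open>ln (1 / \<alpha>)\<close>. The loss is at most
  \<open>ln (3/2) \<le> 2/3 * ln 2\<close>, and \<open>\<alpha> \<le> 1/2\<close> bounds this by two
  thirds of \<open>ln (1 / \<alpha>)\<close>. In particular the logarithm is positive.\<close>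

lemma ln_rate_bounds:
  fixes L \<alpha> \<epsilon> :: real
  assumes L: "2/3 \<le> L" and \<epsilon>: "0 < \<epsilon>" "\<epsilon> \<le> 1" and \<alpha>: "0 < \<alpha>" "\<alpha> \<le> 1/2"
  shows "ln (1 / \<alpha>) \<le> 3 * ln (L / (\<alpha> * \<epsilon>))"
proof -
  have l2: "ln (2::real) \<le> ln (1 / \<alpha>)" using \<alpha> by (subst ln_le_cancel_iff) (auto simp: field_simps)
  have "3 * ln (3/2::real) = ln ((3/2)^3)" by (simp add: ln_realpow)
  also have "\<dots> \<le> ln (2^2)" by (subst ln_le_cancel_iff) (auto simp: power3_eq_cube)
  also have "\<dots> = 2 * ln (2::real)" using ln_realpow[of 2 2] by simp
  finally have "- ln (3/2::real) \<ge> - 2/3 * ln (1 / \<alpha>)" using l2 by linarith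
  also have "- ln (3/2::real) = ln (2/3)" by (simp add: ln_div)
  also have "\<dots> \<le> ln (L / \<epsilon>)" using L \<epsilon> by (subst ln_le_cancel_iff) (auto simp: field_simps intro: order_trans)
  finally have "- 2/3 * ln (1 / \<alpha>) \<le> ln (L / \<epsilon>)" .
  moreover have "ln (L / (\<alpha> * \<epsilon>)) = ln (L / \<epsilon>) + ln (1 / \<alpha>)"
    using L \<epsilon> \<alpha> by (subst ln_mult_pos[symmetric]) (auto simp: field_simps)
  ultimately show ?thesis by linarith
qed

text \<open>With \<open>L = ln (1 / \<delta>)\<close>, clipping is rare when \<open>B^2\<close> is a
  large multiple of \<open>U\<close>, and the privacy conditions hold when \<open>N\<close> is a
  large multiple of \<open>U * L / \<epsilon>\<close>. The apparent circle, that the sample size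
  enters the clipping estimate, is harmless: the factor \<open>U * q / \<alpha>\<close> is absorbed
  by the exponential tail.\<close>

lemma gaussian_sampler:
  fixes d :: nat and \<kappa> R \<epsilon> \<delta> \<alpha> :: real
  defines "U \<equiv> R\<^sup>2 + \<kappa>\<^sup>2 * (real d + ln (ln (1 / \<delta>) / (\<alpha> * \<epsilon>)))" and "q \<equiv> ln (1 / \<delta>) / \<epsilon>"
  assumes d: "1 \<le> d" and \<kappa>: "1 \<le> \<kappa>" and R: "0 < R" and \<epsilon>: "0 < \<epsilon>" "\<epsilon> \<le> 1"
    and \<delta>: "0 < \<delta>" "\<delta> \<le> 1/2" and \<alpha>: "0 < \<alpha>" "\<alpha> \<le> 1/2"
  obtains n \<A> where "real n \<le> 250000000 * (U * q)" "is_sampler n (lborel_pow d) \<A>"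
    "accurate_sampler n \<alpha> (gaussian_class d \<kappa> R) \<A>" "differentially_private n (lborel_pow d) \<epsilon> \<delta> \<A>"
proof -
  define L where "L = ln (1 / \<delta>)"
  define \<Lambda> where "\<Lambda> = ln (L / (\<alpha> * \<epsilon>))"
  have "ln (2::real) \<le> L" unfolding L_def using \<delta> by (subst ln_le_cancel_iff) (auto simp: field_simps)
  then have L: "2/3 \<le> L" using ln2_ge_two_thirds by linarith
  have q: "q = L / \<epsilon>" by (simp add: q_def L_def)
  have qL: "L \<le> q" unfolding q using L \<epsilon> by (simp add: field_simps mult_left_le)
  have q23: "2/3 \<le> q" using qL L by linarith
  have ln\<alpha>: "ln (1 / \<alpha>) \<le> 3 * \<Lambda>" unfolding \<Lambda>_def by (rule ln_rate_bounds) (use L \<epsilon> \<alpha> in auto)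
  have ln2\<alpha>: "ln 2 \<le> ln (1 / \<alpha>)" using \<alpha> by (subst ln_le_cancel_iff) (auto simp: field_simps)
  have \<Lambda>: "0 < \<Lambda>" using ln\<alpha> ln2\<alpha> ln2_ge_two_thirds by linarith
  have exp\<Lambda>: "q / \<alpha> = exp \<Lambda>" unfolding \<Lambda>_def q using L \<epsilon> \<alpha> by (simp add: field_simps)
  have U: "U = R\<^sup>2 + \<kappa>\<^sup>2 * (real d + \<Lambda>)" by (simp add: U_def \<Lambda>_def L_def)
  have \<kappa>2: "1 \<le> \<kappa>\<^sup>2" using \<kappa> by simp
  have d\<Lambda>: "1 \<le> real d + \<Lambda>" using d \<Lambda> by linarith
  have Ud: "real d + \<Lambda> \<le> U"
    unfolding U using mult_right_mono[OF \<kappa>2, of "real d + \<Lambda>"] d\<Lambda> by (intro add_increasing) auto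
  have U1: "1 \<le> U" using Ud d\<Lambda> by linarith
  have UR: "R\<^sup>2 \<le> U" unfolding U using \<kappa>2 d\<Lambda> by simp
  \<comment> \<open>\<open>B^2 / \<kappa>\<close> is a multiple of \<open>V\<close>, the natural
    exponent in the norm tail. \<open>V\<close> dominates \<open>d + \<Lambda>\<close>, and
    \<open>U \<le> V^2\<close> makes the polynomial factor \<open>U\<close> harmless.\<close>
  define V where "V = U / \<kappa>"
  have "\<kappa> * (real d + \<Lambda>) \<le> V" unfolding V_def U using \<kappa> by (simp add: field_simps power2_eq_square)
  then have Vd: "real d + \<Lambda> \<le> V"
    by (rule order_trans[rotated]) (use mult_right_mono[OF \<kappa>, of "real d + \<Lambda>"] d\<Lambda> in auto)
  have V1: "1 \<le> V" using Vd d\<Lambda> by linarith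
  have UV: "U \<le> V\<^sup>2"
  proof -
    have "\<kappa>\<^sup>2 \<le> U"
      unfolding U using mult_left_mono[OF d\<Lambda>, of "\<kappa>\<^sup>2"] by (intro add_increasing) auto
    then have "U * \<kappa>\<^sup>2 \<le> U * U" using U1 by (intro mult_left_mono) auto
    then show ?thesis unfolding V_def using \<kappa> by (simp add: field_simps power2_eq_square)
  qed
  \<comment> \<open>The constant leaves room for the gate condition \<open>T * B^2 < N / 32\<close>,
    for the row and centre conditions, for the eigenvalue bound and for
    \<open>k \<le> 2 * N\<close>.\<close>
  define N where "N = nat \<lceil>25000000 * U * q\<rceil>"
  \<comment> \<open>As \<open>ln 2 \<ge> 2/3\<close>, this gives
    \<open>2^(-p) \<le> exp (- 4 * L) = \<delta>^4 \<le> \<delta> / 8\<close>.\<close>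
  define p where "p = nat \<lceil>6 * L\<rceil>"
  define B where "B = sqrt (1000 * U)"
  \<comment> \<open>The gate runs with \<open>\<epsilon> / 2\<close>, so this margin gives its tail
    the value \<open>exp (- 4 * L) \<le> \<delta> / 8\<close>. The next choice gives
    \<open>exp (- z / 4) = exp (- 6 * L)\<close>.\<close>
  define T where "T = 1 + 8 * q"
  define z where "z = 24 * L"
  define \<rho> where "\<rho> = sqrt (1 - 1 / real N)"
  \<comment> \<open>The centre condition after \<open>1 / \<rho>^2 \<le> 2\<close> and
    \<open>k \<le> 2 * N\<close>; the constants combine to
    \<open>2 * 4 * 32 * 16 = 64^2\<close>.\<close>
  define W where "W = 64 * B / real N"
  define k where "k = num_rows d N p"
  define n where "n = num_samples d N p"
  have Uq: "2/3 * U \<le> U * q" using q23 U1 by simp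
  have UqL: "U * L \<le> U * q" using qL U1 by simp
  have Nlo: "25000000 * (U * q) \<le> real N" unfolding N_def by (simp add: mult.assoc real_nat_ceiling_ge)
  have Nhi: "real N \<le> 50000000 * (U * q)"
  proof -
    have "real N = of_int \<lceil>25000000 * U * q\<rceil>" unfolding N_def using q23 U1 by (simp add: ceiling_le_zero)
    also have "\<dots> \<le> 25000000 * U * q + 1" by (rule of_int_ceiling_le_add_one)
    finally have "real N \<le> 25000000 * (U * q) + 1" by (simp only: mult.assoc)
    then show ?thesis using Uq U1 by linarith
  qed
  have N: "16000000 \<le> real N" using Nlo Uq U1 by linarith
  have plo: "6 * L \<le> real p" and phi: "real p \<le> 6 * L + 1"
    unfolding p_def using L by (auto simp: of_nat_nat)
  have p1: "1 \<le> p" using plo L by linarith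
  have B0: "0 < B" unfolding B_def using U1 by simp
  have B2: "B\<^sup>2 = 1000 * U" unfolding B_def using U1 by simp
  have T1: "1 \<le> T" unfolding T_def using q23 by simp
  have k: "real k \<le> 2 * real N"
  proof -
    have "real (2 * p + 2) * real (Suc d) \<le> (18 * L) * (2 * U)"
    proof (rule mult_mono)
      show "real (2 * p + 2) \<le> 18 * L" using phi L by simp
      show "real (Suc d) \<le> 2 * U" using Ud \<Lambda> d by simp
    qed (use L in auto)
    then have "real (2 * p + 2) * real (Suc d) \<le> 36 * (U * L)" by (simp add: mult_ac)
    moreover have "real k = real N + real (2 * p + 2) * real (Suc d)"
      unfolding k_def num_rows_def by (simp only: of_nat_add of_nat_mult)
    ultimately show ?thesis using UqL Nlo Uq U1 by linarith
  qed
  have nk: "real n = real N + 2 * real k" by (simp add: n_def num_samples_def k_def)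
  \<comment> \<open>\<open>n = N + 2 * k \<le> 5 * N\<close>, and rounding up at most doubles
    \<open>N\<close>.\<close>
  have size: "real n \<le> 250000000 * (U * q)" unfolding nk using k Nhi by linarith
  have T2: "T * B\<^sup>2 < real N / 32"
  proof -
    have "T * B\<^sup>2 = 1000 * U + 8000 * (U * q)" unfolding T_def B2 by (simp add: algebra_simps)
    then show ?thesis using Nlo Uq U1 by linarith
  qed
  have expL: "exp (- L) = \<delta>" unfolding L_def using \<delta> by (simp add: ln_div)
  have \<delta>4: "exp (- (4 * L)) \<le> \<delta> / 8"
  proof -
    have "exp (- (4 * L)) = exp (- L) ^ 4" by (simp add: exp_of_nat_mult[symmetric])
    also have "\<dots> = \<delta> * \<delta> ^ 3" unfolding expL by (simp add: eval_nat_numeral)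
    also have "\<dots> \<le> \<delta> * (1/2) ^ 3" using \<delta> by (intro mult_left_mono power_mono) auto
    finally show ?thesis by (simp add: power3_eq_cube)
  qed
  have priv: "differentially_private n (lborel_pow d) \<epsilon> \<delta> (mech d N p B \<rho> (\<epsilon> / 2) T)"
    unfolding n_def
  proof (rule mech_private[where z = z and W = W])
    show "exp (\<epsilon> / 2 * (1 - T)) \<le> \<delta> / 8"
      using \<delta>4 \<epsilon> by (simp add: T_def q)
    have "B\<^sup>2 / (real N / 32) * z = 768000 * (U * L) / real N" by (simp add: B2 z_def)
    also have "\<dots> \<le> \<epsilon> / 4 / 8"
    proof -
      have "25000000 * (U * L) \<le> real N * \<epsilon>" using Nlo \<epsilon> by (simp add: q field_simps)
      then have "768000 * (U * L) * 32 \<le> real N * \<epsilon>" using mult_nonneg_nonneg[of U L] U1 L by linarith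
      then show ?thesis using N by (simp add: field_simps)
    qed
    finally show "B\<^sup>2 / (real N / 32) * z \<le> \<epsilon> / 4 / 8" .
    have \<rho>12: "1/2 \<le> 1 - 1 / real N" using N by (simp add: field_simps)
    show "0 < \<rho>" unfolding \<rho>_def using \<rho>12 by simp
    have "1 / \<rho> * sqrt ((2 * B / real N)\<^sup>2 / (real N / 32)) * sqrt (8 * real k)
        = sqrt (1 / (1 - 1 / real N) * ((2 * B / real N)\<^sup>2 / (real N / 32)) * (8 * real k))"
      unfolding \<rho>_def by (simp only: real_sqrt_mult real_sqrt_divide real_sqrt_one)
    also have "\<dots> \<le> sqrt (2 * ((2 * B / real N)\<^sup>2 / (real N / 32)) * (8 * (2 * real N)))"
      by (intro real_sqrt_le_mono mult_mono k mult_nonneg_nonneg divide_nonneg_nonneg) (use \<rho>12 k N in \<open>auto simp: field_simps\<close>)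
    also have "\<dots> = sqrt ((64 * B / real N)\<^sup>2)"
      using N by (simp add: field_simps power2_eq_square)
    also have "\<dots> = W" using B0 N by (simp add: W_def)
    finally show "1 / \<rho> * sqrt ((2 * B / real N)\<^sup>2 / (real N / 32)) * sqrt (8 * real (num_rows d N p)) \<le> W"
      unfolding k_def .
    have z1: "1 \<le> z" unfolding z_def using L by simp
    show "1 \<le> z" by (rule z1)
    have W0: "0 \<le> W" unfolding W_def using B0 N by simp
    have zW: "sqrt z * W \<le> \<epsilon> / 64"
    proof (rule power2_le_imp_le)
      have "64\<^sup>2 * (24 * L) * (64\<^sup>2 * (1000 * U)) \<le> (25000000 * (U * L))\<^sup>2"
      proof -
        have "U * L \<ge> 2/3" using mult_mono[of 1 U "2/3" L] U1 L by simp
        then have "2/3 * (U * L) \<le> (U * L) * (U * L)" by (intro mult_right_mono) auto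
        moreover have "64\<^sup>2 * (24 * L) * (64\<^sup>2 * (1000 * U)) = 402653184000 * (U * L)"
          and "(25000000 * (U * L))\<^sup>2 = 625000000000000 * ((U * L) * (U * L))"
          by (simp_all add: power2_eq_square)
        moreover have "0 \<le> (U * L) * (U * L)" by simp
        ultimately show ?thesis by linarith
      qed
      also have "\<dots> \<le> (real N * \<epsilon>)\<^sup>2"
        using Nlo \<epsilon> U1 L by (intro power_mono) (auto simp: q field_simps)
      finally have "64\<^sup>2 * (24 * L) * (64\<^sup>2 * (1000 * U)) \<le> (real N * \<epsilon>)\<^sup>2" .
      then show "(sqrt z * W)\<^sup>2 \<le> (\<epsilon> / 64)\<^sup>2"
        using N L z1 by (simp add: power_mult_distrib power_divide W_def B2 z_def field_simps)
    qed (use \<epsilon> in auto)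
    have "1 * W \<le> sqrt z * W" using W0 z1 by (intro mult_right_mono) auto
    then have W64: "W \<le> \<epsilon> / 64" using zW by linarith
    have "W\<^sup>2 \<le> W * 1" unfolding power2_eq_square using W0 W64 \<epsilon> by (intro mult_left_mono) auto
    then show "2 * sqrt z * W + W\<^sup>2 \<le> \<epsilon> / 2 / 8" using zW W64 \<epsilon> by linarith
    have half: "(1/2::real) ^ p \<le> \<delta> / 8"
    proof -
      have "(1/2::real) ^ p = exp (- (real p * ln 2))"
        by (simp add: exp_minus exp_of_nat_mult power_divide inverse_eq_divide)
      also have "real p * ln 2 \<ge> (6 * L) * (2/3)"
        using plo L ln2_ge_two_thirds by (intro mult_mono) auto
      then have "exp (- (real p * ln 2)) \<le> exp (- (4 * L))" by simp
      finally show ?thesis using \<delta>4 by linarith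
    qed
    have "p \<le> k" unfolding k_def num_rows_def using d by (simp add: trans_le_add2)
    then have "(1/2::real) ^ k \<le> (1/2) ^ p" by (intro power_decreasing) auto
    moreover have "sqrt 2 * exp (- z / 4) \<le> 2 * (\<delta> / 8)"
    proof (rule mult_mono)
      show "sqrt 2 \<le> (2::real)" by (rule real_le_lsqrt) auto
      have "exp (- z / 4) \<le> exp (- (4 * L))" using L by (simp add: z_def)
      then show "exp (- z / 4) \<le> \<delta> / 8" using \<delta>4 by linarith
    qed auto
    ultimately have "tail_bound p k z \<le> \<delta> / 2" unfolding tail_bound_def using half by linarith
    then show "tail_bound p (num_rows d N p) z \<le> \<delta> / 2" by (simp add: k_def)
  qed (use d p1 \<epsilon> B0 N T1 T2 in auto)
  have acc: "accurate_sampler n \<alpha> (gaussian_class d \<kappa> R) (mech d N p B \<rho> (\<epsilon> / 2) T)"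
    unfolding accurate_sampler_def
  proof
    fix D assume "D \<in> gaussian_class d \<kappa> R"
    then obtain \<mu> \<Sigma> where D: "D = gaussian d \<mu> \<Sigma>" and \<mu>: "\<mu> \<in> carrier_vec d" and \<Sigma>: "\<Sigma> \<in> carrier_mat d d"
      and lo: "loewner_le d (1\<^sub>m d) \<Sigma>" and up: "loewner_le d \<Sigma> (\<kappa> \<cdot>\<^sub>m 1\<^sub>m d)"
      and R\<mu>: "L2_set (\<lambda>i. vec_index \<mu> i) {..<d} \<le> R"
      unfolding gaussian_class_def by blast
    obtain P S where gf: "gauss_form d P S \<kappa>" and DP: "gaussian d \<mu> \<Sigma> = gauss_form.D d P (vec_index \<mu>)"
      by (rule gaussian_class_gauss_form[OF \<mu> \<Sigma> lo up])
    have "ip d (vec_index \<mu>) (vec_index \<mu>) = (L2_set (\<lambda>i. vec_index \<mu> i) {..<d})\<^sup>2"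
      by (simp add: L2_set_def ip_def sum_nonneg power2_eq_square)
    also have "\<dots> \<le> R\<^sup>2" using R\<mu> by (intro power_mono) auto
    finally have ip\<mu>: "ip d (vec_index \<mu>) (vec_index \<mu>) \<le> R\<^sup>2" .
    have ln4: "ln (2 * (2 / \<alpha>)) \<le> 9 * U"
    proof -
      have "ln (2 * (2 / \<alpha>)) = 2 * ln 2 + ln (1 / \<alpha>)"
        using \<alpha> ln_realpow[of 2 2] by (simp add: ln_div ln_mult_pos)
      then show ?thesis using ln2\<alpha> ln\<alpha> Ud by linarith
    qed
    have tail: "real (N + k) * (exp (- (B\<^sup>2 - 2 * R\<^sup>2) / (8 * \<kappa>)) * sqrt 2 ^ d) \<le> \<alpha> / 2"
    proof -
      \<comment> \<open>\<open>B^2 - 2 * R^2 \<ge> 998 * U\<close> leaves an exponent of at least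
        \<open>33 * V\<close>: \<open>29 * V\<close> pays for the numerical constant,
        \<open>2 * V\<close> for the factor \<open>U\<close>, and the last \<open>2 * V\<close> for
        \<open>d + \<Lambda>\<close>.\<close>
      have "998 * V / 8 \<le> (B\<^sup>2 - 2 * R\<^sup>2) / (8 * \<kappa>)"
        unfolding V_def B2 using \<kappa> UR by (simp add: field_simps)
      then have "33 * V \<le> (B\<^sup>2 - 2 * R\<^sup>2) / (8 * \<kappa>)" using V1 by linarith
      then have e1: "exp (- (B\<^sup>2 - 2 * R\<^sup>2) / (8 * \<kappa>)) \<le> exp (- (33 * V))"
        unfolding minus_divide_left[symmetric] exp_le_cancel_iff by (rule le_imp_neg_le)
      have e2: "sqrt 2 ^ d \<le> exp (real d)"
      proof -
        have "sqrt 2 \<le> (2::real)" by (rule real_le_lsqrt) auto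
        then have "sqrt 2 \<le> exp (1::real)" using exp_ge_add_one_self[of 1] by linarith
        then have "sqrt 2 ^ d \<le> exp (1::real) ^ d" by (intro power_mono) auto
        then show ?thesis by (simp add: exp_of_nat_mult[symmetric])
      qed
      have e3: "U \<le> exp (2 * V)"
      proof -
        have "V \<le> exp V" using exp_ge_add_one_self[of V] by linarith
        then have "V\<^sup>2 \<le> (exp V)\<^sup>2" using V1 by (intro power_mono) auto
        then show ?thesis using UV by (simp add: exp_double)
      qed
      have e4: "300000000 \<le> exp (29 * V)"
      proof -
        have "2 \<le> exp (1::real)" using exp_ge_add_one_self[of 1] by linarith
        then have "2 ^ 29 \<le> exp (1::real) ^ 29" by (intro power_mono) auto
        also have "\<dots> = exp 29" by (simp add: exp_of_nat_mult[symmetric])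
        also have "\<dots> \<le> exp (29 * V)" using V1 by simp
        finally show ?thesis by simp
      qed
      have "real (N + k) \<le> 150000000 * (U * q)" using k Nhi by simp
      also have "\<dots> = 300000000 * U * exp \<Lambda> * (\<alpha> / 2)" unfolding exp\<Lambda>[symmetric] using \<alpha> by simp
      also have "\<dots> \<le> exp (29 * V) * exp (2 * V) * exp \<Lambda> * (\<alpha> / 2)"
        using e3 e4 \<alpha> U1 by (intro mult_right_mono mult_mono) auto
      finally have e5: "real (N + k) \<le> exp (29 * V) * exp (2 * V) * exp \<Lambda> * (\<alpha> / 2)" .
      have "real (N + k) * (exp (- (B\<^sup>2 - 2 * R\<^sup>2) / (8 * \<kappa>)) * sqrt 2 ^ d)
          \<le> (exp (29 * V) * exp (2 * V) * exp \<Lambda> * (\<alpha> / 2)) * (exp (- (33 * V)) * exp (real d))"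
        by (intro mult_mono e5 e1 e2) (use \<alpha> in auto)
      also have "\<dots> = exp (real d + \<Lambda> - 2 * V) * (\<alpha> / 2)"
        by (simp add: exp_add[symmetric] exp_diff exp_minus field_simps)
      also have "\<dots> \<le> 1 * (\<alpha> / 2)" using Vd V1 \<alpha> by (intro mult_right_mono) auto
      finally show ?thesis by simp
    qed
    show "tv_dist (distr D (option_space D) Some) (output_dist n (mech d N p B \<rho> (\<epsilon> / 2) T) D) \<le> \<alpha>"
      unfolding D DP n_def
    proof (rule gauss_form.mech_accurate[OF gf, where t = "2 / \<alpha>"])
      show "\<rho>\<^sup>2 = 1 - 1 / real N" unfolding \<rho>_def using N by (simp add: field_simps)
      show "256 * B\<^sup>2 + ln (2 * (2 / \<alpha>)) \<le> real N / 8" unfolding B2 using ln4 Nlo Uq U1 by linarith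
      show "real (N + num_rows d N p) * (exp (- (B\<^sup>2 - 2 * R\<^sup>2) / (8 * \<kappa>)) * sqrt 2 ^ d) + 1 / (2 / \<alpha>) \<le> \<alpha>"
        using tail by (simp add: k_def)
    qed (use d N B0 ip\<mu> T1 T2 \<alpha> in auto)
  qed
  show thesis by (rule that[OF size _ acc priv]) (simp add: n_def mech_is_sampler)
qed

theorem theorem18:
  shows "\<exists>C::real. C > 0 \<and>
    (\<forall>(d::nat) (\<kappa>::real) (R::real) (\<epsilon>::real) (\<delta>::real) (\<alpha>::real).
       d \<ge> 1 \<longrightarrow> \<kappa> > 0 \<longrightarrow> R > 0 \<longrightarrow>
       \<epsilon> \<in> {0<..1} \<longrightarrow> \<delta> \<in> {0<..1/2} \<longrightarrow> \<alpha> \<in> {0<..1/2} \<longrightarrow>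
       (\<exists>(n::nat) (\<A> :: (nat \<Rightarrow> (nat \<Rightarrow> real)) \<Rightarrow> (nat \<Rightarrow> real) option measure).
          real n \<le> C * ((R^2 + \<kappa>^2 * (real d + ln (ln (1 / \<delta>) / (\<alpha> * \<epsilon>)))) * (ln (1 / \<delta>) / \<epsilon>)) \<and>
          is_sampler n (lborel_pow d) \<A> \<and>
          accurate_sampler n \<alpha> (gaussian_class d \<kappa> R) \<A> \<and>
          differentially_private n (lborel_pow d) \<epsilon> \<delta> \<A>))"
proof (rule exI[of _ 250000000], intro conjI allI impI)
  fix d :: nat and \<kappa> R \<epsilon> \<delta> \<alpha> :: real
  assume d: "d \<ge> 1" and \<kappa>: "\<kappa> > 0" and R: "R > 0" and "\<epsilon> \<in> {0<..1}" "\<delta> \<in> {0<..1/2}" "\<alpha> \<in> {0<..1/2}"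
  then have \<epsilon>: "0 < \<epsilon>" "\<epsilon> \<le> 1" and \<delta>: "0 < \<delta>" "\<delta> \<le> 1/2" and \<alpha>: "0 < \<alpha>" "\<alpha> \<le> 1/2" by auto
  let ?rate = "(R^2 + \<kappa>^2 * (real d + ln (ln (1 / \<delta>) / (\<alpha> * \<epsilon>)))) * (ln (1 / \<delta>) / \<epsilon>)"
  show "\<exists>(n::nat) (\<A> :: (nat \<Rightarrow> (nat \<Rightarrow> real)) \<Rightarrow> (nat \<Rightarrow> real) option measure).
      real n \<le> 250000000 * ?rate \<and> is_sampler n (lborel_pow d) \<A> \<and>
      accurate_sampler n \<alpha> (gaussian_class d \<kappa> R) \<A> \<and> differentially_private n (lborel_pow d) \<epsilon> \<delta> \<A>"
  proof (cases "1 \<le> \<kappa>")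
    case True
    show ?thesis by (rule gaussian_sampler[OF d True R \<epsilon> \<delta> \<alpha>]) blast
  next
    \<comment> \<open>For \<open>\<kappa> < 1\<close> the two Loewner bounds contradict each other
      in positive dimension, so the class is empty. The sampler that takes no samples and always
      fails is then accurate, and it is private because empty data sets have no neighbours.\<close>
    case False
    have "gaussian_class d \<kappa> R = {}"
    proof (rule ccontr)
      assume "gaussian_class d \<kappa> R \<noteq> {}"
      then obtain \<mu> :: "real vec" and \<Sigma> where *: "\<mu> \<in> carrier_vec d" "\<Sigma> \<in> carrier_mat d d"
        "loewner_le d (1\<^sub>m d) \<Sigma>" "loewner_le d \<Sigma> (\<kappa> \<cdot>\<^sub>m 1\<^sub>m d)"
        unfolding gaussian_class_def by blast
      obtain P S where "gauss_form d P S \<kappa>" by (rule gaussian_class_gauss_form[OF *])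
      then show False using gauss_form.kappa_pos[of d P S \<kappa>] d False by simp
    qed
    moreover have "is_sampler 0 (lborel_pow d) (\<lambda>_. return (option_space (lborel_pow d)) None)"
      unfolding is_sampler_def
      by (intro measurable_const) (auto simp: space_prob_algebra space_option_space intro!: prob_space_return)
    \<comment> \<open>The size bound for \<open>n = 0\<close> still asks for a nonnegative rate,
      hence for a nonnegative logarithm.\<close>
    moreover have "0 \<le> ?rate"
    proof -
      have "ln (2::real) \<le> ln (1 / \<delta>)" using \<delta> by (subst ln_le_cancel_iff) (auto simp: field_simps)
      then have L: "2/3 \<le> ln (1 / \<delta>)" using ln2_ge_two_thirds by linarith
      have "0 \<le> ln (1 / \<alpha>)" using \<alpha> by simp
      then have "0 \<le> ln (ln (1 / \<delta>) / (\<alpha> * \<epsilon>))" using ln_rate_bounds[OF L \<epsilon> \<alpha>] by linarith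
      then show ?thesis using L \<epsilon> by (intro mult_nonneg_nonneg add_nonneg_nonneg divide_nonneg_nonneg) auto
    qed
    ultimately show ?thesis
      by (intro exI[of _ 0] exI[of _ "\<lambda>_. return (option_space (lborel_pow d)) None"])
        (auto simp: accurate_sampler_def differentially_private_def neighbors_def)
  qed
qed simp

end
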